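(* There exist universal constants $C_1,C_2,C_3,C_4>0$ such that the following holds. Let $P_0$ be a probability distribution on $\mathbb{R}$ and $\nu$ a finite measure on $\mathbb{R}$ with total mass $|\nu|=\nu(\mathbb{R})$. On a suitable probability space, there exist i.i.d. random variables $Z_1,Z_2,\ldots\sim P_0$, random distribution functions $F_n$ with $F_n\mid Z_1,\ldots,Z_n\sim\mathrm{DP}(\nu+n\mathbb{P}_n)$, and a Kiefer process $K$ independent of $Z_1,Z_2,\ldots$, such that $$P\left(\sup_{z\in\mathbb{R}}\left|\sqrt{n}(F_n-\mathbb{F}_n)(z)-n^{-1/2}K(\mathbb{F}_n(z),n)\right|\ge\frac{C_1|\nu|+x\log n}{n^{1/2}}+\frac{C_2\sqrt{\log n}\,x^{3/4}}{n^{1/4}}\,\Big|\,Z_1,\ldots,Z_n\right)\le C_3e^{-C_4x}$$ for all $x>0$ and $n\ge2$.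
   Context: $\mathbb{P}_n=n^{-1}\sum_{i=1}^n\delta_{Z_i}$ is the empirical measure and $\mathbb{F}_n(z)=\mathbb{P}_n((-\infty,z])$ the empirical distribution function. For a random distribution function $F$, "$F\sim\mathrm{DP}(\mu)$" means that $F(z)=P((-\infty,z])$ for a random probability measure $P$ distributed as the Dirichlet process with base measure $\mu$. The case $\nu=0$ is allowed. A Kiefer process $\{K(s,t):s\in[0,1],t\ge0\}$ is a two-parameter mean-zero Gaussian process (with continuous sample paths) with covariance $\mathrm{E}K(s_1,t_1)K(s_2,t_2)=(s_1\wedge s_2-s_1s_2)(t_1\wedge t_2)$. *)

theory Defs
  imports "HOL-Probability.Probability"
begin

section \<open>Empirical measures\<close>

definition empirical_measure :: "nat \<Rightarrow> (nat \<Rightarrow> real) \<Rightarrow> real measure" where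
  "empirical_measure n z =
     measure_of UNIV (sets borel) (\<lambda>A. (\<Sum>i=1..n. indicator A (z i)) / of_nat n)"

text \<open>The base measure \<open>\<nu> + n \<bbbP>\<^sub>n\<close> of the posterior.\<close>

definition posterior_base :: "real measure \<Rightarrow> nat \<Rightarrow> (nat \<Rightarrow> real) \<Rightarrow> real measure" where
  "posterior_base \<nu> n z =
     measure_of UNIV (sets borel)
       (\<lambda>A. emeasure \<nu> A + of_nat n * emeasure (empirical_measure n z) A)"

lemma sets_empirical_measure [simp, measurable_cong]: "sets (empirical_measure n z) = sets borel"
  by (simp add: empirical_measure_def sets_measure_of_conv
      sets.sigma_sets_eq[of borel, simplified])

lemma sets_posterior_base [simp, measurable_cong]: "sets (posterior_base \<nu> n z) = sets borel"
  by (simp add: posterior_base_def sets_measure_of_conv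
      sets.sigma_sets_eq[of borel, simplified])

lemma emeasure_empirical_measure:
  assumes "A \<in> sets borel"
  shows "emeasure (empirical_measure n z) A = (\<Sum>i=1..n. indicator A (z i)) / of_nat n"
proof (rule emeasure_measure_of[OF empirical_measure_def])
  show "countably_additive (sets (empirical_measure n z))
          (\<lambda>A. (\<Sum>i=1..n. indicator A (z i)) / of_nat n)"
  proof (rule countably_additiveI)
    fix B :: "nat \<Rightarrow> real set"
    assume B: "disjoint_family B"
    have "(\<Sum>k. (\<Sum>i=1..n. indicator (B k) (z i)) / (of_nat n :: ennreal)) =
          (\<Sum>i=1..n. \<Sum>k. indicator (B k) (z i)) / of_nat n"
      by (subst suminf_sum[symmetric]) (auto simp: divide_ennreal_def)
    also have "\<dots> = (\<Sum>i=1..n. indicator (\<Union>k. B k) (z i)) / of_nat n"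
      by (simp add: suminf_indicator[OF B])
    finally show "(\<Sum>k. (\<Sum>i=1..n. indicator (B k) (z i)) / (of_nat n :: ennreal)) =
          (\<Sum>i=1..n. indicator (\<Union>k. B k) (z i)) / of_nat n" .
  qed
qed (use assms in \<open>auto simp: positive_def\<close>)

lemma emeasure_posterior_base:
  assumes "A \<in> sets borel" and "sets \<nu> = sets borel"
  shows "emeasure (posterior_base \<nu> n z) A = emeasure \<nu> A + (\<Sum>i=1..n. indicator A (z i))"
proof -
  have "emeasure (posterior_base \<nu> n z) A =
          emeasure \<nu> A + of_nat n * emeasure (empirical_measure n z) A"
  proof (rule emeasure_measure_of[OF posterior_base_def])
    show "countably_additive (sets (posterior_base \<nu> n z))
            (\<lambda>A. emeasure \<nu> A + of_nat n * emeasure (empirical_measure n z) A)"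
    proof (rule countably_additiveI)
      fix B :: "nat \<Rightarrow> real set"
      assume B: "range B \<subseteq> sets (posterior_base \<nu> n z)" "disjoint_family B"
      have "(\<Sum>k. emeasure \<nu> (B k) + of_nat n * emeasure (empirical_measure n z) (B k)) =
            (\<Sum>k. emeasure \<nu> (B k)) + of_nat n * (\<Sum>k. emeasure (empirical_measure n z) (B k))"
        by (subst suminf_add[symmetric]) auto
      also have "\<dots> = emeasure \<nu> (\<Union>k. B k) + of_nat n * emeasure (empirical_measure n z) (\<Union>k. B k)"
        using B assms(2) by (simp add: suminf_emeasure)
      finally show "(\<Sum>k. emeasure \<nu> (B k) + of_nat n * emeasure (empirical_measure n z) (B k)) =
        emeasure \<nu> (\<Union>k. B k) + of_nat n * emeasure (empirical_measure n z) (\<Union>k. B k)" .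
    qed
  qed (use assms in \<open>auto simp: positive_def\<close>)
  also have "of_nat n * emeasure (empirical_measure n z) A = (\<Sum>i=1..n. indicator A (z i))"
    using assms(1)
    by (cases "n = 0")
      (auto simp: emeasure_empirical_measure ennreal_times_divide
        ennreal_mult_divide_eq mult.commute[of "of_nat n"])
  finally show ?thesis .
qed


section \<open>The Dirichlet process\<close>

text \<open>The gamma distribution with scale 1; shape 0 is the point mass at 0.\<close>

definition gamma_law :: "real \<Rightarrow> real measure" where
  "gamma_law a =
     (if a > 0
      then density lborel (\<lambda>x. ennreal (if x > 0 then x powr (a - 1) * exp (- x) / Gamma a else 0))
      else return borel 0)"

lemma sets_gamma_law [simp, measurable_cong]: "sets (gamma_law a) = sets borel"
  by (simp add: gamma_law_def)

lemma prob_space_gamma_law: "prob_space (gamma_law a)"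
proof (cases "a > 0")
  case True
  let ?f = "\<lambda>x. if x > 0 then x powr (a - 1) * exp (- x) / Gamma a else 0"
  have G: "Gamma a > 0"
    using True by (rule Gamma_real_pos)
  have "(\<integral>\<^sup>+x. ennreal (?f x) \<partial>lborel) =
        (\<integral>\<^sup>+x. ennreal (indicator {0..} x * x powr (a - 1) / exp x) / ennreal (Gamma a) \<partial>lborel)"
    using G by (intro nn_integral_cong) (auto simp: divide_ennreal exp_minus field_simps indicator_def)
  also have "\<dots> = (\<integral>\<^sup>+x. ennreal (indicator {0..} x * x powr (a - 1) / exp x) \<partial>lborel) / ennreal (Gamma a)"
    by (rule nn_integral_divide) simp
  also have "\<dots> = 1"
    using G Gamma_conv_nn_integral_real[OF True]
    by (simp flip: Gamma_conv_nn_integral_real[OF True] add: divide_ennreal)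
  finally show ?thesis
    using True by (intro prob_spaceI) (simp add: gamma_law_def emeasure_density)
next
  case False
  then show ?thesis
    by (simp add: gamma_law_def prob_space_return)
qed

text \<open>
  The Dirichlet distribution as the law of normalised independent gamma variables (Ferguson).
  In this form parameters equal to 0 are allowed, as long as not all of them are; the
  corresponding coordinates vanish.
\<close>

definition dirichlet_law :: "nat \<Rightarrow> (nat \<Rightarrow> real) \<Rightarrow> (nat \<Rightarrow> real) measure" where
  "dirichlet_law k \<alpha> =
     distr (PiM {..<k} (\<lambda>i. gamma_law (\<alpha> i))) (PiM {..<k} (\<lambda>_. borel))
       (\<lambda>g. \<lambda>i\<in>{..<k}. g i / (\<Sum>j<k. g j))"

text \<open>
  \<open>is_dirichlet_process \<mu> D\<close>: the law \<open>D\<close> of a random probability measure is the Dirichlet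
  process with base measure \<open>\<mu>\<close>. There is no such \<open>D\<close> if \<open>\<mu> = 0\<close>.
\<close>

definition is_dirichlet_process :: "real measure \<Rightarrow> real measure measure \<Rightarrow> bool" where
  "is_dirichlet_process \<mu> D \<longleftrightarrow>
     finite_borel_measure \<mu> \<and>
     D \<in> space (prob_algebra (prob_algebra borel)) \<and>
     (\<forall>k A. A ` {..<k} \<subseteq> sets borel \<and> disjoint_family_on A {..<k} \<and> (\<Union>i<k. A i) = UNIV \<longrightarrow>
        distr D (PiM {..<k} (\<lambda>_. borel)) (\<lambda>P. \<lambda>i\<in>{..<k}. measure P (A i)) =
        dirichlet_law k (\<lambda>i. measure \<mu> (A i)))"


section \<open>Conditioning\<close>

text \<open>The sub-\<open>\<sigma>\<close>-algebra generated by \<open>Z\<^sub>1, \<dots>, Z\<^sub>n\<close>.\<close>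

definition gen_by :: "'w measure \<Rightarrow> (nat \<Rightarrow> 'w \<Rightarrow> real) \<Rightarrow> nat \<Rightarrow> 'w measure" where
  "gen_by M Z n =
     vimage_algebra (space M) (\<lambda>\<omega>. \<lambda>i\<in>{1..n}. Z i \<omega>) (PiM {1..n} (\<lambda>_. borel))"

text \<open>
  A version of the conditional probability of the event \<open>E\<close> given \<open>G\<close>, determined only almost
  surely. The library's conditional expectation is 0 by convention for non-measurable \<open>E\<close>.
\<close>

definition cond_prob_given :: "'w measure \<Rightarrow> 'w measure \<Rightarrow> 'w set \<Rightarrow> 'w \<Rightarrow> real" where
  "cond_prob_given M G E = real_cond_exp M G (indicator E)"

text \<open>The library's \<open>indep_var\<close> only covers random variables with values in the same type.\<close>

definition independent_rvs ::
    "'w measure \<Rightarrow> 'a measure \<Rightarrow> ('w \<Rightarrow> 'a) \<Rightarrow> 'b measure \<Rightarrow> ('w \<Rightarrow> 'b) \<Rightarrow> bool" where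
  "independent_rvs M N X N' Y \<longleftrightarrow>
     X \<in> measurable M N \<and> Y \<in> measurable M N' \<and>
     prob_space.indep_set M
       {X -` A \<inter> space M | A. A \<in> sets N} {Y -` B \<inter> space M | B. B \<in> sets N'}"

text \<open>\<open>\<kappa>\<close> is a regular version of the conditional law of \<open>X\<close> given \<open>G\<close>.\<close>

definition regular_cond_law ::
    "'w measure \<Rightarrow> 'w measure \<Rightarrow> 'b measure \<Rightarrow> ('w \<Rightarrow> 'b) \<Rightarrow> ('w \<Rightarrow> 'b measure) \<Rightarrow> bool" where
  "regular_cond_law M G N X \<kappa> \<longleftrightarrow>
     X \<in> measurable M N \<and> \<kappa> \<in> measurable G (prob_algebra N) \<and>
     (\<forall>B\<in>sets N. AE \<omega> in M. cond_prob_given M G (X -` B \<inter> space M) \<omega> = measure (\<kappa> \<omega>) B)"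

text \<open>
  The random distribution function \<open>F\<close> satisfies \<open>F | G \<sim> DP(\<mu>)\<close>, where the base measure \<open>\<mu>\<close>
  may itself be random.
\<close>

definition cond_DP ::
    "'w measure \<Rightarrow> 'w measure \<Rightarrow> ('w \<Rightarrow> real \<Rightarrow> real) \<Rightarrow> ('w \<Rightarrow> real measure) \<Rightarrow> bool" where
  "cond_DP M G F \<mu> \<longleftrightarrow>
     (\<exists>P \<kappa>. (\<forall>\<omega>\<in>space M. F \<omega> = cdf (P \<omega>)) \<and>
        regular_cond_law M G (prob_algebra borel) P \<kappa> \<and>
        (\<forall>\<omega>\<in>space M. is_dirichlet_process (\<mu> \<omega>) (\<kappa> \<omega>)))"


section \<open>Kiefer processes\<close>

text \<open>Normal distributions with variance 0 are included.\<close>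

definition gaussian_rv :: "'w measure \<Rightarrow> ('w \<Rightarrow> real) \<Rightarrow> bool" where
  "gaussian_rv M X \<longleftrightarrow> X \<in> borel_measurable M \<and>
     (\<exists>m \<sigma>. \<sigma> \<ge> 0 \<and>
        distr M borel X = (if \<sigma> = 0 then return borel m else density lborel (normal_density m \<sigma>)))"

definition gaussian_process :: "'w measure \<Rightarrow> 'i set \<Rightarrow> ('i \<Rightarrow> 'w \<Rightarrow> real) \<Rightarrow> bool" where
  "gaussian_process M T X \<longleftrightarrow>
     (\<forall>J c. finite J \<and> J \<subseteq> T \<longrightarrow> gaussian_rv M (\<lambda>\<omega>. \<Sum>t\<in>J. c t * X t \<omega>))"

definition kiefer_index :: "(real \<times> real) set" where
  "kiefer_index = {0..1} \<times> {0..}"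

definition kiefer_process :: "'w measure \<Rightarrow> (real \<times> real \<Rightarrow> 'w \<Rightarrow> real) \<Rightarrow> bool" where
  "kiefer_process M K \<longleftrightarrow>
     gaussian_process M kiefer_index K \<and>
     (\<forall>p\<in>kiefer_index. (\<integral>\<omega>. K p \<omega> \<partial>M) = 0) \<and>
     (\<forall>(s1, t1)\<in>kiefer_index. \<forall>(s2, t2)\<in>kiefer_index.
        (\<integral>\<omega>. K (s1, t1) \<omega> * K (s2, t2) \<omega> \<partial>M) = (min s1 s2 - s1 * s2) * min t1 t2) \<and>
     (\<forall>\<omega>\<in>space M. continuous_on kiefer_index (\<lambda>p. K p \<omega>))"

end

theory Submission
  imports Defs
begin

text \<open>
  Given the data, a Dirichlet process with base measure \<open>\<nu> + \<delta>\<^sub>z\<^sub>1 + \<dots> +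
  \<delta>\<^sub>z\<^sub>n\<close> is a normalised gamma random measure: independent standard exponential weights
  sit at the data points, and an independent gamma random measure with intensity \<open>\<nu>\<close>, of total mass
  \<open>V \<sim> Gamma(|\<nu>|)\<close>, is added. If the weights \<open>e\<^sub>1, \<dots>, e\<^sub>n\<close> are
  attached to the data in increasing order, then at a point below which there are \<open>j\<close> data, the
  posterior distribution function differs by at most \<open>V / (V + T)\<close> from \<open>(e\<^sub>1 + \<dots> +
  e\<^sub>j) / T\<close>, where \<open>T = e\<^sub>1 + \<dots> + e\<^sub>n\<close>. Exponential moments give
  \<open>V \<le> 2 ln 2 |\<nu>| + 2 x\<close> and \<open>T \<ge> n / 4\<close> outside small events; this is the
  part \<open>C\<^sub>1 |\<nu>|\<close> of the bound. What remains is a strong approximation of a normalised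
  exponential partial sum process by \<open>K(j / n, n)\<close>, uniformly in \<open>j\<close>.

  The Kiefer process comes first and the weights are built from it. A double Schauder series with independent normal
  coefficients gives \<open>K\<close>; for fixed \<open>n\<close> the coefficients of the Brownian bridge
  \<open>K(\<cdot>, n) / sqrt n\<close> are normalised sums of \<open>n\<close> of these normals
  (\<open>kiefer_of_integer_dyadic\<close>). The same normals, pushed through the quantile transformation to
  symmetric beta variables, split a \<open>Gamma(n)\<close> variable dyadically into \<open>2\<^sup>k\<close>
  independent gamma masses for cells of width between \<open>1/2\<close> and \<open>1\<close>; one further beta
  split at the integers inside the cells and a regrouping give exactly \<open>n\<close> independent exponentials
  (\<open>distr_weight\<close>). On the event that all normals are at most \<open>2 sqrt L\<close> in absolute
  value, a node of the tree contributes an error of order \<open>L\<close> (\<open>node_error\<close>), whatever its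
  level, so a partial sum is off by \<open>O(L ln n)\<close> (\<open>weight_sum_error\<close>). With \<open>L = ln n
  + x\<close> the exceptional event has probability \<open>O(exp (- x))\<close> and the error is \<open>O((x ln n +
  (ln n)\<^sup>2) / sqrt n)\<close>; the second summand is below \<open>sqrt (ln n) /
  n\<^sup>1\<^sup>/\<^sup>4\<close> up to a constant.

  The comparison of quantiles rests on a monotone substitution (\<open>half_bend\<close>) under which the symmetric
  beta density is a Gaussian density times an explicit monotone factor. The distribution functions of beta and
  normal variables are then ordered by a single-crossing argument (\<open>sym_beta_cdf_half_bend\<close>), which
  bounds the coupling error by \<open>|\<eta>| / 4 + \<eta>\<^sup>2 / 2\<close> for all \<open>\<eta>\<close>
  (\<open>beta_of_normal_close\<close>).

  The gamma random measure is the almost surely convergent series with weights \<open>exp (- (v\<^sub>0 + \<dots> +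
  v\<^sub>m) / a) e\<^sub>m\<close> at independent locations. Its law is found by running the series backwards: a
  vector of independent gamma variables is a fixed point of one step of the recursion
  (\<open>nn_integral_gamma_perpetuity_step\<close>).

  The weights, the gamma random measure and \<open>K\<close> are functions of a noise that is independent of the
  data, and the data enter the discrepancy only through their order. So the deviation event is contained in an event
  about the noise alone, and its conditional probability given the data is bounded by the unconditional probability
  of that event.
\<close>

section \<open>Gamma and beta laws\<close>

text \<open>
  Products of indicators are product tests, so these determine the measure of all boxes.
\<close>
lemma PiM_eqI_product_tests:
 fixes N :: "'i => 'a measure"
 assumes J: "finite J" and N: "\<And>j. prob_space (N j)" and sets: "sets \<mu> = sets (PiM J N)"
  and tests: "\<And>f :: 'i => 'a => ennreal. (\<And>j. f j \<in> borel_measurable (N j)) ==>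
    (\<integral>\<^sup>+x. (\<Prod>j\<in>J. f j (x j)) \<partial>\<mu>) = (\<Prod>j\<in>J. \<integral>\<^sup>+y. f j y \<partial>N j)"
 shows "\<mu> = PiM J N"
proof -
 interpret product_prob_space N by (rule product_prob_spaceI) (rule N)
 show ?thesis
 proof (rule PiM_eqI[OF J sets])
  fix A assume A: "\<And>j. j \<in> J ==> A j \<in> sets (N j)"
  define f :: "'i => 'a => ennreal" where "f j = indicator (if j \<in> J then A j else {})" for j
  have f: "f j \<in> borel_measurable (N j)" for j
   using A by (auto simp: f_def)
  have PA: "Pi\<^sub>E J A \<in> sets \<mu>"
   unfolding sets using J A by (intro sets_PiM_I_finite) auto
  have "emeasure \<mu> (Pi\<^sub>E J A) = (\<integral>\<^sup>+x. indicator (Pi\<^sub>E J A) x \<partial>\<mu>)"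
   using PA by simp
  also have "... = (\<integral>\<^sup>+x. (\<Prod>j\<in>J. f j (x j)) \<partial>\<mu>)"
  proof (rule nn_integral_cong)
   fix x assume "x \<in> space \<mu>"
   then have x: "x \<in> extensional J"
    using sets_eq_imp_space_eq[OF sets] by (auto simp: space_PiM PiE_def)
   show "indicator (Pi\<^sub>E J A) x = (\<Prod>j\<in>J. f j (x j))"
   proof (cases "x \<in> Pi\<^sub>E J A")
    case True
    then show ?thesis by (auto simp: f_def PiE_def Pi_def intro!: prod.neutral[symmetric])
   next
    case False
    then obtain j where "j \<in> J" "x j \<notin> A j"
     using x by (auto simp: PiE_def)
    then have "f j (x j) = 0" by (simp add: f_def)
    then show ?thesis using False J \<open>j \<in> J\<close> by (auto intro!: prod_zero[symmetric])
   qed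
  qed
  also have "... = (\<Prod>j\<in>J. \<integral>\<^sup>+y. f j y \<partial>N j)"
   by (rule tests[OF f])
  also have "... = (\<Prod>j\<in>J. emeasure (N j) (A j))"
   using A by (intro prod.cong) (auto simp: f_def)
  finally show "emeasure \<mu> (Pi\<^sub>E J A) = (\<Prod>j\<in>J. emeasure (N j) (A j))" .
 qed
qed

definition gamma_dens :: "real => real => real" where
 "gamma_dens a x = (if x > 0 then x powr (a - 1) * exp (- x) / Gamma a else 0)"

lemma gamma_dens_measurable [measurable]: "gamma_dens a \<in> borel_measurable borel"
 unfolding gamma_dens_def by measurable

lemma gamma_dens_nonneg: "a > 0 ==> gamma_dens a x >= 0"
 using Gamma_real_pos[of a] by (simp add: gamma_dens_def)

lemma gamma_law_eq_density: "a > 0 ==> gamma_law a = density lborel (\<lambda>x. ennreal (gamma_dens a x))"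
 by (simp add: gamma_law_def gamma_dens_def)

lemma gamma_law_0: "gamma_law 0 = return borel 0"
 by (simp add: gamma_law_def)

lemma space_gamma_law [simp]: "space (gamma_law a) = UNIV"
 using sets_eq_imp_space_eq[OF sets_gamma_law[of a]] by simp

lemma nn_integral_gamma_law:
 assumes "a > 0" and [measurable]: "f \<in> borel_measurable borel"
 shows "(\<integral>\<^sup>+x. f x \<partial>gamma_law a) = (\<integral>\<^sup>+x. ennreal (gamma_dens a x) * f x \<partial>lborel)"
 using assms(1) by (simp add: gamma_law_eq_density nn_integral_density)

lemma nn_integral_gamma_law_0:
 assumes [measurable]: "f \<in> borel_measurable borel"
 shows "(\<integral>\<^sup>+x. f x \<partial>gamma_law 0) = f 0"
 by (simp add: gamma_law_0 nn_integral_return)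

lemma AE_gamma_law_pos: "a > 0 ==> AE x in gamma_law a. x > 0"
 by (subst gamma_law_eq_density, assumption, subst AE_density)
   (auto simp: gamma_dens_def intro!: AE_I2 split: if_splits)

lemma AE_gamma_law_nonneg: "AE x in gamma_law a. x >= 0"
proof (cases "a > 0")
 case True
 from AE_gamma_law_pos[OF this] show ?thesis by eventually_elim simp
next
 case False
 then have "gamma_law a = return borel 0" by (simp add: gamma_law_def)
 then show ?thesis by (simp only:) (subst AE_return, auto)
qed

text \<open>
  Change of measure for a rescaled gamma variable. It trades the shrinking factor of the perpetuity for a density.
\<close>
lemma nn_integral_gamma_scale:
 assumes u: "u > 0" and a: "a >= 0" and [measurable]: "f \<in> borel_measurable borel"
 shows "(\<integral>\<^sup>+x. f (u * x) \<partial>gamma_law a) =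
  (\<integral>\<^sup>+x. ennreal (u powr (- a) * exp (- x * (1 / u - 1))) * f x \<partial>gamma_law a)"
proof (cases "a = 0")
 case True
 then show ?thesis using u by (simp add: nn_integral_gamma_law_0)
next
 case False
 then have a: "a > 0" using a by simp
 have "(\<integral>\<^sup>+x. ennreal (u powr (- a) * exp (- x * (1 / u - 1))) * f x \<partial>gamma_law a)
   = (\<integral>\<^sup>+x. ennreal (gamma_dens a x) * (ennreal (u powr (- a) * exp (- x * (1 / u - 1))) * f x) \<partial>lborel)"
  by (rule nn_integral_gamma_law[OF a]) measurable
 also have "... = \<bar>u\<bar> * (\<integral>\<^sup>+x. ennreal (gamma_dens a (0 + u * x)) *
   (ennreal (u powr (- a) * exp (- (0 + u * x) * (1 / u - 1))) * f (0 + u * x)) \<partial>lborel)"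
  using u by (intro nn_integral_real_affine) auto
 also have "... = (\<integral>\<^sup>+x. \<bar>u\<bar> * (ennreal (gamma_dens a (0 + u * x)) *
   (ennreal (u powr (- a) * exp (- (0 + u * x) * (1 / u - 1))) * f (0 + u * x))) \<partial>lborel)"
  by (rule nn_integral_cmult[symmetric]) measurable
 also have "... = (\<integral>\<^sup>+x. ennreal (gamma_dens a x) * f (u * x) \<partial>lborel)"
 proof (rule nn_integral_cong)
  fix x :: real
  have "\<bar>u\<bar> * gamma_dens a (u * x) * (u powr (- a) * exp (- (u * x) * (1 / u - 1))) = gamma_dens a x"
  proof (cases "x > 0")
   case True
   have e: "exp (- (u * x)) * exp (- (u * x) * (1 / u - 1)) = exp (- x)"
    using u by (simp add: exp_add[symmetric] field_simps)
   have p: "u * (u * x) powr (a - 1) * u powr (- a) = x powr (a - 1)"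
   proof -
    have "u * (u powr (a - 1) * u powr (- a)) = 1"
     using u by (simp add: powr_diff powr_minus)
    then show ?thesis using u True by (simp add: powr_mult algebra_simps)
   qed
   have "\<bar>u\<bar> * gamma_dens a (u * x) * (u powr (- a) * exp (- (u * x) * (1 / u - 1)))
    = (u * (u * x) powr (a - 1) * u powr (- a)) *
     (exp (- (u * x)) * exp (- (u * x) * (1 / u - 1))) / Gamma a"
    using u True by (simp add: gamma_dens_def)
   then show ?thesis unfolding e p using True by (simp add: gamma_dens_def)
  next
   case False
   then show ?thesis using u by (simp add: gamma_dens_def zero_less_mult_iff)
  qed
  then have "ennreal \<bar>u\<bar> * ennreal (gamma_dens a (u * x)) *
    ennreal (u powr (- a) * exp (- (u * x) * (1 / u - 1))) = ennreal (gamma_dens a x)"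
   using a by (simp add: ennreal_mult'[symmetric] gamma_dens_nonneg)
  then show "ennreal \<bar>u\<bar> * (ennreal (gamma_dens a (0 + u * x)) *
   (ennreal (u powr (- a) * exp (- (0 + u * x) * (1 / u - 1))) * f (0 + u * x)))
   = ennreal (gamma_dens a x) * f (u * x)"
   by (simp add: mult.assoc[symmetric])
 qed
 also have "... = (\<integral>\<^sup>+x. f (u * x) \<partial>gamma_law a)"
  by (rule nn_integral_gamma_law[OF a, symmetric]) measurable
 finally show ?thesis by simp
qed

lemma nn_integral_gamma_exp:
 assumes "\<theta> < 1" "a >= 0"
 shows "(\<integral>\<^sup>+x. ennreal (exp (\<theta> * x)) \<partial>gamma_law a) = ennreal ((1 - \<theta>) powr (- a))"
proof -
 define u where "u = 1 / (1 - \<theta>)"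
 have u: "u > 0" and u1: "1 / u - 1 = - \<theta>" using assms by (auto simp: u_def)
 have "1 = (\<integral>\<^sup>+x. 1 \<partial>gamma_law a)"
  by (simp add: prob_space.emeasure_space_1[OF prob_space_gamma_law, simplified])
 also have "... = (\<integral>\<^sup>+x. ennreal (u powr (- a)) * ennreal (exp (\<theta> * x)) \<partial>gamma_law a)"
  using nn_integral_gamma_scale[OF u assms(2), of "\<lambda>_. 1"] u1
  by (simp add: ennreal_mult' mult.commute)
 also have "... = ennreal (u powr (- a)) * (\<integral>\<^sup>+x. ennreal (exp (\<theta> * x)) \<partial>gamma_law a)"
  by (rule nn_integral_cmult) measurable
 finally have "ennreal (u powr a) = ennreal (u powr a) * (ennreal (u powr (- a)) *
   (\<integral>\<^sup>+x. ennreal (exp (\<theta> * x)) \<partial>gamma_law a))"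
  by simp
 also have "... = (\<integral>\<^sup>+x. ennreal (exp (\<theta> * x)) \<partial>gamma_law a)"
  using u by (simp add: mult.assoc[symmetric] ennreal_mult''[symmetric] powr_minus)
 also have "u powr a = (1 - \<theta>) powr (- a)"
 proof -
  have "(1 - \<theta>) * u = 1" using assms by (simp add: u_def)
  then have "(1 - \<theta>) powr a * u powr a = 1" using assms u by (simp add: powr_mult[symmetric])
  then show ?thesis using assms by (simp add: powr_minus field_simps)
 qed
 finally show ?thesis ..
qed

text \<open>
  Weighting a gamma law by its argument raises the shape by one. In the perpetuity this absorbs the new exponential
  weight.
\<close>
lemma nn_integral_gamma_size_bias:
 assumes a: "a > 0" and [measurable]: "f \<in> borel_measurable borel"
 shows "(\<integral>\<^sup>+x. f x \<partial>gamma_law (a + 1)) = (\<integral>\<^sup>+x. ennreal (x / a) * f x \<partial>gamma_law a)"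
proof -
 have "(\<integral>\<^sup>+x. ennreal (x / a) * f x \<partial>gamma_law a)
   = (\<integral>\<^sup>+x. ennreal (gamma_dens a x) * (ennreal (x / a) * f x) \<partial>lborel)"
  by (rule nn_integral_gamma_law[OF a]) measurable
 also have "... = (\<integral>\<^sup>+x. ennreal (gamma_dens (a + 1) x) * f x \<partial>lborel)"
 proof (rule nn_integral_cong)
  fix x :: real
  have "gamma_dens a x * (x / a) = gamma_dens (a + 1) x"
  proof (cases "x > 0")
   case True
   have "Gamma (a + 1) = a * Gamma a" using a by (intro Gamma_plus1) auto
   moreover have "x powr a = x powr (a - 1) * x"
    using True by (metis powr_add powr_one diff_add_cancel less_imp_le)
   ultimately show ?thesis using True a by (simp add: gamma_dens_def mult_ac)
  qed (simp add: gamma_dens_def)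
  then show "ennreal (gamma_dens a x) * (ennreal (x / a) * f x) = ennreal (gamma_dens (a + 1) x) * f x"
   by (cases "x > 0")
     (auto simp: mult.assoc[symmetric] ennreal_mult''[symmetric] a less_imp_le gamma_dens_def)
 qed
 also have "... = (\<integral>\<^sup>+x. f x \<partial>gamma_law (a + 1))"
  using a by (intro nn_integral_gamma_law[symmetric]) auto
 finally show ?thesis ..
qed

definition beta_dens :: "real => real => real => real" where
 "beta_dens p q b = (if 0 < b \<and> b < 1 then b powr (p - 1) * (1 - b) powr (q - 1) / Beta p q else 0)"

lemma beta_dens_measurable [measurable]: "beta_dens p q \<in> borel_measurable borel"
 unfolding beta_dens_def by measurable

lemma Beta_pos: "p > 0 ==> q > 0 ==> Beta p q > (0::real)"
 by (simp add: Beta_def Gamma_real_pos)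

lemma beta_dens_nonneg: "p > 0 ==> q > 0 ==> beta_dens p q b >= 0"
 using Beta_pos[of p q] by (simp add: beta_dens_def)

text \<open>
  The case \<open>q = 0\<close> is the limit of a split that keeps everything in the left part; it occurs for cells
  that contain no integer.
\<close>
definition beta_law :: "real => real => real measure" where
 "beta_law p q = (if q > 0 then density lborel (\<lambda>b. ennreal (beta_dens p q b)) else return borel 1)"

lemma sets_beta_law [simp, measurable_cong]: "sets (beta_law p q) = sets borel"
 by (simp add: beta_law_def)

lemma space_beta_law [simp]: "space (beta_law p q) = UNIV"
 using sets_eq_imp_space_eq[OF sets_beta_law[of p q]] by simp

text \<open>
  Beta-gamma algebra: a gamma variable multiplied by an independent beta fraction and by its complement gives two
  independent gamma variables. The proof is the substitution \<open>(x, y) = (s b, s (1 - b))\<close>, carried out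
  one variable at a time.
\<close>
lemma nn_integral_gamma_split_measurable:
 assumes p: "p > 0" and q: "q >= 0" and F[measurable]: "F \<in> borel_measurable (borel \<Otimes>\<^sub>M borel)"
 shows "(\<integral>\<^sup>+t. \<integral>\<^sup>+b. F (t * b, t * (1 - b)) \<partial>beta_law p q \<partial>gamma_law (p + q)) =
     (\<integral>\<^sup>+x. \<integral>\<^sup>+y. F (x, y) \<partial>gamma_law q \<partial>gamma_law p)"
proof (cases "q = 0")
 case True
 then show ?thesis
  by (simp add: beta_law_def nn_integral_return nn_integral_gamma_law_0)
next
 case False
 then have q: "q > 0" using q by simp
 have [simp]: "ennreal (gamma_dens p x) * (ennreal (gamma_dens q y) * z) =
   ennreal (gamma_dens p x * gamma_dens q y) * z" for x y z
  using p q by (simp add: ennreal_mult gamma_dens_nonneg mult.assoc)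
 have "(\<integral>\<^sup>+x. \<integral>\<^sup>+y. F (x, y) \<partial>gamma_law q \<partial>gamma_law p) =
  (\<integral>\<^sup>+x. \<integral>\<^sup>+y. ennreal (gamma_dens q y) * F (x, y) \<partial>lborel \<partial>gamma_law p)"
  by (intro nn_integral_cong nn_integral_gamma_law[OF q]) measurable
 also have "... = (\<integral>\<^sup>+x. ennreal (gamma_dens p x) * (\<integral>\<^sup>+y. ennreal (gamma_dens q y) * F (x, y) \<partial>lborel) \<partial>lborel)"
  by (rule nn_integral_gamma_law[OF p]) measurable
 also have "... = (\<integral>\<^sup>+x. (\<integral>\<^sup>+y. ennreal (gamma_dens p x) * (ennreal (gamma_dens q y) * F (x, y)) \<partial>lborel) \<partial>lborel)"
  by (intro nn_integral_cong nn_integral_cmult[symmetric]) measurable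
 also have "... = (\<integral>\<^sup>+x. (\<integral>\<^sup>+y. ennreal (gamma_dens p x * gamma_dens q y) * F (x, y) \<partial>lborel) \<partial>lborel)"
  by simp
 also have "... = (\<integral>\<^sup>+x. (\<integral>\<^sup>+s. ennreal (gamma_dens p x * gamma_dens q (s - x)) * F (x, s - x) \<partial>lborel) \<partial>lborel)"
 proof (rule nn_integral_cong)
  fix x :: real
  show "(\<integral>\<^sup>+y. ennreal (gamma_dens p x * gamma_dens q y) * F (x, y) \<partial>lborel) =
   (\<integral>\<^sup>+s. ennreal (gamma_dens p x * gamma_dens q (s - x)) * F (x, s - x) \<partial>lborel)"
   by (subst nn_integral_real_affine[where c = 1 and t = "- x"]) auto
 qed
 also have "... = (\<integral>\<^sup>+s. (\<integral>\<^sup>+x. ennreal (gamma_dens p x * gamma_dens q (s - x)) * F (x, s - x) \<partial>lborel) \<partial>lborel)"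
  by (rule lborel_pair.Fubini') measurable
 also have "... = (\<integral>\<^sup>+s. ennreal (gamma_dens (p + q) s) *
   (\<integral>\<^sup>+b. ennreal (beta_dens p q b) * F (s * b, s * (1 - b)) \<partial>lborel) \<partial>lborel)"
 proof (rule nn_integral_cong)
  fix s :: real
  show "(\<integral>\<^sup>+x. ennreal (gamma_dens p x * gamma_dens q (s - x)) * F (x, s - x) \<partial>lborel) =
   ennreal (gamma_dens (p + q) s) *
   (\<integral>\<^sup>+b. ennreal (beta_dens p q b) * F (s * b, s * (1 - b)) \<partial>lborel)"
  proof (cases "s > 0")
   case False
   then have "gamma_dens p x * gamma_dens q (s - x) = 0" for x
    by (auto simp: gamma_dens_def)
   moreover have "gamma_dens (p + q) s = 0" using False by (simp add: gamma_dens_def)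
   ultimately show ?thesis by (simp only: mult_zero_left ennreal_0) simp
  next
   case s: True
   have "(\<integral>\<^sup>+x. ennreal (gamma_dens p x * gamma_dens q (s - x)) * F (x, s - x) \<partial>lborel)
    = ennreal \<bar>s\<bar> * (\<integral>\<^sup>+b. ennreal (gamma_dens p (0 + s * b) * gamma_dens q (s - (0 + s * b))) *
      F (0 + s * b, s - (0 + s * b)) \<partial>lborel)"
    using s by (intro nn_integral_real_affine) auto
   also have "... = (\<integral>\<^sup>+b. ennreal \<bar>s\<bar> * (ennreal (gamma_dens p (0 + s * b) * gamma_dens q (s - (0 + s * b))) *
      F (0 + s * b, s - (0 + s * b))) \<partial>lborel)"
    by (rule nn_integral_cmult[symmetric]) measurable
   also have "... = (\<integral>\<^sup>+b. ennreal (gamma_dens (p + q) s) *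
     (ennreal (beta_dens p q b) * F (s * b, s * (1 - b))) \<partial>lborel)"
   proof (rule nn_integral_cong)
    fix b :: real
    have "s * (gamma_dens p (s * b) * gamma_dens q (s - s * b)) =
      gamma_dens (p + q) s * beta_dens p q b"
    proof (cases "0 < b \<and> b < 1")
     case True
     have "Gamma (p + q) > 0" using p q by (intro Gamma_real_pos) simp
     then have G: "Beta p q * Gamma (p + q) = Gamma p * Gamma q"
      by (simp add: Beta_def)
     have e: "exp (- (s * b)) * exp (- (s - s * b)) = exp (- s)"
      by (simp add: exp_add[symmetric])
     have "s * (s powr (p - 1) * s powr (q - 1)) = s powr 1 * s powr (p - 1) * s powr (q - 1)"
      using s by simp
     also have "... = s powr (p + q - 1)"
      unfolding powr_add[symmetric] by (simp add: algebra_simps)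
     finally have e2: "s * (s powr (p - 1) * s powr (q - 1)) = s powr (p + q - 1)" .
     have e3: "s - s * b = s * (1 - b)" by (simp add: algebra_simps)
     have "s * (gamma_dens p (s * b) * gamma_dens q (s - s * b)) =
       (s * (s powr (p - 1) * s powr (q - 1))) * (exp (- (s * b)) * exp (- (s - s * b))) *
       (b powr (p - 1) * (1 - b) powr (q - 1)) / (Gamma p * Gamma q)"
      using True s by (simp add: gamma_dens_def e3 powr_mult)
     also have "... = s powr (p + q - 1) * exp (- s) *
       (b powr (p - 1) * (1 - b) powr (q - 1)) / (Beta p q * Gamma (p + q))"
      unfolding e e2 G ..
     also have "... = gamma_dens (p + q) s * beta_dens p q b"
      using True s by (simp add: gamma_dens_def beta_dens_def)
     finally show ?thesis .
    next
     case False
     then have "b <= 0 \<or> s - s * b <= 0" using s by auto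
     then show ?thesis using s False by (auto simp: gamma_dens_def beta_dens_def zero_less_mult_iff)
    qed
    then have "ennreal s * ennreal (gamma_dens p (s * b) * gamma_dens q (s - s * b)) =
      ennreal (gamma_dens (p + q) s) * ennreal (beta_dens p q b)"
     using s p q by (simp add: ennreal_mult'[symmetric] gamma_dens_nonneg)
    then show "ennreal \<bar>s\<bar> * (ennreal (gamma_dens p (0 + s * b) * gamma_dens q (s - (0 + s * b))) *
      F (0 + s * b, s - (0 + s * b))) =
     ennreal (gamma_dens (p + q) s) * (ennreal (beta_dens p q b) * F (s * b, s * (1 - b)))"
     using s by (simp add: mult.assoc[symmetric] right_diff_distrib)
   qed
   also have "... = ennreal (gamma_dens (p + q) s) *
     (\<integral>\<^sup>+b. ennreal (beta_dens p q b) * F (s * b, s * (1 - b)) \<partial>lborel)"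
    by (rule nn_integral_cmult) measurable
   finally show ?thesis .
  qed
 qed
 also have "... = (\<integral>\<^sup>+s. (\<integral>\<^sup>+b. ennreal (beta_dens p q b) * F (s * b, s * (1 - b)) \<partial>lborel) \<partial>gamma_law (p + q))"
  using p q by (intro nn_integral_gamma_law[symmetric]) auto
 also have "... = (\<integral>\<^sup>+s. (\<integral>\<^sup>+b. F (s * b, s * (1 - b)) \<partial>beta_law p q) \<partial>gamma_law (p + q))"
  using q by (intro nn_integral_cong) (simp add: beta_law_def nn_integral_density)
 finally show ?thesis ..
qed

lemma prob_space_beta_law:
 assumes "p > 0" "q >= 0"
 shows "prob_space (beta_law p q)"
proof
 have "(\<integral>\<^sup>+t. \<integral>\<^sup>+b. 1 \<partial>beta_law p q \<partial>gamma_law (p + q)) =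
     (\<integral>\<^sup>+x. \<integral>\<^sup>+y. 1 \<partial>gamma_law q \<partial>gamma_law p)"
  using nn_integral_gamma_split_measurable[OF assms, of "\<lambda>_. 1"] by simp
 then show "emeasure (beta_law p q) (space (beta_law p q)) = 1"
  using prob_space.emeasure_space_1[OF prob_space_gamma_law] by simp
qed

lemma nn_integral_gamma_add:
 assumes "p >= 0" "q >= 0" and [measurable]: "f \<in> borel_measurable borel"
 shows "(\<integral>\<^sup>+x. \<integral>\<^sup>+y. f (x + y) \<partial>gamma_law q \<partial>gamma_law p) = (\<integral>\<^sup>+x. f x \<partial>gamma_law (p + q))"
proof (cases "p = 0")
 case True
 interpret q: prob_space "gamma_law q" by (rule prob_space_gamma_law)
 have "(\<integral>\<^sup>+x. \<integral>\<^sup>+y. f (x + y) \<partial>gamma_law q \<partial>gamma_law 0) = (\<integral>\<^sup>+y. f (0 + y) \<partial>gamma_law q)"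
  by (rule nn_integral_gamma_law_0) measurable
 then show ?thesis using True by simp
next
 case False
 then have p: "p > 0" using assms by simp
 interpret beta: prob_space "beta_law p q" by (rule prob_space_beta_law[OF p assms(2)])
 have "(\<integral>\<^sup>+t. \<integral>\<^sup>+b. f (t * b + t * (1 - b)) \<partial>beta_law p q \<partial>gamma_law (p + q)) =
     (\<integral>\<^sup>+x. \<integral>\<^sup>+y. f (x + y) \<partial>gamma_law q \<partial>gamma_law p)"
  using nn_integral_gamma_split_measurable[OF p assms(2), of "\<lambda>(x, y). f (x + y)"] by simp
 moreover have "t * b + t * (1 - b) = t" for t b :: real by (simp add: algebra_simps)
 ultimately show ?thesis
  using beta.emeasure_space_1 by simp
qed

text \<open>
  Sums of independent gamma variables over the fibres of a map are independent gamma variables. Induction on the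
  index set, adding one variable to its fibre by \<open>nn_integral_gamma_add\<close>.
\<close>
lemma nn_integral_PiM_gamma_aggregate:
 assumes "finite I" "finite J" "g ` I \<subseteq> J" "\<And>i. i \<in> I ==> a i >= 0"
  and f: "\<And>j. j \<in> J ==> f j \<in> borel_measurable borel"
 shows "(\<integral>\<^sup>+x. (\<Prod>j\<in>J. f j (\<Sum>i\<in>{i\<in>I. g i = j}. x i)) \<partial>(PiM I (\<lambda>i. gamma_law (a i)))) =
  (\<Prod>j\<in>J. \<integral>\<^sup>+y. f j y \<partial>gamma_law (\<Sum>i\<in>{i\<in>I. g i = j}. a i))"
 using assms(1,3,4) f
proof (induction I arbitrary: f rule: finite_induct)
 case empty
 then show ?case
  by (simp add: nn_integral_gamma_law_0 PiM_empty nn_integral_count_space_finite)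
next
 case (insert i0 I)
 note [measurable] = insert.prems(3)
 interpret product_prob_space "\<lambda>i. gamma_law (a i)"
  by (rule product_prob_spaceI) (rule prob_space_gamma_law)
 let ?j = "g i0"
 let ?S = "\<lambda>j. {i\<in>I. g i = j}"
 have j: "?j \<in> J" using insert.prems by auto
 have S: "{i\<in>insert i0 I. g i = j} = (if j = ?j then insert i0 (?S j) else ?S j)" for j by auto
 have sum: "(\<Sum>i\<in>{i\<in>insert i0 I. g i = j}. (x(i0 := y)) i) = (\<Sum>i\<in>?S j. x i) + (if j = ?j then y else 0)"
  for j y and x :: "'a => real"
 proof -
  have "(\<Sum>i\<in>?S j. (x(i0 := y)) i) = (\<Sum>i\<in>?S j. x i)"
   using insert.hyps by (intro sum.cong) auto
  then show ?thesis using insert.hyps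
   unfolding S by (cases "j = ?j") (simp_all add: add.commute)
 qed
 have suma: "(\<Sum>i\<in>{i\<in>insert i0 I. g i = j}. a i) = (\<Sum>i\<in>?S j. a i) + (if j = ?j then a i0 else 0)" for j
  unfolding S using insert.hyps by (cases "j = ?j") (simp_all add: add.commute)
 have meas: "(\<lambda>x. \<Prod>j\<in>J. f j (\<Sum>i\<in>{i\<in>insert i0 I. g i = j}. x i)) \<in>
   borel_measurable (PiM (insert i0 I) (\<lambda>i. gamma_law (a i)))"
 proof (intro borel_measurable_prod_ennreal)
  fix j' assume "j' \<in> J"
  have "(\<lambda>x. \<Sum>i\<in>{i\<in>insert i0 I. g i = j'}. x i) \<in> borel_measurable (PiM (insert i0 I) (\<lambda>i. gamma_law (a i)))"
   by (intro borel_measurable_sum) (auto intro!: measurable_component_singleton)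
  from measurable_compose[OF this insert.prems(3)[OF \<open>j' \<in> J\<close>]]
  show "(\<lambda>x. f j' (\<Sum>i\<in>{i\<in>insert i0 I. g i = j'}. x i)) \<in>
    borel_measurable (PiM (insert i0 I) (\<lambda>i. gamma_law (a i)))" .
 qed
 have "(\<integral>\<^sup>+x. (\<Prod>j\<in>J. f j (\<Sum>i\<in>{i\<in>insert i0 I. g i = j}. x i)) \<partial>(PiM (insert i0 I) (\<lambda>i. gamma_law (a i)))) =
  (\<integral>\<^sup>+y. \<integral>\<^sup>+x. (\<Prod>j\<in>J. f j (\<Sum>i\<in>{i\<in>insert i0 I. g i = j}. (x(i0 := y)) i))
    \<partial>(PiM I (\<lambda>i. gamma_law (a i))) \<partial>gamma_law (a i0))"
  using insert.hyps by (intro product_nn_integral_insert_rev meas) auto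
 also have "... = (\<integral>\<^sup>+y. (\<integral>\<^sup>+x. (\<Prod>j\<in>J. (\<lambda>s. f j (s + (if j = ?j then y else 0))) (\<Sum>i\<in>?S j. x i))
    \<partial>(PiM I (\<lambda>i. gamma_law (a i)))) \<partial>gamma_law (a i0))"
  by (simp only: sum)
 also have "... = (\<integral>\<^sup>+y. (\<Prod>j\<in>J. \<integral>\<^sup>+s. f j (s + (if j = ?j then y else 0)) \<partial>gamma_law (\<Sum>i\<in>?S j. a i)) \<partial>gamma_law (a i0))"
 proof (intro nn_integral_cong)
  fix y :: real
  show "(\<integral>\<^sup>+x. (\<Prod>j\<in>J. (\<lambda>s. f j (s + (if j = ?j then y else 0))) (\<Sum>i\<in>?S j. x i))
    \<partial>(PiM I (\<lambda>i. gamma_law (a i)))) =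
   (\<Prod>j\<in>J. \<integral>\<^sup>+s. f j (s + (if j = ?j then y else 0)) \<partial>gamma_law (\<Sum>i\<in>?S j. a i))"
   using insert.prems by (intro insert.IH) auto
 qed
 also have "... = (\<integral>\<^sup>+y. (\<Prod>j\<in>J - {?j}. \<integral>\<^sup>+s. f j s \<partial>gamma_law (\<Sum>i\<in>?S j. a i)) *
    (\<integral>\<^sup>+s. f ?j (s + y) \<partial>gamma_law (\<Sum>i\<in>?S ?j. a i)) \<partial>gamma_law (a i0))"
  using j assms(2) by (intro nn_integral_cong)
   (simp add: prod.remove[OF assms(2) j] mult.commute)
 also have "... = (\<Prod>j\<in>J - {?j}. \<integral>\<^sup>+s. f j s \<partial>gamma_law (\<Sum>i\<in>?S j. a i)) *
    (\<integral>\<^sup>+y. (\<integral>\<^sup>+s. f ?j (y + s) \<partial>gamma_law (\<Sum>i\<in>?S ?j. a i)) \<partial>gamma_law (a i0))"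
 proof -
  interpret Q: prob_space "gamma_law (\<Sum>i\<in>?S ?j. a i)" by (rule prob_space_gamma_law)
  have [measurable]: "f ?j \<in> borel_measurable borel" using insert.prems j by auto
  have eq: "(\<integral>\<^sup>+s. f ?j (s + y) \<partial>gamma_law (\<Sum>i\<in>?S ?j. a i)) =
    (\<integral>\<^sup>+s. f ?j (y + s) \<partial>gamma_law (\<Sum>i\<in>?S ?j. a i))" for y
   by (simp add: add.commute)
  show ?thesis
   unfolding eq by (rule nn_integral_cmult) measurable
 qed
 also have "(\<integral>\<^sup>+y. (\<integral>\<^sup>+s. f ?j (y + s) \<partial>gamma_law (\<Sum>i\<in>?S ?j. a i)) \<partial>gamma_law (a i0)) =
   (\<integral>\<^sup>+y. f ?j y \<partial>gamma_law (a i0 + (\<Sum>i\<in>?S ?j. a i)))"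
  using j insert.prems by (intro nn_integral_gamma_add sum_nonneg) auto
 also have "(\<Prod>j\<in>J - {?j}. \<integral>\<^sup>+s. f j s \<partial>gamma_law (\<Sum>i\<in>?S j. a i)) *
   (\<integral>\<^sup>+y. f ?j y \<partial>gamma_law (a i0 + (\<Sum>i\<in>?S ?j. a i))) =
  (\<Prod>j\<in>J. \<integral>\<^sup>+y. f j y \<partial>gamma_law (\<Sum>i\<in>{i\<in>insert i0 I. g i = j}. a i))"
  unfolding suma by (simp add: prod.remove[OF assms(2) j] mult.commute add.commute)
 finally show ?case .
qed

section \<open>Product laws and summability\<close>

lemma (in prob_space) nn_integral_indep_var:
 assumes ind: "indep_var S X T Y" and F[measurable]: "F \<in> borel_measurable (S \<Otimes>\<^sub>M T)"
 shows "(\<integral>\<^sup>+wo. F (X wo, Y wo) \<partial>M) = (\<integral>\<^sup>+x. \<integral>\<^sup>+y. F (x, y) \<partial>distr M T Y \<partial>distr M S X)"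
proof -
 have [measurable]: "X \<in> measurable M S" "Y \<in> measurable M T"
  using ind by (blast dest: indep_var_rv1 indep_var_rv2)+
 interpret Y: prob_space "distr M T Y" by (rule prob_space_distr) simp
 have "(\<integral>\<^sup>+wo. F (X wo, Y wo) \<partial>M) = (\<integral>\<^sup>+z. F z \<partial>distr M (S \<Otimes>\<^sub>M T) (\<lambda>wo. (X wo, Y wo)))"
  by (subst nn_integral_distr) auto
 also have "... = (\<integral>\<^sup>+z. F z \<partial>(distr M S X \<Otimes>\<^sub>M distr M T Y))"
  using ind by (simp add: indep_var_distribution_eq)
 also have "... = (\<integral>\<^sup>+x. \<integral>\<^sup>+y. F (x, y) \<partial>distr M T Y \<partial>distr M S X)"
  by (subst Y.nn_integral_fst[symmetric]) auto
 finally show ?thesis .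
qed

text \<open>
  Limits of random vectors are accessible through continuous test functions only. Half lines generate the Borel sets
  and their indicators are limits of continuous ramps, so continuous product tests are enough to identify marginals
  and independence.
\<close>
lemma (in prob_space) distr_eq_PiM_if_continuous_tests:
 fixes W :: "'i => 'a => real"
 assumes J: "finite J" "J \<noteq> {}" and W[measurable]: "\<And>i. W i \<in> borel_measurable M"
  and N: "\<And>i. real_distribution (N i)"
  and tests: "\<And>g :: 'i => real => real. (\<And>i. continuous_on UNIV (g i)) ==>
    (\<And>i x. 0 <= g i x \<and> g i x <= 1) ==>
    (\<integral>\<^sup>+wo. (\<Prod>i\<in>J. ennreal (g i (W i wo))) \<partial>M) = (\<Prod>i\<in>J. \<integral>\<^sup>+y. ennreal (g i y) \<partial>N i)"
 shows "distr M (PiM J (\<lambda>_. borel)) (\<lambda>wo. \<lambda>i\<in>J. W i wo) = PiM J N"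
proof -
 define E :: "real set set" where "E = insert UNIV (range atMost)"
 \<comment> \<open>ramps from 1 to 0 on an interval of length 1/n after the right end of the half line\<close>
 define h :: "real set => nat => real => real" where
  "h A n x = (if A = UNIV then 1 else max 0 (min 1 (1 - real n * (x - Sup A))))" for A n x
 have h_cont: "continuous_on UNIV (h A n)" for A n
  unfolding h_def by (cases "A = UNIV") (auto intro!: continuous_intros)
 have h_bd: "0 <= h A n x \<and> h A n x <= 1" for A n x
  by (auto simp: h_def)
 have h_meas[measurable]: "h A n \<in> borel_measurable borel" for A n
  by (rule borel_measurable_continuous_onI[OF h_cont])
 have h_lim: "(\<lambda>n. h A n x) \<longlonglongrightarrow> indicator A x" if A_E: "A \<in> E" for A x
 proof (cases "A = UNIV")
  case False
  then obtain c where A: "A = {..c}" using A_E unfolding E_def by blast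
  show ?thesis
  proof (cases "x <= c")
   case True
   have "h A n x = 1" for n
    using True mult_nonneg_nonpos[of "real n" "x - c"] by (auto simp: h_def A)
   then show ?thesis using True by (simp add: A)
  next
   case False
   obtain n0 :: nat where n0: "1 / (x - c) < n0" using reals_Archimedean2 by blast
   have "h A n x = 0" if "n >= n0" for n
   proof -
    have "1 < real n0 * (x - c)" using n0 False by (simp add: field_simps)
    also have "... <= real n * (x - c)" using that False by (intro mult_right_mono) auto
    finally show ?thesis using \<open>A \<noteq> UNIV\<close> by (simp add: h_def A)
   qed
   then have "eventually (\<lambda>n. h A n x = 0) sequentially"
    by (auto simp: eventually_sequentially)
   then show ?thesis using False by (simp add: A tendsto_eventually)
  qed
 qed (simp add: h_def)
 have Eb: "A \<in> sets borel" if "A \<in> E" for A using that by (auto simp: E_def)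
 \<comment> \<open>products of half lines suffice, since they form an Int-stable generator\<close>
 have rect: "emeasure M {wo\<in>space M. \<forall>i\<in>J. W i wo \<in> A i} = (\<Prod>i\<in>J. emeasure (N i) (A i))"
  if A: "\<And>i. i \<in> J ==> A i \<in> E" for A
 proof -
  have "(\<lambda>n. \<integral>\<^sup>+wo. (\<Prod>i\<in>J. ennreal (h (A i) n (W i wo))) \<partial>M) \<longlonglongrightarrow>
    (\<integral>\<^sup>+wo. (\<Prod>i\<in>J. ennreal (indicator (A i) (W i wo))) \<partial>M)"
  proof (rule nn_integral_dominated_convergence[where w = "\<lambda>_. 1"])
   show "(\<lambda>wo. \<Prod>i\<in>J. ennreal (indicator (A i) (W i wo))) \<in> borel_measurable M"
    using A Eb by (intro borel_measurable_prod_ennreal measurable_compose[OF W]) (auto intro!: measurable_compose[OF _ measurable_ennreal])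
   show "AE wo in M. (\<Prod>i\<in>J. ennreal (h (A i) n (W i wo))) <= 1" for n
    using h_bd by (intro AE_I2 prod_le_1) (auto simp flip: ennreal_1 intro: ennreal_leI)
   show "AE wo in M. (\<lambda>n. \<Prod>i\<in>J. ennreal (h (A i) n (W i wo))) \<longlonglongrightarrow> (\<Prod>i\<in>J. ennreal (indicator (A i) (W i wo)))"
    using h_bd h_lim A by (intro AE_I2)
     (simp add: prod_ennreal del: ennreal_indicator, intro tendsto_ennrealI tendsto_prod, auto)
  qed (auto simp: emeasure_space_1)
  moreover have "(\<lambda>n. \<Prod>i\<in>J. \<integral>\<^sup>+y. ennreal (h (A i) n y) \<partial>N i) \<longlonglongrightarrow> (\<Prod>i\<in>J. emeasure (N i) (A i))"
  proof -
   have "(\<lambda>n. \<integral>\<^sup>+y. ennreal (h (A i) n y) \<partial>N i) \<longlonglongrightarrow> emeasure (N i) (A i)" if "i \<in> J" for i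
   proof -
    interpret Ni: real_distribution "N i" by (rule N)
    have "(\<lambda>n. \<integral>\<^sup>+y. ennreal (h (A i) n y) \<partial>N i) \<longlonglongrightarrow> (\<integral>\<^sup>+y. ennreal (indicator (A i) y) \<partial>N i)"
    proof (rule nn_integral_dominated_convergence[where w = "\<lambda>_. 1"])
     show "AE y in N i. ennreal (h (A i) n y) <= 1" for n
      using h_bd by (intro AE_I2) (auto simp flip: ennreal_1 intro: ennreal_leI)
     show "AE y in N i. (\<lambda>n. ennreal (h (A i) n y)) \<longlonglongrightarrow> ennreal (indicator (A i) y)"
      using h_lim A that by (intro AE_I2 tendsto_ennrealI) auto
    qed (use Eb A that in \<open>auto simp: Ni.emeasure_space_1[simplified]\<close>)
    moreover have "(\<integral>\<^sup>+y. ennreal (indicator (A i) y) \<partial>N i) = emeasure (N i) (A i)"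
     using Eb[OF A[OF that]] by (simp add: ennreal_indicator)
    ultimately show ?thesis by simp
   qed
   then have "(\<lambda>n. \<Prod>i\<in>J. enn2real (\<integral>\<^sup>+y. ennreal (h (A i) n y) \<partial>N i)) \<longlonglongrightarrow> (\<Prod>i\<in>J. enn2real (emeasure (N i) (A i)))"
   proof (intro tendsto_prod)
    fix i assume i: "i \<in> J"
     and *: "\<And>i. i \<in> J ==> (\<lambda>n. \<integral>\<^sup>+y. ennreal (h (A i) n y) \<partial>N i) \<longlonglongrightarrow> emeasure (N i) (A i)"
    interpret Ni: real_distribution "N i" by (rule N)
    show "(\<lambda>n. enn2real (\<integral>\<^sup>+y. ennreal (h (A i) n y) \<partial>N i)) \<longlonglongrightarrow> enn2real (emeasure (N i) (A i))"
     using *[OF i] by (intro tendsto_enn2real) (auto simp: Ni.emeasure_eq_measure)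
   qed
   then have "(\<lambda>n. ennreal (\<Prod>i\<in>J. enn2real (\<integral>\<^sup>+y. ennreal (h (A i) n y) \<partial>N i))) \<longlonglongrightarrow> ennreal (\<Prod>i\<in>J. enn2real (emeasure (N i) (A i)))"
    by (rule tendsto_ennrealI)
   moreover have "ennreal (enn2real (\<integral>\<^sup>+y. ennreal (h (A i) n y) \<partial>N i)) = (\<integral>\<^sup>+y. ennreal (h (A i) n y) \<partial>N i)" for i n
   proof -
    interpret Ni: real_distribution "N i" by (rule N)
    have "(\<integral>\<^sup>+y. ennreal (h (A i) n y) \<partial>N i) <= (\<integral>\<^sup>+y. 1 \<partial>N i)"
     using h_bd by (intro nn_integral_mono) (auto simp flip: ennreal_1 intro: ennreal_leI)
    also have "... = 1" by (simp add: Ni.emeasure_space_1[simplified])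
    also have "(1::ennreal) < top" by simp
    finally show ?thesis by (rule ennreal_enn2real)
   qed
   moreover have "ennreal (enn2real (emeasure (N i) (A i))) = emeasure (N i) (A i)" for i
   proof -
    interpret Ni: real_distribution "N i" by (rule N)
    show ?thesis by (simp add: Ni.emeasure_eq_measure)
   qed
   ultimately show ?thesis by (simp add: prod_ennreal[symmetric])
  qed
  moreover have "(\<integral>\<^sup>+wo. (\<Prod>i\<in>J. ennreal (h (A i) n (W i wo))) \<partial>M) = (\<Prod>i\<in>J. \<integral>\<^sup>+y. ennreal (h (A i) n y) \<partial>N i)" for n
   using tests[of "\<lambda>i. h (A i) n"] h_cont h_bd by auto
  ultimately have "(\<integral>\<^sup>+wo. (\<Prod>i\<in>J. ennreal (indicator (A i) (W i wo))) \<partial>M) = (\<Prod>i\<in>J. emeasure (N i) (A i))"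
   using LIMSEQ_unique by fastforce
  moreover have "(\<Prod>i\<in>J. ennreal (indicator (A i) (W i wo))) = indicator {wo\<in>space M. \<forall>i\<in>J. W i wo \<in> A i} wo"
   if "wo \<in> space M" for wo
   using that J by (auto simp: indicator_def prod_zero_iff)
  moreover have "{wo\<in>space M. \<forall>i\<in>J. W i wo \<in> A i} \<in> sets M"
  proof -
   have "{wo\<in>space M. \<forall>i\<in>J. W i wo \<in> A i} = (\<Inter>i\<in>J. W i -` A i \<inter> space M)" using J by auto
   also have "... \<in> sets M" using J A Eb by (intro sets.finite_INT measurable_sets[OF W]) auto
   finally show ?thesis .
  qed
  ultimately show ?thesis
   by (simp cong: nn_integral_cong)
 qed
 have marg: "distr M borel (W i) = N i" if i: "i \<in> J" for i
 proof -
  interpret Ni: real_distribution "N i" by (rule N)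
  have "cdf (distr M borel (W i)) = cdf (N i)"
  proof
   fix c
   have "emeasure M {wo\<in>space M. \<forall>j\<in>J. W j wo \<in> (if j = i then {..c} else UNIV)} =
    (\<Prod>j\<in>J. emeasure (N j) (if j = i then {..c} else UNIV))"
    by (rule rect) (auto simp: E_def)
   moreover have "{wo\<in>space M. \<forall>j\<in>J. W j wo \<in> (if j = i then {..c} else UNIV)} = W i -` {..c} \<inter> space M"
    using i by auto
   moreover have "emeasure (N j) UNIV = 1" for j
   proof -
    interpret Nj: real_distribution "N j" by (rule N)
    show ?thesis using Nj.emeasure_space_1 by simp
   qed
   ultimately have "emeasure M (W i -` {..c} \<inter> space M) = emeasure (N i) {..c}"
    using i J by (simp add: prod.remove[of J i] prod.neutral)
   then show "cdf (distr M borel (W i)) c = cdf (N i) c"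
    by (simp add: cdf_def measure_def emeasure_distr)
  qed
  then show ?thesis by (intro cdf_unique) (auto intro: N)
 qed
 have "indep_vars (\<lambda>_. borel) W J"
 proof (subst indep_vars_finite[where E = "\<lambda>_. E"])
  show "J \<noteq> {}" "finite J" by fact+
  show "sets borel = sigma_sets (space borel) E"
  proof -
   have "sigma_sets UNIV (range atMost :: real set set) = sets borel"
    using borel_eq_atMost by (metis UNIV_I sets_measure_of_conv subsetI top_greatest Pow_UNIV)
   moreover have "sigma_sets UNIV E = sigma_sets UNIV (range atMost :: real set set)"
    unfolding E_def by (rule sigma_sets_eqI) (auto intro: sigma_sets_top)
   ultimately show ?thesis by simp
  qed
  show "Int_stable E"
   by (auto simp: Int_stable_def E_def)
  show "space borel \<in> E" by (simp add: E_def)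
  show "\<forall>A\<in>J \<rightarrow> E. prob (\<Inter>j\<in>J. W j -` A j \<inter> space M) = (\<Prod>j\<in>J. prob (W j -` A j \<inter> space M))"
  proof
   fix A assume A: "A \<in> J \<rightarrow> E"
   have "emeasure M {wo\<in>space M. \<forall>i\<in>J. W i wo \<in> A i} = (\<Prod>i\<in>J. emeasure (N i) (A i))"
    using A by (intro rect) auto
   also have "... = (\<Prod>i\<in>J. emeasure M (W i -` A i \<inter> space M))"
   proof (intro prod.cong refl)
    fix i assume i: "i \<in> J"
    then have "A i \<in> sets borel" using A Eb by auto
    then have "emeasure (distr M borel (W i)) (A i) = emeasure M (W i -` A i \<inter> space M)"
     by (intro emeasure_distr) auto
    then show "emeasure (N i) (A i) = emeasure M (W i -` A i \<inter> space M)"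
     unfolding marg[OF i] .
   qed
   also have "{wo\<in>space M. \<forall>i\<in>J. W i wo \<in> A i} = (\<Inter>j\<in>J. W j -` A j \<inter> space M)" using J by auto
   finally show "prob (\<Inter>j\<in>J. W j -` A j \<inter> space M) = (\<Prod>j\<in>J. prob (W j -` A j \<inter> space M))"
    by (simp add: emeasure_eq_measure prod_ennreal prod_nonneg)
  qed
 qed (auto simp: E_def)
 then have "distr M (PiM J (\<lambda>_. borel)) (\<lambda>wo. \<lambda>i\<in>J. W i wo) = PiM J (\<lambda>i. distr M borel (W i))"
  using J by (subst (asm) indep_vars_iff_distr_eq_PiM') auto
 also have "... = PiM J N" using marg by (intro PiM_cong) auto
 finally show ?thesis .
qed

text \<open>
  After cancelling \<open>exp v\<close> with the exponential density, the integrand is the derivative of \<open>-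
  exp (- S (exp (v / a) - 1))\<close> in \<open>v\<close>.
\<close>
lemma nn_integral_size_biased_shrink:
 assumes "S > 0" "a > 0"
 shows "(\<integral>\<^sup>+v. ennreal (S / a * exp (v / a) * exp v * exp (- S * (exp (v / a) - 1))) \<partial>gamma_law 1) = 1"
proof -
 define f where "f v = S / a * exp (v / a) * exp (- S * (exp (v / a) - 1))" for v
 have fpos: "f v >= 0" for v using assms by (simp add: f_def)
 have "(\<integral>\<^sup>+v. ennreal (S / a * exp (v / a) * exp v * exp (- S * (exp (v / a) - 1))) \<partial>gamma_law 1)
  = (\<integral>\<^sup>+v. ennreal (gamma_dens 1 v) * ennreal (S / a * exp (v / a) * exp v * exp (- S * (exp (v / a) - 1))) \<partial>lborel)"
  by (rule nn_integral_gamma_law) auto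
 also have "... = (\<integral>\<^sup>+v. ennreal (f v) * indicator {0..} v \<partial>lborel)"
 proof (rule nn_integral_cong_AE)
  have "AE v in lborel. v \<noteq> (0::real)" by (rule AE_lborel_singleton)
  then show "AE v in lborel. ennreal (gamma_dens 1 v) * ennreal (S / a * exp (v / a) * exp v * exp (- S * (exp (v / a) - 1)))
    = ennreal (f v) * indicator {0..} v"
  proof eventually_elim
   fix v :: real assume "v \<noteq> 0"
   have "exp (- v) * (S / a * exp (v / a) * exp v * exp (- S * (exp (v / a) - 1))) = f v"
    by (simp add: f_def exp_minus)
   then show "ennreal (gamma_dens 1 v) * ennreal (S / a * exp (v / a) * exp v * exp (- S * (exp (v / a) - 1)))
    = ennreal (f v) * indicator {0..} v"
    using \<open>v \<noteq> 0\<close> by (cases "v > 0") (auto simp: gamma_dens_def ennreal_mult'[symmetric])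
  qed
 qed
 also have "... = ennreal (0 - (- exp (- S * (exp (0 / a) - 1))))"
 proof (rule nn_integral_FTC_atLeast)
  show "f \<in> borel_measurable borel" unfolding f_def by measurable
  show "((\<lambda>v. - exp (- S * (exp (v / a) - 1))) has_real_derivative f x) (at x)" for x
   unfolding f_def using assms by (auto intro!: derivative_eq_intros simp: field_simps)
  show "((\<lambda>v. - exp (- S * (exp (v / a) - 1))) \<longlongrightarrow> 0) at_top"
  proof -
   have "filterlim (\<lambda>v. (1 / a) * v) at_top at_top"
    using assms by (intro filterlim_tendsto_pos_mult_at_top[OF tendsto_const]) (auto simp: filterlim_ident)
   then have "filterlim (\<lambda>v. exp ((1 / a) * v)) at_top at_top"
    by (rule filterlim_compose[OF exp_at_top])
   then have "filterlim (\<lambda>v. - 1 + exp ((1 / a) * v)) at_top at_top"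
    by (intro filterlim_tendsto_add_at_top[OF tendsto_const])
   then have "filterlim (\<lambda>v. S * (- 1 + exp ((1 / a) * v))) at_top at_top"
    using assms by (intro filterlim_tendsto_pos_mult_at_top[OF tendsto_const]) auto
   then have "((\<lambda>v. exp (- (S * (- 1 + exp ((1 / a) * v))))) \<longlongrightarrow> 0) at_top"
    by (intro filterlim_compose[OF exp_at_bot]) (simp add: filterlim_uminus_at_bot)
   from tendsto_minus[OF this] show ?thesis by (simp add: algebra_simps)
  qed
 qed (use fpos in auto)
 also have "... = 1" by simp
 finally show ?thesis .
qed

text \<open>
  The expectation of the sum is finite by monotone convergence.
\<close>
lemma (in prob_space) AE_summable_of_nn_integral_bound:
 assumes X[measurable]: "\<And>n. X n \<in> borel_measurable M"
  and nn: "AE wo in M. \<forall>n. X n wo >= 0"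
  and le: "\<And>n. (\<integral>\<^sup>+wo. ennreal (X n wo) \<partial>M) <= ennreal (b n)"
  and b: "summable b" "\<And>n. b n >= (0::real)"
 shows "AE wo in M. summable (\<lambda>n. X n wo)"
proof -
 have "(\<integral>\<^sup>+wo. (\<Sum>n. ennreal (X n wo)) \<partial>M) = (\<Sum>n. \<integral>\<^sup>+wo. ennreal (X n wo) \<partial>M)"
  by (rule nn_integral_suminf) measurable
 also have "... <= (\<Sum>n. ennreal (b n))"
  by (intro suminf_le le) auto
 also have "... = ennreal (\<Sum>n. b n)" using b by (intro suminf_ennreal2) auto
 also have "... < \<infinity>" by simp
 finally have "AE wo in M. (\<Sum>n. ennreal (X n wo)) \<noteq> \<infinity>"
  by (intro nn_integral_PInf_AE) auto
 with nn show ?thesis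
  by eventually_elim (auto intro: summable_suminf_not_top)
qed

section \<open>Quantile coupling of symmetric beta and normal variables\<close>

text \<open>
  A function vanishing at both ends whose derivative changes sign at most once, from minus to plus, is nonpositive
  in between: it first decreases, then increases to its limit 0.
\<close>
lemma single_crossing_nonpos:
 fixes D :: "real => real"
 assumes cont: "continuous_on {0..} D" and D0: "D 0 = 0" and lim: "(D \<longlongrightarrow> 0) at_top"
  and deriv: "\<And>y. y > 0 ==> (D has_real_derivative (w y * r y)) (at y)"
  and w: "\<And>y. y > 0 ==> w y > 0" and r: "\<And>x y. 0 < x ==> x <= y ==> r x <= r y"
  and y: "y >= 0"
 shows "D y <= 0"
proof (rule ccontr)
 assume "\<not> ?thesis"
 then have Dy: "D y > 0" by simp
 then have y0: "y > 0" using y D0 by (cases "y = 0") auto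
 have "\<exists>l z. 0 < z \<and> z < y \<and> (D has_real_derivative l) (at z) \<and> D y - D 0 = (y - 0) * l"
 proof (rule MVT[OF y0])
  show "continuous_on {0..y} D" by (rule continuous_on_subset[OF cont]) auto
  show "D differentiable (at x)" if "0 < x" "x < y" for x
   using deriv[OF that(1)] by (auto simp: real_differentiable_def)
 qed
 then obtain l z where z: "0 < z" "z < y" and l: "(D has_real_derivative l) (at z)" "D y = y * l"
  using D0 by auto
 have "l = w z * r z" using DERIV_unique[OF l(1) deriv[OF z(1)]] .
 then have "w z * r z > 0" using Dy y0 l(2) by (simp add: zero_less_mult_iff)
 then have rz: "r z > 0" using w[OF z(1)] by (simp add: zero_less_mult_iff)
 have mono: "D y <= D t" if "t >= y" for t
 proof (rule DERIV_nonneg_imp_nondecreasing[OF that])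
  fix x assume "y <= x" "x <= t"
  then have "x > 0" "r x > 0" using z rz r[of z x] by auto
  then show "\<exists>d. (D has_real_derivative d) (at x) \<and> 0 <= d"
   using deriv[of x] w[of x] by (intro exI[of _ "w x * r x"]) auto
 qed
 have "eventually (\<lambda>t. D t < D y) at_top"
  using lim Dy by (rule order_tendstoD(2))
 then have "eventually (\<lambda>t. D t < D y \<and> t >= y) at_top"
  using eventually_ge_at_top by (rule eventually_conj)
 then obtain t where "D t < D y" "t >= y"
  by (auto simp: eventually_at_top_linorder)
 then show False using mono[of t] by simp
qed

lemma cdf_density_has_derivative:
 fixes f :: "real => real"
 assumes M: "M = density lborel (\<lambda>x. ennreal (f x))" and prob: "real_distribution M"
  and f[measurable]: "f \<in> borel_measurable borel" and nn: "\<And>x. f x >= 0"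
  and S: "open S" "x \<in> S" and cont: "continuous_on S f"
 shows "(cdf M has_real_derivative f x) (at x)"
proof -
 interpret real_distribution M by (rule prob)
 obtain d where d: "d > 0" "cball x d \<subseteq> S"
  using S open_contains_cball by blast
 have "{x - d..x + d} \<subseteq> S"
 proof
  fix y assume "y \<in> {x - d..x + d}"
  then have "y \<in> cball x d" by (auto simp: dist_real_def abs_le_iff)
  then show "y \<in> S" using d by blast
 qed
 then have cont': "continuous_on {x - d..x + d} f"
  by (rule continuous_on_subset[OF cont])
 have eq: "cdf M t = cdf M (x - d) + integral {x - d..t} f" if t: "t \<in> {x - d..x + d}" for t
 proof -
  have c: "continuous_on {x - d..t} f" by (rule continuous_on_subset[OF cont']) (use t in auto)
  have int: "set_integrable lborel {x - d..t} f"
   using borel_integrable_atLeastAtMost'[OF c] .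
  have diff: "cdf M t - cdf M (x - d) = measure M {x - d<..t}"
   using t d cdf_diff_eq[of "x - d" t] by (cases "x - d = t") auto
  have "emeasure M {x - d<..t} = (\<integral>\<^sup>+y. ennreal (f y) * indicator {x - d<..t} y \<partial>lborel)"
   unfolding M by (rule emeasure_density) auto
  also have "... = (\<integral>\<^sup>+y. ennreal (indicator {x - d..t} y * f y) \<partial>lborel)"
  proof (rule nn_integral_cong_AE)
   have "AE y in lborel. y \<noteq> x - d" by (rule AE_lborel_singleton)
   then show "AE y in lborel. ennreal (f y) * indicator {x - d<..t} y = ennreal (indicator {x - d..t} y * f y)"
    by eventually_elim (auto simp: indicator_def)
  qed
  also have "... = ennreal (LINT y:{x - d..t}|lborel. f y)"
   unfolding set_lebesgue_integral_def using int nn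
   by (subst nn_integral_eq_integral) (auto simp: set_integrable_def)
  also have "(LINT y:{x - d..t}|lborel. f y) = integral {x - d..t} f"
   by (rule set_borel_integral_eq_integral(2)[OF int])
  finally have "emeasure M {x - d<..t} = ennreal (integral {x - d..t} f)" .
  moreover have "integral {x - d..t} f >= 0" using nn by (intro integral_nonneg integrable_continuous_interval c) auto
  ultimately have "measure M {x - d<..t} = integral {x - d..t} f"
   by (simp add: measure_def)
  then show ?thesis using diff by simp
 qed
 have "((\<lambda>t. integral {x - d..t} f) has_real_derivative f x) (at x within {x - d..x + d})"
  using d by (intro integral_has_real_derivative cont') auto
 then have "((\<lambda>t. cdf M (x - d) + integral {x - d..t} f) has_real_derivative f x) (at x within {x - d..x + d})"
  by (auto intro!: derivative_eq_intros)
 then have "(cdf M has_real_derivative f x) (at x within {x - d..x + d})"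
 proof (rule has_field_derivative_transform_within[OF _ d(1)])
  show "x \<in> {x - d..x + d}" using d by simp
  show "cdf M (x - d) + integral {x - d..t} f = cdf M t" if "t \<in> {x - d..x + d}" for t
   by (rule eq[OF that, symmetric])
 qed
 moreover have "at x within {x - d..x + d} = at x"
  by (rule at_within_interior) (use d in \<open>auto simp: interior_atLeastAtMost_real\<close>)
 ultimately show ?thesis by simp
qed

lemma cdf_density_reflect:
 fixes f :: "real => real"
 assumes M: "M = density lborel (\<lambda>x. ennreal (f x))" and prob: "real_distribution M"
  and f[measurable]: "f \<in> borel_measurable borel" and sym: "\<And>x. f (c - x) = f x"
 shows "cdf M (c - x) = 1 - cdf M x"
proof -
 interpret real_distribution M by (rule prob)
 have "emeasure M {..c - x} = (\<integral>\<^sup>+t. ennreal (f t) * indicator {..c - x} t \<partial>lborel)"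
  unfolding M by (rule emeasure_density) auto
 also have "... = \<bar>- 1 :: real\<bar> * (\<integral>\<^sup>+t. ennreal (f (c + (-1) * t)) * indicator {..c - x} (c + (-1) * t) \<partial>lborel)"
  by (rule nn_integral_real_affine) auto
 also have "... = (\<integral>\<^sup>+t. ennreal (f t) * indicator {x<..} t \<partial>lborel)"
 proof -
  have "AE t in lborel. t \<noteq> x" by (rule AE_lborel_singleton)
  then have "(\<integral>\<^sup>+t. ennreal (f (c + (-1) * t)) * indicator {..c - x} (c + (-1) * t) \<partial>lborel) =
   (\<integral>\<^sup>+t. ennreal (f t) * indicator {x<..} t \<partial>lborel)"
   by (intro nn_integral_cong_AE, eventually_elim) (use sym in \<open>auto simp: indicator_def\<close>)
  then show ?thesis by simp
 qed
 also have "... = emeasure M {x<..}"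
  unfolding M by (rule emeasure_density[symmetric]) auto
 finally have "measure M {..c - x} = measure M {x<..}" by (simp add: measure_def)
 also have "... = measure M (space M - {..x})" by (intro arg_cong[where f = "measure M"]) auto
 also have "... = 1 - measure M {..x}" by (rule prob_compl) auto
 finally show ?thesis by (simp add: cdf_def)
qed

lemma cdf_density_isCont:
 fixes f :: "real => real"
 assumes M: "M = density lborel (\<lambda>x. ennreal (f x))" and prob: "real_distribution M"
  and f[measurable]: "f \<in> borel_measurable borel"
 shows "isCont (cdf M) x"
proof -
 interpret real_distribution M by (rule prob)
 have "emeasure M {x} = (\<integral>\<^sup>+t. ennreal (f t) * indicator {x} t \<partial>lborel)"
  unfolding M by (rule emeasure_density) auto
 also have "... = (\<integral>\<^sup>+t. 0 \<partial>(lborel :: real measure))"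
 proof (rule nn_integral_cong_AE)
  have "AE t in lborel. t \<noteq> x" by (rule AE_lborel_singleton)
  then show "AE t in lborel. ennreal (f t) * indicator {x} t = 0" by eventually_elim auto
 qed
 finally show ?thesis by (simp add: isCont_cdf measure_def)
qed

abbreviation Phi :: "real => real" where "Phi \<equiv> cdf std_normal_distribution"

lemma Phi_deriv: "(Phi has_real_derivative std_normal_density x) (at x)"
proof (rule cdf_density_has_derivative[OF refl real_dist_normal_dist, where S = UNIV])
 show "continuous_on UNIV std_normal_density"
  unfolding normal_density_def by (intro continuous_intros) auto
qed auto

lemma Phi_strict_mono: assumes "x < y" shows "Phi x < Phi y"
proof (rule DERIV_pos_imp_increasing[OF assms])
 fix t
 show "\<exists>d. (Phi has_real_derivative d) (at t) \<and> 0 < d"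
  using Phi_deriv[of t] normal_density_pos[of 1 0 t]
  by (intro exI[of _ "std_normal_density t"] conjI) simp_all
qed

lemma Phi_isCont: "isCont Phi x"
 by (rule DERIV_isCont[OF Phi_deriv])

lemma Phi_bounds: "0 < Phi x" "Phi x < 1"
proof -
 interpret real_distribution std_normal_distribution by (rule real_dist_normal_dist)
 show "0 < Phi x" using Phi_strict_mono[of "x - 1" x] cdf_nonneg[of "x - 1"] by simp
 show "Phi x < 1" using Phi_strict_mono[of x "x + 1"] cdf_bounded_prob[of "x + 1"] by simp
qed

lemma Phi_reflect: "Phi (- x) = 1 - Phi x"
proof -
 have "Phi (0 - x) = 1 - Phi x"
  by (rule cdf_density_reflect[OF refl real_dist_normal_dist]) (auto simp: normal_density_def)
 then show ?thesis by simp
qed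

lemma real_distribution_beta_law: "p > 0 ==> q >= 0 ==> real_distribution (beta_law p q)"
 using prob_space_beta_law[of p q] by (simp add: real_distribution_def real_distribution_axioms_def)

lemma beta_law_density: "q > 0 ==> beta_law p q = density lborel (\<lambda>b. ennreal (beta_dens p q b))"
 by (simp add: beta_law_def)

definition sym_beta_cdf :: "real => real => real" where
 "sym_beta_cdf m = cdf (beta_law m m)"

context
 fixes m :: real assumes m: "m >= 1 / 2"
begin

lemma m_pos: "m > 0" using m by simp

lemma sym_beta_cdf_deriv:
 assumes "0 < x" "x < 1" shows "(sym_beta_cdf m has_real_derivative beta_dens m m x) (at x)"
 unfolding sym_beta_cdf_def
proof (rule cdf_density_has_derivative[where S = "{0<..<1}"])
 show "beta_law m m = density lborel (\<lambda>b. ennreal (beta_dens m m b))"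
  by (rule beta_law_density[OF m_pos])
 have "continuous_on {0<..<1} (\<lambda>b::real. b powr (m - 1) * (1 - b) powr (m - 1) / Beta m m)"
  using Beta_pos[OF m_pos m_pos] by (intro continuous_intros) auto
 then show "continuous_on {0<..<1} (beta_dens m m)"
  by (rule continuous_on_eq) (auto simp: beta_dens_def)
qed (use assms m_pos beta_dens_nonneg in \<open>auto intro!: real_distribution_beta_law\<close>)

lemma sym_beta_cdf_isCont: "isCont (sym_beta_cdf m) x"
 unfolding sym_beta_cdf_def using m_pos
 by (intro cdf_density_isCont[OF beta_law_density real_distribution_beta_law]) auto

lemma sym_beta_cdf_reflect: "sym_beta_cdf m (1 - x) = 1 - sym_beta_cdf m x"
 unfolding sym_beta_cdf_def using m_pos
 by (intro cdf_density_reflect[OF beta_law_density real_distribution_beta_law])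
   (auto simp: beta_dens_def mult.commute)

lemma sym_beta_cdf_nonpos: assumes "x <= 0" shows "sym_beta_cdf m x = 0"
proof -
 have "emeasure (beta_law m m) {..x} = (\<integral>\<^sup>+t. ennreal (beta_dens m m t) * indicator {..x} t \<partial>lborel)"
  unfolding beta_law_density[OF m_pos] by (rule emeasure_density) auto
 also have "... = (\<integral>\<^sup>+t. 0 \<partial>(lborel :: real measure))"
  using assms by (intro nn_integral_cong) (auto simp: beta_dens_def indicator_def)
 finally show ?thesis by (simp add: sym_beta_cdf_def cdf_def measure_def)
qed

lemma sym_beta_cdf_ge_1: "x >= 1 ==> sym_beta_cdf m x = 1"
 using sym_beta_cdf_reflect[of x] sym_beta_cdf_nonpos[of "1 - x"] by simp

lemma sym_beta_cdf_half: "sym_beta_cdf m (1 / 2) = 1 / 2"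
 using sym_beta_cdf_reflect[of "1 / 2"] by simp

lemma sym_beta_cdf_strict_mono:
 assumes "0 <= x" "x < y" "y <= 1" shows "sym_beta_cdf m x < sym_beta_cdf m y"
proof (rule DERIV_pos_imp_increasing_open[OF assms(2)])
 show "\<exists>d. (sym_beta_cdf m has_real_derivative d) (at t) \<and> 0 < d" if "x < t" "t < y" for t
  using sym_beta_cdf_deriv[of t] that assms Beta_pos[OF m_pos m_pos]
  by (intro exI[of _ "beta_dens m m t"]) (auto simp: beta_dens_def)
 show "continuous_on {x..y} (sym_beta_cdf m)"
  by (intro continuous_at_imp_continuous_on) (auto simp: sym_beta_cdf_isCont)
qed

lemma sym_beta_cdf_le_iff:
 assumes "0 <= x" "x <= 1" "0 <= y" "y <= 1" shows "sym_beta_cdf m x <= sym_beta_cdf m y \<longleftrightarrow> x <= y"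
 using sym_beta_cdf_strict_mono[of x y] sym_beta_cdf_strict_mono[of y x] assms
 by (metis linorder_not_le order_le_less)

end

text \<open>
  The solution \<open>t\<close> in \<open>[1/2, 1)\<close> of \<open>4 t (1 - t) = exp (- y\<^sup>2)\<close>. In
  this coordinate the power \<open>(t (1 - t))\<^sup>m\<close> in the beta density becomes a Gaussian exponential.
\<close>
definition half_bend :: "real => real" where
 "half_bend y = 1 / 2 + sqrt (1 - exp (- (y\<^sup>2))) / 2"

lemma half_bend_bounds: "1 / 2 <= half_bend y" "half_bend y < 1"
proof -
 have "sqrt (1 - exp (- (y\<^sup>2))) < 1" by simp
 then show "half_bend y < 1" unfolding half_bend_def by linarith
qed (simp add: half_bend_def)

lemma half_bend_deriv:
 assumes "y > 0"
 shows "(half_bend has_real_derivative y * exp (- (y\<^sup>2)) / (2 * sqrt (1 - exp (- (y\<^sup>2))))) (at y)"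
proof -
 have p: "1 - exp (- (y\<^sup>2)) > 0" using assms by simp
 show ?thesis
  unfolding half_bend_def using p
  by (auto intro!: derivative_eq_intros simp: field_simps)
qed

text \<open>
  The beta density in the coordinate \<open>y\<close> is Gaussian up to the factor \<open>sqrt (y\<^sup>2 / (1 - exp
  (- y\<^sup>2)))\<close>, which is increasing; multiplied by \<open>exp (- y\<^sup>2 / 4)\<close> it becomes
  decreasing. These two facts give the upper and the lower comparison.
\<close>
lemma half_bend_density:
 assumes "y > 0"
 shows "beta_dens m m (half_bend y) * (y * exp (- (y\<^sup>2)) / (2 * sqrt (1 - exp (- (y\<^sup>2)))))
  = exp (- m * y\<^sup>2) * ((1 / 4) powr (m - 1) / (2 * Beta m m) * sqrt (y\<^sup>2 / (1 - exp (- (y\<^sup>2)))))"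
proof -
 let ?q = "1 - exp (- (y\<^sup>2))"
 have q: "?q > 0" using assms by simp
 have b: "half_bend y * (1 - half_bend y) = 1 / 4 * exp (- (y\<^sup>2))"
 proof -
  have "half_bend y * (1 - half_bend y) = 1 / 4 - (sqrt ?q)\<^sup>2 / 4"
   by (simp add: half_bend_def power2_eq_square algebra_simps add_divide_distrib)
  also have "... = 1 / 4 * exp (- (y\<^sup>2))" using q by (simp add: field_simps)
  finally show ?thesis .
 qed
 have "beta_dens m m (half_bend y) = (half_bend y * (1 - half_bend y)) powr (m - 1) / Beta m m"
  using half_bend_bounds[of y] by (simp add: beta_dens_def powr_mult)
 also have "... = (1 / 4) powr (m - 1) * exp (- (m - 1) * y\<^sup>2) / Beta m m"
  unfolding b by (subst powr_mult) (simp_all add: powr_def algebra_simps)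
 finally have "beta_dens m m (half_bend y) * (y * exp (- (y\<^sup>2)) / (2 * sqrt ?q)) =
   (exp (- (m - 1) * y\<^sup>2) * exp (- (y\<^sup>2))) * ((1 / 4) powr (m - 1) / (2 * Beta m m) * (y / sqrt ?q))"
  by (simp add: ac_simps)
 also have "exp (- (m - 1) * y\<^sup>2) * exp (- (y\<^sup>2)) = exp (- m * y\<^sup>2)"
  by (simp add: exp_add[symmetric] algebra_simps)
 also have "y / sqrt ?q = sqrt (y\<^sup>2 / ?q)" using assms by (simp add: real_sqrt_divide)
 finally show ?thesis .
qed

lemma bend_ratio_mono:
 assumes "0 < s" "s <= (t::real)" shows "s / (1 - exp (- s)) <= t / (1 - exp (- t))"
proof -
 have "exp ((1 - s / t) *\<^sub>R 0 + (s / t) *\<^sub>R (- t)) <= (1 - s / t) * exp 0 + (s / t) * exp (- t)"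
  using assms by (intro convex_onD[OF exp_convex]) auto
 then have "(s / t) * (1 - exp (- t)) <= 1 - exp (- s)"
  using assms by (simp add: algebra_simps)
 then show ?thesis using assms by (simp add: field_simps)
qed

lemma sinh_ratio_mono:
 assumes "0 < s" "s <= (t::real)" shows "sinh s / s <= sinh t / t"
proof (rule DERIV_nonneg_imp_nondecreasing[OF assms(2)])
 fix x assume "s <= x" "x <= t"
 then have x: "x > 0" using assms by simp
 have "0 * cosh 0 - sinh 0 <= x * cosh x - sinh x"
 proof (rule DERIV_nonneg_imp_nondecreasing[of 0 x "\<lambda>x. x * cosh x - sinh x"])
  show "\<exists>d. ((\<lambda>x. x * cosh x - sinh x) has_real_derivative d) (at z) \<and> 0 <= d" if "0 <= z" for z :: real
   using that by (intro exI[of _ "z * sinh z"]) (auto intro!: derivative_eq_intros)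
 qed (use x in auto)
 then show "\<exists>d. ((\<lambda>x. sinh x / x) has_real_derivative d) (at x) \<and> 0 <= d"
  using x by (intro exI[of _ "(cosh x * x - sinh x) / (x * x)"])
   (auto intro!: derivative_eq_intros simp: mult.commute)
qed

text \<open>
  The expression is \<open>(s / 2) / sinh (s / 2)\<close>.
\<close>
lemma bend_ratio_damped_antimono:
 assumes "0 < s" "s <= (t::real)"
 shows "t / (1 - exp (- t)) * exp (- t / 2) <= s / (1 - exp (- s)) * exp (- s / 2)"
proof -
 have eq: "v / (1 - exp (- v)) * exp (- v / 2) = 1 / (sinh (v / 2) / (v / 2))" if "v > 0" for v :: real
 proof -
  have "1 - exp (- v) = exp (- v / 2) * (2 * sinh (v / 2))"
   by (simp add: sinh_def algebra_simps exp_add[symmetric] field_simps)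
  then show ?thesis using that by simp
 qed
 have "sinh (s / 2) / (s / 2) <= sinh (t / 2) / (t / 2)"
  using assms by (intro sinh_ratio_mono) auto
 moreover have "sinh (s / 2) / (s / 2) > 0" using assms by simp
 ultimately show ?thesis using assms unfolding eq[OF assms(1)] eq[OF less_le_trans[OF assms]]
  by (intro divide_left_mono mult_pos_pos) auto
qed

text \<open>
  Both differences vanish at 0 by symmetry and at infinity, and by monotonicity of the density ratio they satisfy
  the hypothesis of \<open>single_crossing_nonpos\<close>. The squares of the two Gaussian scales differ by
  \<open>1/2\<close> whatever \<open>m\<close> is, which is why the coupling error does not grow with
  \<open>m\<close>.
\<close>
lemma sym_beta_cdf_half_bend:
 assumes m: "m >= 1 / 2" and y: "y >= 0"
 shows "sym_beta_cdf m (half_bend y) <= Phi (sqrt (2 * m) * y)"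
  and "Phi (sqrt (2 * m - 1 / 2) * y) <= sym_beta_cdf m (half_bend y)"
proof -
 let ?F = "\<lambda>y. sym_beta_cdf m (half_bend y)"
 have F_cont: "continuous_on {0..} ?F"
 proof (rule continuous_on_compose2[of UNIV "sym_beta_cdf m"])
  show "continuous_on UNIV (sym_beta_cdf m)"
   using sym_beta_cdf_isCont[OF m] by (intro continuous_at_imp_continuous_on) auto
  show "continuous_on {0..} half_bend"
   unfolding half_bend_def by (intro continuous_intros) auto
 qed auto
 have Phi_cont: "continuous_on {0..} (\<lambda>y. Phi (c * y))" for c
 proof (rule continuous_on_compose2[of UNIV Phi])
  show "continuous_on UNIV Phi"
   using Phi_isCont by (intro continuous_at_imp_continuous_on) auto
 qed (auto intro!: continuous_intros)
 have F_lim: "(?F \<longlongrightarrow> 1) at_top"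
 proof -
  have "filterlim (\<lambda>y::real. y\<^sup>2) at_top at_top"
   by (rule filterlim_pow_at_top) (auto simp: filterlim_ident)
  then have "((\<lambda>y::real. exp (- (y\<^sup>2))) \<longlongrightarrow> 0) at_top"
   by (intro filterlim_compose[OF exp_at_bot]) (simp add: filterlim_uminus_at_bot)
  then have "(half_bend \<longlongrightarrow> 1 / 2 + sqrt (1 - 0) / 2) at_top"
   unfolding half_bend_def by (intro tendsto_intros) auto
  then have "(half_bend \<longlongrightarrow> 1) at_top" by simp
  then have "(?F \<longlongrightarrow> sym_beta_cdf m 1) at_top"
   by (rule isCont_tendsto_compose[OF sym_beta_cdf_isCont[OF m]])
  then show ?thesis using sym_beta_cdf_ge_1[OF m] by simp
 qed
 have Phi_lim: "((\<lambda>y. Phi (c * y)) \<longlongrightarrow> 1) at_top" if "c > 0" for c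
 proof -
  interpret real_distribution std_normal_distribution by (rule real_dist_normal_dist)
  have "filterlim (\<lambda>y::real. c * y) at_top at_top"
   using that by (intro filterlim_tendsto_pos_mult_at_top[OF tendsto_const]) (auto simp: filterlim_ident)
  then show ?thesis by (rule filterlim_compose[OF cdf_lim_at_top_prob])
 qed
 have zero: "?F 0 = 1 / 2" "Phi 0 = 1 / 2"
  using sym_beta_cdf_half[OF m] Phi_reflect[of 0] by (simp_all add: half_bend_def)
 have F_deriv: "(?F has_real_derivative exp (- m * y\<^sup>2) *
   ((1 / 4) powr (m - 1) / (2 * Beta m m) * sqrt (y\<^sup>2 / (1 - exp (- (y\<^sup>2)))))) (at y)" if y: "y > 0" for y
 proof -
  have "(sym_beta_cdf m has_real_derivative beta_dens m m (half_bend y)) (at (half_bend y))"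
   using half_bend_bounds[of y] by (intro sym_beta_cdf_deriv[OF m]) auto
  from DERIV_chain2[OF this half_bend_deriv[OF y]] show ?thesis
   unfolding half_bend_density[OF y] .
 qed
 have Phi_deriv': "((\<lambda>y. Phi (sqrt c * y)) has_real_derivative exp (- (c / 2) * y\<^sup>2) * (sqrt c / sqrt (2 * pi))) (at y)"
  if "c >= 0" for c y
 proof -
  have "((\<lambda>y. Phi (sqrt c * y)) has_real_derivative std_normal_density (sqrt c * y) * sqrt c) (at y)"
   by (rule DERIV_chain2[OF Phi_deriv]) (auto intro!: derivative_eq_intros)
  also have "std_normal_density (sqrt c * y) * sqrt c = exp (- (c / 2) * y\<^sup>2) * (sqrt c / sqrt (2 * pi))"
   using that by (simp add: normal_density_def power_mult_distrib)
  finally show ?thesis .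
 qed
 let ?C = "(1 / 4) powr (m - 1) / (2 * Beta m m)"
 have C: "?C > 0" using Beta_pos[of m m] m by simp
 have "?F y - Phi (sqrt (2 * m) * y) <= 0"
 proof (rule single_crossing_nonpos[where w = "\<lambda>y. exp (- m * y\<^sup>2)" and
    r = "\<lambda>y. ?C * sqrt (y\<^sup>2 / (1 - exp (- (y\<^sup>2)))) - sqrt (2 * m) / sqrt (2 * pi)"
    and D = "\<lambda>y. ?F y - Phi (sqrt (2 * m) * y)"])
  show "continuous_on {0..} (\<lambda>y. ?F y - Phi (sqrt (2 * m) * y))"
   by (intro continuous_on_diff F_cont Phi_cont)
  show "((\<lambda>y. ?F y - Phi (sqrt (2 * m) * y)) \<longlongrightarrow> 0) at_top"
   using tendsto_diff[OF F_lim Phi_lim[of "sqrt (2 * m)"]] m by simp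
  show "((\<lambda>y. ?F y - Phi (sqrt (2 * m) * y)) has_real_derivative exp (- m * y\<^sup>2) *
    (?C * sqrt (y\<^sup>2 / (1 - exp (- (y\<^sup>2)))) - sqrt (2 * m) / sqrt (2 * pi))) (at y)" if "y > 0" for y
   using DERIV_diff[OF F_deriv[OF that] Phi_deriv'[of "2 * m" y]] m by (simp add: right_diff_distrib)
  show "?C * sqrt (x\<^sup>2 / (1 - exp (- (x\<^sup>2)))) - sqrt (2 * m) / sqrt (2 * pi) <=
    ?C * sqrt (y\<^sup>2 / (1 - exp (- (y\<^sup>2)))) - sqrt (2 * m) / sqrt (2 * pi)" if "0 < x" "x <= y" for x y
   using that C bend_ratio_mono[of "x\<^sup>2" "y\<^sup>2"]
   by (intro diff_right_mono mult_left_mono real_sqrt_le_mono) (auto intro: power_mono)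
 qed (use y zero in auto)
 then show "?F y <= Phi (sqrt (2 * m) * y)" by simp
 let ?s = "2 * m - 1 / 2"
 have s: "?s > 0" using m by simp
 have "Phi (sqrt ?s * y) - ?F y <= 0"
 proof (rule single_crossing_nonpos[where w = "\<lambda>y. exp (- (?s / 2) * y\<^sup>2)" and
    r = "\<lambda>y. sqrt ?s / sqrt (2 * pi) - ?C * sqrt (y\<^sup>2 / (1 - exp (- (y\<^sup>2))) * exp (- (y\<^sup>2) / 2))"
    and D = "\<lambda>y. Phi (sqrt ?s * y) - ?F y"])
  show "continuous_on {0..} (\<lambda>y. Phi (sqrt ?s * y) - ?F y)"
   by (intro continuous_on_diff F_cont Phi_cont)
  show "((\<lambda>y. Phi (sqrt ?s * y) - ?F y) \<longlongrightarrow> 0) at_top"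
   using tendsto_diff[OF Phi_lim[of "sqrt ?s"] F_lim] s by simp
  show "((\<lambda>y. Phi (sqrt ?s * y) - ?F y) has_real_derivative exp (- (?s / 2) * y\<^sup>2) *
    (sqrt ?s / sqrt (2 * pi) - ?C * sqrt (y\<^sup>2 / (1 - exp (- (y\<^sup>2))) * exp (- (y\<^sup>2) / 2)))) (at y)" if "y > 0" for y
  proof -
   have "sqrt (exp (- (y\<^sup>2) / 2)) = exp (- (y\<^sup>2) / 4)"
    by (rule real_sqrt_unique) (simp_all add: power2_eq_square exp_add[symmetric])
   moreover have "exp (- (?s / 2) * y\<^sup>2) * exp (- (y\<^sup>2) / 4) = exp (- m * y\<^sup>2)"
    by (simp add: exp_add[symmetric] algebra_simps diff_divide_distrib)
   ultimately have e: "sqrt (exp (- (y\<^sup>2) / 2)) = exp (- (y\<^sup>2) / 4)"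
    "exp (- m * y\<^sup>2) = exp (- (?s / 2) * y\<^sup>2) * exp (- (y\<^sup>2) / 4)" by simp_all
   have "exp (- (?s / 2) * y\<^sup>2) * (?C * sqrt (y\<^sup>2 / (1 - exp (- (y\<^sup>2))) * exp (- (y\<^sup>2) / 2)))
     = exp (- m * y\<^sup>2) * (?C * sqrt (y\<^sup>2 / (1 - exp (- (y\<^sup>2)))))"
    unfolding real_sqrt_mult e by (simp only: mult_ac)
   then show ?thesis
    using DERIV_diff[OF Phi_deriv'[of ?s y] F_deriv[OF that]] s by (simp only: right_diff_distrib)
  qed
  show "sqrt ?s / sqrt (2 * pi) - ?C * sqrt (x\<^sup>2 / (1 - exp (- (x\<^sup>2))) * exp (- (x\<^sup>2) / 2)) <=
    sqrt ?s / sqrt (2 * pi) - ?C * sqrt (y\<^sup>2 / (1 - exp (- (y\<^sup>2))) * exp (- (y\<^sup>2) / 2))" if "0 < x" "x <= y" for x y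
   using that C bend_ratio_damped_antimono[of "x\<^sup>2" "y\<^sup>2"]
   by (intro diff_left_mono mult_left_mono real_sqrt_le_mono) (auto intro: power_mono)
 qed (use y zero in auto)
 then show "Phi (sqrt (2 * m - 1 / 2) * y) <= ?F y" by simp
qed

text \<open>
  The quantile transformation. It is specified by an equation of distribution functions, which has exactly one
  solution because both functions are continuous and strictly increasing.
\<close>
definition beta_of_normal :: "real => real => real" where
 "beta_of_normal m \<eta> = (SOME b. 0 < b \<and> b < 1 \<and> sym_beta_cdf m b = Phi \<eta>)"

context
 fixes m :: real assumes m: "m >= 1 / 2"
begin

lemma beta_of_normal:
 "0 < beta_of_normal m \<eta>" "beta_of_normal m \<eta> < 1" "sym_beta_cdf m (beta_of_normal m \<eta>) = Phi \<eta>"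
proof -
 have "\<exists>b\<ge>0. b <= 1 \<and> sym_beta_cdf m b = Phi \<eta>"
  using Phi_bounds[of \<eta>] sym_beta_cdf_nonpos[OF m, of 0] sym_beta_cdf_ge_1[OF m, of 1] sym_beta_cdf_isCont[OF m]
  by (intro IVT) auto
 then obtain b where b: "0 <= b" "b <= 1" "sym_beta_cdf m b = Phi \<eta>" by auto
 have "b \<noteq> 0" "b \<noteq> 1"
  using b(3) Phi_bounds[of \<eta>] sym_beta_cdf_nonpos[OF m, of 0] sym_beta_cdf_ge_1[OF m, of 1] by auto
 then have "\<exists>b. 0 < b \<and> b < 1 \<and> sym_beta_cdf m b = Phi \<eta>" using b by (intro exI[of _ b]) auto
 from someI_ex[OF this]
 show "0 < beta_of_normal m \<eta>" "beta_of_normal m \<eta> < 1" "sym_beta_cdf m (beta_of_normal m \<eta>) = Phi \<eta>"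
  by (simp_all add: beta_of_normal_def)
qed

lemma beta_of_normal_le_iff: "0 <= x ==> x <= 1 ==> beta_of_normal m \<eta> <= x \<longleftrightarrow> Phi \<eta> <= sym_beta_cdf m x"
 using beta_of_normal[of \<eta>] sym_beta_cdf_le_iff[OF m, of "beta_of_normal m \<eta>" x] by simp

lemma le_beta_of_normal_iff: "0 <= x ==> x <= 1 ==> x <= beta_of_normal m \<eta> \<longleftrightarrow> sym_beta_cdf m x <= Phi \<eta>"
 using beta_of_normal[of \<eta>] sym_beta_cdf_le_iff[OF m, of x "beta_of_normal m \<eta>"] by simp

lemma beta_of_normal_mono: "mono (beta_of_normal m)"
proof (rule monoI)
 fix x y :: real assume "x <= y"
 then have "Phi x <= Phi y" using Phi_strict_mono[of x y] by (cases "x = y") auto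
 then show "beta_of_normal m x <= beta_of_normal m y"
  using beta_of_normal[of y] by (subst beta_of_normal_le_iff) auto
qed

lemma beta_of_normal_measurable: "beta_of_normal m \<in> borel_measurable borel"
 by (rule borel_measurable_mono[OF beta_of_normal_mono])

lemma beta_of_normal_reflect: "beta_of_normal m (- \<eta>) = 1 - beta_of_normal m \<eta>"
proof -
 have "sym_beta_cdf m (1 - beta_of_normal m \<eta>) = Phi (- \<eta>)"
  by (simp add: sym_beta_cdf_reflect[OF m] beta_of_normal Phi_reflect)
 moreover have "0 <= 1 - beta_of_normal m \<eta>" "1 - beta_of_normal m \<eta> <= 1"
  using beta_of_normal[of \<eta>] by auto
 ultimately show ?thesis
  using beta_of_normal_le_iff[of "1 - beta_of_normal m \<eta>" "- \<eta>"]
   le_beta_of_normal_iff[of "1 - beta_of_normal m \<eta>" "- \<eta>"] by simp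
qed

lemma distr_beta_of_normal: "distr std_normal_distribution borel (beta_of_normal m) = beta_law m m"
proof (rule cdf_unique)
 note [measurable] = beta_of_normal_measurable
 interpret N: real_distribution std_normal_distribution by (rule real_dist_normal_dist)
 show "real_distribution (distr std_normal_distribution borel (beta_of_normal m))"
  by (rule N.real_distribution_distr) simp
 show "real_distribution (beta_law m m)" using m by (intro real_distribution_beta_law) auto
 show "cdf (distr std_normal_distribution borel (beta_of_normal m)) = cdf (beta_law m m)"
 proof
  fix x
  have eq: "cdf (distr std_normal_distribution borel (beta_of_normal m)) x = N.prob {\<eta>. beta_of_normal m \<eta> <= x}"
   unfolding cdf_def by (subst measure_distr) (auto simp: vimage_def)
  consider "x <= 0" | "x >= 1" | "0 < x" "x < 1" by linarith
  then have "N.prob {\<eta>. beta_of_normal m \<eta> <= x} = sym_beta_cdf m x"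
  proof cases
   case 1
   then have none: "\<not> beta_of_normal m \<eta> <= x" for \<eta> using beta_of_normal(1)[of \<eta>] by simp
   show ?thesis using 1 sym_beta_cdf_nonpos[OF m, of x] by (simp add: none)
  next
   case 2
   then have all: "beta_of_normal m \<eta> <= x" for \<eta> using beta_of_normal(2)[of \<eta>] by simp
   show ?thesis using 2 sym_beta_cdf_ge_1[OF m, of x] N.prob_space by (simp add: all)
  next
   case 3
   have F: "0 < sym_beta_cdf m x" "sym_beta_cdf m x < 1"
    using sym_beta_cdf_strict_mono[OF m, of 0 x] sym_beta_cdf_strict_mono[OF m, of x 1] 3
     sym_beta_cdf_nonpos[OF m, of 0] sym_beta_cdf_ge_1[OF m, of 1] by auto
   have "eventually (\<lambda>q. Phi q < sym_beta_cdf m x) at_bot"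
    using N.cdf_lim_at_bot F(1) by (rule order_tendstoD(2))
   then obtain q1 where q1: "Phi q1 < sym_beta_cdf m x" by (auto simp: eventually_at_bot_linorder)
   have "eventually (\<lambda>q. Phi q > sym_beta_cdf m x) at_top"
    using N.cdf_lim_at_top_prob F(2) by (rule order_tendstoD(1))
   then obtain q2 where q2: "Phi q2 > sym_beta_cdf m x" by (auto simp: eventually_at_top_linorder)
   have "q1 <= q2" using Phi_strict_mono[of q2 q1] q1 q2 by force
   then have "\<exists>q\<ge>q1. q <= q2 \<and> Phi q = sym_beta_cdf m x"
    using q1 q2 Phi_isCont by (intro IVT) auto
   then obtain q where q: "Phi q = sym_beta_cdf m x" by auto
   have "{\<eta>. beta_of_normal m \<eta> <= x} = {..q}"
   proof (intro set_eqI)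
    fix \<eta>
    have "Phi \<eta> <= Phi q \<longleftrightarrow> \<eta> <= q"
     using Phi_strict_mono[of q \<eta>] Phi_strict_mono[of \<eta> q] by (cases "\<eta> = q") force+
    then show "\<eta> \<in> {\<eta>. beta_of_normal m \<eta> <= x} \<longleftrightarrow> \<eta> \<in> {..q}"
     using 3 by (simp add: beta_of_normal_le_iff q)
   qed
   then show ?thesis by (simp add: q[symmetric] cdf_def)
  qed
  then show "cdf (distr std_normal_distribution borel (beta_of_normal m)) x = cdf (beta_law m m) x"
   unfolding eq by (simp add: sym_beta_cdf_def)
 qed
qed

end

lemma sqrt_one_minus_exp_lower:
 assumes "z >= 0" shows "z - sqrt (1 - exp (- (z\<^sup>2))) <= z\<^sup>2"
proof (cases "z <= 1")
 case False
 have "z * 1 <= z * z" using False by (intro mult_left_mono) auto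
 moreover have "sqrt (1 - exp (- (z\<^sup>2))) >= 0" by simp
 ultimately show ?thesis unfolding power2_eq_square by linarith
next
 case True
 have "(1 + z\<^sup>2) * (1 - z)\<^sup>2 <= 1"
 proof -
  have "(1 + z\<^sup>2) * (1 - z) <= (1 + z) * (1 - z)"
   using True assms by (intro mult_right_mono) (auto simp: power2_eq_square mult_left_le)
  also have "... <= 1" by (simp add: algebra_simps)
  finally have "(1 + z\<^sup>2) * (1 - z) * (1 - z) <= 1 * 1"
   using True assms by (intro mult_mono) auto
  then show ?thesis by (simp add: power2_eq_square mult.assoc)
 qed
 then have "z\<^sup>2 * ((1 + z\<^sup>2) * (1 - z)\<^sup>2) <= z\<^sup>2 * 1" by (intro mult_left_mono) auto
 then have "(z - z\<^sup>2)\<^sup>2 * (1 + z\<^sup>2) <= z\<^sup>2" by (simp add: power2_eq_square algebra_simps)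
 moreover have p: "1 + z\<^sup>2 > 0" by (simp add: add_pos_nonneg)
 ultimately have "(z - z\<^sup>2)\<^sup>2 <= z\<^sup>2 / (1 + z\<^sup>2)" by (simp add: pos_le_divide_eq)
 also have "... = 1 - 1 / (1 + z\<^sup>2)" using p by (simp add: field_simps)
 finally have 1: "(z - z\<^sup>2)\<^sup>2 <= 1 - 1 / (1 + z\<^sup>2)" .
 have "1 + z\<^sup>2 <= exp (z\<^sup>2)" by (rule exp_ge_add_one_self)
 then have "exp (- (z\<^sup>2)) <= 1 / (1 + z\<^sup>2)"
  using p by (simp add: exp_minus field_simps)
 then have "(z - z\<^sup>2)\<^sup>2 <= 1 - exp (- (z\<^sup>2))" using 1 by simp
 then have "z - z\<^sup>2 <= sqrt (1 - exp (- (z\<^sup>2)))" by (rule real_le_rsqrt)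
 then show ?thesis by simp
qed

text \<open>
  For \<open>\<eta> > 0\<close> the quantile is \<open>half_bend y\<close> with \<open>\<eta>\<close> between
  \<open>sqrt (2 m - 1/2) y\<close> and \<open>sqrt (2 m) y\<close> by the preceding comparison; the rest is Taylor
  expansion of \<open>half_bend\<close>. Negative \<open>\<eta>\<close> follow by reflection.
\<close>
lemma beta_of_normal_close:
 assumes m: "m >= 1 / 2"
 shows "\<bar>beta_of_normal m \<eta> - 1 / 2\<bar> <= \<bar>\<eta>\<bar> / (2 * sqrt m)"
  and "\<bar>2 * m * (beta_of_normal m \<eta> - 1 / 2) - sqrt (m / 2) * \<eta>\<bar> <= \<bar>\<eta>\<bar> / 4 + \<eta>\<^sup>2 / 2"
proof -
 have main: "\<bar>beta_of_normal m \<eta> - 1 / 2\<bar> <= \<eta> / (2 * sqrt m) \<and>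
   \<bar>2 * m * (beta_of_normal m \<eta> - 1 / 2) - sqrt (m / 2) * \<eta>\<bar> <= \<eta> / 4 + \<eta>\<^sup>2 / 2" if \<eta>: "\<eta> >= 0" for \<eta>
 proof -
  define s where "s = sqrt (2 * m)"
  have s1: "s >= 1" using m by (simp add: s_def)
  have m_s: "m = s\<^sup>2 / 2" using m by (simp add: s_def)
  define r where "r = sqrt (s\<^sup>2 - 1 / 2)"
  have s21: "s\<^sup>2 >= 1" using s1 by simp
  then have r0: "r > 0" by (simp add: r_def)
  have r2: "r\<^sup>2 = s\<^sup>2 - 1 / 2" using s21 by (simp add: r_def)
  define t where "t = beta_of_normal m \<eta> - 1 / 2"
  have sm: "sqrt (2 * m - 1 / 2) = r" by (simp add: r_def m_s)
  have "half_bend (\<eta> / s) <= beta_of_normal m \<eta>"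
   using sym_beta_cdf_half_bend(1)[OF m, of "\<eta> / s"] \<eta> s1 half_bend_bounds[of "\<eta> / s"]
   by (subst le_beta_of_normal_iff[OF m]) (auto simp: s_def[symmetric])
  then have lo: "t >= sqrt (1 - exp (- ((\<eta> / s)\<^sup>2))) / 2" by (simp add: t_def half_bend_def)
  have "beta_of_normal m \<eta> <= half_bend (\<eta> / r)"
   using sym_beta_cdf_half_bend(2)[OF m, of "\<eta> / r"] \<eta> r0 half_bend_bounds[of "\<eta> / r"]
   by (subst beta_of_normal_le_iff[OF m]) (auto simp: sm)
  then have "t <= sqrt (1 - exp (- ((\<eta> / r)\<^sup>2))) / 2" by (simp add: t_def half_bend_def)
  also have "sqrt (1 - exp (- ((\<eta> / r)\<^sup>2))) <= sqrt ((\<eta> / r)\<^sup>2)"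
   using exp_ge_add_one_self[of "- ((\<eta> / r)\<^sup>2)"] by (intro real_sqrt_le_mono) simp
  also have "... = \<eta> / r" using \<eta> r0 by simp
  finally have up: "t <= \<eta> / r / 2" by simp
  have "sqrt (1 - exp (- ((\<eta> / s)\<^sup>2))) / 2 >= 0" by simp
  then have t0: "t >= 0" using lo by linarith
  have "sqrt m <= r" unfolding r_def using s21 by (intro real_sqrt_le_mono) (simp add: m_s)
  moreover have "sqrt m > 0" using m by simp
  ultimately have "\<eta> / r / 2 <= \<eta> / sqrt m / 2"
   using \<eta> r0 by (intro divide_right_mono divide_left_mono mult_pos_pos) auto
  then have 1: "\<bar>t\<bar> <= \<eta> / (2 * sqrt m)" using up t0 by (simp add: mult.commute)
  have sq: "sqrt (m / 2) = s / 2"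
   using s1 by (intro real_sqrt_unique) (auto simp: m_s power2_eq_square)
  have "s\<^sup>2 / 2 <= (s / 2 + 1 / 4) * r"
  proof (rule power2_le_imp_le)
   have "s\<^sup>2 * s >= s * 1 * 1" "s\<^sup>2 * s >= s\<^sup>2 * 1"
    using s1 s21 by (auto intro!: mult_mono simp: mult.commute)
   moreover have "((s / 2 + 1 / 4) * r)\<^sup>2 = (s / 2 + 1 / 4)\<^sup>2 * (s\<^sup>2 - 1 / 2)"
    by (simp add: power_mult_distrib r2)
   moreover have "(s / 2 + 1 / 4)\<^sup>2 * (s\<^sup>2 - 1 / 2) =
     (s\<^sup>2 / 2)\<^sup>2 + s\<^sup>2 * s / 4 - s\<^sup>2 / 16 - s / 8 - 1 / 32"
    by (simp add: power2_eq_square algebra_simps)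
   ultimately show "(s\<^sup>2 / 2)\<^sup>2 <= ((s / 2 + 1 / 4) * r)\<^sup>2" using s21 s1 by linarith
  qed (use s1 r0 in auto)
  then have "s\<^sup>2 / 2 / r <= s / 2 + 1 / 4" using r0 by (simp add: field_simps)
  then have "\<eta> * (s\<^sup>2 / 2 / r) <= \<eta> * (s / 2 + 1 / 4)" using \<eta> by (rule mult_left_mono)
  moreover have "2 * m * t <= 2 * m * (\<eta> / r / 2)" using up m by (intro mult_left_mono) auto
  moreover have "2 * m * (\<eta> / r / 2) = \<eta> * (s\<^sup>2 / 2 / r)" by (simp add: m_s mult_ac)
  ultimately have u: "2 * m * t - sqrt (m / 2) * \<eta> <= \<eta> / 4"
   by (simp add: sq algebra_simps)
  have "\<eta> / s - sqrt (1 - exp (- ((\<eta> / s)\<^sup>2))) <= (\<eta> / s)\<^sup>2"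
   using \<eta> s1 by (intro sqrt_one_minus_exp_lower) auto
  then have "m * (\<eta> / s - sqrt (1 - exp (- ((\<eta> / s)\<^sup>2)))) <= m * (\<eta> / s)\<^sup>2"
   using m by (intro mult_left_mono) auto
  moreover have "m * (\<eta> / s)\<^sup>2 = \<eta>\<^sup>2 / 2" using s1 by (simp add: m_s power_divide)
  moreover have "m * (\<eta> / s) = sqrt (m / 2) * \<eta>"
   unfolding sq using s1 by (simp add: m_s power2_eq_square)
  moreover have "2 * m * t >= 2 * m * (sqrt (1 - exp (- ((\<eta> / s)\<^sup>2))) / 2)"
   using lo m by (intro mult_left_mono) auto
  ultimately have l: "sqrt (m / 2) * \<eta> - 2 * m * t <= \<eta>\<^sup>2 / 2"
   unfolding right_diff_distrib by linarith
  have "\<bar>2 * m * t - sqrt (m / 2) * \<eta>\<bar> <= \<eta> / 4 + \<eta>\<^sup>2 / 2"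
   using u l \<eta> zero_le_power2[of \<eta>] by (intro abs_leI) linarith+
  then show ?thesis using 1 unfolding t_def by simp
 qed
 show "\<bar>beta_of_normal m \<eta> - 1 / 2\<bar> <= \<bar>\<eta>\<bar> / (2 * sqrt m)"
  using main[of \<eta>] main[of "- \<eta>"] beta_of_normal_reflect[OF m, of \<eta>] by (cases "\<eta> >= 0") auto
 show "\<bar>2 * m * (beta_of_normal m \<eta> - 1 / 2) - sqrt (m / 2) * \<eta>\<bar> <= \<bar>\<eta>\<bar> / 4 + \<eta>\<^sup>2 / 2"
 proof (cases "\<eta> >= 0")
  case False
  have "2 * m * (beta_of_normal m (- \<eta>) - 1 / 2) - sqrt (m / 2) * (- \<eta>) =
    - (2 * m * (beta_of_normal m \<eta> - 1 / 2) - sqrt (m / 2) * \<eta>)"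
   by (simp add: beta_of_normal_reflect[OF m] algebra_simps)
  then show ?thesis using main[of "- \<eta>"] False by (simp only: abs_minus_cancel) auto
 qed (use main in auto)
qed

section \<open>The gamma random measure as a perpetuity\<close>

text \<open>
  If \<open>X\<close> has independent gamma cell masses, then so has \<open>exp (- v / a) (X + e
  \<delta>\<^sub>y)\<close>. Given the cell of \<open>y\<close>, the new weight raises one shape by 1, that is, it
  size-biases that cell; averaging over \<open>y\<close> size-biases the total mass \<open>S\<close>. Undoing the
  factor \<open>exp (- v / a)\<close> by a change of measure leaves a density in \<open>v\<close> that depends on
  the cells only through \<open>S\<close> and integrates to 1 by \<open>nn_integral_size_biased_shrink\<close>.
\<close>
lemma nn_integral_gamma_perpetuity_step:
 fixes A :: "nat => real set" and f :: "nat => real => ennreal"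
 assumes a: "a > 0" and \<eta>: "real_distribution \<eta>"
  and A: "A ` {..<k} \<subseteq> sets borel" "disjoint_family_on A {..<k}" "(\<Union>i<k. A i) = UNIV"
  and \<alpha>: "\<And>i. \<alpha> i = a * measure \<eta> (A i)"
  and f: "\<And>i. f i \<in> borel_measurable borel"
 shows "(\<integral>\<^sup>+v. \<integral>\<^sup>+y. \<integral>\<^sup>+e. \<integral>\<^sup>+x. (\<Prod>i<k. f i (exp (- v / a) * (x i + e * indicator (A i) y)))
   \<partial>(PiM {..<k} (\<lambda>i. gamma_law (\<alpha> i))) \<partial>gamma_law 1 \<partial>\<eta> \<partial>gamma_law 1) =
  (\<Prod>i<k. \<integral>\<^sup>+x. f i x \<partial>gamma_law (\<alpha> i))"
proof -
 note f[measurable]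
 interpret eta: real_distribution \<eta> by (rule \<eta>)
 interpret P: product_prob_space "\<lambda>i. gamma_law (\<alpha> i)"
  by (rule product_prob_spaceI) (rule prob_space_gamma_law)
 let ?G = "PiM {..<k} (\<lambda>i. gamma_law (\<alpha> i))"
 have \<alpha>0: "\<alpha> i >= 0" for i using a by (simp add: \<alpha>)
 have A': "A i \<in> sets borel" if "i < k" for i using A that by auto
 have sum_\<alpha>: "(\<Sum>i<k. \<alpha> i) = a"
 proof -
  have "(\<Sum>i<k. measure \<eta> (A i)) = measure \<eta> (\<Union>i<k. A i)"
   using A A' by (intro measure_finite_Union[symmetric]) (auto simp: eta.emeasure_eq_measure)
  then show ?thesis using eta.prob_space A(3) by (simp add: \<alpha> sum_distrib_left[symmetric])
 qed
 define w where "w i v x = exp (v / a) powr \<alpha> i * exp (- x * (exp (v / a) - 1))" for i and v x :: real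
 have w_meas[measurable]: "(\<lambda>x. w i v x) \<in> borel_measurable borel" for i v
  unfolding w_def by measurable
 have w_meas2[measurable]: "(\<lambda>(v, x). w i v x) \<in> borel_measurable (borel \<Otimes>\<^sub>M borel)" for i
  unfolding w_def by measurable
 let ?W = "\<lambda>x v. \<Prod>j<k. ennreal (w j v (x j)) * f j (x j)"
 let ?D = "\<lambda>x v. ennreal ((\<Sum>i<k. x i) / a * exp (v / a) * exp v * exp (- (\<Sum>i<k. x i) * (exp (v / a) - 1)))"
 have w_nn: "w i v x >= 0" for i v x by (simp add: w_def)
 have scale: "(\<integral>\<^sup>+x. g (exp (- v / a) * x) \<partial>gamma_law (\<alpha> i)) = (\<integral>\<^sup>+x. ennreal (w i v x) * g x \<partial>gamma_law (\<alpha> i))"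
  if "g \<in> borel_measurable borel" for g :: "real => ennreal" and v i
 proof -
  have "1 / exp (- v / a) = exp (v / a)" by (simp add: exp_minus field_simps)
  moreover have "exp (- v / a) powr (- \<alpha> i) = exp (v / a) powr \<alpha> i" by (simp add: powr_def)
  ultimately have "exp (- v / a) powr (- \<alpha> i) * exp (- x * (1 / exp (- v / a) - 1)) = w i v x" for x
   by (simp add: w_def)
  then show ?thesis
   using nn_integral_gamma_scale[of "exp (- v / a)" "\<alpha> i" g] \<alpha>0[of i] that by simp
 qed
 let ?J = "\<lambda>v y e. \<integral>\<^sup>+x. (\<Prod>j<k. f j (exp (- v / a) * (x j + e * indicator (A j) y))) \<partial>?G" and ?I = "\<lambda>v y. \<integral>\<^sup>+e. \<integral>\<^sup>+x. (\<Prod>j<k. f j (exp (- v / a) * (x j + e * indicator (A j) y))) \<partial>?G \<partial>gamma_law 1"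
 let ?R = "\<lambda>v i. \<Prod>j\<in>{..<k} - {i}. \<integral>\<^sup>+x. f j (exp (- v / a) * x) \<partial>gamma_law (\<alpha> j)"
 \<comment> \<open>the test integral after a new atom fell into cell i\<close>
 define Q where "Q v i = ?R v i *
   (\<integral>\<^sup>+x. f i (exp (- v / a) * x) \<partial>gamma_law (\<alpha> i + 1))" for v i
 have inner: "?I v y = Q v i"
  if i: "i < k" and y: "y \<in> A i" for v y i
 proof -
  have ind: "indicator (A j) y = (if j = i then 1 else 0 :: real)" if "j < k" for j
   using A(2) i y that by (fastforce simp: disjoint_family_on_def indicator_def)
  have "?J v y e =
    ?R v i *
    (\<integral>\<^sup>+x. f i (exp (- v / a) * (e + x)) \<partial>gamma_law (\<alpha> i))" for e
  proof -
   have "?J v y e =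
    (\<Prod>j<k. \<integral>\<^sup>+x. f j (exp (- v / a) * (x + e * indicator (A j) y)) \<partial>gamma_law (\<alpha> j))"
    by (rule P.product_nn_integral_prod) auto
   also have "... = (\<integral>\<^sup>+x. f i (exp (- v / a) * (x + e)) \<partial>gamma_law (\<alpha> i)) *
     ?R v i"
    using i by (subst prod.remove[of _ i]) (auto simp: ind intro!: prod.cong)
   finally show ?thesis by (simp add: mult.commute add.commute)
  qed
  then have "?I v y
   = ?R v i *
    (\<integral>\<^sup>+e. \<integral>\<^sup>+x. f i (exp (- v / a) * (e + x)) \<partial>gamma_law (\<alpha> i) \<partial>gamma_law 1)"
  proof -
   interpret R: prob_space "gamma_law (\<alpha> i)" by (rule prob_space_gamma_law)
   assume *: "\<And>e. ?J v y e =
    ?R v i *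
    (\<integral>\<^sup>+x. f i (exp (- v / a) * (e + x)) \<partial>gamma_law (\<alpha> i))"
   show ?thesis unfolding * by (rule nn_integral_cmult) measurable
  qed
  also have "(\<integral>\<^sup>+e. \<integral>\<^sup>+x. f i (exp (- v / a) * (e + x)) \<partial>gamma_law (\<alpha> i) \<partial>gamma_law 1) =
    (\<integral>\<^sup>+x. f i (exp (- v / a) * x) \<partial>gamma_law (1 + \<alpha> i))"
   using \<alpha>0 by (intro nn_integral_gamma_add) auto
  finally show ?thesis by (simp add: Q_def add.commute)
 qed
 have eta_int: "(\<integral>\<^sup>+y. ?I v y \<partial>\<eta>)
   = (\<Sum>i<k. emeasure \<eta> (A i) * Q v i)" for v
 proof -
  have "?I v y
    = (\<Sum>i<k. Q v i * indicator (A i) y)" for y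
  proof -
   obtain i where i: "i < k" "y \<in> A i" using A(3) by blast
   have "(\<Sum>j<k. Q v j * indicator (A j) y) = (\<Sum>j<k. if j = i then Q v i else 0)"
    using A(2) i by (intro sum.cong refl) (fastforce simp: disjoint_family_on_def indicator_def)
   then show ?thesis using i inner[OF i] by simp
  qed
  then have "(\<integral>\<^sup>+y. ?I v y \<partial>\<eta>)
    = (\<integral>\<^sup>+y. (\<Sum>i<k. Q v i * indicator (A i) y) \<partial>\<eta>)" by simp
  also have "... = (\<Sum>i<k. \<integral>\<^sup>+y. Q v i * indicator (A i) y \<partial>\<eta>)"
   using A' by (intro nn_integral_sum) auto
  also have "... = (\<Sum>i<k. emeasure \<eta> (A i) * Q v i)"
   using A' by (intro sum.cong) (auto simp: nn_integral_cmult_indicator mult.commute)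
  finally show ?thesis .
 qed
 have Qi: "emeasure \<eta> (A i) * Q v i =
   (\<integral>\<^sup>+x. ennreal (x i / a * exp (v / a)) * ?W x v \<partial>?G)"
  if i: "i < k" for v i
 proof -
  have bias: "emeasure \<eta> (A i) * (\<integral>\<^sup>+x. f i (exp (- v / a) * x) \<partial>gamma_law (\<alpha> i + 1)) =
    (\<integral>\<^sup>+x. ennreal (w i v x) * (ennreal (x / a * exp (v / a)) * f i x) \<partial>gamma_law (\<alpha> i))"
  proof (cases "\<alpha> i = 0")
   case True
   then have "measure \<eta> (A i) = 0" using a by (simp add: \<alpha>)
   then have "emeasure \<eta> (A i) = 0" by (simp add: eta.emeasure_eq_measure)
   then show ?thesis unfolding True by (subst nn_integral_gamma_law_0) auto
  next
   case False
   then have pos: "\<alpha> i > 0" using \<alpha>0[of i] by simp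
   have "emeasure \<eta> (A i) * (\<integral>\<^sup>+x. f i (exp (- v / a) * x) \<partial>gamma_law (\<alpha> i + 1)) =
    emeasure \<eta> (A i) * (\<integral>\<^sup>+x. ennreal (x / \<alpha> i) * f i (exp (- v / a) * x) \<partial>gamma_law (\<alpha> i))"
    by (subst nn_integral_gamma_size_bias[OF pos]) auto
   also have "... = (\<integral>\<^sup>+x. emeasure \<eta> (A i) * (ennreal (x / \<alpha> i) * f i (exp (- v / a) * x)) \<partial>gamma_law (\<alpha> i))"
    by (rule nn_integral_cmult[symmetric]) measurable
   also have "... = (\<integral>\<^sup>+x. ennreal ((exp (- v / a) * x) / a * exp (v / a)) * f i (exp (- v / a) * x) \<partial>gamma_law (\<alpha> i))"
   proof (intro nn_integral_cong)
    fix x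
    have "measure \<eta> (A i) * (x / \<alpha> i) = (exp (- v / a) * x) / a * exp (v / a)"
    proof -
     have "measure \<eta> (A i) \<noteq> 0" using pos by (auto simp: \<alpha>)
     then show ?thesis using a by (simp add: \<alpha> exp_minus field_simps)
    qed
    then have "emeasure \<eta> (A i) * ennreal (x / \<alpha> i) = ennreal ((exp (- v / a) * x) / a * exp (v / a))"
     by (simp add: eta.emeasure_eq_measure ennreal_mult'[symmetric])
    then show "emeasure \<eta> (A i) * (ennreal (x / \<alpha> i) * f i (exp (- v / a) * x)) =
      ennreal ((exp (- v / a) * x) / a * exp (v / a)) * f i (exp (- v / a) * x)"
     by (simp add: mult.assoc[symmetric])
   qed
   also have "... = (\<integral>\<^sup>+x. ennreal (w i v x) * (ennreal (x / a * exp (v / a)) * f i x) \<partial>gamma_law (\<alpha> i))"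
    by (rule scale[of "\<lambda>x. ennreal (x / a * exp (v / a)) * f i x"]) measurable
   finally show ?thesis .
  qed
  have "emeasure \<eta> (A i) * Q v i = ?R v i *
    (emeasure \<eta> (A i) * (\<integral>\<^sup>+x. f i (exp (- v / a) * x) \<partial>gamma_law (\<alpha> i + 1)))"
   by (simp add: Q_def mult_ac)
  also have "... = (\<Prod>j\<in>{..<k} - {i}. \<integral>\<^sup>+x. ennreal (w j v x) * f j x \<partial>gamma_law (\<alpha> j)) *
    (\<integral>\<^sup>+x. ennreal (w i v x) * (ennreal (x / a * exp (v / a)) * f i x) \<partial>gamma_law (\<alpha> i))"
   unfolding bias by (subst scale) auto
  also have "... = (\<Prod>j<k. \<integral>\<^sup>+x. (if j = i then ennreal (x / a * exp (v / a)) else 1) * (ennreal (w j v x) * f j x) \<partial>gamma_law (\<alpha> j))"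
   using i by (subst prod.remove[of "{..<k}" i]) (auto simp: mult_ac intro!: prod.cong)
  also have "... = (\<integral>\<^sup>+x. (\<Prod>j<k. (if j = i then ennreal (x j / a * exp (v / a)) else 1) * (ennreal (w j v (x j)) * f j (x j))) \<partial>?G)"
   by (rule P.product_nn_integral_prod[symmetric]) auto
  also have "... = (\<integral>\<^sup>+x. ennreal (x i / a * exp (v / a)) * ?W x v \<partial>?G)"
   using i by (intro nn_integral_cong) (simp add: prod.distrib prod.delta)
  finally show ?thesis .
 qed
 have meas_x[measurable]: "(\<lambda>x. x j) \<in> borel_measurable ?G" if "j < k" for j
  using that measurable_component_singleton[of j "{..<k}" "\<lambda>i. gamma_law (\<alpha> i)"] by simp
 have AE_nonneg: "AE x in ?G. \<forall>i\<in>{..<k}. x i >= 0"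
  by (intro AE_finite_allI AE_PiM_component prob_space_gamma_law AE_gamma_law_nonneg) auto
 have AE_pos: "AE x in ?G. \<forall>i\<in>{..<k}. \<alpha> i > 0 --> x i > 0"
 proof (intro AE_finite_allI)
  show "AE x in ?G. \<alpha> i > 0 --> x i > 0" if "i \<in> {..<k}" for i
   using that by (cases "\<alpha> i > 0")
    (auto intro!: AE_PiM_component prob_space_gamma_law AE_gamma_law_pos)
 qed simp
 have prodf[measurable]: "(\<lambda>x. \<Prod>j<k. f j (x j)) \<in> borel_measurable ?G"
  by (intro borel_measurable_prod_ennreal) auto
 have "(\<integral>\<^sup>+v. \<integral>\<^sup>+y. \<integral>\<^sup>+e. \<integral>\<^sup>+x. (\<Prod>i<k. f i (exp (- v / a) * (x i + e * indicator (A i) y)))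
   \<partial>?G \<partial>gamma_law 1 \<partial>\<eta> \<partial>gamma_law 1) =
  (\<integral>\<^sup>+v. (\<Sum>i<k. \<integral>\<^sup>+x. ennreal (x i / a * exp (v / a)) * ?W x v \<partial>?G) \<partial>gamma_law 1)"
  unfolding eta_int using Qi by (intro nn_integral_cong sum.cong) auto
 also have "... = (\<integral>\<^sup>+v. \<integral>\<^sup>+x. (\<Prod>j<k. f j (x j)) *
   ?D x v \<partial>?G \<partial>gamma_law 1)"
 proof (rule nn_integral_cong)
  fix v :: real
  have "(\<Sum>i<k. \<integral>\<^sup>+x. ennreal (x i / a * exp (v / a)) * ?W x v \<partial>?G) =
   (\<integral>\<^sup>+x. (\<Sum>i<k. ennreal (x i / a * exp (v / a)) * ?W x v) \<partial>?G)"
  proof (intro nn_integral_sum[symmetric] borel_measurable_times_ennreal borel_measurable_prod_ennreal)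
  qed (auto intro!: measurable_compose[OF meas_x])
  also have "... = (\<integral>\<^sup>+x. (\<Prod>j<k. f j (x j)) *
   ?D x v \<partial>?G)"
  proof (rule nn_integral_cong_AE)
   show "AE x in ?G. (\<Sum>i<k. ennreal (x i / a * exp (v / a)) * ?W x v) =
    (\<Prod>j<k. f j (x j)) *
    ?D x v"
    using AE_nonneg
   proof eventually_elim
    fix x :: "nat => real" assume x: "\<forall>i\<in>{..<k}. x i >= 0"
    have wprod: "(\<Prod>j<k. w j v (x j)) = exp v * exp (- (\<Sum>i<k. x i) * (exp (v / a) - 1))"
    proof -
     have "(\<Prod>j<k. exp (v / a) powr \<alpha> j) = exp (v / a) powr (\<Sum>j<k. \<alpha> j)"
      by (rule powr_sum[symmetric]) auto
     also have "... = exp v" using a by (simp add: sum_\<alpha> powr_def)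
     finally show ?thesis
      by (simp add: w_def prod.distrib exp_sum[symmetric] sum_distrib_right sum_negf)
    qed
    have 1: "(\<Sum>i<k. ennreal (x i / a * exp (v / a)) * ?W x v) =
     (\<Sum>i<k. ennreal (x i / a * exp (v / a))) * ?W x v"
     by (simp add: sum_distrib_right)
    have 2: "(\<Sum>i<k. ennreal (x i / a * exp (v / a))) = ennreal ((\<Sum>i<k. x i) / a * exp (v / a))"
     using x a by (subst sum_ennreal) (auto simp: sum_divide_distrib sum_distrib_right)
    have 3: "?W x v =
      ennreal (exp v * exp (- (\<Sum>i<k. x i) * (exp (v / a) - 1))) * (\<Prod>j<k. f j (x j))"
     by (simp add: prod.distrib prod_ennreal w_nn wprod)
    have *: "(\<Sum>i<k. ennreal (x i / a * exp (v / a)) * ?W x v) =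
     ennreal ((\<Sum>i<k. x i) / a * exp (v / a)) *
     (ennreal (exp v * exp (- (\<Sum>i<k. x i) * (exp (v / a) - 1))) * (\<Prod>j<k. f j (x j)))"
     unfolding 1 unfolding 2 3 ..
    have "?D x v =
     ennreal ((\<Sum>i<k. x i) / a * exp (v / a)) * ennreal (exp v * exp (- (\<Sum>i<k. x i) * (exp (v / a) - 1)))"
     by (subst ennreal_mult''[symmetric]) (auto simp: mult.assoc)
    then show "(\<Sum>i<k. ennreal (x i / a * exp (v / a)) * ?W x v) =
    (\<Prod>j<k. f j (x j)) *
    ?D x v"
     unfolding * by (simp only: mult_ac)
   qed
  qed
  finally show "(\<Sum>i<k. \<integral>\<^sup>+x. ennreal (x i / a * exp (v / a)) * ?W x v \<partial>?G) =
   (\<integral>\<^sup>+x. (\<Prod>j<k. f j (x j)) *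
   ?D x v \<partial>?G)" .
 qed
 also have "... = (\<integral>\<^sup>+x. \<integral>\<^sup>+v. (\<Prod>j<k. f j (x j)) *
   ?D x v \<partial>gamma_law 1 \<partial>?G)"
 proof (rule pair_sigma_finite.Fubini')
  show "pair_sigma_finite ?G (gamma_law 1)"
   by (intro pair_sigma_finite.intro prob_space_imp_sigma_finite prob_space_PiM prob_space_gamma_law)
  have [measurable]: "(\<lambda>x. \<Sum>i<k. x i) \<in> borel_measurable ?G" by (intro borel_measurable_sum) auto
  show "(\<lambda>(x, v). (\<Prod>j<k. f j (x j)) *
   ?D x v)
   \<in> borel_measurable (?G \<Otimes>\<^sub>M gamma_law 1)"
   using measurable_compose[OF measurable_fst prodf, of "gamma_law 1"]
    measurable_compose[OF measurable_fst \<open>(\<lambda>x. \<Sum>i<k. x i) \<in> borel_measurable ?G\<close>, of "gamma_law 1"]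
   by (simp add: split_beta')
 qed
 also have "... = (\<integral>\<^sup>+x. (\<Prod>j<k. f j (x j)) \<partial>?G)"
 proof (rule nn_integral_cong_AE)
  have shrink: "(\<integral>\<^sup>+v. C * ennreal (s / a * exp (v / a) * exp v * exp (- s * (exp (v / a) - 1))) \<partial>gamma_law 1) = C"
   if "s > 0" for s C
  proof -
   have "(\<lambda>v. ennreal (s / a * exp (v / a) * exp v * exp (- s * (exp (v / a) - 1)))) \<in> borel_measurable borel"
    by measurable
   then have "(\<lambda>v. ennreal (s / a * exp (v / a) * exp v * exp (- s * (exp (v / a) - 1)))) \<in> borel_measurable (gamma_law 1)"
    by (simp add: measurable_cong_sets[OF sets_gamma_law refl])
   from nn_integral_cmult[OF this, of C] show ?thesis
    unfolding nn_integral_size_biased_shrink[OF that a] by simp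
  qed
  from AE_pos AE_nonneg
  show "AE x in ?G. (\<integral>\<^sup>+v. (\<Prod>j<k. f j (x j)) *
   ?D x v \<partial>gamma_law 1)
    = (\<Prod>j<k. f j (x j))"
  proof eventually_elim
   fix x :: "nat => real" assume x: "\<forall>i\<in>{..<k}. \<alpha> i > 0 --> x i > 0" "\<forall>i\<in>{..<k}. x i >= 0"
   have "\<exists>i<k. \<alpha> i > 0"
   proof (rule ccontr)
    assume "\<not> ?thesis"
    then have "(\<Sum>i<k. \<alpha> i) <= 0" by (intro sum_nonpos) auto
    then show False using a sum_\<alpha> by simp
   qed
   then have S: "(\<Sum>i<k. x i) > 0"
    using x by (metis finite_lessThan lessThan_iff sum_pos2)
   show "(\<integral>\<^sup>+v. (\<Prod>j<k. f j (x j)) *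
     ?D x v \<partial>gamma_law 1)
    = (\<Prod>j<k. f j (x j))"
    by (rule shrink[OF S])
  qed
 qed
 also have "... = (\<Prod>i<k. \<integral>\<^sup>+x. f i x \<partial>gamma_law (\<alpha> i))"
  by (rule P.product_nn_integral_prod) (simp_all add: f measurable_cong_sets[OF sets_gamma_law refl])
 finally show ?thesis .
qed

text \<open>
  One step of the recursion attaches an atom of size \<open>e\<close> at \<open>y\<close> and shrinks everything by
  \<open>exp (- v / a)\<close>; an input maps a step to its triple \<open>(v, y, e)\<close>.
\<close>
definition perp_scale :: "real => (nat => real \<times> real \<times> real) => nat => real" where
 "perp_scale a g N = (\<Prod>m<N. exp (- fst (g m) / a))"

definition perp_weight :: "real => (nat => real \<times> real \<times> real) => nat => real" where
 "perp_weight a g m = perp_scale a g (Suc m) * snd (snd (g m))"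

definition perp_sum :: "real => (nat => real \<times> real \<times> real) => nat => real set => real" where
 "perp_sum a g N A = (\<Sum>m<N. perp_weight a g m * indicator A (fst (snd (g m))))"

lemma perp_cong:
 assumes "\<And>m. m < N ==> g m = h m"
 shows "perp_scale a g N = perp_scale a h N" "perp_sum a g N A = perp_sum a h N A"
 using assms by (auto simp: perp_scale_def perp_sum_def perp_weight_def intro!: sum.cong prod.cong)

abbreviation R3 :: "(real \<times> real \<times> real) measure" where "R3 \<equiv> borel \<Otimes>\<^sub>M (borel \<Otimes>\<^sub>M borel)"

lemma perp_measurable:
 assumes A: "A \<in> sets borel"
 shows "(\<lambda>g. perp_scale a g N) \<in> borel_measurable (PiM {..<N} (\<lambda>_. R3))"
  and "(\<lambda>g. perp_sum a g N A) \<in> borel_measurable (PiM {..<N} (\<lambda>_. R3))"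
proof -
 have c: "(\<lambda>g. g m) \<in> measurable (PiM {..<N} (\<lambda>_. R3)) R3" if "m < N" for m
  using that by (intro measurable_component_singleton) auto
 have c1: "(\<lambda>g. fst (g m)) \<in> borel_measurable (PiM {..<N} (\<lambda>_. R3))"
  and c2: "(\<lambda>g. fst (snd (g m))) \<in> borel_measurable (PiM {..<N} (\<lambda>_. R3))"
  and c3: "(\<lambda>g. snd (snd (g m))) \<in> borel_measurable (PiM {..<N} (\<lambda>_. R3))" if "m < N" for m
  using measurable_compose[OF c[OF that] measurable_fst]
   measurable_compose[OF measurable_compose[OF c[OF that] measurable_snd] measurable_fst]
   measurable_compose[OF measurable_compose[OF c[OF that] measurable_snd] measurable_snd] by simp_all
 have s: "(\<lambda>g. perp_scale a g K) \<in> borel_measurable (PiM {..<N} (\<lambda>_. R3))" if "K <= N" for K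
  unfolding perp_scale_def using that
  by (intro borel_measurable_prod measurable_compose[OF c1, of _ "\<lambda>x. exp (- x / a)"]) auto
 show "(\<lambda>g. perp_scale a g N) \<in> borel_measurable (PiM {..<N} (\<lambda>_. R3))" by (rule s) simp
 show "(\<lambda>g. perp_sum a g N A) \<in> borel_measurable (PiM {..<N} (\<lambda>_. R3))"
  unfolding perp_sum_def perp_weight_def
 proof (intro borel_measurable_sum borel_measurable_times s c3)
  fix m assume "m \<in> {..<N}"
  then show "(\<lambda>g. indicator A (fst (snd (g m))) :: real) \<in> borel_measurable (PiM {..<N} (\<lambda>_. R3))"
   using A by (intro measurable_compose[OF c2]) auto
 qed auto
qed

locale perpetuity_noise = prob_space M for M :: "'w measure" +
 fixes G :: "nat => 'w => real \<times> real \<times> real" and a :: real and \<eta> :: "real measure"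
 assumes a: "a > 0" and \<eta>: "real_distribution \<eta>"
  and indep: "indep_vars (\<lambda>_. R3) G UNIV"
  and law: "\<And>m. distr M R3 (G m) = gamma_law 1 \<Otimes>\<^sub>M (\<eta> \<Otimes>\<^sub>M gamma_law 1)"
begin

lemma G_measurable [measurable]: "G m \<in> measurable M R3"
 using indep by (auto simp: indep_vars_def)

definition gvec :: "'w => nat => real \<times> real \<times> real" where "gvec w m = G m w"

lemma nn_integral_triple:
 assumes F[measurable]: "F \<in> borel_measurable R3"
 shows "(\<integral>\<^sup>+\<theta>. F \<theta> \<partial>distr M R3 (G m)) = (\<integral>\<^sup>+v. \<integral>\<^sup>+y. \<integral>\<^sup>+e. F (v, y, e) \<partial>gamma_law 1 \<partial>\<eta> \<partial>gamma_law 1)"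
proof -
 interpret eta: real_distribution \<eta> by (rule \<eta>)
 interpret g1: prob_space "gamma_law 1" by (rule prob_space_gamma_law)
 interpret P: pair_prob_space \<eta> "gamma_law 1" by standard
 have sets: "sets (\<eta> \<Otimes>\<^sub>M gamma_law 1) = sets (borel \<Otimes>\<^sub>M borel)"
  by (intro sets_pair_measure_cong) auto
 have sets3: "sets (gamma_law 1 \<Otimes>\<^sub>M (\<eta> \<Otimes>\<^sub>M gamma_law 1)) = sets R3"
  by (intro sets_pair_measure_cong sets) auto
 have F': "F \<in> borel_measurable (gamma_law 1 \<Otimes>\<^sub>M (\<eta> \<Otimes>\<^sub>M gamma_law 1))"
  using F by (simp add: measurable_cong_sets[OF sets3 refl])
 have "(\<integral>\<^sup>+\<theta>. F \<theta> \<partial>distr M R3 (G m)) = (\<integral>\<^sup>+v. \<integral>\<^sup>+z. F (v, z) \<partial>(\<eta> \<Otimes>\<^sub>M gamma_law 1) \<partial>gamma_law 1)"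
  unfolding law by (rule P.nn_integral_fst[symmetric, OF F'])
 also have "... = (\<integral>\<^sup>+v. \<integral>\<^sup>+y. \<integral>\<^sup>+e. F (v, y, e) \<partial>gamma_law 1 \<partial>\<eta> \<partial>gamma_law 1)"
 proof (rule nn_integral_cong)
  fix v
  have "(\<lambda>z. F (v, z)) \<in> borel_measurable (borel \<Otimes>\<^sub>M borel)" by measurable
  then have "(\<lambda>z. F (v, z)) \<in> borel_measurable (\<eta> \<Otimes>\<^sub>M gamma_law 1)"
   by (simp add: measurable_cong_sets[OF sets refl])
  from g1.nn_integral_fst[symmetric, OF this]
  show "(\<integral>\<^sup>+z. F (v, z) \<partial>(\<eta> \<Otimes>\<^sub>M gamma_law 1)) = (\<integral>\<^sup>+y. \<integral>\<^sup>+e. F (v, y, e) \<partial>gamma_law 1 \<partial>\<eta>)" .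
 qed
 finally show ?thesis .
qed

text \<open>
  The first \<open>N\<close> atoms together with a shrunk independent copy of the limit have the law of the limit,
  by induction from \<open>nn_integral_gamma_perpetuity_step\<close>. No knowledge of the limit is used: the copy is
  an arbitrary vector with the claimed gamma law.
\<close>
lemma perpetuity_iterate:
 fixes A :: "nat => real set" and f :: "nat => real => ennreal"
 assumes A: "A ` {..<k} \<subseteq> sets borel" "disjoint_family_on A {..<k}" "(\<Union>i<k. A i) = UNIV"
  and \<alpha>: "\<And>i. \<alpha> i = a * measure \<eta> (A i)"
  and f: "\<And>i. f i \<in> borel_measurable borel"
 shows "(\<integral>\<^sup>+w. \<integral>\<^sup>+x. (\<Prod>i<k. f i (perp_sum a (gvec w) N (A i) + perp_scale a (gvec w) N * x i))
   \<partial>(PiM {..<k} (\<lambda>i. gamma_law (\<alpha> i))) \<partial>M) = (\<Prod>i<k. \<integral>\<^sup>+x. f i x \<partial>gamma_law (\<alpha> i))"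
proof (induction N)
 case 0
 interpret P: product_prob_space "\<lambda>i. gamma_law (\<alpha> i)"
  by (rule product_prob_spaceI) (rule prob_space_gamma_law)
 have "(\<integral>\<^sup>+x. (\<Prod>i<k. f i (x i)) \<partial>(PiM {..<k} (\<lambda>i. gamma_law (\<alpha> i)))) = (\<Prod>i<k. \<integral>\<^sup>+x. f i x \<partial>gamma_law (\<alpha> i))"
  by (rule P.product_nn_integral_prod) (simp_all add: f measurable_cong_sets[OF sets_gamma_law refl])
 then show ?case by (simp add: perp_sum_def perp_scale_def emeasure_space_1)
next
 case (Suc N)
 note f[measurable]
 interpret P: product_prob_space "\<lambda>i. gamma_law (\<alpha> i)"
  by (rule product_prob_spaceI) (rule prob_space_gamma_law)
 let ?\<Gamma> = "PiM {..<k} (\<lambda>i. gamma_law (\<alpha> i))"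
 interpret \<Gamma>: prob_space ?\<Gamma> by (intro prob_space_PiM prob_space_gamma_law)
 have A': "A i \<in> sets borel" if "i < k" for i using A that by auto
 let ?S = "PiM {..<N} (\<lambda>_. R3)" and ?T = "PiM {N} (\<lambda>_. R3)"
 let ?X = "\<lambda>w. \<lambda>m\<in>{..<N}. G m w" and ?Y = "\<lambda>w. \<lambda>m\<in>{N}. G m w"
 have "indep_var ?S ?X ?T ?Y" using indep by (rule indep_var_restrict) auto
 note ind = this
 have Y_meas[measurable]: "?Y \<in> measurable M ?T" by (rule measurable_restrict) measurable
 have compN: "(\<lambda>y. y N) \<in> measurable ?T R3" by (intro measurable_component_singleton) simp
 have X_meas[measurable]: "?X \<in> measurable M ?S" by (rule measurable_restrict) measurable
 \<comment> \<open>the test integral as a function of the first N steps h and of the next step theta\<close>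
 define F where "F = (\<lambda>(h, \<theta>). \<integral>\<^sup>+x. (\<Prod>i<k. f i (perp_sum a h N (A i) + perp_scale a h N *
   (exp (- fst \<theta> / a) * (x i + snd (snd \<theta>) * indicator (A i) (fst (snd \<theta>)))))) \<partial>?\<Gamma>)"
 have F: "F \<in> borel_measurable (?S \<Otimes>\<^sub>M R3)"
 proof -
  have "(\<lambda>z. f i (perp_sum a (fst (fst z)) N (A i) + perp_scale a (fst (fst z)) N *
   (exp (- fst (snd (fst z)) / a) * (snd z i + snd (snd (snd (fst z))) * indicator (A i) (fst (snd (snd (fst z))))))))
   \<in> borel_measurable ((?S \<Otimes>\<^sub>M R3) \<Otimes>\<^sub>M ?\<Gamma>)" if i: "i < k" for i
  proof -
   have [measurable]: "A i \<in> sets borel" by (rule A'[OF i])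
   note [measurable] = perp_measurable[OF A'[OF i]]
   have [measurable]: "(\<lambda>x. x i) \<in> borel_measurable ?\<Gamma>"
    using measurable_component_singleton[of i "{..<k}" "\<lambda>i. gamma_law (\<alpha> i)"] i by simp
   have [measurable]: "(\<lambda>z. snd z i) \<in> borel_measurable ((?S \<Otimes>\<^sub>M R3) \<Otimes>\<^sub>M ?\<Gamma>)"
    by (rule measurable_compose[OF measurable_snd]) measurable
   have [measurable]: "(\<lambda>z. fst (snd (fst z))) \<in> borel_measurable ((?S \<Otimes>\<^sub>M R3) \<Otimes>\<^sub>M ?\<Gamma>)"
    "(\<lambda>z. fst (snd (snd (fst z)))) \<in> borel_measurable ((?S \<Otimes>\<^sub>M R3) \<Otimes>\<^sub>M ?\<Gamma>)"
    "(\<lambda>z. snd (snd (snd (fst z)))) \<in> borel_measurable ((?S \<Otimes>\<^sub>M R3) \<Otimes>\<^sub>M ?\<Gamma>)"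
    by measurable
   have [measurable]: "(\<lambda>z. perp_sum a (fst (fst z)) N (A i)) \<in> borel_measurable ((?S \<Otimes>\<^sub>M R3) \<Otimes>\<^sub>M ?\<Gamma>)"
    "(\<lambda>z. perp_scale a (fst (fst z)) N) \<in> borel_measurable ((?S \<Otimes>\<^sub>M R3) \<Otimes>\<^sub>M ?\<Gamma>)"
    using measurable_compose[OF measurable_compose[OF measurable_fst measurable_fst] perp_measurable(2)[OF A'[OF i]]]
     measurable_compose[OF measurable_compose[OF measurable_fst measurable_fst] perp_measurable(1)[OF A'[OF i]]]
    by auto
   show ?thesis by (intro measurable_compose[OF _ f]) measurable
  qed
  then have "(\<lambda>z. \<Prod>i<k. f i (perp_sum a (fst (fst z)) N (A i) + perp_scale a (fst (fst z)) N *
   (exp (- fst (snd (fst z)) / a) * (snd z i + snd (snd (snd (fst z))) * indicator (A i) (fst (snd (snd (fst z))))))))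
   \<in> borel_measurable ((?S \<Otimes>\<^sub>M R3) \<Otimes>\<^sub>M ?\<Gamma>)"
   by (intro borel_measurable_prod_ennreal) auto
  from \<Gamma>.borel_measurable_nn_integral_fst[OF this]
  show ?thesis by (simp add: F_def split_beta')
 qed
 have sc: "perp_scale a (gvec w) N = perp_scale a (?X w) N"
  "perp_sum a (gvec w) N B = perp_sum a (?X w) N B" for w B
  by (auto simp: gvec_def intro!: perp_cong)
 have "(\<integral>\<^sup>+x. (\<Prod>i<k. f i (perp_sum a (gvec w) (Suc N) (A i) + perp_scale a (gvec w) (Suc N) * x i)) \<partial>?\<Gamma>) = F (?X w, G N w)" for w
  unfolding F_def split
  by (intro nn_integral_cong prod.cong refl arg_cong[where f = "f _"])
    (simp add: sc[symmetric], simp add: perp_sum_def perp_weight_def perp_scale_def gvec_def algebra_simps)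
 then have "(\<integral>\<^sup>+w. \<integral>\<^sup>+x. (\<Prod>i<k. f i (perp_sum a (gvec w) (Suc N) (A i) + perp_scale a (gvec w) (Suc N) * x i)) \<partial>?\<Gamma> \<partial>M)
   = (\<integral>\<^sup>+w. F (?X w, G N w) \<partial>M)" by simp
 also have "... = (\<integral>\<^sup>+w. (\<lambda>(h, y). F (h, y N)) (?X w, ?Y w) \<partial>M)" by simp
 also have "... = (\<integral>\<^sup>+h. \<integral>\<^sup>+y. (\<lambda>(h, y). F (h, y N)) (h, y) \<partial>distr M ?T ?Y \<partial>distr M ?S ?X)"
  by (rule nn_integral_indep_var[OF ind])
    (use measurable_compose[OF _ F, of "\<lambda>z. (fst z, snd z N)" "?S \<Otimes>\<^sub>M ?T"]
     measurable_compose[OF measurable_snd compN] in \<open>auto simp: split_beta'\<close>)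
 also have "... = (\<integral>\<^sup>+h. \<integral>\<^sup>+\<theta>. F (h, \<theta>) \<partial>distr M R3 (G N) \<partial>distr M ?S ?X)"
 proof (rule nn_integral_cong)
  fix h assume "h \<in> space (distr M ?S ?X)"
  then have h: "h \<in> space ?S" by simp
  have [measurable]: "(\<lambda>\<theta>. F (h, \<theta>)) \<in> borel_measurable R3" by (rule measurable_Pair2[OF F h])
  have "(\<integral>\<^sup>+y. F (h, y N) \<partial>distr M ?T ?Y) = (\<integral>\<^sup>+w. F (h, G N w) \<partial>M)"
   by (subst nn_integral_distr) (auto intro: measurable_compose[OF compN])
  also have "... = (\<integral>\<^sup>+\<theta>. F (h, \<theta>) \<partial>distr M R3 (G N))"
   by (subst nn_integral_distr) auto
  finally show "(\<integral>\<^sup>+y. (\<lambda>(h, y). F (h, y N)) (h, y) \<partial>distr M ?T ?Y) = (\<integral>\<^sup>+\<theta>. F (h, \<theta>) \<partial>distr M R3 (G N))"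
   by simp
 qed
 also have "... = (\<integral>\<^sup>+h. (\<Prod>i<k. \<integral>\<^sup>+x. f i (perp_sum a h N (A i) + perp_scale a h N * x) \<partial>gamma_law (\<alpha> i)) \<partial>distr M ?S ?X)"
 proof (rule nn_integral_cong)
  fix h assume "h \<in> space (distr M ?S ?X)"
  then have h: "h \<in> space ?S" by simp
  have "(\<integral>\<^sup>+\<theta>. F (h, \<theta>) \<partial>distr M R3 (G N)) = (\<integral>\<^sup>+v. \<integral>\<^sup>+y. \<integral>\<^sup>+e. F (h, v, y, e) \<partial>gamma_law 1 \<partial>\<eta> \<partial>gamma_law 1)"
   by (rule nn_integral_triple) (rule measurable_Pair2[OF F h])
  also have "... = (\<Prod>i<k. \<integral>\<^sup>+x. f i (perp_sum a h N (A i) + perp_scale a h N * x) \<partial>gamma_law (\<alpha> i))"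
   unfolding F_def split fst_conv snd_conv
   by (rule nn_integral_gamma_perpetuity_step[OF a \<eta> A \<alpha>,
      where f = "\<lambda>i z. f i (perp_sum a h N (A i) + perp_scale a h N * z)"]) measurable
  finally show "(\<integral>\<^sup>+\<theta>. F (h, \<theta>) \<partial>distr M R3 (G N)) =
   (\<Prod>i<k. \<integral>\<^sup>+x. f i (perp_sum a h N (A i) + perp_scale a h N * x) \<partial>gamma_law (\<alpha> i))" .
 qed
 also have "... = (\<integral>\<^sup>+h. (\<integral>\<^sup>+x. (\<Prod>i<k. f i (perp_sum a h N (A i) + perp_scale a h N * x i)) \<partial>?\<Gamma>) \<partial>distr M ?S ?X)"
  by (intro nn_integral_cong P.product_nn_integral_prod[symmetric]) auto
 also have "... = (\<integral>\<^sup>+w. (\<integral>\<^sup>+x. (\<Prod>i<k. f i (perp_sum a (?X w) N (A i) + perp_scale a (?X w) N * x i)) \<partial>?\<Gamma>) \<partial>M)"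
 proof (subst nn_integral_distr)
  have "(\<lambda>z. f i (perp_sum a (fst z) N (A i) + perp_scale a (fst z) N * snd z i)) \<in> borel_measurable (?S \<Otimes>\<^sub>M ?\<Gamma>)"
   if i: "i < k" for i
  proof -
   have [measurable]: "(\<lambda>z. snd z i) \<in> borel_measurable (?S \<Otimes>\<^sub>M ?\<Gamma>)"
    using measurable_component_singleton[of i "{..<k}" "\<lambda>i. gamma_law (\<alpha> i)"] i
    by (intro measurable_compose[OF measurable_snd]) simp
   have [measurable]: "(\<lambda>z. perp_sum a (fst z) N (A i)) \<in> borel_measurable (?S \<Otimes>\<^sub>M ?\<Gamma>)"
    "(\<lambda>z. perp_scale a (fst z) N) \<in> borel_measurable (?S \<Otimes>\<^sub>M ?\<Gamma>)"
    using measurable_compose[OF measurable_fst perp_measurable(2)[OF A'[OF i]]]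
     measurable_compose[OF measurable_fst perp_measurable(1)[OF A'[OF i]]] by auto
   show ?thesis by (intro measurable_compose[OF _ f]) measurable
  qed
  then have "(\<lambda>z. \<Prod>i<k. f i (perp_sum a (fst z) N (A i) + perp_scale a (fst z) N * snd z i)) \<in> borel_measurable (?S \<Otimes>\<^sub>M ?\<Gamma>)"
   by (intro borel_measurable_prod_ennreal) auto
  from \<Gamma>.borel_measurable_nn_integral_fst[OF this]
  show "(\<lambda>h. \<integral>\<^sup>+x. (\<Prod>i<k. f i (perp_sum a h N (A i) + perp_scale a h N * x i)) \<partial>?\<Gamma>) \<in> borel_measurable (distr M ?S ?X)"
   by simp
 qed auto
 also have "... = (\<Prod>i<k. \<integral>\<^sup>+x. f i x \<partial>gamma_law (\<alpha> i))"
  unfolding sc[symmetric] by (rule Suc.IH)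
 finally show ?case .
qed

end

context perpetuity_noise begin

lemma gvec_component_measurable [measurable]:
 "(\<lambda>wo. fst (gvec wo m)) \<in> borel_measurable M"
 "(\<lambda>wo. fst (snd (gvec wo m))) \<in> borel_measurable M"
 "(\<lambda>wo. snd (snd (gvec wo m))) \<in> borel_measurable M"
 unfolding gvec_def by measurable

lemma perp_scale_measurable [measurable]: "(\<lambda>wo. perp_scale a (gvec wo) N) \<in> borel_measurable M"
 unfolding perp_scale_def by measurable

lemma perp_weight_measurable [measurable]: "(\<lambda>wo. perp_weight a (gvec wo) N) \<in> borel_measurable M"
 unfolding perp_weight_def by measurable

lemma gvec_indicator_measurable [measurable]:
 "A \<in> sets borel ==> (\<lambda>wo. indicator A (fst (snd (gvec wo m))) :: real) \<in> borel_measurable M"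
 by (rule measurable_compose[OF gvec_component_measurable(2) borel_measurable_indicator])

lemma perp_sum_measurable [measurable]:
 "A \<in> sets borel ==> (\<lambda>wo. perp_sum a (gvec wo) N A) \<in> borel_measurable M"
 unfolding perp_sum_def
 by (intro borel_measurable_sum borel_measurable_times perp_weight_measurable gvec_indicator_measurable)

lemma nn_integral_prod_triples:
 assumes c[measurable]: "\<And>m. c m \<in> borel_measurable R3"
 shows "(\<integral>\<^sup>+wo. (\<Prod>m<N. c m (gvec wo m) :: ennreal) \<partial>M) =
  (\<Prod>m<N. \<integral>\<^sup>+v. \<integral>\<^sup>+y. \<integral>\<^sup>+e. c m (v, y, e) \<partial>gamma_law 1 \<partial>\<eta> \<partial>gamma_law 1)"
proof -
 have "indep_vars (\<lambda>_. borel) (\<lambda>m wo. c m (G m wo)) {..<N}"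
  by (rule indep_vars_compose2[OF indep_vars_subset[OF indep]]) auto
 then have "(\<integral>\<^sup>+wo. (\<Prod>m<N. c m (G m wo)) \<partial>M) = (\<Prod>m<N. \<integral>\<^sup>+wo. c m (G m wo) \<partial>M)"
  by (intro indep_vars_nn_integral) auto
 also have "... = (\<Prod>m<N. \<integral>\<^sup>+\<theta>. c m \<theta> \<partial>distr M R3 (G m))"
  by (intro prod.cong refl) (subst nn_integral_distr, auto)
 finally show ?thesis by (simp add: nn_integral_triple gvec_def)
qed

lemma nn_integral_triple_const: "(\<integral>\<^sup>+v. \<integral>\<^sup>+y. \<integral>\<^sup>+e. f v \<partial>gamma_law 1 \<partial>\<eta> \<partial>gamma_law 1) = (\<integral>\<^sup>+v. f v \<partial>gamma_law 1)"
 "(\<integral>\<^sup>+v. \<integral>\<^sup>+y. \<integral>\<^sup>+e. h e \<partial>gamma_law 1 \<partial>\<eta> \<partial>gamma_law 1) = (\<integral>\<^sup>+e. h e \<partial>gamma_law 1)"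
proof -
 interpret eta: real_distribution \<eta> by (rule \<eta>)
 interpret g1: prob_space "gamma_law 1" by (rule prob_space_gamma_law)
 show "(\<integral>\<^sup>+v. \<integral>\<^sup>+y. \<integral>\<^sup>+e. f v \<partial>gamma_law 1 \<partial>\<eta> \<partial>gamma_law 1) = (\<integral>\<^sup>+v. f v \<partial>gamma_law 1)"
  "(\<integral>\<^sup>+v. \<integral>\<^sup>+y. \<integral>\<^sup>+e. h e \<partial>gamma_law 1 \<partial>\<eta> \<partial>gamma_law 1) = (\<integral>\<^sup>+e. h e \<partial>gamma_law 1)"
  using g1.emeasure_space_1 eta.emeasure_space_1 by simp_all
qed

definition shrink_rate :: real where "shrink_rate = a / (a + 1)"

lemma shrink_rate: "0 < shrink_rate" "shrink_rate < 1"
 using a by (auto simp: shrink_rate_def)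

lemma nn_integral_shrink: "(\<integral>\<^sup>+v. ennreal (exp (- v / a)) \<partial>gamma_law 1) = ennreal shrink_rate"
proof -
 have "(\<integral>\<^sup>+v. ennreal (exp ((- 1 / a) * v)) \<partial>gamma_law 1) = ennreal ((1 - (- 1 / a)) powr (- 1))"
  using a by (intro nn_integral_gamma_exp) (auto simp: field_simps)
 also have "(1 - (- 1 / a)) powr (- 1) = shrink_rate"
  using a by (simp add: shrink_rate_def powr_minus field_simps)
 finally show ?thesis by simp
qed

lemma nn_integral_gamma_1: "(\<integral>\<^sup>+e. ennreal e \<partial>gamma_law 1) = 1"
proof -
 interpret g: prob_space "gamma_law (1 + 1)" by (rule prob_space_gamma_law)
 have "(\<integral>\<^sup>+e. 1 \<partial>gamma_law (1 + 1)) = (\<integral>\<^sup>+e. ennreal (e / 1) * 1 \<partial>gamma_law 1)"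
  by (rule nn_integral_gamma_size_bias) auto
 then show ?thesis using g.emeasure_space_1 by simp
qed

lemma nn_integral_perp_scale: "(\<integral>\<^sup>+wo. ennreal (perp_scale a (gvec wo) N) \<partial>M) = ennreal (shrink_rate ^ N)"
proof -
 have "(\<integral>\<^sup>+wo. ennreal (perp_scale a (gvec wo) N) \<partial>M) = (\<integral>\<^sup>+wo. (\<Prod>m<N. (\<lambda>\<theta>. ennreal (exp (- fst \<theta> / a))) (gvec wo m)) \<partial>M)"
  by (simp add: perp_scale_def prod_ennreal)
 also have "... = (\<Prod>m<N. \<integral>\<^sup>+v. \<integral>\<^sup>+y. \<integral>\<^sup>+e. ennreal (exp (- fst (v, y, e) / a)) \<partial>gamma_law 1 \<partial>\<eta> \<partial>gamma_law 1)"
  by (rule nn_integral_prod_triples) measurable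
 also have "... = ennreal (shrink_rate ^ N)"
  using shrink_rate unfolding fst_conv nn_integral_triple_const nn_integral_shrink
  by (simp add: ennreal_power)
 finally show ?thesis .
qed

lemma AE_snd_gvec_nonneg: "AE wo in M. \<forall>m. fst (gvec wo m) >= 0 \<and> snd (snd (gvec wo m)) >= 0"
 unfolding AE_all_countable
proof
 fix m
 let ?N = "\<lambda>\<theta> :: real \<times> real \<times> real. indicator {\<theta>. \<not> (fst \<theta> >= 0 \<and> snd (snd \<theta>) >= 0)} \<theta> :: ennreal"
 have meas: "{\<theta> :: real \<times> real \<times> real. \<not> (fst \<theta> >= 0 \<and> snd (snd \<theta>) >= 0)} \<in> sets R3"
 proof -
  have "Measurable.pred R3 (\<lambda>\<theta> :: real \<times> real \<times> real. \<not> (fst \<theta> >= 0 \<and> snd (snd \<theta>) >= 0))" by measurable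
  then show ?thesis by (simp add: pred_def space_pair_measure)
 qed
 interpret eta: real_distribution \<eta> by (rule \<eta>)
 have "(\<integral>\<^sup>+\<theta>. ?N \<theta> \<partial>distr M R3 (G m)) = (\<integral>\<^sup>+v. \<integral>\<^sup>+y. \<integral>\<^sup>+e. ?N (v, y, e) \<partial>gamma_law 1 \<partial>\<eta> \<partial>gamma_law 1)"
  using meas by (intro nn_integral_triple) auto
 also have "... = (\<integral>\<^sup>+v. \<integral>\<^sup>+(y::real). \<integral>\<^sup>+(e::real). 0 \<partial>gamma_law 1 \<partial>\<eta> \<partial>gamma_law 1)"
 proof (rule nn_integral_cong_AE)
  show "AE v in gamma_law 1. (\<integral>\<^sup>+y. \<integral>\<^sup>+e. ?N (v, y, e) \<partial>gamma_law 1 \<partial>\<eta>) = (\<integral>\<^sup>+(y::real). \<integral>\<^sup>+(e::real). 0 \<partial>gamma_law 1 \<partial>\<eta>)"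
   using AE_gamma_law_nonneg[of 1]
  proof eventually_elim
   case (elim v)
   have "(\<integral>\<^sup>+e. ?N (v, y, e) \<partial>gamma_law 1) = (\<integral>\<^sup>+(e::real). 0 \<partial>gamma_law 1)" for y
    using AE_gamma_law_nonneg[of 1] elim by (intro nn_integral_cong_AE) (auto elim!: eventually_mono)
   then show ?case by simp
  qed
 qed
 finally have "(\<integral>\<^sup>+\<theta>. ?N \<theta> \<partial>distr M R3 (G m)) = 0" by simp
 then have "(\<integral>\<^sup>+wo. ?N (G m wo) \<partial>M) = 0"
  using meas by (subst (asm) nn_integral_distr) auto
 then have "AE wo in M. ?N (G m wo) = 0"
  using meas by (subst (asm) nn_integral_0_iff_AE) (auto intro!: measurable_compose[OF G_measurable])
 then show "AE wo in M. fst (gvec wo m) >= 0 \<and> snd (snd (gvec wo m)) >= 0"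
  by eventually_elim (auto simp: gvec_def indicator_def split: if_splits)
qed

lemma AE_perp_scale_summable: "AE wo in M. summable (\<lambda>N. perp_scale a (gvec wo) N)"
proof (rule AE_summable_of_nn_integral_bound[where b = "\<lambda>N. shrink_rate ^ N"])
 show "summable (\<lambda>N. shrink_rate ^ N)" using shrink_rate by (intro summable_geometric) auto
 show "(\<integral>\<^sup>+wo. ennreal (perp_scale a (gvec wo) N) \<partial>M) <= ennreal (shrink_rate ^ N)" for N
  by (simp add: nn_integral_perp_scale)
qed (use shrink_rate in \<open>auto simp: perp_scale_def intro!: AE_I2 prod_nonneg\<close>)

lemma perp_weight_nonneg: "snd (snd (g m)) >= 0 ==> perp_weight a g m >= 0"
 by (auto simp: perp_weight_def perp_scale_def intro!: mult_nonneg_nonneg prod_nonneg)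

lemma AE_perp_weight_nonneg: "AE wo in M. \<forall>m. perp_weight a (gvec wo) m >= 0"
 using AE_snd_gvec_nonneg by eventually_elim (auto intro: perp_weight_nonneg)

lemma AE_perp_weight_summable: "AE wo in M. summable (\<lambda>m. perp_weight a (gvec wo) m)"
proof (rule AE_summable_of_nn_integral_bound[where b = "\<lambda>N. shrink_rate ^ N"])
 show "summable (\<lambda>N. shrink_rate ^ N)" using shrink_rate by (intro summable_geometric) auto
 show "(\<integral>\<^sup>+wo. ennreal (perp_weight a (gvec wo) n) \<partial>M) <= ennreal (shrink_rate ^ n)" for n
 proof -
  define c :: "nat => real \<times> real \<times> real => ennreal" where
   "c m = (\<lambda>\<theta>. if m = n then ennreal (snd (snd \<theta>)) else ennreal (exp (- fst \<theta> / a)))" for m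
  have [measurable]: "c m \<in> borel_measurable R3" for m unfolding c_def by measurable
  have "(\<integral>\<^sup>+wo. ennreal (perp_weight a (gvec wo) n) \<partial>M) <= (\<integral>\<^sup>+wo. (\<Prod>m<Suc n. c m (gvec wo m)) \<partial>M)"
  proof (rule nn_integral_mono_AE)
   show "AE wo in M. ennreal (perp_weight a (gvec wo) n) <= (\<Prod>m<Suc n. c m (gvec wo m))"
    using AE_snd_gvec_nonneg
   proof eventually_elim
    case (elim wo)
    have "exp (- fst (gvec wo n) / a) * snd (snd (gvec wo n)) <= 1 * snd (snd (gvec wo n))"
     using elim a by (intro mult_right_mono) auto
    then have "perp_weight a (gvec wo) n <= (\<Prod>m<n. exp (- fst (gvec wo m) / a)) * snd (snd (gvec wo n))"
     unfolding perp_weight_def perp_scale_def prod.lessThan_Suc mult.assoc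
     by (intro mult_left_mono prod_nonneg) auto
    then have "ennreal (perp_weight a (gvec wo) n) <= ennreal ((\<Prod>m<n. exp (- fst (gvec wo m) / a)) * snd (snd (gvec wo n)))"
     by (rule ennreal_leI)
    also have "... = (\<Prod>m<Suc n. c m (gvec wo m))"
     using elim by (simp add: c_def ennreal_mult prod_nonneg prod_ennreal)
    finally show ?case .
   qed
  qed
  also have "... = (\<Prod>m<Suc n. \<integral>\<^sup>+v. \<integral>\<^sup>+y. \<integral>\<^sup>+e. c m (v, y, e) \<partial>gamma_law 1 \<partial>\<eta> \<partial>gamma_law 1)"
   by (rule nn_integral_prod_triples) measurable
  also have "... = (\<Prod>m<Suc n. if m = n then 1 else ennreal shrink_rate)"
  proof (intro prod.cong refl)
   fix x
   show "(\<integral>\<^sup>+v. \<integral>\<^sup>+y. \<integral>\<^sup>+e. c x (v, y, e) \<partial>gamma_law 1 \<partial>\<eta> \<partial>gamma_law 1) = (if x = n then 1 else ennreal shrink_rate)"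
   proof (cases "x = n")
    case True
    have "(\<integral>\<^sup>+v. \<integral>\<^sup>+y. \<integral>\<^sup>+e. ennreal e \<partial>gamma_law 1 \<partial>\<eta> \<partial>gamma_law 1) = 1"
     by (rule trans[OF nn_integral_triple_const(2) nn_integral_gamma_1])
    then show ?thesis unfolding c_def using True by simp
   next
    case False
    have "(\<integral>\<^sup>+v. \<integral>\<^sup>+y. \<integral>\<^sup>+e. ennreal (exp (- v / a)) \<partial>gamma_law 1 \<partial>\<eta> \<partial>gamma_law 1) = ennreal shrink_rate"
     by (rule trans[OF nn_integral_triple_const(1) nn_integral_shrink])
    then show ?thesis unfolding c_def using False by simp
   qed
  qed
  also have "... = ennreal (shrink_rate ^ n)"
   using shrink_rate by (simp add: ennreal_power)
  finally show ?thesis .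
 qed
qed (use shrink_rate AE_perp_weight_nonneg in auto)

definition perp_measure :: "'w => real set => real" where
 "perp_measure wo A = (\<Sum>m. perp_weight a (gvec wo) m * indicator A (fst (snd (gvec wo m))))"

lemma perp_measure_measurable [measurable]:
 "A \<in> sets borel ==> (\<lambda>wo. perp_measure wo A) \<in> borel_measurable M"
 unfolding perp_measure_def
 by (intro borel_measurable_suminf borel_measurable_times perp_weight_measurable gvec_indicator_measurable)

lemma AE_perp_sum_tendsto: "AE wo in M. \<forall>A. (\<lambda>N. perp_sum a (gvec wo) N A) \<longlonglongrightarrow> perp_measure wo A"
 using AE_perp_weight_summable AE_perp_weight_nonneg
proof eventually_elim
 case (elim wo)
 show ?case
 proof
  fix A
  have "summable (\<lambda>m. perp_weight a (gvec wo) m * indicator A (fst (snd (gvec wo m))))"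
   by (rule summable_comparison_test'[OF elim(1), of 0]) (use elim in \<open>auto simp: indicator_def abs_of_nonneg\<close>)
  from summable_LIMSEQ[OF this]
  show "(\<lambda>N. perp_sum a (gvec wo) N A) \<longlonglongrightarrow> perp_measure wo A"
   by (simp add: perp_sum_def perp_measure_def)
 qed
qed

text \<open>
  As \<open>N\<close> grows the shrunk copy in \<open>perpetuity_iterate\<close> tends to 0 almost surely, so the
  test integrals of the series converge to those of the gamma vector.
\<close>
lemma distr_perp_measure:
 fixes A :: "nat => real set"
 assumes A: "A ` {..<k} \<subseteq> sets borel" "disjoint_family_on A {..<k}" "(\<Union>i<k. A i) = UNIV"
  and \<alpha>: "\<And>i. \<alpha> i = a * measure \<eta> (A i)"
 shows "distr M (PiM {..<k} (\<lambda>_. borel)) (\<lambda>wo. \<lambda>i\<in>{..<k}. perp_measure wo (A i)) = PiM {..<k} (\<lambda>i. gamma_law (\<alpha> i))"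
proof -
 define B where "B i = (if i < k then A i else UNIV)" for i
 have AB: "A i \<in> sets borel" if "i < k" for i using that A by auto
 have k: "k > 0" using A(3) by (cases "k = 0") auto
 have eqB: "(\<lambda>wo. \<lambda>i\<in>{..<k}. perp_measure wo (A i)) = (\<lambda>wo. \<lambda>i\<in>{..<k}. perp_measure wo (B i))"
  by (auto simp: B_def fun_eq_iff)
 show ?thesis unfolding eqB
 proof (rule distr_eq_PiM_if_continuous_tests)
  show "(\<lambda>wo. perp_measure wo (B i)) \<in> borel_measurable M" for i
   using AB by (intro perp_measure_measurable) (auto simp: B_def)
  show "real_distribution (gamma_law (\<alpha> i))" for i
   using prob_space_gamma_law by (simp add: real_distribution_def real_distribution_axioms_def)
  fix g :: "nat => real => real"
  assume gc: "\<And>i. continuous_on UNIV (g i)" and gb: "\<And>i x. 0 <= g i x \<and> g i x <= 1"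
  have gm[measurable]: "g i \<in> borel_measurable borel" for i
   by (rule borel_measurable_continuous_onI[OF gc])
  let ?\<Gamma> = "PiM {..<k} (\<lambda>i. gamma_law (\<alpha> i))"
  interpret \<Gamma>: prob_space ?\<Gamma> by (intro prob_space_PiM prob_space_gamma_law)
  let ?I = "\<lambda>N wo. \<integral>\<^sup>+x. (\<Prod>i<k. ennreal (g i (perp_sum a (gvec wo) N (A i) + perp_scale a (gvec wo) N * x i))) \<partial>?\<Gamma>"
  have comp: "(\<lambda>x. x i) \<in> borel_measurable ?\<Gamma>" if "i < k" for i
   using measurable_component_singleton[of i "{..<k}" "\<lambda>i. gamma_law (\<alpha> i)"] that by simp
  have I_meas: "?I N \<in> borel_measurable M" for N
  proof -
   have "(\<lambda>z. ennreal (g i (perp_sum a (gvec (fst z)) N (A i) + perp_scale a (gvec (fst z)) N * snd z i)))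
     \<in> borel_measurable (M \<Otimes>\<^sub>M ?\<Gamma>)" if i: "i < k" for i
   proof -
    have [measurable]: "(\<lambda>z. snd z i) \<in> borel_measurable (M \<Otimes>\<^sub>M ?\<Gamma>)"
     by (rule measurable_compose[OF measurable_snd comp[OF i]])
    have [measurable]: "A i \<in> sets borel" by (rule AB[OF i])
    show ?thesis by measurable
   qed
   then have "(\<lambda>z. \<Prod>i<k. ennreal (g i (perp_sum a (gvec (fst z)) N (A i) + perp_scale a (gvec (fst z)) N * snd z i)))
     \<in> borel_measurable (M \<Otimes>\<^sub>M ?\<Gamma>)" by (intro borel_measurable_prod_ennreal) auto
   from \<Gamma>.borel_measurable_nn_integral_fst[OF this] show ?thesis by simp
  qed
  have le1: "(\<Prod>i<k. ennreal (g i (h i))) <= 1" for h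
   using gb by (intro prod_le_1) (auto simp flip: ennreal_1 intro: ennreal_leI)
  have I_le: "?I N wo <= 1" for N wo
  proof -
   have "?I N wo <= (\<integral>\<^sup>+x. 1 \<partial>?\<Gamma>)" by (intro nn_integral_mono le1)
   then show ?thesis using \<Gamma>.emeasure_space_1 by simp
  qed
  have "(\<lambda>N. \<integral>\<^sup>+wo. ?I N wo \<partial>M) \<longlonglongrightarrow> (\<integral>\<^sup>+wo. (\<Prod>i<k. ennreal (g i (perp_measure wo (B i)))) \<partial>M)"
  proof (rule nn_integral_dominated_convergence[where w = "\<lambda>_. 1"])
   show "(\<lambda>wo. \<Prod>i<k. ennreal (g i (perp_measure wo (B i)))) \<in> borel_measurable M"
    using AB by (intro borel_measurable_prod_ennreal measurable_compose[OF _ measurable_ennreal]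
      measurable_compose[OF _ gm] perp_measure_measurable) (auto simp: B_def)
   show "AE wo in M. (\<lambda>N. ?I N wo) \<longlonglongrightarrow> (\<Prod>i<k. ennreal (g i (perp_measure wo (B i))))"
    using AE_perp_sum_tendsto AE_perp_scale_summable
   proof eventually_elim
    case (elim wo)
    have "(\<lambda>N. ?I N wo) \<longlonglongrightarrow> (\<integral>\<^sup>+x. (\<Prod>i<k. ennreal (g i (perp_measure wo (B i)))) \<partial>?\<Gamma>)"
    proof (rule nn_integral_dominated_convergence[where w = "\<lambda>_. 1"])
     show "(\<lambda>x. \<Prod>i<k. ennreal (g i (perp_sum a (gvec wo) N (A i) + perp_scale a (gvec wo) N * x i))) \<in> borel_measurable ?\<Gamma>" for N
      by (intro borel_measurable_prod_ennreal measurable_compose[OF _ measurable_ennreal]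
        measurable_compose[OF _ gm] borel_measurable_add borel_measurable_times comp) auto
     show "AE x in ?\<Gamma>. (\<lambda>N. \<Prod>i<k. ennreal (g i (perp_sum a (gvec wo) N (A i) + perp_scale a (gvec wo) N * x i)))
       \<longlonglongrightarrow> (\<Prod>i<k. ennreal (g i (perp_measure wo (B i))))"
     proof (rule AE_I2)
      fix x :: "nat => real"
      have "(\<lambda>N. g i (perp_sum a (gvec wo) N (A i) + perp_scale a (gvec wo) N * x i)) \<longlonglongrightarrow> g i (perp_measure wo (A i))" for i
      proof (rule isCont_tendsto_compose[where g = "g i"])
       show "isCont (g i) (perp_measure wo (A i))"
        using gc[of i] by (simp add: continuous_on_eq_continuous_at)
       show "(\<lambda>N. perp_sum a (gvec wo) N (A i) + perp_scale a (gvec wo) N * x i) \<longlonglongrightarrow> perp_measure wo (A i)"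
        using tendsto_add[OF elim(1)[rule_format, of "A i"] tendsto_mult_right[OF summable_LIMSEQ_zero[OF elim(2)], of "x i"]]
        by simp
      qed
      then have "(\<lambda>N. ennreal (\<Prod>i<k. g i (perp_sum a (gvec wo) N (A i) + perp_scale a (gvec wo) N * x i)))
        \<longlonglongrightarrow> ennreal (\<Prod>i<k. g i (perp_measure wo (A i)))"
       by (intro tendsto_ennrealI tendsto_prod)
      then show "(\<lambda>N. \<Prod>i<k. ennreal (g i (perp_sum a (gvec wo) N (A i) + perp_scale a (gvec wo) N * x i)))
        \<longlonglongrightarrow> (\<Prod>i<k. ennreal (g i (perp_measure wo (B i))))"
       using gb by (simp add: prod_ennreal B_def)
     qed
    qed (use le1 \<Gamma>.emeasure_space_1 in auto)
    then show ?case using \<Gamma>.emeasure_space_1 by simp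
   qed
  qed (use I_meas I_le emeasure_space_1 in auto)
  moreover have "(\<integral>\<^sup>+wo. ?I N wo \<partial>M) = (\<Prod>i<k. \<integral>\<^sup>+y. ennreal (g i y) \<partial>gamma_law (\<alpha> i))" for N
   by (rule perpetuity_iterate[OF A \<alpha>, where f = "\<lambda>i x. ennreal (g i x)"]) measurable
  ultimately have "(\<lambda>N::nat. \<Prod>i<k. \<integral>\<^sup>+y. ennreal (g i y) \<partial>gamma_law (\<alpha> i)) \<longlonglongrightarrow> (\<integral>\<^sup>+wo. (\<Prod>i<k. ennreal (g i (perp_measure wo (B i)))) \<partial>M)"
   by simp
  from LIMSEQ_unique[OF this tendsto_const] have fin: "(\<integral>\<^sup>+wo. (\<Prod>i\<in>{..<k}. ennreal (g i (perp_measure wo (B i)))) \<partial>M) =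
    (\<Prod>i\<in>{..<k}. \<integral>\<^sup>+y. ennreal (g i y) \<partial>gamma_law (\<alpha> i))" by simp
  from fin
  show "(\<integral>\<^sup>+wo. (\<Prod>i\<in>{..<k}. ennreal (g i (perp_measure wo (B i)))) \<partial>M) =
    (\<Prod>i\<in>{..<k}. \<integral>\<^sup>+y. ennreal (g i y) \<partial>gamma_law (\<alpha> i))" .
 qed (use k in auto)
qed

end

section \<open>Splitting families of gamma variables\<close>

lemma prod_lessThan_double:
 "(\<Prod>i<2 * N. f i) = (\<Prod>b<N. f (2 * b) * f (2 * b + 1))" for f :: "nat => 'a :: comm_monoid_mult"
 by (induction N) (simp_all add: mult_ac)

text \<open>
  Beta-gamma algebra applied to one index after the other, for splits that are functions of an arbitrary noise.
\<close>
lemma nn_integral_split_gamma_family: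
 fixes J :: "nat set" and s :: "nat => real => real" and H :: "nat => real measure"
 assumes J: "finite J" and p: "\<And>b. p b > 0" and q: "\<And>b. q b >= 0"
  and H: "\<And>b. prob_space (H b)" "\<And>b. sets (H b) = sets borel"
  and s[measurable]: "\<And>b. s b \<in> borel_measurable borel"
  and law: "\<And>b. b \<in> J ==> distr (H b) borel (s b) = beta_law (p b) (q b)"
  and f[measurable]: "\<And>b. f b \<in> borel_measurable borel" and g[measurable]: "\<And>b. g b \<in> borel_measurable borel"
 shows "(\<integral>\<^sup>+x. \<integral>\<^sup>+\<theta>. (\<Prod>b\<in>J. f b (x b * s b (\<theta> b)) * g b (x b * (1 - s b (\<theta> b)))) \<partial>PiM J H
   \<partial>PiM J (\<lambda>b. gamma_law (p b + q b))) =
  (\<Prod>b\<in>J. (\<integral>\<^sup>+y. f b y \<partial>gamma_law (p b)) * (\<integral>\<^sup>+y. g b y \<partial>gamma_law (q b)))"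
proof -
 interpret G: product_prob_space "\<lambda>b. gamma_law (p b + q b)"
  by (rule product_prob_spaceI) (rule prob_space_gamma_law)
 interpret H: product_prob_space H by (rule product_prob_spaceI) (rule H)
 have sb[measurable]: "s b \<in> borel_measurable (H b)" for b
  using s[of b] by (simp add: measurable_cong_sets[OF H(2) refl])
 have inner: "(\<integral>\<^sup>+\<theta>. f b (x * s b \<theta>) * g b (x * (1 - s b \<theta>)) \<partial>H b) =
   (\<integral>\<^sup>+z. f b (x * z) * g b (x * (1 - z)) \<partial>beta_law (p b) (q b))" if "b \<in> J" for x b
  unfolding law[OF that, symmetric] by (subst nn_integral_distr) auto
 have m2: "(\<lambda>x. \<integral>\<^sup>+z. f b (x * z) * g b (x * (1 - z)) \<partial>beta_law (p b) (q b)) \<in> borel_measurable borel" for b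
 proof -
  interpret B: prob_space "beta_law (p b) (q b)" by (rule prob_space_beta_law[OF p q])
  show ?thesis by measurable
 qed
 have "(\<integral>\<^sup>+x. \<integral>\<^sup>+\<theta>. (\<Prod>b\<in>J. f b (x b * s b (\<theta> b)) * g b (x b * (1 - s b (\<theta> b)))) \<partial>PiM J H
   \<partial>PiM J (\<lambda>b. gamma_law (p b + q b))) =
  (\<integral>\<^sup>+x. (\<Prod>b\<in>J. \<integral>\<^sup>+z. f b (x b * z) * g b (x b * (1 - z)) \<partial>beta_law (p b) (q b)) \<partial>PiM J (\<lambda>b. gamma_law (p b + q b)))"
 proof (rule nn_integral_cong)
  fix x :: "nat => real"
  have "(\<integral>\<^sup>+\<theta>. (\<Prod>b\<in>J. f b (x b * s b (\<theta> b)) * g b (x b * (1 - s b (\<theta> b)))) \<partial>PiM J H) =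
   (\<Prod>b\<in>J. \<integral>\<^sup>+\<theta>. f b (x b * s b \<theta>) * g b (x b * (1 - s b \<theta>)) \<partial>H b)"
   using J by (intro H.product_nn_integral_prod) auto
  then show "(\<integral>\<^sup>+\<theta>. (\<Prod>b\<in>J. f b (x b * s b (\<theta> b)) * g b (x b * (1 - s b (\<theta> b)))) \<partial>PiM J H) =
   (\<Prod>b\<in>J. \<integral>\<^sup>+z. f b (x b * z) * g b (x b * (1 - z)) \<partial>beta_law (p b) (q b))"
   by (simp add: inner cong: prod.cong)
 qed
 also have "... = (\<Prod>b\<in>J. \<integral>\<^sup>+x. \<integral>\<^sup>+z. f b (x * z) * g b (x * (1 - z)) \<partial>beta_law (p b) (q b) \<partial>gamma_law (p b + q b))"
  using J m2 by (intro G.product_nn_integral_prod) (auto simp: measurable_cong_sets[OF sets_gamma_law refl])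
 also have "... = (\<Prod>b\<in>J. (\<integral>\<^sup>+y. f b y \<partial>gamma_law (p b)) * (\<integral>\<^sup>+y. g b y \<partial>gamma_law (q b)))"
 proof (rule prod.cong[OF refl])
  fix b
  have "(\<integral>\<^sup>+x. \<integral>\<^sup>+z. f b (x * z) * g b (x * (1 - z)) \<partial>beta_law (p b) (q b) \<partial>gamma_law (p b + q b)) =
   (\<integral>\<^sup>+x. \<integral>\<^sup>+y. f b x * g b y \<partial>gamma_law (q b) \<partial>gamma_law (p b))"
   using nn_integral_gamma_split_measurable[OF p q, of "\<lambda>(x, y). f b x * g b y" b b] by simp
  also have "... = (\<integral>\<^sup>+x. f b x * (\<integral>\<^sup>+y. g b y \<partial>gamma_law (q b)) \<partial>gamma_law (p b))"
   by (intro nn_integral_cong nn_integral_cmult) simp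
  also have "... = (\<integral>\<^sup>+y. f b y \<partial>gamma_law (p b)) * (\<integral>\<^sup>+y. g b y \<partial>gamma_law (q b))"
   by (rule nn_integral_multc) simp
  finally show "(\<integral>\<^sup>+x. \<integral>\<^sup>+z. f b (x * z) * g b (x * (1 - z)) \<partial>beta_law (p b) (q b) \<partial>gamma_law (p b + q b)) =
   (\<integral>\<^sup>+y. f b y \<partial>gamma_law (p b)) * (\<integral>\<^sup>+y. g b y \<partial>gamma_law (q b))" .
 qed
 finally show ?thesis .
qed

text \<open>
  Index \<open>b\<close> is split into its children \<open>2 b\<close> and \<open>2 b + 1\<close>.
\<close>
definition split_vec :: "(nat => real => real) => (nat => real) => (nat => real) => nat => real" where
 "split_vec s x \<theta> i = x (i div 2) * (if even i then s (i div 2) (\<theta> (i div 2)) else 1 - s (i div 2) (\<theta> (i div 2)))"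

lemma (in prob_space) distr_split_gamma_family:
 fixes N :: nat and X \<Theta> :: "'a => nat => real"
 assumes p: "\<And>b. p b > 0" and q: "\<And>b. q b >= 0"
  and ind: "indep_var (PiM {..<N} (\<lambda>_. borel)) X (PiM {..<N} (\<lambda>_. borel)) \<Theta>"
  and X: "distr M (PiM {..<N} (\<lambda>_. borel)) X = PiM {..<N} (\<lambda>b. gamma_law (p b + q b))"
  and \<Theta>: "distr M (PiM {..<N} (\<lambda>_. borel)) \<Theta> = PiM {..<N} H"
  and H: "\<And>b. prob_space (H b)" "\<And>b. sets (H b) = sets borel"
  and s[measurable]: "\<And>b. s b \<in> borel_measurable borel"
  and law: "\<And>b. b < N ==> distr (H b) borel (s b) = beta_law (p b) (q b)"
 shows "distr M (PiM {..<2 * N} (\<lambda>_. borel)) (\<lambda>w. \<lambda>i\<in>{..<2 * N}. split_vec s (X w) (\<Theta> w) i) =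
  PiM {..<2 * N} (\<lambda>i. gamma_law (if even i then p (i div 2) else q (i div 2)))"
proof (rule PiM_eqI_product_tests)
 let ?P = "PiM {..<N} (\<lambda>_. borel) :: (nat => real) measure"
 let ?Q = "PiM {..<2 * N} (\<lambda>_. borel) :: (nat => real) measure"
 have [measurable]: "X \<in> measurable M ?P" "\<Theta> \<in> measurable M ?P"
  using ind by (blast dest: indep_var_rv1 indep_var_rv2)+
 have comp: "(\<lambda>x. x b) \<in> borel_measurable ?P" if "b < N" for b
  using that by (intro measurable_component_singleton) auto
 have sv: "(\<lambda>z. split_vec s (fst z) (snd z) i) \<in> borel_measurable (?P \<Otimes>\<^sub>M ?P)" if "i < 2 * N" for i
 proof -
  have b: "i div 2 < N" using that by auto
  have [measurable]: "(\<lambda>z. fst z (i div 2)) \<in> borel_measurable (?P \<Otimes>\<^sub>M ?P)"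
    "(\<lambda>z. snd z (i div 2)) \<in> borel_measurable (?P \<Otimes>\<^sub>M ?P)"
   using measurable_compose[OF measurable_fst comp[OF b]] measurable_compose[OF measurable_snd comp[OF b]] by auto
  show ?thesis unfolding split_vec_def by measurable
 qed
 have svM: "(\<lambda>w. \<lambda>i\<in>{..<2 * N}. split_vec s (X w) (\<Theta> w) i) \<in> measurable M ?Q"
 proof (rule measurable_restrict)
  fix i assume "i \<in> {..<2 * N}"
  then have "(\<lambda>w. (\<lambda>z. split_vec s (fst z) (snd z) i) (X w, \<Theta> w)) \<in> borel_measurable M"
   by (intro measurable_compose[OF _ sv]) auto
  then show "(\<lambda>w. split_vec s (X w) (\<Theta> w) i) \<in> borel_measurable M" by simp
 qed
 fix f :: "nat => real => ennreal"
 assume f: "\<And>j. f j \<in> borel_measurable (gamma_law (if even j then p (j div 2) else q (j div 2)))"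
 then have f'[measurable]: "f j \<in> borel_measurable borel" for j
  by (simp add: measurable_cong_sets[OF sets_gamma_law refl])
 have "(\<integral>\<^sup>+x. (\<Prod>j\<in>{..<2 * N}. f j (x j)) \<partial>distr M ?Q (\<lambda>w. \<lambda>i\<in>{..<2 * N}. split_vec s (X w) (\<Theta> w) i)) =
  (\<integral>\<^sup>+w. (\<Prod>j<2 * N. f j (split_vec s (X w) (\<Theta> w) j)) \<partial>M)"
 proof (subst nn_integral_distr[OF svM])
  show "(\<lambda>x. \<Prod>j\<in>{..<2 * N}. f j (x j)) \<in> borel_measurable (distr M ?Q (\<lambda>w. \<lambda>i\<in>{..<2 * N}. split_vec s (X w) (\<Theta> w) i))"
   by (intro borel_measurable_prod_ennreal measurable_compose[OF _ f']) auto
 qed (auto intro!: nn_integral_cong prod.cong)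
 also have "... = (\<integral>\<^sup>+w. (\<lambda>z. \<Prod>j<2 * N. f j (split_vec s (fst z) (snd z) j)) (X w, \<Theta> w) \<partial>M)" by simp
 also have "... = (\<integral>\<^sup>+x. \<integral>\<^sup>+\<theta>. (\<lambda>z. \<Prod>j<2 * N. f j (split_vec s (fst z) (snd z) j)) (x, \<theta>) \<partial>distr M ?P \<Theta> \<partial>distr M ?P X)"
  by (rule nn_integral_indep_var[OF ind]) (intro borel_measurable_prod_ennreal measurable_compose[OF sv f'], auto)
 also have "... = (\<integral>\<^sup>+x. \<integral>\<^sup>+\<theta>. (\<Prod>b<N. f (2 * b) (x b * s b (\<theta> b)) * f (2 * b + 1) (x b * (1 - s b (\<theta> b)))) \<partial>PiM {..<N} H
   \<partial>PiM {..<N} (\<lambda>b. gamma_law (p b + q b)))"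
  unfolding X \<Theta> by (simp add: prod_lessThan_double split_vec_def)
 also have "... = (\<Prod>b<N. (\<integral>\<^sup>+y. f (2 * b) y \<partial>gamma_law (p b)) * (\<integral>\<^sup>+y. f (2 * b + 1) y \<partial>gamma_law (q b)))"
  using p q H law by (intro nn_integral_split_gamma_family) auto
 also have "... = (\<Prod>j\<in>{..<2 * N}. \<integral>\<^sup>+y. f j y \<partial>gamma_law (if even j then p (j div 2) else q (j div 2)))"
  by (simp add: prod_lessThan_double)
 finally show "(\<integral>\<^sup>+x. (\<Prod>j\<in>{..<2 * N}. f j (x j)) \<partial>distr M ?Q (\<lambda>w. \<lambda>i\<in>{..<2 * N}. split_vec s (X w) (\<Theta> w) i)) =
  (\<Prod>j\<in>{..<2 * N}. \<integral>\<^sup>+y. f j y \<partial>gamma_law (if even j then p (j div 2) else q (j div 2)))" .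
qed (auto simp: prob_space_gamma_law intro!: sets_PiM_cong)

section \<open>Dyadic trees and the Brownian bridge\<close>

text \<open>
  The share of cell \<open>b\<close> at level \<open>q\<close> of a total mass that is split in two at every node by
  a beta variable obtained from the normal \<open>\<eta> q b\<close>. The shape of the beta law is the expected mass
  of a child.
\<close>
fun tree_frac :: "real => (nat => nat => real) => nat => nat => real" where
 "tree_frac n \<eta> 0 b = 1"
| "tree_frac n \<eta> (Suc q) b = tree_frac n \<eta> q (b div 2) *
   (if even b then beta_of_normal (n / 2 ^ Suc q) (\<eta> q (b div 2))
   else 1 - beta_of_normal (n / 2 ^ Suc q) (\<eta> q (b div 2)))"

text \<open>
  Midpoint displacement: the value of a Brownian bridge at \<open>b / 2\<^sup>q\<close> in terms of its Schauder
  coefficients \<open>\<eta>\<close>.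
\<close>
fun dyadic_bridge :: "(nat => nat => real) => nat => nat => real" where
 "dyadic_bridge \<eta> 0 b = 0"
| "dyadic_bridge \<eta> (Suc q) b =
   (if even b then dyadic_bridge \<eta> q (b div 2)
   else (dyadic_bridge \<eta> q (b div 2) + dyadic_bridge \<eta> q (b div 2 + 1)) / 2
    + \<eta> q (b div 2) / (2 * sqrt (2 ^ q)))"

definition tree_cdf :: "real => (nat => nat => real) => nat => nat => real" where
 "tree_cdf n \<eta> q b = (\<Sum>b'<b. tree_frac n \<eta> q b')"

lemma tree_cdf_even: "tree_cdf n \<eta> (Suc q) (2 * b) = tree_cdf n \<eta> q b"
proof (induction b)
 case (Suc b)
 have "tree_cdf n \<eta> (Suc q) (2 * Suc b) = tree_cdf n \<eta> (Suc q) (2 * b) +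
   (tree_frac n \<eta> (Suc q) (2 * b) + tree_frac n \<eta> (Suc q) (2 * b + 1))"
  by (simp add: tree_cdf_def)
 also have "tree_frac n \<eta> (Suc q) (2 * b) + tree_frac n \<eta> (Suc q) (2 * b + 1) = tree_frac n \<eta> q b"
  by (simp add: algebra_simps)
 finally show ?case using Suc by (simp add: tree_cdf_def)
qed (simp add: tree_cdf_def)

lemma tree_cdf_odd:
 "tree_cdf n \<eta> (Suc q) (2 * b + 1) = tree_cdf n \<eta> q b +
   tree_frac n \<eta> q b * beta_of_normal (n / 2 ^ Suc q) (\<eta> q b)"
proof -
 have "tree_cdf n \<eta> (Suc q) (2 * b + 1) = tree_cdf n \<eta> (Suc q) (2 * b) + tree_frac n \<eta> (Suc q) (2 * b)"
  by (simp add: tree_cdf_def)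
 then show ?thesis by (simp only: tree_cdf_even) simp
qed

text \<open>
  Deterministic analysis of the tree under a uniform bound on the normals. The condition \<open>2\<^sup>k \<le> 2
  n\<close> keeps the shapes of all beta laws at least \<open>1/2\<close>, the range of the coupling estimate.
\<close>
locale bounded_tree =
 fixes n :: real and k :: nat and \<eta> :: "nat => nat => real" and L :: real
 assumes n: "n > 0" and k: "2 ^ k <= 2 * n" and L: "L >= 1"
  and \<eta>: "\<And>q b. q < k ==> b < 2 ^ q ==> \<bar>\<eta> q b\<bar> <= 2 * sqrt L"
begin

abbreviation len :: "nat => real" where "len q \<equiv> n / 2 ^ q"
abbreviation \<mu> :: "nat => nat => real" where "\<mu> q b \<equiv> n * tree_frac n \<eta> q b"
abbreviation tt :: "nat => nat => real" where "tt q b \<equiv> beta_of_normal (len (Suc q)) (\<eta> q b) - 1 / 2"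

lemma half_len: "q < k ==> len (Suc q) >= 1 / 2"
proof -
 assume "q < k"
 then have "(2::real) ^ Suc q <= 2 ^ k" by (intro power_increasing) auto
 also have "... <= 2 * n" by (rule k)
 finally show ?thesis by (simp add: field_simps)
qed

lemma len_pos: "len q > 0" using n by simp

lemma frac_pos: "q <= k ==> tree_frac n \<eta> q b > 0"
proof (induction q arbitrary: b)
 case (Suc q)
 then show ?case using beta_of_normal[OF half_len[of q]] by simp
qed simp

lemma tt_bounds:
 assumes q: "q < k" and b: "b < 2 ^ q"
 shows "\<bar>tt q b\<bar> <= 1 / 2" and "\<bar>tt q b\<bar> * sqrt (len q) <= 3 / 2 * sqrt L"
  and "\<bar>len q * tt q b - sqrt (len q) / 2 * \<eta> q b\<bar> <= 5 / 2 * L"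
proof -
 note m = half_len[OF q]
 have l2: "2 * len (Suc q) = len q" by simp
 show "\<bar>tt q b\<bar> <= 1 / 2" using beta_of_normal(1,2)[OF m, of "\<eta> q b"] by (intro abs_leI) linarith+
 have sl: "sqrt (len q) = sqrt 2 * sqrt (len (Suc q))" by (simp add: real_sqrt_mult[symmetric])
 have pos: "sqrt (len (Suc q)) > 0" using n by simp
 have "\<bar>tt q b\<bar> <= \<bar>\<eta> q b\<bar> / (2 * sqrt (len (Suc q)))"
  by (rule beta_of_normal_close(1)[OF m])
 then have "\<bar>tt q b\<bar> * (sqrt 2 * sqrt (len (Suc q))) <= \<bar>\<eta> q b\<bar> / (2 * sqrt (len (Suc q))) * (sqrt 2 * sqrt (len (Suc q)))"
  using pos by (intro mult_right_mono) auto
 also have "... = \<bar>\<eta> q b\<bar> * (sqrt 2 / 2)" using pos by (simp add: field_simps)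
 also have "... <= (2 * sqrt L) * (3 / 4)"
 proof (rule mult_mono)
  have "sqrt 2 <= 3 / 2" by (rule real_le_lsqrt) (auto simp: power2_eq_square)
  then show "sqrt 2 / 2 <= (3 / 4 :: real)" by simp
 qed (use \<eta>[OF q b] L in auto)
 finally show "\<bar>tt q b\<bar> * sqrt (len q) <= 3 / 2 * sqrt L" unfolding sl by simp
 have sqe: "sqrt (len (Suc q) / 2) = sqrt (len q) / 2"
  using n by (intro real_sqrt_unique) (auto simp: power_divide)
 have A: "\<bar>len q * tt q b - sqrt (len q) / 2 * \<eta> q b\<bar> <= \<bar>\<eta> q b\<bar> / 4 + (\<eta> q b)\<^sup>2 / 2"
  using beta_of_normal_close(2)[OF m, of "\<eta> q b"] unfolding l2 sqe .
 have B: "\<bar>\<eta> q b\<bar> / 4 <= L / 2"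
 proof -
  have "sqrt L <= L" using L by (intro real_le_lsqrt) (auto simp: power2_eq_square)
  then show ?thesis using \<eta>[OF q b] by simp
 qed
 have "(\<eta> q b)\<^sup>2 <= (2 * sqrt L)\<^sup>2"
  using \<eta>[OF q b] L by (intro abs_le_square_iff[THEN iffD1]) auto
 then have C: "(\<eta> q b)\<^sup>2 <= 4 * L" using L by (simp add: power_mult_distrib)
 have "\<bar>\<eta> q b\<bar> / 4 + (\<eta> q b)\<^sup>2 / 2 <= 5 / 2 * L" using B C by linarith
 with A show "\<bar>len q * tt q b - sqrt (len q) / 2 * \<eta> q b\<bar> <= 5 / 2 * L" by (rule order.trans)
qed

lemma child_mass:
 assumes q: "q < k"
 shows "\<mu> (Suc q) b <= \<mu> q (b div 2)"
  and "\<bar>\<mu> (Suc q) b - len (Suc q)\<bar> <= \<bar>\<mu> q (b div 2) - len q\<bar> / 2 +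
   \<bar>tt q (b div 2)\<bar> * (len q + \<bar>\<mu> q (b div 2) - len q\<bar>)"
proof -
 define t where "t = tt q (b div 2)"
 define d where "d = \<mu> q (b div 2) - len q"
 note b01 = beta_of_normal[OF half_len[OF q], of "\<eta> q (b div 2)"]
 have "tree_frac n \<eta> (Suc q) b <= tree_frac n \<eta> q (b div 2)"
  using b01 frac_pos[of q "b div 2"] q by (auto intro!: mult_left_le)
 then show "\<mu> (Suc q) b <= \<mu> q (b div 2)" using n by (intro mult_left_mono) auto
 have "\<mu> (Suc q) b = \<mu> q (b div 2) * (1 / 2 + (if even b then t else - t))"
  by (simp add: t_def)
 also have "... = (len q + d) * (1 / 2 + (if even b then t else - t))" by (simp add: d_def)
 finally have "\<mu> (Suc q) b - len (Suc q) = d / 2 + (if even b then t else - t) * (len q + d)"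
  by (simp add: algebra_simps)
 also have "\<bar>...\<bar> <= \<bar>d\<bar> / 2 + \<bar>t\<bar> * \<bar>len q + d\<bar>"
  by (rule order.trans[OF abs_triangle_ineq]) (simp add: abs_mult)
 also have "... <= \<bar>d\<bar> / 2 + \<bar>t\<bar> * (len q + \<bar>d\<bar>)"
  using len_pos[of q] by (intro add_left_mono mult_left_mono) auto
 finally show "\<bar>\<mu> (Suc q) b - len (Suc q)\<bar> <= \<bar>\<mu> q (b div 2) - len q\<bar> / 2 +
   \<bar>tt q (b div 2)\<bar> * (len q + \<bar>\<mu> q (b div 2) - len q\<bar>)"
  by (simp add: t_def d_def)
qed

text \<open>
  Relative deviations accumulate geometrically from level to level, dominated by the last split, as long as a cell
  has expected mass well above \<open>L\<close>. Below that threshold only an upper bound is needed: masses decrease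
  along the tree.
\<close>
lemma mass_deviation:
 assumes "q <= k" "b < 2 ^ q"
 shows "if len q >= 900 * L then \<bar>\<mu> q b - len q\<bar> <= 10 * sqrt (len q * L) else \<mu> q b <= 1200 * L"
 using assms
proof (induction q arbitrary: b)
 case 0
 then show ?case using L n by auto
next
 case (Suc q)
 have q: "q < k" and b: "b div 2 < 2 ^ q" using Suc.prems by auto
 have IH: "if len q >= 900 * L then \<bar>\<mu> q (b div 2) - len q\<bar> <= 10 * sqrt (len q * L) else \<mu> q (b div 2) <= 1200 * L"
  using q b by (intro Suc.IH) auto
 show ?case
 proof (cases "len q >= 900 * L")
  case True
  let ?d = "\<bar>\<mu> q (b div 2) - len q\<bar>" and ?t = "\<bar>tt q (b div 2)\<bar>"
  define R where "R = sqrt (len q * L)"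
  have R0: "R >= 0" using n L by (simp add: R_def)
  have d: "?d <= 10 * R" using IH True by (simp add: R_def)
  have sl: "sqrt (len q) > 0" using len_pos[of q] by simp
  have tl: "?t * len q <= 3 / 2 * R"
  proof -
   have "?t * len q = (?t * sqrt (len q)) * sqrt (len q)"
    using n by (simp add: mult.assoc)
   also have "... <= (3 / 2 * sqrt L) * sqrt (len q)"
    using tt_bounds(2)[OF q b] sl by (intro mult_right_mono) auto
   also have "... = 3 / 2 * R" unfolding R_def real_sqrt_mult by simp
   finally show ?thesis .
  qed
  have t01: "?t <= 1 / 20"
  proof -
   have "sqrt (900 * L) <= sqrt (len q)" using True by (rule real_sqrt_le_mono)
   moreover have "sqrt (900 * L) = 30 * sqrt L"
    using real_sqrt_unique[of 30 900] by (simp add: real_sqrt_mult)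
   ultimately have "30 * sqrt L <= sqrt (len q)" by simp
   then have "?t * (30 * sqrt L) <= ?t * sqrt (len q)" by (intro mult_left_mono) auto
   also have "... <= 3 / 2 * sqrt L" by (rule tt_bounds(2)[OF q b])
   finally have "(?t * 30) * sqrt L <= 3 / 2 * sqrt L" by simp
   then have "?t * 30 <= 3 / 2" using L by (subst (asm) mult_le_cancel_right) auto
   then show ?thesis by simp
  qed
  have "\<bar>\<mu> (Suc q) b - len (Suc q)\<bar> <= ?d / 2 + ?t * (len q + ?d)"
   by (rule child_mass(2)[OF q])
  also have "... = ?d / 2 + ?t * len q + ?t * ?d" by (simp add: distrib_left)
  also have "... <= ?d / 2 + 3 / 2 * R + 1 / 20 * ?d"
   using tl mult_right_mono[OF t01, of ?d] by linarith
  also have "... <= 7 * R"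
  proof -
   have "x / 2 + 3 / 2 * R + 1 / 20 * x <= 7 * R" if "x <= 10 * R" for x
    using that by linarith
   from this[OF d] show ?thesis .
  qed
  also have "... <= 10 * sqrt (len (Suc q) * L)"
  proof -
   have "len q * L = 2 * (len (Suc q) * L)" by simp
   then have e: "R = sqrt 2 * sqrt (len (Suc q) * L)" unfolding R_def by (simp only: real_sqrt_mult)
   have s2: "sqrt 2 <= (10 / 7 :: real)" by (rule real_le_lsqrt) (auto simp: power2_eq_square)
   have "sqrt 2 * sqrt (len (Suc q) * L) <= 10 / 7 * sqrt (len (Suc q) * L)"
    using n L by (intro mult_right_mono s2) auto
   then show ?thesis unfolding e by simp
  qed
  finally have dev: "\<bar>\<mu> (Suc q) b - len (Suc q)\<bar> <= 10 * sqrt (len (Suc q) * L)" .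
  show ?thesis
  proof (cases "len (Suc q) >= 900 * L")
   case False
   have "len (Suc q) * L <= (900 * L) * L" using False L by (intro mult_right_mono) linarith+
   also have "... = (30 * L) * (30 * L)" by simp
   finally have lL: "len (Suc q) * L <= (30 * L) * (30 * L)" .
   have "sqrt (len (Suc q) * L) <= 30 * L"
   proof (rule real_le_lsqrt)
    show "len (Suc q) * L <= (30 * L)\<^sup>2" using lL unfolding power2_eq_square .
   qed (use L in simp)
   then have "\<mu> (Suc q) b <= 1200 * L" using dev False by linarith
   then show ?thesis using False by simp
  qed (use dev in simp)
 next
  case False
  then have f2: "\<not> len (Suc q) >= 900 * L" using len_pos[of q] by simp
  have "\<mu> (Suc q) b <= \<mu> q (b div 2)" by (rule child_mass(1)[OF q])
  also have "... <= 1200 * L" using IH False by simp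
  finally show ?thesis using f2 by simp
 qed
qed

text \<open>
  The displacement of the midpoint caused by a split is mass times centred fraction. If the expected mass is large,
  it equals the bridge displacement up to the coupling error and the product of two deviations of order \<open>sqrt
  L\<close>; for small cells both displacements are of order \<open>L\<close>.
\<close>
lemma node_error:
 assumes q: "q < k" and b: "b < 2 ^ q"
 shows "\<bar>\<mu> q b * tt q b - sqrt (len q) / 2 * \<eta> q b\<bar> <= 603 * L"
proof -
 have "\<bar>(\<mu> q b - len q) * tt q b\<bar> <= 600 * L"
 proof (cases "len q >= 900 * L")
  case True
  then have "\<bar>\<mu> q b - len q\<bar> <= 10 * sqrt (len q * L)" using mass_deviation[of q b] q b by simp
  then have "\<bar>(\<mu> q b - len q) * tt q b\<bar> <= 10 * sqrt (len q * L) * \<bar>tt q b\<bar>"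
   unfolding abs_mult by (rule mult_right_mono) simp
  also have "... = 10 * sqrt L * (\<bar>tt q b\<bar> * sqrt (len q))" by (simp only: real_sqrt_mult mult_ac)
  also have "... <= 10 * sqrt L * (3 / 2 * sqrt L)"
   using L by (intro mult_left_mono tt_bounds(2)[OF q b]) auto
  also have "... = 15 * L" using L by simp
  finally show ?thesis using L by simp
 next
  case False
  then have "\<mu> q b <= 1200 * L" using mass_deviation[of q b] q b by simp
  moreover have "\<mu> q b > 0" using frac_pos[of q b] q n by simp
  ultimately have "\<bar>\<mu> q b - len q\<bar> <= 1200 * L" using False len_pos[of q] by linarith
  then have "\<bar>\<mu> q b - len q\<bar> * \<bar>tt q b\<bar> <= (1200 * L) * (1 / 2)"
   using L by (intro mult_mono tt_bounds(1)[OF q b]) auto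
  then show ?thesis by (simp add: abs_mult)
 qed
 moreover have "\<mu> q b * tt q b - sqrt (len q) / 2 * \<eta> q b =
   (len q * tt q b - sqrt (len q) / 2 * \<eta> q b) + (\<mu> q b - len q) * tt q b"
  by (simp only: left_diff_distrib)
 ultimately have "\<bar>\<mu> q b * tt q b - sqrt (len q) / 2 * \<eta> q b\<bar> <=
   \<bar>len q * tt q b - sqrt (len q) / 2 * \<eta> q b\<bar> + \<bar>(\<mu> q b - len q) * tt q b\<bar>"
  by (simp only: abs_triangle_ineq)
 also have "... <= 5 / 2 * L + 600 * L"
  by (intro add_mono tt_bounds(3)[OF q b]) fact
 also have "... <= 603 * L" using L by simp
 finally show ?thesis .
qed

text \<open>
  Midpoints average the errors of their two neighbours and add one node error, hence linear growth in the level.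
\<close>
lemma tree_cdf_error:
 assumes "q <= k" "b <= 2 ^ q"
 shows "\<bar>n * tree_cdf n \<eta> q b - n * b / 2 ^ q - sqrt n * dyadic_bridge \<eta> q b\<bar> <= 603 * L * q"
 using assms
proof (induction q arbitrary: b)
 case 0
 then have "b = 0 \<or> b = 1" by auto
 then show ?case by (auto simp: tree_cdf_def)
next
 case (Suc q)
 have q: "q < k" using Suc.prems by simp
 let ?e = "\<lambda>q b. n * tree_cdf n \<eta> q b - n * real b / 2 ^ q - sqrt n * dyadic_bridge \<eta> q b"
 show ?case
 proof (cases "even b")
  case True
  then obtain c where c: "b = 2 * c" by auto
  have "?e (Suc q) b = ?e q c" unfolding c tree_cdf_even by simp
  moreover have "\<bar>?e q c\<bar> <= 603 * L * q" using Suc c by auto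
  ultimately have "\<bar>?e (Suc q) b\<bar> <= 603 * L * q" by (simp only:)
  also have "... <= 603 * L * Suc q" using L by (intro mult_left_mono) auto
  finally show ?thesis .
 next
  case False
  then obtain c where c: "b = 2 * c + 1" by (auto elim: oddE)
  have c2: "c < 2 ^ q" using Suc.prems(2) unfolding c by simp
  have e1: "\<bar>?e q c\<bar> <= 603 * L * q" "\<bar>?e q (c + 1)\<bar> <= 603 * L * q"
   using Suc.IH[of c] Suc.IH[of "c + 1"] q c2 by auto
  have cdf1: "tree_cdf n \<eta> q (c + 1) = tree_cdf n \<eta> q c + tree_frac n \<eta> q c" by (simp add: tree_cdf_def)
  have sq: "sqrt n * (\<eta> q c / (2 * sqrt (2 ^ q))) = sqrt (len q) / 2 * \<eta> q c"
   by (simp add: real_sqrt_divide)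
  have "?e (Suc q) b = (?e q c + ?e q (c + 1)) / 2 + (\<mu> q c * tt q c - sqrt n * (\<eta> q c / (2 * sqrt (2 ^ q))))"
  proof -
   have "tree_cdf n \<eta> (Suc q) b = tree_cdf n \<eta> q c + tree_frac n \<eta> q c * (tt q c + 1 / 2)"
    unfolding c tree_cdf_odd by simp
   moreover have "dyadic_bridge \<eta> (Suc q) b = (dyadic_bridge \<eta> q c + dyadic_bridge \<eta> q (c + 1)) / 2 + \<eta> q c / (2 * sqrt (2 ^ q))"
    unfolding c by simp
   moreover have "n * real b / 2 ^ Suc q = (n * real c / 2 ^ q + n * real (c + 1) / 2 ^ q) / 2"
    unfolding c by (simp add: field_simps)
   moreover have "n * (P + F * (t + 1 / 2)) - (x1 + x2) / 2 - s * ((D1 + D2) / 2 + e) =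
     (n * P - x1 - s * D1 + (n * (P + F) - x2 - s * D2)) / 2 + (n * F * t - s * e)"
    for P F t x1 x2 s D1 D2 e :: real
    by (simp add: field_simps)
   ultimately show ?thesis unfolding cdf1 by (simp only:)
  qed
  then have "?e (Suc q) b = (?e q c + ?e q (c + 1)) / 2 + (\<mu> q c * tt q c - sqrt (len q) / 2 * \<eta> q c)"
   unfolding sq .
  note e_rec = this
  have "\<bar>?e (Suc q) b\<bar> <= (\<bar>?e q c\<bar> + \<bar>?e q (c + 1)\<bar>) / 2 + \<bar>\<mu> q c * tt q c - sqrt (len q) / 2 * \<eta> q c\<bar>"
  proof -
   have "\<bar>w\<bar> <= (\<bar>x\<bar> + \<bar>y\<bar>) / 2 + \<bar>z\<bar>" if "w = (x + y) / 2 + z" for w :: real and x :: real and y :: real and z :: real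
   proof -
    have "\<bar>w\<bar> <= \<bar>(x + y) / 2\<bar> + \<bar>z\<bar>" unfolding that by (rule abs_triangle_ineq)
    also have "\<bar>(x + y) / 2\<bar> = \<bar>x + y\<bar> / 2" by simp
    also have "\<bar>x + y\<bar> / 2 + \<bar>z\<bar> <= (\<bar>x\<bar> + \<bar>y\<bar>) / 2 + \<bar>z\<bar>"
     by (intro add_right_mono divide_right_mono abs_triangle_ineq) simp
    finally show ?thesis .
   qed
   from this[OF e_rec] show ?thesis .
  qed
  also have "... <= (603 * L * q + 603 * L * q) / 2 + 603 * L"
   by (intro add_mono divide_right_mono e1 node_error[OF q c2]) auto
  also have "... = 603 * L * Suc q" by (simp add: algebra_simps)
  finally show ?thesis .
 qed
qed

end

section \<open>Exponential weights built from a dyadic tree\<close>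

text \<open>
  Functions of disjoint blocks of an independent family are independent; the pointwise hypotheses spare the
  factorisation through restrictions.
\<close>
lemma (in prob_space) indep_var_of_disjoint_blocks:
 assumes ind: "indep_vars M' W I" and AB: "A \<inter> B = {}" "A \<subseteq> I" "B \<subseteq> I"
  and f: "f \<in> measurable (PiM A M') N" and g: "g \<in> measurable (PiM B M') N'"
  and X: "\<And>wo. wo \<in> space M ==> X wo = f (\<lambda>i\<in>A. W i wo)" and Y: "\<And>wo. wo \<in> space M ==> Y wo = g (\<lambda>i\<in>B. W i wo)"
 shows "indep_var N X N' Y"
proof -
 have "indep_var N (f \<circ> (\<lambda>wo. \<lambda>i\<in>A. W i wo)) N' (g \<circ> (\<lambda>wo. \<lambda>i\<in>B. W i wo))"
  by (rule indep_var_compose[OF indep_var_restrict[OF ind AB] f g])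
 then have "indep_set (sigma_sets (space M) {(f \<circ> (\<lambda>wo. \<lambda>i\<in>A. W i wo)) -` S \<inter> space M |S. S \<in> sets N})
  (sigma_sets (space M) {(g \<circ> (\<lambda>wo. \<lambda>i\<in>B. W i wo)) -` S \<inter> space M |S. S \<in> sets N'})"
  and m: "f \<circ> (\<lambda>wo. \<lambda>i\<in>A. W i wo) \<in> measurable M N" "g \<circ> (\<lambda>wo. \<lambda>i\<in>B. W i wo) \<in> measurable M N'"
  by (auto simp: indep_var_eq)
 moreover have "{(f \<circ> (\<lambda>wo. \<lambda>i\<in>A. W i wo)) -` S \<inter> space M |S. S \<in> sets N} = {X -` S \<inter> space M |S. S \<in> sets N}"
  by (intro Collect_cong ex_cong1 conj_cong refl) (auto simp: X)
 moreover have "{(g \<circ> (\<lambda>wo. \<lambda>i\<in>B. W i wo)) -` S \<inter> space M |S. S \<in> sets N'} = {Y -` S \<inter> space M |S. S \<in> sets N'}"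
  by (intro Collect_cong ex_cong1 conj_cong refl) (auto simp: Y)
 moreover have "X \<in> measurable M N" using m(1) by (rule measurable_cong[THEN iffD1, rotated]) (simp add: X)
 moreover have "Y \<in> measurable M N'" using m(2) by (rule measurable_cong[THEN iffD1, rotated]) (simp add: Y)
 ultimately show ?thesis by (simp add: indep_var_eq)
qed

lemma (in prob_space) distr_block_eq_PiM:
 fixes W :: "'i => 'a => real" and r :: "'j => 'i"
 assumes ind: "indep_vars (\<lambda>_. borel) W I" and J: "J \<noteq> {}" "inj_on r J" "r ` J \<subseteq> I"
 shows "distr M (PiM J (\<lambda>_. borel)) (\<lambda>wo. \<lambda>j\<in>J. W (r j) wo) = PiM J (\<lambda>j. distr M borel (W (r j)))"
proof -
 have "indep_vars (\<lambda>_. borel) W (r ` J)" by (rule indep_vars_subset[OF ind J(3)])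
 moreover have W: "W i \<in> borel_measurable M" if "i \<in> r ` J" for i
  using ind J that by (auto simp: indep_vars_def)
 ultimately have eq: "distr M (PiM (r ` J) (\<lambda>_. borel)) (\<lambda>wo. \<lambda>i\<in>r ` J. W i wo) = PiM (r ` J) (\<lambda>i. distr M borel (W i))"
  using J(1) by (subst (asm) indep_vars_iff_distr_eq_PiM') auto
 have sub: "(\<lambda>w. \<lambda>j\<in>J. w (r j)) \<in> measurable (PiM (r ` J) (\<lambda>_. borel)) (PiM J (\<lambda>_. borel :: real measure))"
  by (intro measurable_restrict measurable_component_singleton) auto
 have "distr M (PiM J (\<lambda>_. borel)) (\<lambda>wo. \<lambda>j\<in>J. W (r j) wo) =
  distr (distr M (PiM (r ` J) (\<lambda>_. borel)) (\<lambda>wo. \<lambda>i\<in>r ` J. W i wo)) (PiM J (\<lambda>_. borel)) (\<lambda>w. \<lambda>j\<in>J. w (r j))"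
  by (subst distr_distr[OF sub measurable_restrict[OF W]])
    (auto intro!: distr_cong simp: comp_def fun_eq_iff)
 also have "... = distr (PiM (r ` J) (\<lambda>i. distr M borel (W i))) (PiM J (\<lambda>j. distr M borel (W (r j)))) (\<lambda>w. \<lambda>j\<in>J. w (r j))"
  unfolding eq by (intro distr_cong sets_PiM_cong) auto
 also have "... = PiM J (\<lambda>j. distr M borel (W (r j)))"
  using J W by (intro distr_PiM_reindex prob_space_distr) auto
 finally show ?thesis .
qed

text \<open>
  One index for the total mass, one for each inner node, and one for the split of each of the
  \<open>2\<^sup>k\<close> leaves at an integer.
\<close>
definition tree_index :: "nat => (nat \<times> nat) set" where
 "tree_index k = {(0, 0)} \<union> {(Suc q, b) |q b. q < k \<and> b < 2 ^ q} \<union> {(Suc k, b) |b. b < 2 ^ k}"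

definition cell_width :: "nat => nat => real" where "cell_width n k = real n / 2 ^ k"

definition cell_floor :: "nat => nat => nat => nat" where
 "cell_floor n k b = nat \<lfloor>real b * cell_width n k\<rfloor>"

text \<open>
  Length of the part of cell \<open>[b c, (b + 1) c]\<close> before the first integer after \<open>b c\<close>, or
  of the whole cell if there is none inside. As cells have width at most 1, each cell meets at most two unit
  intervals.
\<close>
definition left_len :: "nat => nat => nat => real" where
 "left_len n k b = min (cell_width n k) (real (cell_floor n k b + 1) - real b * cell_width n k)"

text \<open>
  The conditions on \<open>k\<close> say that the cells of width \<open>n / 2\<^sup>k\<close> are at most as long as
  the unit intervals, but at least half as long.
\<close>
locale gamma_tree = prob_space M for M :: "'w measure" +
 fixes W :: "nat \<times> nat => 'w => real" and n k :: nat
 assumes n: "n > 0" and k: "real n <= 2 ^ k" "2 ^ k <= 2 * real n"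
  and indep: "indep_vars (\<lambda>_. borel) W (tree_index k)"
  and law_root: "distr M borel (W (0, 0)) = gamma_law (real n)"
  and law_node: "\<And>q b. q < k ==> b < 2 ^ q ==> distr M borel (W (Suc q, b)) = std_normal_distribution"
  and law_leaf: "\<And>b. b < 2 ^ k ==> distr M borel (W (Suc k, b)) =
   beta_law (left_len n k b) (cell_width n k - left_len n k b)"
begin

definition node_noise :: "'w => nat => nat => real" where "node_noise wo q b = W (Suc q, b) wo"

definition cell_mass :: "nat => 'w => nat => real" where
 "cell_mass q wo b = W (0, 0) wo * tree_frac (real n) (node_noise wo) q b"

lemma W_measurable: "i \<in> tree_index k ==> W i \<in> borel_measurable M"
 using indep by (auto simp: indep_vars_def)

definition low_index :: "nat => (nat \<times> nat) set" where "low_index q = {i \<in> tree_index k. fst i <= q}"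

lemma low_index_mem: "q <= k ==> q' < q ==> b < 2 ^ q' ==> (Suc q', b) \<in> low_index q" "(0, 0) \<in> low_index q"
 by (auto simp: low_index_def tree_index_def)

lemma half_le: "q < k ==> 1 / 2 <= real n / 2 ^ Suc q"
proof -
 assume "q < k"
 then have "(2::real) ^ Suc q <= 2 ^ k" by (intro power_increasing) auto
 also have "... <= 2 * real n" by (rule k)
 finally show ?thesis by (simp add: field_simps)
qed

lemma tree_frac_measurable:
 assumes "q <= k" "b < 2 ^ q"
 shows "(\<lambda>w. tree_frac (real n) (\<lambda>q b. w (Suc q, b)) q b) \<in> borel_measurable (PiM (low_index q) (\<lambda>_. borel))"
 using assms
proof (induction q arbitrary: b)
 case (Suc q)
 have q: "q < k" and b2: "b div 2 < 2 ^ q" using Suc.prems by auto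
 have sub: "low_index q \<subseteq> low_index (Suc q)" by (auto simp: low_index_def)
 have "(\<lambda>w. (\<lambda>w. tree_frac (real n) (\<lambda>q b. w (Suc q, b)) q (b div 2)) (restrict w (low_index q)))
   \<in> borel_measurable (PiM (low_index (Suc q)) (\<lambda>_. borel))"
  using q b2 sub by (intro measurable_compose[OF measurable_restrict_subset Suc.IH]) auto
 moreover have "tree_frac (real n) (\<lambda>q b. restrict w (low_index q0) (Suc q, b)) q' b' =
   tree_frac (real n) (\<lambda>q b. w (Suc q, b)) q' b'" if "q' <= q0" "b' < 2 ^ q'" "q0 <= k" for q0 q' b' and w :: "nat \<times> nat => real"
  using that
 proof (induction q' arbitrary: b')
  case (Suc q')
  then have "b' div 2 < 2 ^ q'" by auto
  moreover have "restrict w (low_index q0) (Suc q', b' div 2) = w (Suc q', b' div 2)"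
   using Suc low_index_mem(1)[of q0 q' "b' div 2"] by simp
  ultimately show ?case using Suc by simp
 qed simp
 ultimately have m1: "(\<lambda>w. tree_frac (real n) (\<lambda>q b. w (Suc q, b)) q (b div 2))
   \<in> borel_measurable (PiM (low_index (Suc q)) (\<lambda>_. borel))"
  using q b2 by simp
 have m2: "(\<lambda>w. beta_of_normal (real n / 2 ^ Suc q) (w (Suc q, b div 2))) \<in> borel_measurable (PiM (low_index (Suc q)) (\<lambda>_. borel))"
  using low_index_mem(1)[of "Suc q" q "b div 2"] q b2 Suc.prems
  by (intro measurable_compose[OF measurable_component_singleton[of "(Suc q, b div 2)" "low_index (Suc q)" "\<lambda>_. borel"]
     beta_of_normal_measurable[OF half_le[OF q]]]) auto
 show ?case
  unfolding tree_frac.simps using m1 m2 by (cases "even b") (auto intro!: borel_measurable_times borel_measurable_diff)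
qed simp

lemma tree_frac_restrict:
 "q <= k ==> b < 2 ^ q ==> tree_frac (real n) (\<lambda>q' b. (\<lambda>i\<in>low_index q. W i wo) (Suc q', b)) q b =
  tree_frac (real n) (node_noise wo) q b"
proof -
 have "tree_frac (real n) (\<lambda>q b. (\<lambda>i\<in>low_index q0. W i wo) (Suc q, b)) q' b' = tree_frac (real n) (node_noise wo) q' b'"
  if "q' <= q0" "b' < 2 ^ q'" "q0 <= k" for q0 q' b'
  using that
 proof (induction q' arbitrary: b')
  case (Suc q')
  then have "b' div 2 < 2 ^ q'" by auto
  moreover have "(\<lambda>i\<in>low_index q0. W i wo) (Suc q', b' div 2) = node_noise wo q' (b' div 2)"
   using Suc low_index_mem(1)[of q0 q' "b' div 2"] by (simp add: node_noise_def)
  ultimately show ?case using Suc by simp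
 qed simp
 then show "q <= k ==> b < 2 ^ q ==> ?thesis" by simp
qed

lemma indep_cells_level:
 assumes q: "q <= k"
 shows "indep_var (PiM {..<2 ^ q} (\<lambda>_. borel)) (\<lambda>wo. \<lambda>b\<in>{..<2 ^ q}. cell_mass q wo b)
   (PiM {..<2 ^ q} (\<lambda>_. borel)) (\<lambda>wo. \<lambda>b\<in>{..<2 ^ q}. W (Suc q, b) wo)"
proof (rule indep_var_of_disjoint_blocks[OF indep])
 let ?B = "{(Suc q, b) |b. b < 2 ^ q}"
 let ?f = "\<lambda>w. \<lambda>b\<in>{..<2 ^ q}. w (0, 0) * tree_frac (real n) (\<lambda>q b. w (Suc q, b)) q b"
 show "low_index q \<inter> ?B = {}" by (auto simp: low_index_def)
 show "low_index q \<subseteq> tree_index k" by (auto simp: low_index_def)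
 show "?B \<subseteq> tree_index k" using q by (cases "q = k") (auto simp: tree_index_def)
 show "?f \<in> measurable (PiM (low_index q) (\<lambda>_. borel)) (PiM {..<2 ^ q} (\<lambda>_. borel))"
  using q low_index_mem(2)[of q]
  by (intro measurable_restrict borel_measurable_times tree_frac_measurable measurable_component_singleton) auto
 show "(\<lambda>w. \<lambda>b\<in>{..<2 ^ q}. w (Suc q, b)) \<in> measurable (PiM ?B (\<lambda>_. borel)) (PiM {..<2 ^ q} (\<lambda>_. borel))"
  by (intro measurable_restrict measurable_component_singleton) auto
 show "(\<lambda>b\<in>{..<2 ^ q}. cell_mass q wo b) = ?f (\<lambda>i\<in>low_index q. W i wo)" for wo
 proof (rule restrict_ext)
  fix b :: nat assume "b \<in> {..<2 ^ q}"
  then have "tree_frac (real n) (\<lambda>q' b. (\<lambda>i\<in>low_index q. W i wo) (Suc q', b)) q b = tree_frac (real n) (node_noise wo) q b"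
   using q by (intro tree_frac_restrict) auto
  moreover have "(\<lambda>i\<in>low_index q. W i wo) (0, 0) = W (0, 0) wo"
   using low_index_mem(2)[of q] by simp
  ultimately show "cell_mass q wo b = (\<lambda>i\<in>low_index q. W i wo) (0, 0) *
    tree_frac (real n) (\<lambda>q' b. (\<lambda>i\<in>low_index q. W i wo) (Suc q', b)) q b"
   by (simp only: cell_mass_def)
 qed
qed auto

lemma distr_level_noise:
 assumes q: "q <= k"
 shows "distr M (PiM {..<2 ^ q} (\<lambda>_. borel)) (\<lambda>wo. \<lambda>b\<in>{..<2 ^ q}. W (Suc q, b) wo) =
  PiM {..<2 ^ q} (\<lambda>b. distr M borel (W (Suc q, b)))"
 using q by (intro distr_block_eq_PiM[OF indep]) (auto simp: tree_index_def inj_on_def lessThan_empty_iff)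

lemma distr_cell_mass:
 assumes q: "q <= k"
 shows "distr M (PiM {..<2 ^ q} (\<lambda>_. borel)) (\<lambda>wo. \<lambda>b\<in>{..<2 ^ q}. cell_mass q wo b) =
  PiM {..<2 ^ q} (\<lambda>b. gamma_law (real n / 2 ^ q))"
 using q
proof (induction q)
 case 0
 have "distr M (PiM {..<1} (\<lambda>_. borel)) (\<lambda>wo. \<lambda>b\<in>{..<1::nat}. W ((\<lambda>b. (0, b)) b) wo) =
   PiM {..<1} (\<lambda>b. distr M borel (W (0, b)))"
  by (intro distr_block_eq_PiM[OF indep]) (auto simp: tree_index_def inj_on_def)
 also have "... = PiM {..<1} (\<lambda>b. gamma_law (real n))"
  using law_root by (intro PiM_cong) auto
 also have "(\<lambda>wo. \<lambda>b\<in>{..<1::nat}. W ((\<lambda>b. (0, b)) b) wo) = (\<lambda>wo. \<lambda>b\<in>{..<1}. cell_mass 0 wo b)"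
  by (auto simp: cell_mass_def fun_eq_iff)
 finally show ?case by simp
next
 case (Suc q)
 then have q: "q < k" by simp
 let ?m = "real n / 2 ^ Suc q"
 let ?s = "\<lambda>b::nat. beta_of_normal ?m"
 have m: "?m >= 1 / 2" by (rule half_le[OF q])
 have mm: "?m + ?m = real n / 2 ^ q" by simp
 have "distr M (PiM {..<2 * 2 ^ q} (\<lambda>_. borel))
   (\<lambda>wo. \<lambda>i\<in>{..<2 * 2 ^ q}. split_vec ?s (\<lambda>b\<in>{..<2 ^ q}. cell_mass q wo b) (\<lambda>b\<in>{..<2 ^ q}. W (Suc q, b) wo) i) =
  PiM {..<2 * 2 ^ q} (\<lambda>i. gamma_law (if even i then ?m else ?m))"
 proof (rule distr_split_gamma_family[where H = "\<lambda>_. std_normal_distribution"])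
  show "indep_var (PiM {..<2 ^ q} (\<lambda>_. borel)) (\<lambda>wo. \<lambda>b\<in>{..<2 ^ q}. cell_mass q wo b)
   (PiM {..<2 ^ q} (\<lambda>_. borel)) (\<lambda>wo. \<lambda>b\<in>{..<2 ^ q}. W (Suc q, b) wo)"
   using q by (intro indep_cells_level) auto
  show "distr M (PiM {..<2 ^ q} (\<lambda>_. borel)) (\<lambda>wo. \<lambda>b\<in>{..<2 ^ q}. cell_mass q wo b) =
   PiM {..<2 ^ q} (\<lambda>b. gamma_law (?m + ?m))"
   unfolding mm by (rule Suc.IH[OF less_imp_le[OF q]])
  show "distr M (PiM {..<2 ^ q} (\<lambda>_. borel)) (\<lambda>wo. \<lambda>b\<in>{..<2 ^ q}. W (Suc q, b) wo) =
   PiM {..<2 ^ q} (\<lambda>_. std_normal_distribution)"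
   using q law_node by (subst distr_level_noise) (auto intro!: PiM_cong)
  show "prob_space std_normal_distribution" by (rule prob_space_normal_density) simp
  show "beta_of_normal ?m \<in> borel_measurable borel" by (rule beta_of_normal_measurable[OF m])
  show "distr std_normal_distribution borel (beta_of_normal ?m) = beta_law ?m ?m" by (rule distr_beta_of_normal[OF m])
 qed (use n in auto)
 also have "(\<lambda>wo. \<lambda>i\<in>{..<2 * 2 ^ q}. split_vec ?s (\<lambda>b\<in>{..<2 ^ q}. cell_mass q wo b) (\<lambda>b\<in>{..<2 ^ q}. W (Suc q, b) wo) i) =
  (\<lambda>wo. \<lambda>i\<in>{..<2 ^ Suc q}. cell_mass (Suc q) wo i)"
  by (auto simp: fun_eq_iff split_vec_def cell_mass_def node_noise_def)
 finally show ?case by simp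
qed

end

lemma sum_lessThan_double:
 "(\<Sum>i<2 * N. f i) = (\<Sum>b<N. f (2 * b) + f (2 * b + 1))" for f :: "nat => 'a :: comm_monoid_add"
 by (induction N) (simp_all add: add_ac)

lemma tree_cdf_total: "tree_cdf n \<eta> q (2 ^ q) = 1"
proof (induction q)
 case (Suc q)
 then show ?case using tree_cdf_even[of n \<eta> q "2 ^ q"] by simp
qed (simp add: tree_cdf_def)

context gamma_tree begin

abbreviation c :: real where "c \<equiv> cell_width n k"
abbreviation fl :: "nat => nat" where "fl \<equiv> cell_floor n k"
abbreviation leaf :: "'w => nat => real" where "leaf w b \<equiv> W (Suc k, b) w"

lemma c_bounds: "c > 0" "c <= 1" "1 / 2 <= c"
 using n k by (auto simp: cell_width_def field_simps)

lemma fl_bounds: "real (fl b) <= b * c" "b * c < real (fl b) + 1"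
 using c_bounds unfolding cell_floor_def by (auto simp: le_nat_iff of_nat_nat)

lemma fl_less_iff: "fl b < j \<longleftrightarrow> b * c < real j"
proof
 assume "fl b < j"
 then have "real (fl b) + 1 <= real j" by simp
 then show "b * c < real j" using fl_bounds(2)[of b] by simp
next
 assume "b * c < real j"
 then have "real (fl b) < real j" using fl_bounds(1)[of b] by simp
 then show "fl b < j" by simp
qed

lemma N_c: "2 ^ k * c = real n" by (simp add: cell_width_def)

lemma left_len_bounds: "left_len n k b > 0" "left_len n k b <= c"
 using fl_bounds(2)[of b] c_bounds by (auto simp: left_len_def)

definition piece_len :: "nat => real" where
 "piece_len i = (if even i then left_len n k (i div 2) else c - left_len n k (i div 2))"

definition piece_pos :: "nat => nat" where
 "piece_pos i = (if even i then fl (i div 2) else fl (i div 2) + 1)"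

definition piece :: "'w => nat => real" where
 "piece w i = cell_mass k w (i div 2) * (if even i then leaf w (i div 2) else 1 - leaf w (i div 2))"

text \<open>
  The split leaves: independent gamma masses whose shapes are the lengths of the pieces.
\<close>
lemma distr_piece:
 "distr M (PiM {..<2 * 2 ^ k} (\<lambda>_. borel)) (\<lambda>w. \<lambda>i\<in>{..<2 * 2 ^ k}. piece w i) =
  PiM {..<2 * 2 ^ k} (\<lambda>i. gamma_law (piece_len i))"
proof -
 let ?H = "\<lambda>b. beta_law (left_len n k b) (c - left_len n k b)"
 have "distr M (PiM {..<2 * 2 ^ k} (\<lambda>_. borel))
   (\<lambda>w. \<lambda>i\<in>{..<2 * 2 ^ k}. split_vec (\<lambda>b z. z) (\<lambda>b\<in>{..<2 ^ k}. cell_mass k w b) (\<lambda>b\<in>{..<2 ^ k}. W (Suc k, b) w) i) =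
  PiM {..<2 * 2 ^ k} (\<lambda>i. gamma_law (if even i then left_len n k (i div 2) else c - left_len n k (i div 2)))"
 proof (rule distr_split_gamma_family[where H = ?H])
  show "indep_var (PiM {..<2 ^ k} (\<lambda>_. borel)) (\<lambda>w. \<lambda>b\<in>{..<2 ^ k}. cell_mass k w b)
   (PiM {..<2 ^ k} (\<lambda>_. borel)) (\<lambda>w. \<lambda>b\<in>{..<2 ^ k}. W (Suc k, b) w)"
   by (intro indep_cells_level) auto
  have "distr M (PiM {..<2 ^ k} (\<lambda>_. borel)) (\<lambda>w. \<lambda>b\<in>{..<2 ^ k}. cell_mass k w b) = PiM {..<2 ^ k} (\<lambda>b. gamma_law (real n / 2 ^ k))"
   by (rule distr_cell_mass) simp
  then show "distr M (PiM {..<2 ^ k} (\<lambda>_. borel)) (\<lambda>w. \<lambda>b\<in>{..<2 ^ k}. cell_mass k w b) =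
   PiM {..<2 ^ k} (\<lambda>b. gamma_law (left_len n k b + (c - left_len n k b)))"
   by (simp only: add_diff_cancel_left' add_diff_eq cell_width_def)
  show "distr M (PiM {..<2 ^ k} (\<lambda>_. borel)) (\<lambda>w. \<lambda>b\<in>{..<2 ^ k}. W (Suc k, b) w) = PiM {..<2 ^ k} ?H"
   using law_leaf by (subst distr_level_noise) (auto intro!: PiM_cong)
  show "prob_space (?H b)" for b using left_len_bounds[of b] by (intro prob_space_beta_law) auto
  show "distr (?H b) borel (\<lambda>z. z) = ?H b" for b by (rule distr_id2) simp
 qed (use left_len_bounds in auto)
 also have "(\<lambda>w. \<lambda>i\<in>{..<2 * 2 ^ k}. split_vec (\<lambda>b z. z) (\<lambda>b\<in>{..<2 ^ k}. cell_mass k w b) (\<lambda>b\<in>{..<2 ^ k}. W (Suc k, b) w) i) =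
   (\<lambda>w. \<lambda>i\<in>{..<2 * 2 ^ k}. piece w i)"
  by (auto simp: fun_eq_iff split_vec_def piece_def)
 finally show ?thesis by (simp only: piece_len_def)
qed

text \<open>
  The pieces inside the unit interval \<open>[j, j + 1]\<close> are collected.
\<close>
definition weight :: "'w => nat => real" where
 "weight w j = (\<Sum>i\<in>{i\<in>{..<2 * 2 ^ k}. piece_pos i = j}. piece w i)"

definition weight_sum :: "'w => nat => real" where
 "weight_sum w j = (\<Sum>j'<j. weight w j')"

lemma sum_by_position:
 fixes x :: "nat => real"
 shows "(\<Sum>j'<j. \<Sum>i\<in>{i\<in>{..<2 * 2 ^ k}. piece_pos i = j'}. x i) =
  (\<Sum>b<2 ^ k. (if fl b < j then x (2 * b) else 0) + (if fl b + 1 < j then x (2 * b + 1) else 0))"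
proof -
 have "(\<Sum>j'<j. \<Sum>i\<in>{i\<in>{..<2 * 2 ^ k}. piece_pos i = j'}. x i) = (\<Sum>i\<in>{i\<in>{..<2 * 2 ^ k}. piece_pos i < j}. x i)"
  by (subst sum.group[symmetric, where g = piece_pos and T = "{..<j}"]) (auto intro!: sum.cong)
 also have "... = (\<Sum>i<2 * 2 ^ k. if piece_pos i < j then x i else 0)"
  by (simp add: sum.inter_filter[symmetric])
 also have "... = (\<Sum>b<2 ^ k. (if fl b < j then x (2 * b) else 0) + (if fl b + 1 < j then x (2 * b + 1) else 0))"
  unfolding sum_lessThan_double by (simp add: piece_pos_def)
 finally show ?thesis .
qed

lemma piece_len_cumulative:
 assumes "j <= n"
 shows "(\<Sum>j'<j. \<Sum>i\<in>{i\<in>{..<2 * 2 ^ k}. piece_pos i = j'}. piece_len i) = real j"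
proof -
 have "(if fl b < j then piece_len (2 * b) else 0) + (if fl b + 1 < j then piece_len (2 * b + 1) else 0) =
   min (real j) (real (Suc b) * c) - min (real j) (real b * c)" for b
 proof (cases "fl b < j")
  case False
  then have "real j <= real b * c" using fl_less_iff[of b j] by simp
  moreover have "real (Suc b) * c >= real b * c" using c_bounds by (simp add: algebra_simps)
  ultimately show ?thesis using False by simp
 next
  case True
  then have bj: "real b * c < real j" using fl_less_iff by simp
  have Sb: "real (Suc b) * c = real b * c + c" by (simp add: algebra_simps)
  show ?thesis
  proof (cases "fl b + 1 < j")
   case T: True
   then have "real (fl b) + 2 <= real j" by simp
   then have "real (Suc b) * c <= real j" using fl_bounds(2)[of b] c_bounds Sb by simp
   then show ?thesis using T bj Sb by (simp add: piece_len_def)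
  next
   case F: False
   then have "j = fl b + 1" using True by simp
   then have "left_len n k b = min c (real j - real b * c)" by (simp add: left_len_def)
   then show ?thesis using F True bj Sb by (simp add: piece_len_def min_def)
  qed
 qed
 then have "(\<Sum>j'<j. \<Sum>i\<in>{i\<in>{..<2 * 2 ^ k}. piece_pos i = j'}. piece_len i) =
   (\<Sum>b<2 ^ k. min (real j) (real (Suc b) * c) - min (real j) (real b * c))"
  unfolding sum_by_position by simp
 also have "... = min (real j) (real (2 ^ k) * c) - min (real j) (real 0 * c)"
  by (rule sum_lessThan_telescope)
 also have "... = real j" using assms N_c by simp
 finally show ?thesis .
qed

lemma piece_len_at: "j < n ==> (\<Sum>i\<in>{i\<in>{..<2 * 2 ^ k}. piece_pos i = j}. piece_len i) = 1"
 using piece_len_cumulative[of "Suc j"] piece_len_cumulative[of j] by simp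

lemma piece_pos_le: "i < 2 * 2 ^ k ==> piece_pos i <= n"
proof -
 assume "i < 2 * 2 ^ k"
 then have "i div 2 < 2 ^ k" by auto
 then have "real (i div 2) < real (2 ^ k)" by (subst of_nat_less_iff)
 then have "real (i div 2) * c < 2 ^ k * c"
  using c_bounds by (intro mult_strict_right_mono) (simp_all only: of_nat_power of_nat_numeral)
 then have "fl (i div 2) < n" unfolding N_c by (simp add: fl_less_iff)
 then show ?thesis by (simp add: piece_pos_def)
qed

lemma cell_mass_measurable: "q <= k ==> b < 2 ^ q ==> (\<lambda>w. cell_mass q w b) \<in> borel_measurable M"
proof -
 assume q: "q <= k" and b: "b < 2 ^ q"
 have "indep_var (PiM {..<2 ^ q} (\<lambda>_. borel)) (\<lambda>w. \<lambda>b\<in>{..<2 ^ q}. cell_mass q w b)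
   (PiM {..<2 ^ q} (\<lambda>_. borel)) (\<lambda>w. \<lambda>b\<in>{..<2 ^ q}. W (Suc q, b) w)"
  by (rule indep_cells_level[OF q])
 then have "(\<lambda>w. \<lambda>b\<in>{..<2 ^ q}. cell_mass q w b) \<in> measurable M (PiM {..<2 ^ q} (\<lambda>_. borel))"
  by (rule indep_var_rv1)
 from measurable_compose[OF this measurable_component_singleton[of b]] b
 show ?thesis by simp
qed

lemma piece_measurable: "i < 2 * 2 ^ k ==> (\<lambda>w. piece w i) \<in> borel_measurable M"
 unfolding piece_def
 by (cases "even i") (auto intro!: borel_measurable_times borel_measurable_diff cell_mass_measurable W_measurable simp: tree_index_def)

lemma weight_measurable [measurable]: "(\<lambda>w. weight w j) \<in> borel_measurable M"
 unfolding weight_def by (intro borel_measurable_sum piece_measurable) auto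

text \<open>
  The pieces of a unit interval have total length 1, so aggregation of independent gamma masses gives standard
  exponentials.
\<close>
lemma distr_weight:
 "distr M (PiM {..<n} (\<lambda>_. borel)) (\<lambda>w. \<lambda>j\<in>{..<n}. weight w j) = PiM {..<n} (\<lambda>_. gamma_law 1)"
proof (rule PiM_eqI_product_tests)
 let ?I = "{..<2 * 2 ^ k} :: nat set"
 fix f :: "nat => real => ennreal" assume "\<And>j. f j \<in> borel_measurable (gamma_law 1)"
 then have f: "f j \<in> borel_measurable borel" for j by (simp add: measurable_cong_sets[OF sets_gamma_law refl])
 define f' where "f' j = (if j < n then f j else (\<lambda>_. 1))" for j
 have f'm: "f' j \<in> borel_measurable borel" for j using f by (simp add: f'_def)
 have pm: "(\<lambda>w. \<lambda>i\<in>?I. piece w i) \<in> measurable M (PiM ?I (\<lambda>_. borel))"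
  by (intro measurable_restrict piece_measurable) auto
 have "(\<integral>\<^sup>+x. (\<Prod>j\<in>{..<n}. f j (x j)) \<partial>distr M (PiM {..<n} (\<lambda>_. borel)) (\<lambda>w. \<lambda>j\<in>{..<n}. weight w j)) =
  (\<integral>\<^sup>+w. (\<Prod>j<n. f j (weight w j)) \<partial>M)"
 proof (subst nn_integral_distr)
  show "(\<lambda>x. \<Prod>j\<in>{..<n}. f j (x j)) \<in> borel_measurable (distr M (PiM {..<n} (\<lambda>_. borel)) (\<lambda>w. \<lambda>j\<in>{..<n}. weight w j))"
   by (intro borel_measurable_prod_ennreal measurable_compose[OF _ f]) auto
 qed (auto intro!: nn_integral_cong prod.cong measurable_restrict weight_measurable)
 also have "... = (\<integral>\<^sup>+w. (\<lambda>x. \<Prod>j\<in>{..n}. f' j (\<Sum>i\<in>{i\<in>?I. piece_pos i = j}. x i)) (\<lambda>i\<in>?I. piece w i) \<partial>M)"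
 proof (rule nn_integral_cong)
  fix w
  have "(\<Prod>j\<in>{..n}. f' j (weight w j)) = (\<Prod>j<n. f j (weight w j))"
   by (simp add: f'_def lessThan_Suc_atMost[symmetric])
  moreover have "weight w j = (\<Sum>i\<in>{i\<in>?I. piece_pos i = j}. (\<lambda>i\<in>?I. piece w i) i)" for j
   unfolding weight_def by (intro sum.cong) auto
  ultimately show "(\<Prod>j<n. f j (weight w j)) =
   (\<lambda>x. \<Prod>j\<in>{..n}. f' j (\<Sum>i\<in>{i\<in>?I. piece_pos i = j}. x i)) (\<lambda>i\<in>?I. piece w i)"
   by (simp only:)
 qed
 also have "... = (\<integral>\<^sup>+x. (\<Prod>j\<in>{..n}. f' j (\<Sum>i\<in>{i\<in>?I. piece_pos i = j}. x i)) \<partial>PiM ?I (\<lambda>i. gamma_law (piece_len i)))"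
  unfolding distr_piece[symmetric]
  by (rule nn_integral_distr[OF pm, symmetric])
    (intro borel_measurable_prod_ennreal measurable_compose[OF _ f'm] borel_measurable_sum, auto)
 also have "... = (\<Prod>j\<in>{..n}. \<integral>\<^sup>+y. f' j y \<partial>gamma_law (\<Sum>i\<in>{i\<in>?I. piece_pos i = j}. piece_len i))"
  using piece_pos_le left_len_bounds f'm
  by (intro nn_integral_PiM_gamma_aggregate) (auto simp: piece_len_def less_imp_le)
 also have "... = (\<Prod>j\<in>{..<n}. \<integral>\<^sup>+y. f j y \<partial>gamma_law 1)"
  using piece_len_at prob_space.emeasure_space_1[OF prob_space_gamma_law]
  by (simp add: f'_def lessThan_Suc_atMost[symmetric])
 finally show "(\<integral>\<^sup>+x. (\<Prod>j\<in>{..<n}. f j (x j)) \<partial>distr M (PiM {..<n} (\<lambda>_. borel)) (\<lambda>w. \<lambda>j\<in>{..<n}. weight w j)) =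
  (\<Prod>j\<in>{..<n}. \<integral>\<^sup>+y. f j y \<partial>gamma_law 1)" .
qed (auto simp: prob_space_gamma_law intro!: sets_PiM_cong)

text \<open>
  These hold almost surely. The last clause makes the right piece of an unsplit cell exactly 0; its position could
  be the nonexistent unit interval \<open>n\<close>.
\<close>
definition good_leaves :: "'w => bool" where
 "good_leaves w \<longleftrightarrow> (\<forall>b\<in>{..<2 ^ k}. 0 <= leaf w b \<and> leaf w b <= 1 \<and> (left_len n k b = c --> leaf w b = 1))"

lemma weight_sum_eq:
 "weight_sum w j = (\<Sum>b<2 ^ k. (if fl b < j then cell_mass k w b * leaf w b else 0) +
   (if fl b + 1 < j then cell_mass k w b * (1 - leaf w b) else 0))"
 unfolding weight_sum_def weight_def sum_by_position
 by (intro sum.cong refl arg_cong2[where f = "(+)"]) (simp_all add: piece_def)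

lemma sum_cell_mass: "(\<Sum>b'<b. cell_mass q w b') = W (0, 0) w * tree_cdf (real n) (node_noise w) q b"
 by (simp add: cell_mass_def tree_cdf_def sum_distrib_left)

lemma weight_sum_total:
 assumes g: "good_leaves w"
 shows "weight_sum w n = W (0, 0) w"
proof -
 have "weight_sum w n = (\<Sum>b<2 ^ k. cell_mass k w b)"
  unfolding weight_sum_eq
 proof (rule sum.cong[OF refl])
  fix b :: nat assume b: "b \<in> {..<2 ^ k}"
  have fb: "fl b < n" using piece_pos_le[of "2 * b + 1"] b by (simp add: piece_pos_def)
  show "(if fl b < n then cell_mass k w b * leaf w b else 0) +
    (if fl b + 1 < n then cell_mass k w b * (1 - leaf w b) else 0) = cell_mass k w b"
  proof (cases "fl b + 1 < n")
   case True
   then show ?thesis by (simp add: algebra_simps)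
  next
   case False
   then have n1: "real n = real (fl b) + 1" using fb by simp
   have "real (Suc b) <= real (2 ^ k)" using b by (subst of_nat_le_iff) auto
   then have "real (Suc b) * c <= 2 ^ k * c"
    using c_bounds by (intro mult_right_mono) (simp_all only: of_nat_power of_nat_numeral)
   then have "real b * c + c <= real n" unfolding N_c by (simp add: algebra_simps)
   then have "left_len n k b = c" by (simp add: left_len_def n1)
   then have "leaf w b = 1" using g b by (auto simp: good_leaves_def)
   then show ?thesis using False fb by simp
  qed
 qed
 then show ?thesis unfolding sum_cell_mass by (simp add: tree_cdf_total)
qed

text \<open>
  A partial sum of weights and the partial sum of cells up to the next cell boundary differ by parts of two cells.
\<close>
lemma weight_sum_close:
 assumes g: "good_leaves w" and pos: "\<And>b. b < 2 ^ k ==> 0 <= cell_mass k w b \<and> cell_mass k w b <= m"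
  and b2: "real b2 * c < real j + c" "real j <= real b2 * c" "b2 <= 2 ^ k"
 shows "(\<Sum>b<b2. cell_mass k w b) - 2 * m <= weight_sum w j" "weight_sum w j <= (\<Sum>b<b2. cell_mass k w b)"
proof -
 let ?X = "cell_mass k w"
 let ?s = "\<lambda>b. (if fl b < j then ?X b * leaf w b else 0) + (if fl b + 1 < j then ?X b * (1 - leaf w b) else 0)"
 have m0: "m >= 0" using pos[of 0] by simp
 have zero: "?s b = 0" if "b >= b2" for b
 proof -
  have "real j <= real b2 * c" by fact
  also have "... <= real b * c" using that c_bounds by (intro mult_right_mono) auto
  finally have "\<not> fl b < j" unfolding fl_less_iff by simp
  then show ?thesis by simp
 qed
 have up: "?s b <= ?X b" and low: "0 <= ?s b" if "b < 2 ^ k" for b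
 proof -
  have l: "0 <= leaf w b" "leaf w b <= 1" using g that by (auto simp: good_leaves_def)
  have "?X b * leaf w b <= ?X b" "0 <= ?X b * leaf w b" "0 <= ?X b * (1 - leaf w b)"
   using l pos[OF that] by (auto simp: mult_left_le)
  moreover have "?X b * leaf w b + ?X b * (1 - leaf w b) = ?X b" by (simp add: algebra_simps)
  ultimately show "?s b <= ?X b" "0 <= ?s b" using pos[OF that] by (auto simp del: mult_minus_right)
 qed
 have full: "?s b = ?X b" if "b + 2 < b2" for b
 proof -
  have "real (b + 3) * c <= real b2 * c" using that c_bounds by (intro mult_right_mono) auto
  then have "real b * c + 2 * c < real j" using b2(1) by (simp add: algebra_simps)
  then have "real (fl b) + 1 < real j" using fl_bounds(1)[of b] c_bounds by simp
  then have "fl b + 1 < j" by simp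
  then show ?thesis by (simp add: algebra_simps)
 qed
 have eq: "weight_sum w j = (\<Sum>b<b2. ?s b)"
  unfolding weight_sum_eq
  by (rule sum.mono_neutral_right) (use b2(3) zero in \<open>auto simp: not_less\<close>)
 show "weight_sum w j <= (\<Sum>b<b2. ?X b)"
  unfolding eq using b2(3) by (intro sum_mono up) auto
 have "(\<Sum>b<b2. ?X b) = (\<Sum>b<b2 - 2. ?X b) + (\<Sum>b\<in>{b2 - 2..<b2}. ?X b)"
  by (subst sum.union_disjoint[symmetric]) (auto intro!: sum.cong)
 also have "(\<Sum>b\<in>{b2 - 2..<b2}. ?X b) <= of_nat (card {b2 - 2..<b2}) * m"
  using pos b2(3) by (intro sum_bounded_above) auto
 also have "of_nat (card {b2 - 2..<b2}) * m <= 2 * m" using m0 by (intro mult_right_mono) auto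
 also have "(\<Sum>b<b2 - 2. ?X b) = (\<Sum>b<b2 - 2. ?s b)" using full by (intro sum.cong) auto
 also have "... <= (\<Sum>b<b2. ?s b)" using b2(3) low by (intro sum_mono2) auto
 finally show "(\<Sum>b<b2. ?X b) - 2 * m <= weight_sum w j" unfolding eq by simp
qed

text \<open>
  Combines the tree estimate at the cell boundary \<open>b2\<close> with the cell masses of order \<open>L\<close>
  at the last level. The position \<open>j\<close> and the boundary differ by less than a cell.
\<close>
lemma weight_sum_error:
 fixes L :: real
 assumes g: "good_leaves w" and T: "W (0, 0) w > 0" and L: "L >= 1"
  and \<eta>: "\<And>q b. q < k ==> b < 2 ^ q ==> \<bar>node_noise w q b\<bar> <= 2 * sqrt L"
  and j: "j <= n" and b2: "b2 = nat \<lceil>real j / c\<rceil>"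
 shows "b2 <= 2 ^ k" "\<bar>real b2 / 2 ^ k - real j / n\<bar> <= 1 / n"
  and "\<bar>n * (weight_sum w j / weight_sum w n) - j - sqrt n * dyadic_bridge (node_noise w) k b2\<bar> <= 603 * L * k + 2401 * L"
proof -
 interpret B: bounded_tree "real n" k "node_noise w" L
  by standard (use n k L \<eta> in auto)
 have b2c: "real b2 * c < real j + c" "real j <= real b2 * c"
 proof -
  have "0 <= real j / c" using c_bounds by simp
  then have "real j / c <= real b2" "real b2 < real j / c + 1" unfolding b2
   by (simp_all add: of_nat_nat) linarith+
  then show "real b2 * c < real j + c" "real j <= real b2 * c" using c_bounds by (auto simp: field_simps)
 qed
 show b2N: "b2 <= 2 ^ k"
 proof -
  have "real j / c <= 2 ^ k" using j N_c c_bounds by (simp add: field_simps)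
  then have "\<lceil>real j / c\<rceil> <= 2 ^ k" by (simp add: ceiling_le_iff)
  then show ?thesis unfolding b2 by (simp add: nat_le_iff)
 qed
 have e1: "real b2 / 2 ^ k = real b2 * c / n" using n by (simp add: cell_width_def)
 show "\<bar>real b2 / 2 ^ k - real j / n\<bar> <= 1 / n"
  unfolding e1 diff_divide_distrib[symmetric] abs_divide using b2c c_bounds by (auto intro!: divide_right_mono)
 have mass: "0 <= real n / W (0, 0) w * cell_mass k w b \<and> real n / W (0, 0) w * cell_mass k w b <= 1200 * L" if "b < 2 ^ k" for b
 proof -
  have "real n / 2 ^ k <= 1" using k(1) by simp
  then have "\<not> 900 * L <= real n / 2 ^ k" using L by linarith
  then have "real n * tree_frac (real n) (node_noise w) k b <= 1200 * L"
   using B.mass_deviation[of k b] that by simp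
  moreover have "real n / W (0, 0) w * cell_mass k w b = real n * tree_frac (real n) (node_noise w) k b"
   using T by (simp add: cell_mass_def)
  ultimately show ?thesis using B.frac_pos[of k b] by simp
 qed
 define m where "m = 1200 * L * W (0, 0) w / real n"
 have mass': "0 <= cell_mass k w b \<and> cell_mass k w b <= m" if "b < 2 ^ k" for b
 proof -
  define r where "r = real n / W (0, 0) w"
  have r: "r > 0" using n T by (simp add: r_def)
  have "0 <= r * cell_mass k w b" "r * cell_mass k w b <= 1200 * L"
   using mass[OF that] by (simp_all only: r_def)
  then have "0 <= cell_mass k w b" "cell_mass k w b <= 1200 * L / r"
   using r by (simp_all only: zero_le_mult_iff pos_le_divide_eq mult.commute) auto
  then show ?thesis by (simp add: m_def r_def)
 qed
 have cl: "(\<Sum>b<b2. cell_mass k w b) - 2 * m <= weight_sum w j" "weight_sum w j <= (\<Sum>b<b2. cell_mass k w b)"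
  using weight_sum_close[OF g mass' b2c b2N] by auto
 let ?P = "n * tree_cdf (real n) (node_noise w) k b2"
 have "n * (weight_sum w j / weight_sum w n) = (real n / W (0, 0) w) * weight_sum w j"
  by (simp add: weight_sum_total[OF g])
 moreover have "(real n / W (0, 0) w) * weight_sum w j <= (real n / W (0, 0) w) * (\<Sum>b<b2. cell_mass k w b)"
  "(real n / W (0, 0) w) * ((\<Sum>b<b2. cell_mass k w b) - 2 * m) <= (real n / W (0, 0) w) * weight_sum w j"
  using T by (intro mult_left_mono cl; simp)+
 moreover have "(real n / W (0, 0) w) * (\<Sum>b<b2. cell_mass k w b) = ?P"
  unfolding sum_cell_mass using T by simp
 moreover have "(real n / W (0, 0) w) * ((\<Sum>b<b2. cell_mass k w b) - 2 * m) = ?P - 2400 * L"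
  unfolding right_diff_distrib sum_cell_mass using T n by (simp add: m_def)
 moreover have "\<bar>A - P\<bar> <= 2400 * L" if "A = rw" "rw <= rs" "rsm <= rw" "rs = P" "rsm = P - 2400 * L" for A P rw rs rsm :: real
  using that L by linarith
 ultimately have d1: "\<bar>n * (weight_sum w j / weight_sum w n) - ?P\<bar> <= 2400 * L" by blast
 have d2: "\<bar>?P - real b2 * c - sqrt n * dyadic_bridge (node_noise w) k b2\<bar> <= 603 * L * k"
  using B.tree_cdf_error[of k b2] b2N by (simp add: cell_width_def mult.commute)
 have d3: "\<bar>real b2 * c - j\<bar> <= L" using b2c c_bounds L by linarith
 have "\<bar>A - j - G\<bar> <= x + y + z" if "\<bar>A - P\<bar> <= x" "\<bar>P - B - G\<bar> <= y" "\<bar>B - j\<bar> <= z"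
  for A :: real and j :: real and G :: real and x :: real and y :: real and z :: real and P :: real and B :: real
  using that by linarith
 from this[OF d1 d2 d3] show "\<bar>n * (weight_sum w j / weight_sum w n) - j - sqrt n * dyadic_bridge (node_noise w) k b2\<bar> <= 603 * L * k + 2401 * L"
  by simp
qed

end

section \<open>Schauder series of the bridge and the Brownian motion\<close>

definition tent :: "real => real" where "tent u = max 0 (min (2 * u) (2 - 2 * u))"

definition schauder :: "nat => nat => real => real" where
 "schauder q b s = tent (2 ^ q * s - real b) / (2 * sqrt (2 ^ q))"

lemma tent_bounds: "0 <= tent u" "tent u <= 1" by (auto simp: tent_def)

lemma tent_eq_0: "u <= 0 \<or> u >= 1 ==> tent u = 0" by (auto simp: tent_def)

lemma continuous_on_tent [continuous_intros]: "continuous_on A f ==> continuous_on A (\<lambda>x. tent (f x))"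
 unfolding tent_def by (intro continuous_intros)

lemma schauder_nonneg: "0 <= schauder q b s"
 using tent_bounds by (simp add: schauder_def)

lemma schauder_zero: "schauder q b 0 = 0"
 by (simp add: schauder_def tent_eq_0)

lemma sum_tent_le: "(\<Sum>b<N. tent (x - real b)) <= 1"
proof (cases "x > 0")
 case False
 then have "(\<Sum>b<N. tent (x - real b)) = 0" by (intro sum.neutral ballI tent_eq_0) auto
 then show ?thesis by simp
next
 case True
 define m where "m = nat \<lfloor>x\<rfloor>"
 have m: "real m <= x" "x < real m + 1" using True unfolding m_def by (auto simp: of_nat_nat)
 have "tent (x - real b) = 0" if "b \<noteq> m" for b
 proof (cases "b < m")
  case True
  then have "real b + 1 <= real m" by simp
  then show ?thesis using m by (intro tent_eq_0) auto
 next
  case False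
  then have "real m + 1 <= real b" using that by simp
  then show ?thesis using m by (intro tent_eq_0) auto
 qed
 then have "(\<Sum>b<N. tent (x - real b)) = (\<Sum>b<N. if b = m then tent (x - real m) else 0)"
  by (intro sum.cong) auto
 also have "... <= 1" using tent_bounds by simp
 finally show ?thesis .
qed

lemma sum_schauder_le: "(\<Sum>b<2 ^ q. schauder q b s) <= 1 / (2 * sqrt (2 ^ q))"
proof -
 have "(\<Sum>b<2 ^ q. schauder q b s) = (\<Sum>b<2 ^ q. tent (2 ^ q * s - real b)) / (2 * sqrt (2 ^ q))"
  by (simp add: schauder_def sum_divide_distrib)
 also have "... <= 1 / (2 * sqrt (2 ^ q))" by (intro divide_right_mono sum_tent_le) simp
 finally show ?thesis .
qed

definition schauder_cov :: "nat => real => real => real" where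
 "schauder_cov q s s' = (\<Sum>b<2 ^ q. schauder q b s * schauder q b s')"

lemma schauder_Suc:
 "schauder (Suc q) b s = schauder q b (2 * s) / sqrt 2"
 "schauder (Suc q) (2 ^ q + b) s = schauder q b (2 * s - 1) / sqrt 2"
 by (simp_all add: schauder_def real_sqrt_mult algebra_simps)

lemma schauder_cov_Suc:
 "schauder_cov (Suc q) s s' = (schauder_cov q (2 * s) (2 * s') + schauder_cov q (2 * s - 1) (2 * s' - 1)) / 2"
proof -
 have "(\<Sum>b<2 ^ Suc q. f b) = (\<Sum>b<2 ^ q. f b) + (\<Sum>b<2 ^ q. f (2 ^ q + b))" for f :: "nat => real"
 proof -
  have "{..<2 ^ Suc q} = {..<2 ^ q} \<union> {2 ^ q..<2 ^ q + 2 ^ q :: nat}" by auto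
  then have "(\<Sum>b<2 ^ Suc q. f b) = (\<Sum>b<2 ^ q. f b) + (\<Sum>b\<in>{2 ^ q..<2 ^ q + 2 ^ q}. f b)"
   by (simp add: sum.union_disjoint ivl_disj_int)
  also have "(\<Sum>b\<in>{2 ^ q..<2 ^ q + 2 ^ q}. f b) = (\<Sum>b<2 ^ q. f (2 ^ q + b))"
   using sum.shift_bounds_nat_ivl[of f 0 "2 ^ q" "2 ^ q"] by (simp add: atLeast0LessThan add.commute)
  finally show ?thesis .
 qed
 then have "schauder_cov (Suc q) s s' = (\<Sum>b<2 ^ q. schauder (Suc q) b s * schauder (Suc q) b s') +
   (\<Sum>b<2 ^ q. schauder (Suc q) (2 ^ q + b) s * schauder (Suc q) (2 ^ q + b) s')"
  unfolding schauder_cov_def by blast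
 also have "(\<Sum>b<2 ^ q. schauder (Suc q) b s * schauder (Suc q) b s') = schauder_cov q (2 * s) (2 * s') / 2"
  unfolding schauder_cov_def schauder_Suc(1) by (simp add: sum_divide_distrib)
 also have "(\<Sum>b<2 ^ q. schauder (Suc q) (2 ^ q + b) s * schauder (Suc q) (2 ^ q + b) s') =
   schauder_cov q (2 * s - 1) (2 * s' - 1) / 2"
  unfolding schauder_cov_def schauder_Suc(2) by (simp add: sum_divide_distrib)
 finally show ?thesis by simp
qed

definition bridge_cov :: "real => real => real" where
 "bridge_cov s s' = (if s \<in> {0..1} \<and> s' \<in> {0..1} then min s s' - s * s' else 0)"

lemma bridge_cov_outside: "s <= 0 \<or> s >= 1 \<or> s' <= 0 \<or> s' >= 1 ==> bridge_cov s s' = 0"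
 by (auto simp: bridge_cov_def min_def)

lemma bridge_cov_split:
 assumes "s \<in> {0..1}" "s' \<in> {0..1}"
 shows "bridge_cov s s' = schauder 0 0 s * schauder 0 0 s' +
  (bridge_cov (2 * s) (2 * s') + bridge_cov (2 * s - 1) (2 * s' - 1)) / 2"
proof -
 have t: "schauder 0 0 u = (if u <= 1 / 2 then u else 1 - u)" if "u \<in> {0..1}" for u
  using that by (auto simp: schauder_def tent_def)
 consider "s <= 1/2" "s' <= 1/2" | "s > 1/2" "s' > 1/2" | "s <= 1/2" "s' > 1/2" | "s > 1/2" "s' <= 1/2" by linarith
 then show ?thesis
 proof cases
  case 1
  then have "bridge_cov (2 * s - 1) (2 * s' - 1) = 0" by (intro bridge_cov_outside) auto
  moreover have "bridge_cov (2 * s) (2 * s') = 2 * min s s' - 4 * (s * s')"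
   using 1 assms by (auto simp: bridge_cov_def min_def)
  ultimately show ?thesis using 1 assms by (simp add: t bridge_cov_def field_simps)
 next
  case 2
  then have "bridge_cov (2 * s) (2 * s') = 0" by (intro bridge_cov_outside) auto
  moreover have "bridge_cov (2 * s - 1) (2 * s' - 1) = 2 * min s s' - 1 - (2 * s - 1) * (2 * s' - 1)"
   using 2 assms by (auto simp: bridge_cov_def min_def)
  ultimately show ?thesis using 2 assms by (simp add: t bridge_cov_def field_simps)
 next
  case 3
  then have "bridge_cov (2 * s) (2 * s') = 0" "bridge_cov (2 * s - 1) (2 * s' - 1) = 0"
   by (auto intro!: bridge_cov_outside)
  then show ?thesis using 3 assms by (simp add: t bridge_cov_def min_def algebra_simps)
 next
  case 4
  then have "bridge_cov (2 * s) (2 * s') = 0" "bridge_cov (2 * s - 1) (2 * s' - 1) = 0"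
   by (auto intro!: bridge_cov_outside)
  then show ?thesis using 4 assms by (simp add: t bridge_cov_def min_def algebra_simps)
 qed
qed

lemma schauder_cov_outside: "s <= 0 \<or> s >= 1 \<or> s' <= 0 \<or> s' >= 1 ==> schauder_cov q s s' = 0"
proof -
 have "schauder q b s = 0" if "s <= 0 \<or> s >= 1" "b < 2 ^ q" for s b
 proof -
  have "2 ^ q * s - real b <= 0 \<or> 2 ^ q * s - real b >= 1"
  proof (cases "s <= 0")
   case True
   then have "2 ^ q * s <= 0" by (simp add: mult_nonneg_nonpos)
   then show ?thesis by simp
  next
   case False
   then have "(2::real) ^ q * 1 <= 2 ^ q * s" using that by (intro mult_left_mono) auto
   moreover have "real (Suc b) <= real (2 ^ q)" using that by (subst of_nat_le_iff) auto
   ultimately have "2 ^ q * s - real b >= 1"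
    unfolding of_nat_Suc of_nat_power of_nat_numeral by linarith
   then show ?thesis ..
  qed
  then show ?thesis by (simp add: schauder_def tent_eq_0)
 qed
 then show "s <= 0 \<or> s >= 1 \<or> s' <= 0 \<or> s' >= 1 ==> schauder_cov q s s' = 0"
  unfolding schauder_cov_def by (intro sum.neutral) auto
qed

text \<open>
  Self-similarity: both the bridge covariance and the Schauder sums split into the first coefficient and two
  half-size copies, so the remainder halves with every level.
\<close>
lemma schauder_cov_partial:
 "\<bar>bridge_cov s s' - (\<Sum>q<Q. schauder_cov q s s')\<bar> <= (1 / 2) ^ Q"
proof (induction Q arbitrary: s s')
 case 0
 show ?case
 proof (cases "s \<in> {0..1} \<and> s' \<in> {0..1}")
  case True
  then have "0 <= s * s'" "s * s' <= min s s'" by (auto simp: min_def mult_left_le mult_left_le_one_le mult_right_le_one_le)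
  moreover have "min s s' <= 1" using True by auto
  ultimately have "\<bar>min s s' - s * s'\<bar> <= 1" by linarith
  then show ?thesis using True by (simp add: bridge_cov_def)
 qed (auto simp: bridge_cov_def)
next
 case (Suc Q)
 show ?case
 proof (cases "s \<in> {0..1} \<and> s' \<in> {0..1}")
  case False
  then have "bridge_cov s s' = 0" "\<And>q. schauder_cov q s s' = 0"
   by (auto simp: bridge_cov_def intro!: schauder_cov_outside)
  then show ?thesis by simp
 next
  case True
  let ?D = "\<lambda>s s'. bridge_cov s s' - (\<Sum>q<Q. schauder_cov q s s')"
  have "(\<Sum>q<Suc Q. schauder_cov q s s') = schauder_cov 0 s s' + (\<Sum>q<Q. schauder_cov (Suc q) s s')"
   by (rule sum.lessThan_Suc_shift)
  also have "(\<Sum>q<Q. schauder_cov (Suc q) s s') =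
    ((\<Sum>q<Q. schauder_cov q (2 * s) (2 * s')) + (\<Sum>q<Q. schauder_cov q (2 * s - 1) (2 * s' - 1))) / 2"
   unfolding schauder_cov_Suc by (simp add: sum_divide_distrib[symmetric] sum.distrib)
  also have "schauder_cov 0 s s' = schauder 0 0 s * schauder 0 0 s'" by (simp add: schauder_cov_def)
  finally have S: "bridge_cov s s' - (\<Sum>q<Suc Q. schauder_cov q s s') = (?D (2 * s) (2 * s') + ?D (2 * s - 1) (2 * s' - 1)) / 2"
   using bridge_cov_split[of s s'] True by (simp add: field_simps)
  \<comment> \<open>only one of the two halves contributes\<close>
  have zero: "?D (2 * s) (2 * s') = 0 \<or> ?D (2 * s - 1) (2 * s' - 1) = 0"
  proof (cases "2 * s >= 1")
   case True
   then have "bridge_cov (2 * s) (2 * s') = 0" "\<And>q. schauder_cov q (2 * s) (2 * s') = 0"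
    by (auto intro!: schauder_cov_outside bridge_cov_outside)
   then show ?thesis by simp
  next
   case False
   then have "bridge_cov (2 * s - 1) (2 * s' - 1) = 0" "\<And>q. schauder_cov q (2 * s - 1) (2 * s' - 1) = 0"
    by (auto intro!: schauder_cov_outside bridge_cov_outside)
   then show ?thesis by simp
  qed
  have "\<bar>?D (2 * s) (2 * s')\<bar> <= (1 / 2) ^ Q" "\<bar>?D (2 * s - 1) (2 * s' - 1)\<bar> <= (1 / 2) ^ Q"
   by (rule Suc.IH)+
  then show ?thesis unfolding S using zero by auto
 qed
qed

lemma schauder_cov_sums: "(\<lambda>q. schauder_cov q s s') sums bridge_cov s s'"
proof -
 have "(\<lambda>Q. bridge_cov s s' - (\<Sum>q<Q. schauder_cov q s s')) \<longlonglongrightarrow> 0"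
  by (rule Lim_null_comparison[OF always_eventually LIMSEQ_power_zero[of "1/2 :: real"]])
    (use schauder_cov_partial in auto)
 from tendsto_diff[OF tendsto_const[of "bridge_cov s s'"] this] show ?thesis by (simp add: sums_def)
qed

lemma schauder_cov_nonneg: "schauder_cov q s s' >= 0"
 unfolding schauder_cov_def by (intro sum_nonneg mult_nonneg_nonneg schauder_nonneg)

text \<open>
  Schauder basis of Brownian motion on the unit interval: the bridge basis preceded by the linear function, with
  levels shifted by one.
\<close>
definition bm_basis :: "nat => nat => real => real" where
 "bm_basis p a u = (case p of 0 => u | Suc p' => schauder p' a u)"

definition bm_count :: "nat => nat" where "bm_count p = (case p of 0 => 1 | Suc p' => 2 ^ p')"

definition bm_cov :: "nat => real => real => real" where
 "bm_cov p u u' = (\<Sum>a<bm_count p. bm_basis p a u * bm_basis p a u')"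

lemma bm_cov_sums:
 assumes "u \<in> {0..1}" "u' \<in> {0..1}"
 shows "(\<lambda>p. bm_cov p u u') sums min u u'"
proof -
 have "(\<lambda>p. bm_cov (Suc p) u u') sums bridge_cov u u'"
  using schauder_cov_sums[of u u'] by (simp add: bm_cov_def bm_count_def bm_basis_def schauder_cov_def)
 then have "(\<lambda>p. bm_cov p u u') sums (bridge_cov u u' + bm_cov 0 u u')" by (rule sums_Suc)
 then show ?thesis using assms by (simp add: bridge_cov_def bm_cov_def bm_basis_def bm_count_def)
qed

lemma bm_basis_nonneg: "u >= 0 ==> bm_basis p a u >= 0"
 by (cases p) (auto simp: bm_basis_def schauder_nonneg)

lemma bm_cov_nonneg: "u >= 0 ==> u' >= 0 ==> bm_cov p u u' >= 0"
 unfolding bm_cov_def by (intro sum_nonneg mult_nonneg_nonneg bm_basis_nonneg)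

lemma sum_bm_basis_le: "u \<in> {0..1} ==> (\<Sum>a<bm_count p. bm_basis p a u) <= 1 / sqrt (2 ^ p)"
proof (cases p)
 case (Suc p')
 have "(\<Sum>a<bm_count p. bm_basis p a u) = (\<Sum>b<2 ^ p'. schauder p' b u)"
  by (simp add: Suc bm_count_def bm_basis_def)
 also have "... <= 1 / (2 * sqrt (2 ^ p'))" by (rule sum_schauder_le)
 also have "... <= 1 / sqrt (2 ^ p)"
 proof (rule divide_left_mono)
  have "sqrt 2 <= (2::real)" by (rule real_le_lsqrt) auto
  then show "sqrt (2 ^ p) <= 2 * sqrt (2 ^ p')" by (simp add: Suc real_sqrt_mult mult_right_mono)
 qed auto
 finally show ?thesis .
qed (simp add: bm_count_def bm_basis_def)

lemma bm_basis_0: "bm_basis p a 0 = 0"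
 by (cases p) (auto simp: bm_basis_def schauder_zero)

lemma tent_of_int: "tent (of_int z) = 0"
 by (rule tent_eq_0) (cases "z <= 0"; simp)

lemma bm_basis_1: "bm_basis p a 1 = (if p = 0 then 1 else 0)"
proof (cases p)
 case (Suc p')
 have "tent (2 ^ p' - real a) = tent (of_int (2 ^ p' - int a))" by simp
 then show ?thesis by (simp add: Suc bm_basis_def schauder_def del: of_int_diff) (simp only: tent_of_int)
qed (simp add: bm_basis_def)

text \<open>
  A tent has its kinks at dyadic points of a coarser grid, so it is affine between neighbouring grid points and the
  midpoint rule is exact.
\<close>
lemma tent_affine_between_grid:
 fixes c b d :: nat
 shows "tent ((2 * real c + 1) / 2 ^ Suc (Suc d) - real b) =
  (tent (real c / 2 ^ Suc d - real b) + tent (real (c + 1) / 2 ^ Suc d - real b)) / 2"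
proof -
 define u where "u = real c / 2 ^ Suc d - real b"
 define u' where "u' = real (c + 1) / 2 ^ Suc d - real b"
 have mid: "(2 * real c + 1) / 2 ^ Suc (Suc d) - real b = (u + u') / 2"
  by (simp add: u_def u'_def field_simps)
 have brk: "2 * u >= z \<or> 2 * u' <= z" if z: "z = of_int y" for z y
 proof -
  have "real_of_int (int c) >= of_int (2 ^ d * (y + 2 * int b)) \<or> real_of_int (int c + 1) <= of_int (2 ^ d * (y + 2 * int b))"
   unfolding of_int_le_iff by linarith
  then have "real c >= 2 ^ d * (z + 2 * real b) \<or> real (c + 1) <= 2 ^ d * (z + 2 * real b)"
   by (auto simp: z add.commute)
  moreover have "2 * u = real c / 2 ^ d - 2 * real b" "2 * u' = real (c + 1) / 2 ^ d - 2 * real b"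
   by (simp_all add: u_def u'_def field_simps)
  moreover have "real c / 2 ^ d >= z + 2 * real b \<longleftrightarrow> real c >= 2 ^ d * (z + 2 * real b)"
   "real (c + 1) / 2 ^ d <= z + 2 * real b \<longleftrightarrow> real (c + 1) <= 2 ^ d * (z + 2 * real b)"
   by (simp_all add: pos_le_divide_eq pos_divide_le_eq mult.commute)
  ultimately show ?thesis by linarith
 qed
 have le: "u <= u'" by (simp add: u_def u'_def divide_right_mono)
 have "u >= 0 \<or> u' <= 0" "u >= 1/2 \<or> u' <= 1/2" "u >= 1 \<or> u' <= 1"
  using brk[of 0 0] brk[of 1 1] brk[of 2 2] by auto
 then consider "u' <= 0" | "u >= 1" | "0 <= u" "u' <= 1 / 2" | "1 / 2 <= u" "u' <= 1"
  by linarith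
 then have "tent ((u + u') / 2) = (tent u + tent u') / 2"
 proof cases
  case 1
  then have "tent u = 0" "tent u' = 0" "tent ((u + u') / 2) = 0" using le by (auto intro!: tent_eq_0)
  then show ?thesis by simp
 next
  case 2
  then have "tent u = 0" "tent u' = 0" "tent ((u + u') / 2) = 0" using le by (auto intro!: tent_eq_0)
  then show ?thesis by simp
 next
  case 3
  have "tent x = 2 * x" if "0 <= x" "x <= 1 / 2" for x using that by (simp add: tent_def)
  then have "tent u = 2 * u" "tent u' = 2 * u'" "tent ((u + u') / 2) = 2 * ((u + u') / 2)" using le 3 by auto
  then show ?thesis by simp
 next
  case 4
  have "tent x = 2 - 2 * x" if "1 / 2 <= x" "x <= 1" for x using that by (simp add: tent_def)
  then have "tent u = 2 - 2 * u" "tent u' = 2 - 2 * u'" "tent ((u + u') / 2) = 2 - 2 * ((u + u') / 2)" using le 4 by auto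
  then show ?thesis by (simp add: field_simps)
 qed
 then show ?thesis unfolding mid u_def u'_def .
qed

lemma schauder_at_dyadic_finer: "q' >= q ==> schauder q' b' (real b / 2 ^ q) = 0"
proof -
 assume q: "q' >= q"
 have "2 ^ q' * (real b / 2 ^ q) - real b' = of_int (2 ^ (q' - q) * int b - int b')"
 proof -
  obtain d where "q' = q + d" using q le_Suc_ex by blast
  then show ?thesis by (simp add: power_add)
 qed
 then show ?thesis by (simp add: schauder_def tent_of_int del: of_int_diff of_int_mult of_int_power)
qed

definition schauder_partial :: "(nat => nat => real) => nat => real => real" where
 "schauder_partial \<eta> Q s = (\<Sum>q<Q. \<Sum>b<2 ^ q. \<eta> q b * schauder q b s)"

text \<open>
  At points of level \<open>q\<close> all finer Schauder functions vanish, and the remaining ones obey the midpoint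
  recursion of \<open>dyadic_bridge\<close>.
\<close>
lemma schauder_partial_dyadic:
 assumes "b <= 2 ^ q"
 shows "schauder_partial \<eta> q (real b / 2 ^ q) = dyadic_bridge \<eta> q b"
 using assms
proof (induction q arbitrary: b)
 case 0
 then show ?case by (simp add: schauder_partial_def)
next
 case (Suc q)
 have S: "schauder_partial \<eta> (Suc q) s = schauder_partial \<eta> q s + (\<Sum>b<2 ^ q. \<eta> q b * schauder q b s)" for s
  by (simp add: schauder_partial_def)
 show ?case
 proof (cases "even b")
  case True
  then obtain c where c: "b = 2 * c" by auto
  have e: "real b / 2 ^ Suc q = real c / 2 ^ q" by (simp add: c)
  have "(\<Sum>b<2 ^ q. \<eta> q b * schauder q b (real c / 2 ^ q)) = 0"
   by (simp add: schauder_at_dyadic_finer)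
  then show ?thesis using Suc.IH[of c] Suc.prems unfolding S e by (simp add: c)
 next
  case False
  then obtain c where c: "b = 2 * c + 1" by (auto elim: oddE)
  have c2: "c < 2 ^ q" using Suc.prems c by simp
  let ?s = "real b / 2 ^ Suc q"
  have "schauder q' b' ?s = (schauder q' b' (real c / 2 ^ q) + schauder q' b' (real (c + 1) / 2 ^ q)) / 2"
   if q': "q' < q" for q' b'
  proof -
   have "\<exists>d. q = Suc (q' + d)" using q' by (simp add: less_iff_Suc_add)
   then obtain d where d: "q = q' + Suc d" by auto
   have "2 ^ q' * ?s = (2 * real c + 1) / 2 ^ Suc (Suc d)" "2 ^ q' * (real c / 2 ^ q) = real c / 2 ^ Suc d"
    "2 ^ q' * (real (c + 1) / 2 ^ q) = real (c + 1) / 2 ^ Suc d"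
    by (simp_all add: c d power_add)
   then show ?thesis unfolding schauder_def by (simp only: tent_affine_between_grid) (simp add: add_divide_distrib)
  qed
  then have "schauder_partial \<eta> q ?s = (schauder_partial \<eta> q (real c / 2 ^ q) + schauder_partial \<eta> q (real (c + 1) / 2 ^ q)) / 2"
   unfolding schauder_partial_def by (simp add: sum.distrib[symmetric] sum_divide_distrib distrib_left add_divide_distrib)
  also have "... = (dyadic_bridge \<eta> q c + dyadic_bridge \<eta> q (c + 1)) / 2"
   using Suc.IH[of c] Suc.IH[of "c + 1"] c2 by simp
  finally have 1: "schauder_partial \<eta> q ?s = (dyadic_bridge \<eta> q c + dyadic_bridge \<eta> q (c + 1)) / 2" .
  have "schauder q b' ?s = (if b' = c then 1 / (2 * sqrt (2 ^ q)) else 0)" for b'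
  proof -
   have e: "2 ^ q * ?s - real b' = real c + 1 / 2 - real b'" by (simp add: c field_simps)
   have "tent (real c + 1 / 2 - real b') = (if b' = c then 1 else 0)"
   proof (cases "b' = c")
    case False
    then have "b' + 1 <= c \<or> c + 1 <= b'" by auto
    then have "real b' + 1 <= real c \<or> real c + 1 <= real b'" by linarith
    then show ?thesis using False by (auto intro!: tent_eq_0)
   qed (simp add: tent_def)
   then show ?thesis unfolding schauder_def e by simp
  qed
  then have "(\<Sum>b'<2 ^ q. \<eta> q b' * schauder q b' ?s) = (\<Sum>b'<2 ^ q. if b' = c then \<eta> q c / (2 * sqrt (2 ^ q)) else 0)"
   by (intro sum.cong) auto
  also have "... = \<eta> q c / (2 * sqrt (2 ^ q))" using c2 by simp
  finally show ?thesis unfolding S 1 by (simp add: c)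
 qed
qed

section \<open>The Kiefer process\<close>

type_synonym sheet_index = "nat \<times> nat \<times> nat \<times> nat \<times> nat"

text \<open>
  Level \<open>r\<close> of the tensor product of the two Schauder expansions on the strip \<open>i \<le> t \<le> i
  + 1\<close>. Coefficients are indexed by strip, level and position in time, level and position in space.
\<close>
definition sheet_level :: "(sheet_index => real) => nat => nat => real => real => real" where
 "sheet_level x i r s u = (\<Sum>p\<le>r. \<Sum>a<bm_count p. \<Sum>b<2 ^ (r - p).
   x (i, p, a, r - p, b) * (bm_basis p a u * schauder (r - p) b s))"

text \<open>
  Bounding the maximum of a level by a fourth moment sum makes summability a matter of expectations, without tail
  estimates for maxima of normals.
\<close>
definition level_fourth :: "(sheet_index => real) => nat => nat => real" where
 "level_fourth x i r = (\<Sum>p\<le>r. \<Sum>a<bm_count p. \<Sum>b<2 ^ (r - p). (x (i, p, a, r - p, b)) ^ 4)"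

definition root4 :: real where "root4 = sqrt (sqrt 2)"

text \<open>
  With \<open>\<lambda> = 2\<^sup>r\<^sup>/\<^sup>4\<close>, every coefficient of the level is at most
  \<open>\<lambda> + A / \<lambda>\<^sup>3\<close>, where \<open>A\<close> is the sum of fourth powers, and the
  basis functions of each of the \<open>r + 1\<close> pairs of levels sum to at most
  \<open>2\<^sup>-\<^sup>r\<^sup>/\<^sup>2 = 1 / \<lambda>\<^sup>2\<close>.
\<close>
definition level_bound :: "(sheet_index => real) => nat => nat => real" where
 "level_bound x i r = (real r + 1) * (root4 ^ r + level_fourth x i r / (root4 ^ r) ^ 3) / (root4 ^ r)\<^sup>2"

lemma root4: "root4 > 1" "(root4 ^ r)\<^sup>2 = sqrt (2 ^ r)" "(root4 ^ r) ^ 4 = 2 ^ r"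
proof -
 show "root4 > 1" by (simp add: root4_def)
 have sq: "root4\<^sup>2 = sqrt 2" by (simp add: root4_def)
 show 2: "(root4 ^ r)\<^sup>2 = sqrt (2 ^ r)"
 proof -
  have "(root4 ^ r)\<^sup>2 = (root4\<^sup>2) ^ r" by (simp only: power_mult[symmetric] mult.commute)
  then show ?thesis unfolding sq by (simp add: real_sqrt_power)
 qed
 have "(root4 ^ r) ^ 4 = ((root4 ^ r)\<^sup>2)\<^sup>2" using power_mult[of "root4 ^ r" 2 2] by simp
 also have "... = 2 ^ r" unfolding 2 by simp
 finally show "(root4 ^ r) ^ 4 = 2 ^ r" .
qed

lemma level_fourth_nonneg: "level_fourth x i r >= 0"
 unfolding level_fourth_def by (intro sum_nonneg) simp

lemma level_bound_nonneg: "level_bound x i r >= 0"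
 unfolding level_bound_def using root4(1) level_fourth_nonneg[of x i r]
 by (intro divide_nonneg_nonneg mult_nonneg_nonneg add_nonneg_nonneg) auto

lemma abs_le_level_max:
 assumes "p <= r" "a < bm_count p" "b < 2 ^ (r - p)"
 shows "\<bar>x (i, p, a, r - p, b)\<bar> <= root4 ^ r + level_fourth x i r / (root4 ^ r) ^ 3"
proof -
 let ?z = "\<bar>x (i, p, a, r - p, b)\<bar>" and ?l = "root4 ^ r"
 have l: "?l > 0" using root4(1) by simp
 have "?z ^ 4 <= level_fourth x i r"
 proof -
  have "?z ^ 4 <= (\<Sum>b<2 ^ (r - p). (x (i, p, a, r - p, b)) ^ 4)"
   using assms member_le_sum[of b "{..<2 ^ (r - p)}" "\<lambda>b. (x (i, p, a, r - p, b)) ^ 4"] by simp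
  also have "... <= (\<Sum>a<bm_count p. \<Sum>b<2 ^ (r - p). (x (i, p, a, r - p, b)) ^ 4)"
   using assms member_le_sum[of a "{..<bm_count p}" "\<lambda>a. \<Sum>b<2 ^ (r - p). (x (i, p, a, r - p, b)) ^ 4"]
   by (simp add: sum_nonneg)
  also have "... <= level_fourth x i r"
   unfolding level_fourth_def
   using assms member_le_sum[of p "{..r}" "\<lambda>p. \<Sum>a<bm_count p. \<Sum>b<2 ^ (r - p). (x (i, p, a, r - p, b)) ^ 4"]
   by (simp add: sum_nonneg)
  finally show ?thesis .
 qed
 show ?thesis
 proof (cases "?z <= ?l")
  case True
  then show ?thesis using level_fourth_nonneg[of x i r] l by (simp add: add_increasing2)
 next
  case False
  have "?z * ?l ^ 3 <= ?z * ?z ^ 3" using False l by (intro mult_left_mono power_mono) auto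
  also have "... = ?z ^ 4" by (simp add: power4_eq_xxxx power3_eq_cube)
  also have "... <= level_fourth x i r" by fact
  finally have "?z <= level_fourth x i r / ?l ^ 3" using l by (simp add: pos_le_divide_eq)
  then show ?thesis using l by simp
 qed
qed

lemma sheet_level_le:
 assumes u: "u \<in> {0..1}"
 shows "\<bar>sheet_level x i r s u\<bar> <= level_bound x i r"
proof -
 define m where "m = root4 ^ r + level_fourth x i r / (root4 ^ r) ^ 3"
 have m0: "m >= 0" unfolding m_def using root4(1) level_fourth_nonneg[of x i r] by (intro add_nonneg_nonneg) auto
 have "\<bar>sheet_level x i r s u\<bar> <= (\<Sum>p\<le>r. \<Sum>a<bm_count p. \<Sum>b<2 ^ (r - p). m * (bm_basis p a u * schauder (r - p) b s))"
  unfolding sheet_level_def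
 proof (rule sum_abs[THEN order.trans], rule sum_mono, rule sum_abs[THEN order.trans], rule sum_mono,
   rule sum_abs[THEN order.trans], rule sum_mono)
  fix p a b assume "p \<in> {..r}" "a \<in> {..<bm_count p}" "b \<in> {..<2 ^ (r - p) :: nat}"
  then have "\<bar>x (i, p, a, r - p, b)\<bar> <= m" unfolding m_def by (intro abs_le_level_max) auto
  moreover have "0 <= bm_basis p a u * schauder (r - p) b s"
   using u by (intro mult_nonneg_nonneg bm_basis_nonneg schauder_nonneg) auto
  ultimately show "\<bar>x (i, p, a, r - p, b) * (bm_basis p a u * schauder (r - p) b s)\<bar> <=
    m * (bm_basis p a u * schauder (r - p) b s)"
   unfolding abs_mult[of "x _"] by (simp add: mult_right_mono)
 qed
 also have "... = (\<Sum>p\<le>r. m * ((\<Sum>a<bm_count p. bm_basis p a u) * (\<Sum>b<2 ^ (r - p). schauder (r - p) b s)))"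
  by (intro sum.cong refl) (simp only: sum_product, simp only: sum_distrib_left)
 also have "... <= (\<Sum>p\<le>r. m * (1 / sqrt (2 ^ p) * (1 / sqrt (2 ^ (r - p)))))"
 proof (intro sum_mono mult_left_mono mult_mono m0)
  fix p
  show "(\<Sum>a<bm_count p. bm_basis p a u) <= 1 / sqrt (2 ^ p)" by (rule sum_bm_basis_le[OF u])
  have "(\<Sum>b<2 ^ (r - p). schauder (r - p) b s) <= 1 / (2 * sqrt (2 ^ (r - p)))" by (rule sum_schauder_le)
  also have "... <= 1 / sqrt (2 ^ (r - p))" by (intro divide_left_mono) auto
  finally show "(\<Sum>b<2 ^ (r - p). schauder (r - p) b s) <= 1 / sqrt (2 ^ (r - p))" .
  show "0 <= (\<Sum>b<2 ^ (r - p). schauder (r - p) b s)" by (intro sum_nonneg schauder_nonneg)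
 qed auto
 also have "... = (\<Sum>p\<le>r. m / (root4 ^ r)\<^sup>2)"
 proof (rule sum.cong[OF refl])
  fix p assume "p \<in> {..r}"
  then have "sqrt (2 ^ p) * sqrt (2 ^ (r - p)) = sqrt (2 ^ r)"
   by (simp add: real_sqrt_mult[symmetric] power_add[symmetric])
  then show "m * (1 / sqrt (2 ^ p) * (1 / sqrt (2 ^ (r - p)))) = m / (root4 ^ r)\<^sup>2"
   unfolding root4(2) by simp
 qed
 also have "... = level_bound x i r" by (simp add: level_bound_def m_def add.commute)
 finally show ?thesis .
qed

definition good_array :: "(sheet_index => real) => bool" where
 "good_array x \<longleftrightarrow> (\<forall>i. summable (level_bound x i))"

definition sheet :: "(sheet_index => real) => nat => real => real => real" where
 "sheet x i s u = (\<Sum>r. sheet_level x i r s u)"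

definition clamp01 :: "real => real" where "clamp01 t = max 0 (min 1 t)"

lemma clamp01_in: "clamp01 t \<in> {0..1}" by (auto simp: clamp01_def)

text \<open>
  Independent strips are added up to time \<open>t\<close>, the last one partially. Setting the value to 0 outside
  the good set makes every path continuous, not just almost every one.
\<close>
definition kiefer_of :: "(sheet_index => real) => real \<times> real => real" where
 "kiefer_of x z = (if good_array x then \<Sum>i<nat \<lceil>snd z\<rceil>. sheet x i (fst z) (clamp01 (snd z - real i)) else 0)"

lemma sheet_sums:
 assumes "good_array x" "u \<in> {0..1}"
 shows "(\<lambda>r. sheet_level x i r s u) sums sheet x i s u"
 unfolding sheet_def
proof (rule summable_sums, rule summable_comparison_test')
 show "summable (level_bound x i)" using assms by (simp add: good_array_def)
qed (use sheet_level_le[OF assms(2)] in auto)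

lemma sheet_0: "sheet x i s 0 = 0"
 by (simp add: sheet_def sheet_level_def bm_basis_0)

lemma kiefer_of_eq:
 assumes "good_array x" "t <= real N"
 shows "kiefer_of x (s, t) = (\<Sum>i<N. sheet x i s (clamp01 (t - real i)))"
proof -
 have "(\<Sum>i<nat \<lceil>t\<rceil>. sheet x i s (clamp01 (t - real i))) = (\<Sum>i<N. sheet x i s (clamp01 (t - real i)))"
 proof (rule sum.mono_neutral_left)
  show "{..<nat \<lceil>t\<rceil>} \<subseteq> {..<N}" using assms(2) by (auto simp: ceiling_le_iff nat_le_iff intro: less_le_trans)
  show "\<forall>i\<in>{..<N} - {..<nat \<lceil>t\<rceil>}. sheet x i s (clamp01 (t - real i)) = 0"
  proof
   fix i assume "i \<in> {..<N} - {..<nat \<lceil>t\<rceil>}"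
   then have "t <= real i" by (auto simp: not_less nat_le_iff ceiling_le_iff)
   then show "sheet x i s (clamp01 (t - real i)) = 0" by (simp add: clamp01_def sheet_0)
  qed
 qed simp
 then show ?thesis using assms by (simp add: kiefer_of_def)
qed

text \<open>
  Each strip is a uniform limit by the Weierstrass M-test with the bounds \<open>level_bound\<close>, and locally in
  \<open>t\<close> only finitely many strips are involved.
\<close>
lemma continuous_kiefer_of: "continuous_on UNIV (kiefer_of x)"
proof (cases "good_array x")
 case False
 then show ?thesis by (simp add: kiefer_of_def continuous_on_const)
next
 case True
 have sch: "continuous_on UNIV (\<lambda>z :: real \<times> real. schauder q b (fst z))" for q b
  unfolding schauder_def by (intro continuous_intros) auto
 have bas: "continuous_on UNIV (\<lambda>z :: real \<times> real. bm_basis p a (clamp01 (snd z - c)))" for p a c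
  unfolding bm_basis_def clamp01_def schauder_def by (cases p) (auto intro!: continuous_intros)
 have lev: "continuous_on UNIV (\<lambda>z. sheet_level x i r (fst z) (clamp01 (snd z - real i)))" for i r
  unfolding sheet_level_def by (intro continuous_intros sch bas)
 have sh: "continuous_on UNIV (\<lambda>z. sheet x i (fst z) (clamp01 (snd z - real i)))" for i
 proof (rule uniform_limit_theorem)
  show "uniform_limit UNIV (\<lambda>R z. \<Sum>r<R. sheet_level x i r (fst z) (clamp01 (snd z - real i)))
    (\<lambda>z. sheet x i (fst z) (clamp01 (snd z - real i))) sequentially"
   unfolding sheet_def
   by (rule Weierstrass_m_test[where M = "level_bound x i"])
     (use True sheet_level_le[OF clamp01_in] in \<open>auto simp: good_array_def\<close>)
  show "\<forall>\<^sub>F R in sequentially. continuous_on UNIV (\<lambda>z. \<Sum>r<R. sheet_level x i r (fst z) (clamp01 (snd z - real i)))"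
   by (intro always_eventually allI continuous_on_sum lev)
 qed simp
 have "continuous_on (\<Union>N::nat. {z :: real \<times> real. snd z < real N}) (kiefer_of x)"
 proof (rule continuous_on_open_UN)
  show "open {z :: real \<times> real. snd z < real N}" for N
   by (intro open_Collect_less continuous_intros)
  show "continuous_on {z :: real \<times> real. snd z < real N} (kiefer_of x)" for N
  proof (rule continuous_on_eq)
   show "continuous_on {z :: real \<times> real. snd z < real N} (\<lambda>z. \<Sum>i<N. sheet x i (fst z) (clamp01 (snd z - real i)))"
    by (rule continuous_on_subset[of UNIV]) (auto intro: continuous_on_sum sh)
   show "(\<Sum>i<N. sheet x i (fst z) (clamp01 (snd z - real i))) = kiefer_of x z"
    if "z \<in> {z. snd z < real N}" for z
    using kiefer_of_eq[OF True, of "snd z" N "fst z"] that by simp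
  qed
 qed
 moreover have "(\<Union>N::nat. {z :: real \<times> real. snd z < real N}) = UNIV"
  using reals_Archimedean2 by auto
 ultimately show ?thesis by simp
qed

lemma sheet_level_1: "sheet_level x i r s 1 = (\<Sum>b<2 ^ r. x (i, 0, 0, r, b) * schauder r b s)"
proof -
 have "sheet_level x i r s 1 = (\<Sum>p\<le>r. if p = 0 then (\<Sum>b<2 ^ r. x (i, 0, 0, r, b) * schauder r b s) else 0)"
  unfolding sheet_level_def by (intro sum.cong refl) (auto simp: bm_basis_1 bm_count_def)
 then show ?thesis by simp
qed

lemma schauder_partial_sum:
 "schauder_partial (\<lambda>q b. \<Sum>i<n. f i q b) Q s = (\<Sum>i<n. schauder_partial (f i) Q s)" for n :: nat
proof (induction n)
 case (Suc n)
 have "schauder_partial (\<lambda>q b. \<Sum>i<Suc n. f i q b) Q s =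
   schauder_partial (\<lambda>q b. \<Sum>i<n. f i q b) Q s + schauder_partial (f n) Q s"
  unfolding schauder_partial_def sum.lessThan_Suc distrib_right sum.distrib ..
 then show ?case using Suc by simp
qed (simp add: schauder_partial_def)

lemma schauder_partial_divide: "schauder_partial (\<lambda>q b. f q b / c) Q s = schauder_partial f Q s / c"
 by (simp add: schauder_partial_def sum_divide_distrib)

text \<open>
  At the end of a strip only the linear time function survives, so an integer time adds up the coefficients with
  time level 0.
\<close>
lemma kiefer_of_integer_dyadic:
 assumes good: "good_array x" and n: "n > 0" and b: "b <= 2 ^ q"
 shows "kiefer_of x (real b / 2 ^ q, real n) =
  sqrt n * dyadic_bridge (\<lambda>r b. (\<Sum>i<n. x (i, 0, 0, r, b)) / sqrt n) q b"
proof -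
 let ?s = "real b / 2 ^ q"
 have sh: "sheet x i ?s 1 = schauder_partial (\<lambda>r b. x (i, 0, 0, r, b)) q ?s" for i
 proof -
  have "sheet_level x i r ?s 1 = 0" if "r >= q" for r
   unfolding sheet_level_1 using that by (simp add: schauder_at_dyadic_finer)
  then have "(\<lambda>r. sheet_level x i r ?s 1) sums (\<Sum>r<q. sheet_level x i r ?s 1)"
   by (intro sums_finite) (auto simp: not_less)
  from sums_unique2[OF sheet_sums[OF good, of 1 i ?s] this]
  show ?thesis by (simp add: schauder_partial_def sheet_level_1)
 qed
 have "kiefer_of x (?s, real n) = (\<Sum>i<n. sheet x i ?s (clamp01 (real n - real i)))"
  by (rule kiefer_of_eq[OF good]) simp
 also have "... = (\<Sum>i<n. sheet x i ?s 1)"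
 proof (rule sum.cong[OF refl])
  fix i assume "i \<in> {..<n}"
  then have "real i + 1 <= real n" by simp
  then have "clamp01 (real n - real i) = 1" by (simp add: clamp01_def)
  then show "sheet x i ?s (clamp01 (real n - real i)) = sheet x i ?s 1" by simp
 qed
 also have "... = schauder_partial (\<lambda>r b. \<Sum>i<n. x (i, 0, 0, r, b)) q ?s"
  unfolding sh by (rule schauder_partial_sum[symmetric])
 also have "... = sqrt n * schauder_partial (\<lambda>r b. (\<Sum>i<n. x (i, 0, 0, r, b)) / sqrt n) q ?s"
  using n by (simp add: schauder_partial_divide)
 finally show ?thesis by (simp add: schauder_partial_dyadic[OF b])
qed

text \<open>
  As an image of the standard normal law this covers the degenerate case \<open>\<sigma> = 0\<close> as well.
\<close>
definition gauss_law :: "real => real measure" where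
 "gauss_law \<sigma> = distr std_normal_distribution borel (\<lambda>x. \<sigma> * x)"

lemma sets_gauss_law [simp, measurable_cong]: "sets (gauss_law \<sigma>) = sets borel"
 by (simp add: gauss_law_def)

lemma space_gauss_law [simp]: "space (gauss_law \<sigma>) = UNIV"
 by (simp add: gauss_law_def)

lemma real_distribution_gauss_law: "real_distribution (gauss_law \<sigma>)"
proof -
 interpret real_distribution std_normal_distribution by (rule real_dist_normal_dist)
 show ?thesis unfolding gauss_law_def by (rule real_distribution_distr) simp
qed

lemma char_gauss_law: "char (gauss_law \<sigma>) t = complex_of_real (exp (- (\<sigma>\<^sup>2 * t\<^sup>2) / 2))"
proof -
 have "char (gauss_law \<sigma>) t = char std_normal_distribution (\<sigma> * t)"
  unfolding char_def gauss_law_def by (subst integral_distr) (auto simp: mult_ac)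
 then show ?thesis by (simp add: char_std_normal_distribution power_mult_distrib)
qed

lemma gauss_law_eq:
 assumes "\<sigma> >= 0"
 shows "gauss_law \<sigma> = (if \<sigma> = 0 then return borel 0 else density lborel (normal_density 0 \<sigma>))"
proof (cases "\<sigma> = 0")
 case True
 interpret real_distribution std_normal_distribution by (rule real_dist_normal_dist)
 show ?thesis using True distr_const[of 0 borel] by (simp add: gauss_law_def)
next
 case False
 then have \<sigma>: "\<sigma> > 0" using assms by simp
 interpret real_distribution std_normal_distribution by (rule real_dist_normal_dist)
 have "distributed std_normal_distribution lborel (\<lambda>x. x) std_normal_density"
  unfolding distributed_def by (simp add: distr_id2)
 from normal_density_affine[OF this, of \<sigma> 0] \<sigma>
 have "distributed std_normal_distribution lborel (\<lambda>x. \<sigma> * x) (normal_density 0 \<sigma>)" by simp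
 then have "distr std_normal_distribution lborel (\<lambda>x. \<sigma> * x) = density lborel (normal_density 0 \<sigma>)"
  by (rule distributed_distr_eq_density)
 moreover have "distr std_normal_distribution lborel (\<lambda>x. \<sigma> * x) = distr std_normal_distribution borel (\<lambda>x. \<sigma> * x)"
  by (rule distr_cong) auto
 ultimately show ?thesis using \<sigma> by (simp add: gauss_law_def)
qed

lemma std_normal_moments:
 "integrable std_normal_distribution (\<lambda>x. x ^ k)"
 "(\<integral>x. x \<partial>std_normal_distribution) = 0" "(\<integral>x. x\<^sup>2 \<partial>std_normal_distribution) = 1"
 "(\<integral>x. x ^ 4 \<partial>std_normal_distribution) = 3"
proof -
 show "integrable std_normal_distribution (\<lambda>x. x ^ k)" by (rule integrable_std_normal_distribution_moment)
 show "(\<integral>x. x \<partial>std_normal_distribution) = 0"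
  using integral_std_normal_distribution_moment_odd[of 1] by (simp only: power_one_right odd_one simp_thms)
 have e: "(\<integral>x. x ^ (2 * k) \<partial>std_normal_distribution) = fact (2 * k) / (2 ^ k * fact k)" for k
  by (rule std_normal_distribution_even_moments)
 have f: "fact 4 = (24::real)" "fact 2 = (2::real)" by (simp_all add: fact_numeral)
 show "(\<integral>x. x\<^sup>2 \<partial>std_normal_distribution) = 1" using e[of 1] f by (simp only: mult_1_right) simp
 have "(2::nat) * 2 = 4" by simp
 then show "(\<integral>x. x ^ 4 \<partial>std_normal_distribution) = 3" using e[of 2] f by (simp only:) simp
qed

lemma gauss_law_moments:
 "integrable (gauss_law \<sigma>) (\<lambda>x. x)" "(\<integral>x. x \<partial>gauss_law \<sigma>) = 0"
 "integrable (gauss_law \<sigma>) (\<lambda>x. x\<^sup>2)" "(\<integral>x. x\<^sup>2 \<partial>gauss_law \<sigma>) = \<sigma>\<^sup>2"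
proof -
 have m: "(\<lambda>x. \<sigma> * x) \<in> measurable std_normal_distribution borel" by measurable
 have i1: "integrable std_normal_distribution (\<lambda>x. \<sigma> * x)"
  using std_normal_moments(1)[of 1] by (intro integrable_mult_right) (simp only: power_one_right)
 have i2: "integrable std_normal_distribution (\<lambda>x. (\<sigma> * x)\<^sup>2)"
  unfolding power_mult_distrib by (intro integrable_mult_right std_normal_moments(1))
 show "integrable (gauss_law \<sigma>) (\<lambda>x. x)"
  unfolding gauss_law_def by (subst integrable_distr_eq[OF m]) (use i1 in auto)
 show "integrable (gauss_law \<sigma>) (\<lambda>x. x\<^sup>2)"
  unfolding gauss_law_def by (subst integrable_distr_eq[OF m]) (use i2 in auto)
 have "(\<integral>x. x \<partial>gauss_law \<sigma>) = (\<integral>x. \<sigma> * x \<partial>std_normal_distribution)"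
  unfolding gauss_law_def by (rule integral_distr[OF m]) auto
 also have "... = \<sigma> * (\<integral>x. x \<partial>std_normal_distribution)" by (rule integral_mult_right_zero)
 finally show "(\<integral>x. x \<partial>gauss_law \<sigma>) = 0" by (simp only: std_normal_moments(2) mult_zero_right)
 have "(\<integral>x. x\<^sup>2 \<partial>gauss_law \<sigma>) = (\<integral>x. (\<sigma> * x)\<^sup>2 \<partial>std_normal_distribution)"
  unfolding gauss_law_def by (rule integral_distr[OF m]) auto
 also have "... = \<sigma>\<^sup>2 * (\<integral>x. x\<^sup>2 \<partial>std_normal_distribution)"
  unfolding power_mult_distrib by (rule integral_mult_right_zero)
 finally show "(\<integral>x. x\<^sup>2 \<partial>gauss_law \<sigma>) = \<sigma>\<^sup>2" by (simp only: std_normal_moments(3) mult_1_right)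
qed

locale sheet_noise = prob_space M for M :: "'w measure" +
 fixes \<xi> :: "sheet_index => 'w => real"
 assumes indep: "indep_vars (\<lambda>_. borel) \<xi> UNIV"
  and law: "\<And>x. distr M borel (\<xi> x) = std_normal_distribution"
begin

lemma \<xi>_measurable [measurable]: "\<xi> x \<in> borel_measurable M"
 using indep unfolding indep_vars_def by blast

definition arr :: "'w => sheet_index => real" where "arr wo x = \<xi> x wo"

lemma arr_measurable [measurable]: "(\<lambda>wo. arr wo x) \<in> borel_measurable M"
 by (simp add: arr_def)

lemma char_linear_combination:
 assumes "finite I"
 shows "char (distr M borel (\<lambda>wo. \<Sum>x\<in>I. c x * arr wo x)) t = complex_of_real (exp (- ((\<Sum>x\<in>I. (c x)\<^sup>2) * t\<^sup>2) / 2))"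
proof -
 have "indep_vars (\<lambda>_. borel) (\<lambda>x wo. c x * arr wo x) I"
  unfolding arr_def by (rule indep_vars_compose2[OF indep_vars_subset[OF indep]]) auto
 then have "char (distr M borel (\<lambda>wo. \<Sum>x\<in>I. c x * arr wo x)) t = (\<Prod>x\<in>I. char (distr M borel (\<lambda>wo. c x * arr wo x)) t)"
  by (rule char_distr_sum)
 also have "... = (\<Prod>x\<in>I. complex_of_real (exp (- ((c x)\<^sup>2 * t\<^sup>2) / 2)))"
 proof (rule prod.cong[OF refl])
  fix x
  have "distr M borel (\<lambda>wo. c x * arr wo x) = gauss_law (c x)"
   unfolding gauss_law_def law[of x, symmetric] by (subst distr_distr) (auto simp: comp_def arr_def)
  then show "char (distr M borel (\<lambda>wo. c x * arr wo x)) t = complex_of_real (exp (- ((c x)\<^sup>2 * t\<^sup>2) / 2))"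
   by (simp add: char_gauss_law)
 qed
 also have "... = complex_of_real (\<Prod>x\<in>I. exp (- ((c x)\<^sup>2 * t\<^sup>2) / 2))" by simp
 also have "(\<Prod>x\<in>I. exp (- ((c x)\<^sup>2 * t\<^sup>2) / 2)) = exp (\<Sum>x\<in>I. - ((c x)\<^sup>2 * t\<^sup>2) / 2)"
  by (rule exp_sum[OF assms, symmetric])
 also have "(\<Sum>x\<in>I. - ((c x)\<^sup>2 * t\<^sup>2) / 2) = - ((\<Sum>x\<in>I. (c x)\<^sup>2) * t\<^sup>2) / 2"
  by (simp add: sum_distrib_right sum_divide_distrib sum_negf)
 finally show ?thesis .
qed

text \<open>
  Characteristic functions of the partial sums converge, by dominated convergence on the one hand and by the
  variances on the other.
\<close>
lemma gauss_law_limit: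
 assumes X[measurable]: "X \<in> borel_measurable M"
  and fin: "\<And>R. finite (I R)" and lim: "AE wo in M. (\<lambda>R. \<Sum>x\<in>I R. c R x * arr wo x) \<longlonglongrightarrow> X wo"
  and var: "(\<lambda>R. \<Sum>x\<in>I R. (c R x)\<^sup>2) \<longlonglongrightarrow> \<sigma>2"
 shows "distr M borel X = gauss_law (sqrt \<sigma>2)"
proof (rule Levy_uniqueness)
 have "\<sigma>2 >= 0" by (rule LIMSEQ_le_const[OF var]) (intro exI[of _ 0] allI impI sum_nonneg, simp)
 show "real_distribution (distr M borel X)" by (rule real_distribution_distr) simp
 show "real_distribution (gauss_law (sqrt \<sigma>2))" by (rule real_distribution_gauss_law)
 show "char (distr M borel X) = char (gauss_law (sqrt \<sigma>2))"
 proof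
  fix t
  have ch: "char (distr M borel Y) t = (\<integral>wo. iexp (t * Y wo) \<partial>M)" if "Y \<in> borel_measurable M" for Y
   unfolding char_def using that by (subst integral_distr) auto
  have "(\<lambda>R. (\<integral>wo. iexp (t * (\<Sum>x\<in>I R. c R x * arr wo x)) \<partial>M)) \<longlonglongrightarrow> (\<integral>wo. iexp (t * X wo) \<partial>M)"
  proof (rule integral_dominated_convergence[where w = "\<lambda>_. 1"])
   show "AE wo in M. (\<lambda>R. iexp (t * (\<Sum>x\<in>I R. c R x * arr wo x))) \<longlonglongrightarrow> iexp (t * X wo)"
    using lim by eventually_elim (intro tendsto_intros)
  qed auto
  moreover have mS: "(\<lambda>wo. \<Sum>x\<in>I R. c R x * arr wo x) \<in> borel_measurable M" for R by measurable
  ultimately have "(\<lambda>R. complex_of_real (exp (- ((\<Sum>x\<in>I R. (c R x)\<^sup>2) * t\<^sup>2) / 2))) \<longlonglongrightarrow> char (distr M borel X) t"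
   unfolding ch[OF X, symmetric] ch[OF mS, symmetric] char_linear_combination[OF fin] by simp
  moreover have "(\<lambda>R. complex_of_real (exp (- ((\<Sum>x\<in>I R. (c R x)\<^sup>2) * t\<^sup>2) / 2))) \<longlonglongrightarrow> complex_of_real (exp (- (\<sigma>2 * t\<^sup>2) / 2))"
   by (intro tendsto_intros var) auto
  ultimately show "char (distr M borel X) t = char (gauss_law (sqrt \<sigma>2)) t"
   using \<open>\<sigma>2 >= 0\<close> LIMSEQ_unique by (fastforce simp: char_gauss_law)
 qed
qed

lemma nn_integral_fourth: "(\<integral>\<^sup>+wo. ennreal ((arr wo x) ^ 4) \<partial>M) = 3"
proof -
 have "(\<integral>\<^sup>+wo. ennreal ((arr wo x) ^ 4) \<partial>M) = (\<integral>\<^sup>+y. ennreal (y ^ 4) \<partial>distr M borel (\<xi> x))"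
  by (subst nn_integral_distr) (auto simp: arr_def)
 also have "... = ennreal (\<integral>y. y ^ 4 \<partial>std_normal_distribution)"
  unfolding law using std_normal_moments(1)[of 4] by (intro nn_integral_eq_integral) auto
 finally show ?thesis by (simp add: std_normal_moments(4))
qed

lemma level_fourth_measurable [measurable]: "(\<lambda>wo. level_fourth (arr wo) i r) \<in> borel_measurable M"
 unfolding level_fourth_def by measurable

lemma level_bound_measurable [measurable]: "(\<lambda>wo. level_bound (arr wo) i r) \<in> borel_measurable M"
 unfolding level_bound_def by measurable

lemma nn_integral_level_fourth_le:
 "(\<integral>\<^sup>+wo. ennreal (level_fourth (arr wo) i r) \<partial>M) <= ennreal (3 * (real r + 1) * 2 ^ r)"
proof -
 have "(\<integral>\<^sup>+wo. ennreal (level_fourth (arr wo) i r) \<partial>M) =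
   (\<integral>\<^sup>+wo. (\<Sum>p\<le>r. \<Sum>a<bm_count p. \<Sum>b<2 ^ (r - p). ennreal ((arr wo (i, p, a, r - p, b)) ^ 4)) \<partial>M)"
  unfolding level_fourth_def by (simp add: sum_nonneg sum_ennreal[symmetric] del: sum_ennreal)
 also have "... = (\<Sum>p\<le>r. \<Sum>a<bm_count p. \<Sum>b<(2::nat) ^ (r - p). 3)"
  by (simp add: nn_integral_sum nn_integral_fourth del: sum_ennreal sum_constant)
 also have "... = (\<Sum>p\<le>r. ennreal (3 * (real (bm_count p) * 2 ^ (r - p))))"
 proof (rule sum.cong[OF refl])
  fix p
  have "(\<Sum>a<bm_count p. \<Sum>b<(2::nat) ^ (r - p). (3::ennreal)) = of_nat (bm_count p * (2 ^ (r - p) * 3))" by simp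
  also have "... = ennreal (real (bm_count p * (2 ^ (r - p) * 3)))" by (rule ennreal_of_nat_eq_real_of_nat)
  also have "real (bm_count p * (2 ^ (r - p) * 3)) = 3 * (real (bm_count p) * 2 ^ (r - p))" by simp
  finally show "(\<Sum>a<bm_count p. \<Sum>b<(2::nat) ^ (r - p). (3::ennreal)) = ennreal (3 * (real (bm_count p) * 2 ^ (r - p)))" .
 qed
 also have "... <= (\<Sum>p\<le>r. ennreal (3 * 2 ^ r))"
 proof (intro sum_mono ennreal_leI mult_left_mono)
  fix p assume p: "p \<in> {..r}"
  have "real (bm_count p) <= 2 ^ p" by (cases p) (auto simp: bm_count_def)
  then have "real (bm_count p) * 2 ^ (r - p) <= 2 ^ p * 2 ^ (r - p)" by (intro mult_right_mono) auto
  also have "... = 2 ^ r" using p by (simp add: power_add[symmetric])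
  finally show "real (bm_count p) * 2 ^ (r - p) <= 2 ^ r" .
 qed simp
 also have "... = ennreal (3 * (real r + 1) * 2 ^ r)"
 proof -
  have "(\<Sum>p\<le>r. ennreal (3 * 2 ^ r)) = ennreal (\<Sum>p\<le>r. 3 * 2 ^ r)" by (rule sum_ennreal) simp
  also have "(\<Sum>p\<le>r. 3 * 2 ^ r) = 3 * (real r + 1) * 2 ^ r" by (simp add: algebra_simps)
  finally show ?thesis .
 qed
 finally show ?thesis .
qed

lemma nn_integral_level_bound_le:
 "(\<integral>\<^sup>+wo. ennreal (level_bound (arr wo) i r) \<partial>M) <= ennreal (4 * (real r + 1)\<^sup>2 / root4 ^ r)"
proof -
 let ?l = "root4 ^ r"
 have l: "?l > 0" "?l >= 1" using root4(1) by (auto intro: one_le_power)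
 have "(\<integral>\<^sup>+wo. ennreal (level_bound (arr wo) i r) \<partial>M) =
  (\<integral>\<^sup>+wo. ennreal ((real r + 1) / ?l) + ennreal ((real r + 1) / ?l ^ 5) * ennreal (level_fourth (arr wo) i r) \<partial>M)"
 proof (rule nn_integral_cong)
  fix wo
  have "level_bound (arr wo) i r = (real r + 1) / ?l + (real r + 1) / ?l ^ 5 * level_fourth (arr wo) i r"
  proof -
   have "R * (z + F / z ^ 3) / z\<^sup>2 = R / z + R / z ^ 5 * F" if "z > 0" for R z F :: real
    using that by (simp add: field_simps eval_nat_numeral)
   from this[OF l(1)] show ?thesis by (simp add: level_bound_def)
  qed
  then show "ennreal (level_bound (arr wo) i r) = ennreal ((real r + 1) / ?l) + ennreal ((real r + 1) / ?l ^ 5) * ennreal (level_fourth (arr wo) i r)"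
   using l level_fourth_nonneg[of "arr wo" i r] by (simp add: ennreal_mult[symmetric] ennreal_plus[symmetric] del: ennreal_plus)
 qed
 also have "... = ennreal ((real r + 1) / ?l) + ennreal ((real r + 1) / ?l ^ 5) * (\<integral>\<^sup>+wo. ennreal (level_fourth (arr wo) i r) \<partial>M)"
  by (subst nn_integral_add) (auto simp: nn_integral_cmult emeasure_space_1)
 also have "... <= ennreal ((real r + 1) / ?l) + ennreal ((real r + 1) / ?l ^ 5) * ennreal (3 * (real r + 1) * 2 ^ r)"
  by (intro add_left_mono mult_left_mono nn_integral_level_fourth_le) auto
 also have "... = ennreal ((real r + 1) / ?l + (real r + 1) / ?l ^ 5 * (3 * (real r + 1) * ?l ^ 4))"
  unfolding root4(3) using l by (simp add: ennreal_mult[symmetric] ennreal_plus[symmetric] del: ennreal_plus)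
 also have "... <= ennreal (4 * (real r + 1)\<^sup>2 / ?l)"
 proof (rule ennreal_leI)
  have "(real r + 1) / ?l ^ 5 * (3 * (real r + 1) * ?l ^ 4) = 3 * (real r + 1)\<^sup>2 / ?l"
  proof -
   have "R / z ^ 5 * (3 * R * z ^ 4) = 3 * R\<^sup>2 / z" if "z > 0" for R z :: real
    using that by (simp add: field_simps eval_nat_numeral)
   from this[OF l(1)] show ?thesis .
  qed
  moreover have "(real r + 1) / ?l <= (real r + 1)\<^sup>2 / ?l"
   using l by (intro divide_right_mono) (auto simp: power2_eq_square)
  ultimately show "(real r + 1) / ?l + (real r + 1) / ?l ^ 5 * (3 * (real r + 1) * ?l ^ 4) <= 4 * (real r + 1)\<^sup>2 / ?l"
   by simp
 qed
 finally show ?thesis .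
qed

lemma summable_poly_geometric:
 assumes "0 < w" "w < (1::real)"
 shows "summable (\<lambda>r. (real r + 1)\<^sup>2 * (w\<^sup>2) ^ r)"
proof -
 have s: "summable (\<lambda>r. (real r + 1) * w ^ r)"
  using geometric_deriv_sums[of w] assms by (auto simp: sums_iff add.commute)
 have "(\<lambda>r. (real r + 1) * w ^ r) \<longlonglongrightarrow> 0" by (rule summable_LIMSEQ_zero[OF s])
 then have "Bseq (\<lambda>r. (real r + 1) * w ^ r)" by (intro convergent_imp_Bseq convergentI)
 then obtain B where B: "\<And>r. norm ((real r + 1) * w ^ r) <= B" by (meson BseqE)
 show ?thesis
 proof (rule summable_comparison_test')
  show "summable (\<lambda>r. B * ((real r + 1) * w ^ r))" by (intro summable_mult s)
  fix r :: nat
  have "norm ((real r + 1)\<^sup>2 * (w\<^sup>2) ^ r) = ((real r + 1) * w ^ r) * ((real r + 1) * w ^ r)"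
   using assms by (simp add: power2_eq_square power_mult_distrib)
  also have "... <= B * ((real r + 1) * w ^ r)"
   using B[of r] assms by (intro mult_right_mono) auto
  finally show "norm ((real r + 1)\<^sup>2 * (w\<^sup>2) ^ r) <= B * ((real r + 1) * w ^ r)" .
 qed
qed

text \<open>
  The expectation of \<open>level_bound\<close> is at most a polynomial times
  \<open>2\<^sup>-\<^sup>r\<^sup>/\<^sup>4\<close>.
\<close>
lemma AE_good_array: "AE wo in M. good_array (arr wo)"
 unfolding good_array_def AE_all_countable
proof
 fix i
 show "AE wo in M. summable (level_bound (arr wo) i)"
 proof (rule AE_summable_of_nn_integral_bound[where X = "\<lambda>r wo. level_bound (arr wo) i r"])
  define w where "w = sqrt (1 / root4)"
  have w: "0 < w" "w < 1" "w\<^sup>2 = 1 / root4" using root4(1) by (auto simp: w_def)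
  have "(\<lambda>r. 4 * (real r + 1)\<^sup>2 / root4 ^ r) = (\<lambda>r. 4 * ((real r + 1)\<^sup>2 * (w\<^sup>2) ^ r))"
   unfolding w(3) by (rule ext) (simp add: power_divide)
  then show "summable (\<lambda>r. 4 * (real r + 1)\<^sup>2 / root4 ^ r)"
   by (simp only:) (rule summable_mult[OF summable_poly_geometric[OF w(1,2)]])
  show "AE wo in M. \<forall>n. 0 <= level_bound (arr wo) i n" by (simp add: level_bound_nonneg)
  show "(\<integral>\<^sup>+wo. ennreal (level_bound (arr wo) i r) \<partial>M) <= ennreal (4 * (real r + 1)\<^sup>2 / root4 ^ r)" for r
   by (rule nn_integral_level_bound_le)
  show "0 <= 4 * (real r + 1)\<^sup>2 / root4 ^ r" for r using root4(1) by simp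
  show "(\<lambda>wo. level_bound (arr wo) i r) \<in> borel_measurable M" for r by (rule level_bound_measurable)
 qed
qed

end

context sheet_noise begin

definition kief :: "real \<times> real => 'w => real" where "kief z w = kiefer_of (arr w) z"

definition kcov :: "real \<times> real => real \<times> real => real" where
 "kcov z z' = (min (fst z) (fst z') - fst z * fst z') * min (snd z) (snd z')"

definition sheet_coeff :: "real \<times> real => sheet_index => real" where
 "sheet_coeff z x = (case x of (i, p, a, q, b) => bm_basis p a (clamp01 (snd z - real i)) * schauder q b (fst z))"

text \<open>
  Finite sets of coefficients exhausting those of the first \<open>N\<close> strips, level by level.
\<close>
definition index_upto :: "nat => nat => sheet_index set" where
 "index_upto N R = (\<lambda>(i, r, p, a, b). (i, p, a, r - p, b)) `
   (SIGMA i:{..<N}. SIGMA r:{..<R}. SIGMA p:{..r}. SIGMA a:{..<bm_count p}. {..<2 ^ (r - p)})"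

lemma sum_index_upto:
 "(\<Sum>x\<in>index_upto N R. f x) =
  (\<Sum>i<N. \<Sum>r<R. \<Sum>p\<le>r. \<Sum>a<bm_count p. \<Sum>b<2 ^ (r - p). f (i, p, a, r - p, b))" for f :: "sheet_index => real"
proof -
 have inj: "inj_on (\<lambda>(i, r, p, a, b). (i, p, a, r - p, b))
   (SIGMA i:{..<N}. SIGMA r:{..<R}. SIGMA p:{..r}. SIGMA a:{..<bm_count p}. {..<2 ^ (r - p)})"
  by (auto simp: inj_on_def)
 have "(\<Sum>x\<in>index_upto N R. f x) =
  (\<Sum>(i, r, p, a, b)\<in>(SIGMA i:{..<N}. SIGMA r:{..<R}. SIGMA p:{..r}. SIGMA a:{..<bm_count p}. {..<2 ^ (r - p)}). f (i, p, a, r - p, b))"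
  unfolding index_upto_def by (subst sum.reindex[OF inj]) (auto intro!: sum.cong)
 then show ?thesis by (simp add: sum.Sigma)
qed

lemma finite_index_upto: "finite (index_upto N R)"
 unfolding index_upto_def by (intro finite_imageI finite_SigmaI) auto

lemma kief_limit:
 assumes good: "good_array (arr w)" and t: "snd z <= real N"
 shows "(\<lambda>R. \<Sum>x\<in>index_upto N R. sheet_coeff z x * arr w x) \<longlonglongrightarrow> kief z w"
proof -
 have "(\<lambda>R. \<Sum>i<N. \<Sum>r<R. sheet_level (arr w) i r (fst z) (clamp01 (snd z - real i))) \<longlonglongrightarrow>
   (\<Sum>i<N. sheet (arr w) i (fst z) (clamp01 (snd z - real i)))"
  using sheet_sums[OF good clamp01_in] by (intro tendsto_sum) (simp add: sums_def)
 also have "(\<Sum>i<N. sheet (arr w) i (fst z) (clamp01 (snd z - real i))) = kief z w"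
  using kiefer_of_eq[OF good t, of "fst z"] by (simp add: kief_def)
 also have "(\<lambda>R. \<Sum>i<N. \<Sum>r<R. sheet_level (arr w) i r (fst z) (clamp01 (snd z - real i))) =
   (\<lambda>R. \<Sum>x\<in>index_upto N R. sheet_coeff z x * arr w x)"
  unfolding sum_index_upto sheet_level_def sheet_coeff_def by (simp add: mult.commute)
 finally show ?thesis .
qed

lemma clamp01_min_sum:
 assumes "0 <= t" "0 <= t'" "t <= real N" "t' <= real N"
 shows "(\<Sum>i<N. min (clamp01 (t - real i)) (clamp01 (t' - real i))) = min t t'"
proof -
 have "min (clamp01 (t - real i)) (clamp01 (t' - real i)) = min (min t t') (real (Suc i)) - min (min t t') (real i)" for i
  by (auto simp: clamp01_def min_def max_def)
 then have "(\<Sum>i<N. min (clamp01 (t - real i)) (clamp01 (t' - real i))) =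
   (\<Sum>i<N. min (min t t') (real (Suc i)) - min (min t t') (real i))" by simp
 also have "... = min (min t t') (real N) - min (min t t') (real 0)" by (rule sum_lessThan_telescope)
 finally show ?thesis using assms by (simp add: min_def)
qed

text \<open>
  On a strip the covariance is a Cauchy product of the covariance series in time and in space, both with nonnegative
  terms; the time increments then telescope over the strips.
\<close>
lemma cov_limit:
 assumes z: "z \<in> kiefer_index" "z' \<in> kiefer_index" and N: "snd z <= real N" "snd z' <= real N"
 shows "(\<lambda>R. \<Sum>x\<in>index_upto N R. sheet_coeff z x * sheet_coeff z' x) \<longlonglongrightarrow> kcov z z'"
proof -
 let ?u = "\<lambda>i. clamp01 (snd z - real i)" and ?u' = "\<lambda>i. clamp01 (snd z' - real i)"
 have cov_lim: "(\<lambda>r. \<Sum>p\<le>r. bm_cov p (?u i) (?u' i) * schauder_cov (r - p) (fst z) (fst z')) sums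
   (min (?u i) (?u' i) * bridge_cov (fst z) (fst z'))" for i
 proof -
  have b: "(\<lambda>p. bm_cov p (?u i) (?u' i)) sums min (?u i) (?u' i)"
   by (rule bm_cov_sums[OF clamp01_in clamp01_in])
  have s: "(\<lambda>q. schauder_cov q (fst z) (fst z')) sums bridge_cov (fst z) (fst z')"
   by (rule schauder_cov_sums)
  have "summable (\<lambda>p. norm (bm_cov p (?u i) (?u' i)))"
   using b clamp01_in[of "snd z - real i"] clamp01_in[of "snd z' - real i"]
   by (simp add: bm_cov_nonneg sums_iff)
  moreover have "summable (\<lambda>q. norm (schauder_cov q (fst z) (fst z')))"
   using s by (simp add: schauder_cov_nonneg sums_iff)
  ultimately show ?thesis
   using Cauchy_product_sums[of "\<lambda>p. bm_cov p (?u i) (?u' i)" "\<lambda>q. schauder_cov q (fst z) (fst z')"] b s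
   by (simp add: sums_iff)
 qed
 have "(\<lambda>R. \<Sum>i<N. \<Sum>r<R. \<Sum>p\<le>r. bm_cov p (?u i) (?u' i) * schauder_cov (r - p) (fst z) (fst z')) \<longlonglongrightarrow>
   (\<Sum>i<N. min (?u i) (?u' i) * bridge_cov (fst z) (fst z'))"
  using cov_lim by (intro tendsto_sum) (simp add: sums_def)
 also have "(\<Sum>i<N. min (?u i) (?u' i) * bridge_cov (fst z) (fst z')) = kcov z z'"
 proof -
  have "(\<Sum>i<N. min (?u i) (?u' i) * bridge_cov (fst z) (fst z')) =
    (\<Sum>i<N. min (?u i) (?u' i)) * bridge_cov (fst z) (fst z')"
   by (rule sum_distrib_right[symmetric])
  also have "(\<Sum>i<N. min (?u i) (?u' i)) = min (snd z) (snd z')"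
   using z N by (intro clamp01_min_sum) (auto simp: kiefer_index_def)
  also have "min (snd z) (snd z') * bridge_cov (fst z) (fst z') = kcov z z'"
   using z by (auto simp: kcov_def bridge_cov_def kiefer_index_def)
  finally show ?thesis .
 qed
 also have "(\<lambda>R. \<Sum>i<N. \<Sum>r<R. \<Sum>p\<le>r. bm_cov p (?u i) (?u' i) * schauder_cov (r - p) (fst z) (fst z')) =
   (\<lambda>R. \<Sum>x\<in>index_upto N R. sheet_coeff z x * sheet_coeff z' x)"
  unfolding sum_index_upto bm_cov_def schauder_cov_def sum_product
  by (simp add: sheet_coeff_def mult_ac)
 finally show ?thesis .
qed

lemma good_array_measurable [measurable]: "Measurable.pred M (\<lambda>w. good_array (arr w))"
proof -
 have "Measurable.pred M (\<lambda>w. Cauchy (\<lambda>n. \<Sum>r<n. level_bound (arr w) i r))" for i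
  unfolding pred_def by (rule sets_Collect_Cauchy) measurable
 then show ?thesis
  unfolding good_array_def summable_iff_convergent Cauchy_convergent_iff[symmetric] by measurable
qed

lemma kief_measurable [measurable]: "kief z \<in> borel_measurable M"
proof -
 have "(\<lambda>w. sheet_level (arr w) i r s u) \<in> borel_measurable M" for i r s u
  unfolding sheet_level_def by measurable
 then have "(\<lambda>w. if good_array (arr w) then \<Sum>i<nat \<lceil>snd z\<rceil>. sheet (arr w) i (fst z) (clamp01 (snd z - real i)) else 0) \<in> borel_measurable M"
  unfolding sheet_def by (intro measurable_If borel_measurable_sum borel_measurable_suminf) auto
 then show ?thesis by (simp add: kief_def kiefer_of_def fun_eq_iff[symmetric] cong: measurable_cong)
qed

lemma distr_kief_combination:
 assumes J: "finite J" "J \<subseteq> kiefer_index"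
 shows "distr M borel (\<lambda>w. \<Sum>z\<in>J. c z * kief z w) = gauss_law (sqrt (\<Sum>z\<in>J. \<Sum>z'\<in>J. c z * c z' * kcov z z'))"
proof -
 obtain N :: nat where N: "\<And>z. z \<in> J ==> snd z <= real N"
 proof -
  obtain N :: nat where "Max (insert 0 (snd ` J)) <= real N" using real_arch_simple by blast
  then have "snd z <= real N" if "z \<in> J" for z using J(1) that by (simp add: order.trans[OF Max_ge])
  then show ?thesis by (rule that)
 qed
 show ?thesis
 proof (rule gauss_law_limit[where I = "index_upto N" and c = "\<lambda>R x. \<Sum>z\<in>J. c z * sheet_coeff z x"])
  show "AE w in M. (\<lambda>R. \<Sum>x\<in>index_upto N R. (\<Sum>z\<in>J. c z * sheet_coeff z x) * arr w x) \<longlonglongrightarrow> (\<Sum>z\<in>J. c z * kief z w)"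
   using AE_good_array
  proof eventually_elim
   case (elim w)
   have "(\<lambda>R. \<Sum>z\<in>J. c z * (\<Sum>x\<in>index_upto N R. sheet_coeff z x * arr w x)) \<longlonglongrightarrow> (\<Sum>z\<in>J. c z * kief z w)"
    using N by (intro tendsto_sum tendsto_mult_left kief_limit[OF elim]) auto
   also have "(\<lambda>R. \<Sum>z\<in>J. c z * (\<Sum>x\<in>index_upto N R. sheet_coeff z x * arr w x)) =
     (\<lambda>R. \<Sum>x\<in>index_upto N R. (\<Sum>z\<in>J. c z * sheet_coeff z x) * arr w x)"
    unfolding sum_distrib_left sum_distrib_right by (subst sum.swap) (simp add: mult.assoc)
   finally show ?case .
  qed
  have "(\<lambda>R. \<Sum>z\<in>J. \<Sum>z'\<in>J. c z * c z' * (\<Sum>x\<in>index_upto N R. sheet_coeff z x * sheet_coeff z' x)) \<longlonglongrightarrow>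
    (\<Sum>z\<in>J. \<Sum>z'\<in>J. c z * c z' * kcov z z')"
   using J N by (intro tendsto_sum tendsto_mult_left cov_limit) auto
  also have "(\<lambda>R. \<Sum>z\<in>J. \<Sum>z'\<in>J. c z * c z' * (\<Sum>x\<in>index_upto N R. sheet_coeff z x * sheet_coeff z' x)) =
   (\<lambda>R. \<Sum>x\<in>index_upto N R. (\<Sum>z\<in>J. c z * sheet_coeff z x)\<^sup>2)"
  proof (rule ext)
   fix R
   have "(\<Sum>z\<in>J. \<Sum>z'\<in>J. c z * c z' * (\<Sum>x\<in>index_upto N R. sheet_coeff z x * sheet_coeff z' x)) =
     (\<Sum>z\<in>J. \<Sum>x\<in>index_upto N R. \<Sum>z'\<in>J. (c z * sheet_coeff z x) * (c z' * sheet_coeff z' x))"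
    unfolding sum_distrib_left by (intro sum.cong refl, subst sum.swap) (simp add: mult_ac)
   also have "... = (\<Sum>x\<in>index_upto N R. \<Sum>z\<in>J. \<Sum>z'\<in>J. (c z * sheet_coeff z x) * (c z' * sheet_coeff z' x))"
    by (rule sum.swap)
   finally show "(\<Sum>z\<in>J. \<Sum>z'\<in>J. c z * c z' * (\<Sum>x\<in>index_upto N R. sheet_coeff z x * sheet_coeff z' x)) =
     (\<Sum>x\<in>index_upto N R. (\<Sum>z\<in>J. c z * sheet_coeff z x)\<^sup>2)"
    by (simp add: power2_eq_square sum_product)
  qed
  finally show "(\<lambda>R. \<Sum>x\<in>index_upto N R. (\<Sum>z\<in>J. c z * sheet_coeff z x)\<^sup>2) \<longlonglongrightarrow> (\<Sum>z\<in>J. \<Sum>z'\<in>J. c z * c z' * kcov z z')" .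
 qed (auto simp: finite_index_upto)
qed

lemma kcov_nonneg: "z \<in> kiefer_index ==> kcov z z >= 0"
 by (auto simp: kcov_def kiefer_index_def mult_left_le intro!: mult_nonneg_nonneg)

lemma kcov_sym: "kcov z z' = kcov z' z"
 by (simp add: kcov_def min.commute mult.commute)

text \<open>
  It is a limit of sums of squares.
\<close>
lemma quadratic_form_nonneg:
 assumes J: "finite J" "J \<subseteq> kiefer_index"
 shows "(\<Sum>z\<in>J. \<Sum>z'\<in>J. c z * c z' * kcov z z') >= 0"
proof -
 obtain N :: nat where N: "\<And>z. z \<in> J ==> snd z <= real N"
 proof -
  obtain N :: nat where "Max (insert 0 (snd ` J)) <= real N" using real_arch_simple by blast
  then have "snd z <= real N" if "z \<in> J" for z using J(1) that by (simp add: order.trans[OF Max_ge])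
  then show ?thesis by (rule that)
 qed
 have "(\<lambda>R. \<Sum>z\<in>J. \<Sum>z'\<in>J. c z * c z' * (\<Sum>x\<in>index_upto N R. sheet_coeff z x * sheet_coeff z' x)) \<longlonglongrightarrow>
   (\<Sum>z\<in>J. \<Sum>z'\<in>J. c z * c z' * kcov z z')"
  using J N by (intro tendsto_sum tendsto_mult_left cov_limit) auto
 then show ?thesis
 proof (rule LIMSEQ_le_const, intro exI[of _ 0] allI impI)
  fix R
  have "(\<Sum>z\<in>J. \<Sum>z'\<in>J. c z * c z' * (\<Sum>x\<in>index_upto N R. sheet_coeff z x * sheet_coeff z' x)) =
     (\<Sum>z\<in>J. \<Sum>x\<in>index_upto N R. \<Sum>z'\<in>J. (c z * sheet_coeff z x) * (c z' * sheet_coeff z' x))"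
    unfolding sum_distrib_left by (intro sum.cong refl, subst sum.swap) (simp add: mult_ac)
  also have "... = (\<Sum>x\<in>index_upto N R. \<Sum>z\<in>J. \<Sum>z'\<in>J. (c z * sheet_coeff z x) * (c z' * sheet_coeff z' x))"
    by (rule sum.swap)
  also have "... = (\<Sum>x\<in>index_upto N R. (\<Sum>z\<in>J. c z * sheet_coeff z x)\<^sup>2)"
   by (simp add: power2_eq_square sum_product)
  also have "... >= 0" by (intro sum_nonneg) simp
  finally show "0 <= (\<Sum>z\<in>J. \<Sum>z'\<in>J. c z * c z' * (\<Sum>x\<in>index_upto N R. sheet_coeff z x * sheet_coeff z' x))" .
 qed
qed

lemma moments_of_gauss:
 assumes X[measurable]: "X \<in> borel_measurable M" and d: "distr M borel X = gauss_law \<sigma>"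
 shows "integrable M X" "expectation X = 0" "integrable M (\<lambda>w. (X w)\<^sup>2)" "expectation (\<lambda>w. (X w)\<^sup>2) = \<sigma>\<^sup>2"
proof -
 note g = gauss_law_moments[of \<sigma>, folded d]
 show "integrable M X" using g(1) by (subst (asm) integrable_distr_eq) auto
 show "integrable M (\<lambda>w. (X w)\<^sup>2)" using g(3) by (subst (asm) integrable_distr_eq) auto
 show "expectation X = 0" using g(2) by (subst (asm) integral_distr) auto
 show "expectation (\<lambda>w. (X w)\<^sup>2) = \<sigma>\<^sup>2" using g(4) by (subst (asm) integral_distr) auto
qed

lemma distr_kief_single: "z \<in> kiefer_index ==> distr M borel (kief z) = gauss_law (sqrt (kcov z z))"
 using distr_kief_combination[of "{z}" "\<lambda>_. 1"] by simp

lemma distr_kief_pair: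
 assumes "z \<in> kiefer_index" "z' \<in> kiefer_index" "z \<noteq> z'"
 shows "distr M borel (\<lambda>w. kief z w + d * kief z' w) = gauss_law (sqrt (kcov z z + 2 * d * kcov z z' + d\<^sup>2 * kcov z' z'))"
  "0 <= kcov z z + 2 * d * kcov z z' + d\<^sup>2 * kcov z' z'"
proof -
 let ?c = "\<lambda>y. if y = z then 1 else d"
 have s: "(\<Sum>y\<in>{z, z'}. \<Sum>y'\<in>{z, z'}. ?c y * ?c y' * kcov y y') = kcov z z + 2 * d * kcov z z' + d\<^sup>2 * kcov z' z'"
  using assms by (simp add: kcov_sym[of z' z] power2_eq_square algebra_simps)
 show "distr M borel (\<lambda>w. kief z w + d * kief z' w) = gauss_law (sqrt (kcov z z + 2 * d * kcov z z' + d\<^sup>2 * kcov z' z'))"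
  using distr_kief_combination[of "{z, z'}" ?c] assms unfolding s by simp
 show "0 <= kcov z z + 2 * d * kcov z z' + d\<^sup>2 * kcov z' z'"
  using quadratic_form_nonneg[of "{z, z'}" ?c] assms unfolding s by simp
qed

text \<open>
  By polarisation from the variances of linear combinations.
\<close>
lemma expectation_kief_mult:
 assumes "z \<in> kiefer_index" "z' \<in> kiefer_index"
 shows "expectation (\<lambda>w. kief z w * kief z' w) = kcov z z'"
proof (cases "z = z'")
 case True
 then show ?thesis
  using moments_of_gauss(4)[OF kief_measurable distr_kief_single[OF assms(1)]] kcov_nonneg[OF assms(1)]
  by (simp add: power2_eq_square)
next
 case False
 note p = distr_kief_pair[OF assms False, of 1] and m = distr_kief_pair[OF assms False, of "-1"]
 note mp = moments_of_gauss(3,4)[OF _ p(1)] and mm = moments_of_gauss(3,4)[OF _ m(1)]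
 have "expectation (\<lambda>w. kief z w * kief z' w) =
   expectation (\<lambda>w. ((kief z w + 1 * kief z' w)\<^sup>2 - (kief z w + (-1) * kief z' w)\<^sup>2) / 4)"
  by (intro Bochner_Integration.integral_cong refl) (simp add: power2_eq_square algebra_simps)
 also have "... = (expectation (\<lambda>w. (kief z w + 1 * kief z' w)\<^sup>2) - expectation (\<lambda>w. (kief z w + (-1) * kief z' w)\<^sup>2)) / 4"
  using mp(1) mm(1) by simp
 also have "... = kcov z z'"
  using mp(2) mm(2) p(2) m(2) by simp
 finally show ?thesis .
qed

lemma kiefer_process_kief: "kiefer_process M kief"
 unfolding kiefer_process_def
proof (intro conjI)
 show "gaussian_process M kiefer_index kief"
  unfolding gaussian_process_def gaussian_rv_def
 proof (intro allI impI conjI)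
  fix J c assume J: "finite J \<and> J \<subseteq> kiefer_index"
  show "(\<lambda>w. \<Sum>t\<in>J. c t * kief t w) \<in> borel_measurable M" by measurable
  let ?s = "sqrt (\<Sum>z\<in>J. \<Sum>z'\<in>J. c z * c z' * kcov z z')"
  have "?s >= 0" using quadratic_form_nonneg[of J c] J by simp
  then show "\<exists>m \<sigma>. \<sigma> >= 0 \<and> distr M borel (\<lambda>w. \<Sum>t\<in>J. c t * kief t w) =
    (if \<sigma> = 0 then return borel m else density lborel (normal_density m \<sigma>))"
   using distr_kief_combination[of J c] J gauss_law_eq[of ?s] by (intro exI[of _ 0] exI[of _ ?s]) simp
 qed
 show "\<forall>p\<in>kiefer_index. (\<integral>w. kief p w \<partial>M) = 0"
  using moments_of_gauss(2)[OF kief_measurable distr_kief_single] by blast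
 show "\<forall>(s1, t1)\<in>kiefer_index. \<forall>(s2, t2)\<in>kiefer_index.
    (\<integral>w. kief (s1, t1) w * kief (s2, t2) w \<partial>M) = (min s1 s2 - s1 * s2) * min t1 t2"
 proof (clarify)
  fix s1 t1 s2 t2 assume "(s1, t1) \<in> kiefer_index" "(s2, t2) \<in> kiefer_index"
  from expectation_kief_mult[OF this]
  show "(\<integral>w. kief (s1, t1) w * kief (s2, t2) w \<partial>M) = (min s1 s2 - s1 * s2) * min t1 t2"
   by (simp add: kcov_def)
 qed
 show "\<forall>w\<in>space M. continuous_on kiefer_index (\<lambda>p. kief p w)"
  unfolding kief_def using continuous_on_subset[OF continuous_kiefer_of] by auto
qed

end

section \<open>Conditioning on an independent variable\<close>

context prob_space begin

lemma joint_law_compose: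
 assumes ind: "indep_var S X T Y" and g: "g \<in> measurable S S'" and h: "h \<in> measurable T T'"
 shows "distr M (S' \<Otimes>\<^sub>M T') (\<lambda>w. (g (X w), h (Y w))) =
  distr M S' (\<lambda>w. g (X w)) \<Otimes>\<^sub>M distr M T' (\<lambda>w. h (Y w))"
proof -
 have rv [measurable]: "X \<in> measurable M S" "Y \<in> measurable M T" and joint: "distr M S X \<Otimes>\<^sub>M distr M T Y = distr M (S \<Otimes>\<^sub>M T) (\<lambda>w. (X w, Y w))"
  using ind unfolding indep_var_distribution_eq by auto
 note [measurable] = g h
 have sf: "sigma_finite_measure (distr (distr M T Y) T' h)"
  by (intro prob_space_imp_sigma_finite prob_space.prob_space_distr prob_space_distr) auto
 have "distr M S' (\<lambda>w. g (X w)) \<Otimes>\<^sub>M distr M T' (\<lambda>w. h (Y w)) =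
   distr (distr M S X) S' g \<Otimes>\<^sub>M distr (distr M T Y) T' h"
  by (subst (1 2) distr_distr) (auto simp: o_def)
 also have "... = distr (distr M (S \<Otimes>\<^sub>M T) (\<lambda>w. (X w, Y w))) (S' \<Otimes>\<^sub>M T') (\<lambda>(x, y). (g x, h y))"
  unfolding joint[symmetric] by (rule pair_measure_distr[OF _ _ sf]) auto
 also have "... = distr M (S' \<Otimes>\<^sub>M T') (\<lambda>w. (g (X w), h (Y w)))"
  by (subst distr_distr) (auto simp: o_def)
 finally show ?thesis by simp
qed

end

text \<open>
  Here \<open>X\<close> will be the data and \<open>Y\<close> the noise, which have different value types.
\<close>
locale independent_pair = prob_space M for M :: "'w measure" +
 fixes N1 :: "'a measure" and X :: "'w => 'a" and N2 :: "'b measure" and Y :: "'w => 'b"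
 assumes X [measurable]: "X \<in> measurable M N1" and Y [measurable]: "Y \<in> measurable M N2"
  and joint: "distr M (N1 \<Otimes>\<^sub>M N2) (\<lambda>w. (X w, Y w)) = distr M N1 X \<Otimes>\<^sub>M distr M N2 Y"
begin

lemma emeasure_rectangle:
 assumes A: "A \<in> sets N1" and B: "B \<in> sets N2"
 shows "emeasure M ((X -` A \<inter> space M) \<inter> (Y -` B \<inter> space M)) = emeasure M (X -` A \<inter> space M) * emeasure M (Y -` B \<inter> space M)"
proof -
 interpret L2: prob_space "distr M N2 Y" by (rule prob_space_distr) simp
 have "emeasure M ((X -` A \<inter> space M) \<inter> (Y -` B \<inter> space M)) = emeasure (distr M (N1 \<Otimes>\<^sub>M N2) (\<lambda>w. (X w, Y w))) (A \<times> B)"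
  using A B by (subst emeasure_distr) (auto intro!: arg_cong[where f = "emeasure M"])
 also have "... = emeasure (distr M N1 X) A * emeasure (distr M N2 Y) B"
  unfolding joint using A B by (intro L2.emeasure_pair_measure_Times) auto
 finally show ?thesis using A B by (simp add: emeasure_distr)
qed

lemma independent_rvs_compose:
 assumes g [measurable]: "g \<in> measurable N2 N2'" and h [measurable]: "h \<in> measurable N1 N1'"
 shows "independent_rvs M N2' (\<lambda>w. g (Y w)) N1' (\<lambda>w. h (X w))"
 unfolding independent_rvs_def
proof (intro conjI indep_setI)
 fix a b
 assume "a \<in> {(\<lambda>w. g (Y w)) -` A \<inter> space M |A. A \<in> sets N2'}" "b \<in> {(\<lambda>w. h (X w)) -` B \<inter> space M |B. B \<in> sets N1'}"
 then obtain A B where A: "A \<in> sets N2'" "a = (\<lambda>w. g (Y w)) -` A \<inter> space M"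
  and B: "B \<in> sets N1'" "b = (\<lambda>w. h (X w)) -` B \<inter> space M" by auto
 have a: "a = Y -` (g -` A \<inter> space N2) \<inter> space M" and b: "b = X -` (h -` B \<inter> space N1) \<inter> space M"
  using A B measurable_space[OF X] measurable_space[OF Y] by auto
 have "emeasure M (b \<inter> a) = emeasure M b * emeasure M a"
  unfolding a b by (rule emeasure_rectangle) (use A B in auto)
 then have "measure M (b \<inter> a) = measure M b * measure M a"
  by (simp add: measure_def enn2real_mult)
 then show "prob (a \<inter> b) = prob a * prob b" by (simp add: Int_commute mult.commute)
qed (use g h in \<open>auto intro: measurable_compose\<close>)

lemma nn_integral_pair:
 assumes f [measurable]: "f \<in> borel_measurable (N1 \<Otimes>\<^sub>M N2)"
 shows "(\<integral>\<^sup>+w. f (X w, Y w) \<partial>M) = (\<integral>\<^sup>+w. (\<integral>\<^sup>+y. f (X w, y) \<partial>distr M N2 Y) \<partial>M)"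
proof -
 interpret L2: prob_space "distr M N2 Y" by (rule prob_space_distr) simp
 have s: "sets (distr M N1 X \<Otimes>\<^sub>M distr M N2 Y) = sets (N1 \<Otimes>\<^sub>M N2)" by (intro sets_pair_measure_cong) auto
 have f': "f \<in> borel_measurable (distr M N1 X \<Otimes>\<^sub>M distr M N2 Y)" by (simp add: measurable_cong_sets[OF s refl])
 have g: "(\<lambda>x. \<integral>\<^sup>+y. f (x, y) \<partial>distr M N2 Y) \<in> borel_measurable (distr M N1 X)"
  by (rule L2.borel_measurable_nn_integral_fst[OF f'])
 have "(\<integral>\<^sup>+w. f (X w, Y w) \<partial>M) = (\<integral>\<^sup>+z. f z \<partial>distr M (N1 \<Otimes>\<^sub>M N2) (\<lambda>w. (X w, Y w)))"
  by (subst nn_integral_distr) auto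
 also have "... = (\<integral>\<^sup>+x. \<integral>\<^sup>+y. f (x, y) \<partial>distr M N2 Y \<partial>distr M N1 X)"
  unfolding joint by (rule L2.nn_integral_fst[OF f', symmetric])
 also have "... = (\<integral>\<^sup>+w. (\<integral>\<^sup>+y. f (X w, y) \<partial>distr M N2 Y) \<partial>M)"
  using g by (intro nn_integral_distr) auto
 finally show ?thesis .
qed

definition history :: "'w measure" where "history = vimage_algebra (space M) X N1"

lemma X_space: "X \<in> space M \<rightarrow> space N1" using measurable_space[OF X] by auto

lemma subalgebra_history: "subalgebra M history"
 unfolding subalgebra_def history_def using X_space by (auto simp: sets_vimage_algebra2)

lemma X_history: "X \<in> measurable history N1"
 unfolding history_def by (rule measurable_vimage_algebra1[OF X_space])

text \<open>
  Conditionally on \<open>X\<close> the variable \<open>Y\<close> keeps its law, so the conditional probability of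
  an event is the measure of its section. This is Fubini on the sets that generate the history.
\<close>
lemma cond_prob_pair:
 assumes D [measurable]: "D \<in> sets (N1 \<Otimes>\<^sub>M N2)"
 shows "AE w in M. cond_prob_given M history ((\<lambda>w. (X w, Y w)) -` D \<inter> space M) w =
   measure (distr M N2 Y) (Pair (X w) -` D)"
proof -
 interpret L2: prob_space "distr M N2 Y" by (rule prob_space_distr) simp
 interpret H: finite_measure_subalgebra M history
  by (intro finite_measure_subalgebra.intro finite_measure_subalgebra_axioms.intro subalgebra_history) unfold_locales
 let ?E = "(\<lambda>w. (X w, Y w)) -` D \<inter> space M"
 let ?g = "\<lambda>w. measure (distr M N2 Y) (Pair (X w) -` D)"
 have E [measurable]: "?E \<in> sets M" by (rule measurable_sets[OF _ D]) simp
 have s: "sets (N1 \<Otimes>\<^sub>M distr M N2 Y) = sets (N1 \<Otimes>\<^sub>M N2)" by (intro sets_pair_measure_cong) auto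
 have k: "(\<lambda>x. measure (distr M N2 Y) (Pair x -` D)) \<in> borel_measurable N1"
  unfolding measure_def by (intro measurable_compose[OF L2.measurable_emeasure_Pair]) (auto simp: s)
 have gF: "?g \<in> borel_measurable history" by (rule measurable_compose[OF X_history k])
 have gM [measurable]: "?g \<in> borel_measurable M" by (rule measurable_compose[OF X k])
 have int_g: "integrable M ?g"
  by (rule integrable_const_bound[where B = 1]) auto
 show ?thesis unfolding cond_prob_given_def
 proof (rule H.real_cond_exp_charact)
  fix A assume "A \<in> sets history"
  then obtain A' where A' [measurable]: "A' \<in> sets N1" and A: "A = X -` A' \<inter> space M"
   unfolding history_def using X_space by (auto simp: sets_vimage_algebra2)
  have AM [measurable]: "A \<in> sets M" unfolding A by measurable
  have "(\<integral>\<^sup>+w. ennreal (indicator A w * indicator ?E w) \<partial>M) = (\<integral>\<^sup>+w. (\<lambda>z. indicator A' (fst z) * indicator D z) (X w, Y w) \<partial>M)"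
   by (intro nn_integral_cong) (auto simp: A indicator_def)
  also have "... = (\<integral>\<^sup>+w. (\<integral>\<^sup>+y. indicator A' (X w) * indicator D (X w, y) \<partial>distr M N2 Y) \<partial>M)"
   by (subst nn_integral_pair) auto
  also have "... = (\<integral>\<^sup>+w. ennreal (indicator A w * ?g w) \<partial>M)"
  proof (rule nn_integral_cong)
   fix w assume w: "w \<in> space M"
   have x: "X w \<in> space N1" using w X_space by auto
   have Dw: "Pair (X w) -` D \<in> sets N2" using sets_Pair1[OF D] by simp
   have "(\<integral>\<^sup>+y. indicator A' (X w) * indicator D (X w, y) \<partial>distr M N2 Y) =
     indicator A' (X w) * (\<integral>\<^sup>+y. indicator (Pair (X w) -` D) y \<partial>distr M N2 Y)"
    using Dw by (subst nn_integral_cmult[symmetric]) (auto intro!: nn_integral_cong borel_measurable_indicator simp: indicator_def[of D] indicator_def[of "Pair (X w) -` D"])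
   also have "(\<integral>\<^sup>+y. indicator (Pair (X w) -` D) y \<partial>distr M N2 Y) = ennreal (?g w)"
    using Dw by (simp add: L2.emeasure_eq_measure)
   finally show "(\<integral>\<^sup>+y. indicator A' (X w) * indicator D (X w, y) \<partial>distr M N2 Y) = ennreal (indicator A w * ?g w)"
    using w by (auto simp: A indicator_def)
  qed
  finally show "(\<integral>w\<in>A. indicator ?E w \<partial>M) = (\<integral>w\<in>A. ?g w \<partial>M)"
   unfolding set_lebesgue_integral_def by (subst (1 2) integral_eq_nn_integral) (auto simp: )
 qed (use gF int_g in \<open>auto simp: emeasure_eq_measure\<close>)
qed

text \<open>
  The conditional law of a function of the pair freezes \<open>X\<close> and lets \<open>Y\<close> have its own law.
\<close>
lemma regular_cond_law_pair:
 assumes h [measurable]: "h \<in> measurable (N1 \<Otimes>\<^sub>M N2) N"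
 shows "regular_cond_law M history N (\<lambda>w. h (X w, Y w)) (\<lambda>w. distr (distr M N2 Y) N (\<lambda>y. h (X w, y)))"
 unfolding regular_cond_law_def
proof (intro conjI ballI)
 let ?Q = "distr M N2 Y"
 interpret L2: prob_space ?Q by (rule prob_space_distr) simp
 have Q: "?Q \<in> space (prob_algebra N2)" by (simp add: space_prob_algebra L2.prob_space_axioms)
 show "(\<lambda>w. h (X w, Y w)) \<in> measurable M N" by measurable
 have hx: "(\<lambda>y. h (x, y)) \<in> measurable ?Q N" if "x \<in> space N1" for x
  using that by simp
 have "(\<lambda>x. distr ?Q N (\<lambda>y. h (x, y))) \<in> measurable N1 (prob_algebra N)"
 proof (rule measurable_prob_algebraI)
  show "prob_space (distr ?Q N (\<lambda>y. h (x, y)))" if "x \<in> space N1" for x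
   by (rule L2.prob_space_distr[OF hx[OF that]])
  show "(\<lambda>x. distr ?Q N (\<lambda>y. h (x, y))) \<in> measurable N1 (subprob_algebra N)"
  proof (rule measurable_distr2)
   show "(\<lambda>(x, y). h (x, y)) \<in> measurable (N1 \<Otimes>\<^sub>M N2) N" by simp
   show "(\<lambda>x. ?Q) \<in> measurable N1 (subprob_algebra N2)"
    by (rule measurable_const) (simp add: space_subprob_algebra prob_space_imp_subprob_space L2.prob_space_axioms)
  qed
 qed
 then show "(\<lambda>w. distr ?Q N (\<lambda>y. h (X w, y))) \<in> measurable history (prob_algebra N)"
  by (rule measurable_compose[OF X_history])
 fix B assume B [measurable]: "B \<in> sets N"
 let ?D = "h -` B \<inter> space (N1 \<Otimes>\<^sub>M N2)"
 have D: "?D \<in> sets (N1 \<Otimes>\<^sub>M N2)" by measurable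
 have eq: "(\<lambda>w. (X w, Y w)) -` ?D \<inter> space M = (\<lambda>w. h (X w, Y w)) -` B \<inter> space M"
  using X_space measurable_space[OF Y] by (auto simp: space_pair_measure)
 have "measure ?Q (Pair (X w) -` ?D) = measure (distr ?Q N (\<lambda>y. h (X w, y))) B" if "w \<in> space M" for w
 proof -
  have x: "X w \<in> space N1" using that X_space by auto
  have "Pair (X w) -` ?D = (\<lambda>y. h (X w, y)) -` B \<inter> space ?Q" using x by (auto simp: space_pair_measure)
  then show ?thesis using measure_distr[OF hx[OF x] B] by simp
 qed
 then show "AE w in M. cond_prob_given M history ((\<lambda>w. h (X w, Y w)) -` B \<inter> space M) w =
    measure (distr ?Q N (\<lambda>y. h (X w, y))) B"
  using cond_prob_pair[OF D] AE_space unfolding eq by (auto elim: AE_mp intro!: AE_I2)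
qed

text \<open>
  The event \<open>E\<close> may involve both variables; the bound is uniform because the containing event involves
  \<open>Y\<close> only.
\<close>
lemma cond_prob_le_of_bad_event:
 assumes E: "E \<in> sets M" and B: "B \<in> sets N2"
  and sub: "\<And>w. w \<in> E ==> Y w \<in> B" and le: "measure (distr M N2 Y) B <= p"
 shows "AE w in M. cond_prob_given M history E w <= p"
proof -
 interpret H: finite_measure_subalgebra M history
  by (intro finite_measure_subalgebra.intro finite_measure_subalgebra_axioms.intro subalgebra_history) unfold_locales
 let ?D = "space N1 \<times> B" and ?E = "(\<lambda>w. (X w, Y w)) -` (space N1 \<times> B) \<inter> space M"
 have D: "?D \<in> sets (N1 \<Otimes>\<^sub>M N2)" using B by auto
 have E' [measurable]: "?E \<in> sets M" by (rule measurable_sets[OF _ D]) simp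
 have m: "measure (distr M N2 Y) (Pair (X w) -` ?D) <= p" if "w \<in> space M" for w
 proof -
  have "Pair (X w) -` ?D = B" using that X_space by auto
  then show ?thesis using le by simp
 qed
 have "AE w in M. cond_prob_given M history E w <= cond_prob_given M history ?E w"
  unfolding cond_prob_given_def
  using E E' sub X_space sets.sets_into_space[OF E]
  by (intro H.real_cond_exp_mono AE_I2) (fastforce simp: indicator_def emeasure_eq_measure)+
 then show ?thesis using cond_prob_pair[OF D] AE_space
 proof eventually_elim
  case (elim w)
  then show ?case using m[of w] by simp
 qed
qed

end

section \<open>Random measures with countably many atoms\<close>

definition atom_total :: "(nat => real) => ennreal" where "atom_total w = (\<Sum>k. ennreal (w k))"

definition proper_weights :: "(nat => real) => bool" where
 "proper_weights w \<longleftrightarrow> (\<forall>k. 0 <= w k) \<and> 0 < atom_total w \<and> atom_total w < \<infinity>"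

text \<open>
  The point mass as a default makes \<open>atomic_prob\<close> a probability measure for arbitrary input.
\<close>
definition norm_weight :: "(nat => real) => nat => real" where
 "norm_weight w k = (if proper_weights w then w k / enn2real (atom_total w) else if k = 0 then 1 else 0)"

definition atomic_prob :: "(nat => real) => (nat => real) => real measure" where
 "atomic_prob w l = distr (density (count_space UNIV) (\<lambda>k. ennreal (norm_weight w k))) borel l"

lemma sets_atomic_prob [simp, measurable_cong]: "sets (atomic_prob w l) = sets borel"
 by (simp add: atomic_prob_def)

lemma emeasure_atomic_prob:
 assumes "A \<in> sets borel"
 shows "emeasure (atomic_prob w l) A = (\<Sum>k. ennreal (norm_weight w k) * indicator A (l k))"
proof -
 have "emeasure (atomic_prob w l) A = (\<integral>\<^sup>+k. ennreal (norm_weight w k) * indicator (l -` A) k \<partial>count_space UNIV)"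
  unfolding atomic_prob_def using assms by (subst emeasure_distr) (auto simp: emeasure_density)
 also have "... = (\<Sum>k. ennreal (norm_weight w k) * indicator A (l k))"
  by (subst nn_integral_count_space_nat) (auto simp: indicator_def)
 finally show ?thesis .
qed

lemma norm_weight_sum: "(\<Sum>k. ennreal (norm_weight w k)) = 1"
proof (cases "proper_weights w")
 case True
 then have t: "0 < enn2real (atom_total w)" "ennreal (enn2real (atom_total w)) = atom_total w"
  by (auto simp: proper_weights_def enn2real_positive_iff)
 have nw: "ennreal (norm_weight w k) = ennreal (w k) / atom_total w" for k
 proof -
  have "ennreal (norm_weight w k) = ennreal (w k) / ennreal (enn2real (atom_total w))"
   using True divide_ennreal[OF _ t(1), of "w k"] by (simp add: norm_weight_def proper_weights_def)
  then show ?thesis unfolding t(2) .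
 qed
 have "(\<Sum>k. ennreal (norm_weight w k)) = (\<Sum>k. ennreal (w k) / atom_total w)"
  unfolding nw ..
 also have "... = atom_total w / atom_total w"
  unfolding divide_ennreal_def atom_total_def by (rule ennreal_suminf_multc)
 also have "... = 1" using True by (auto simp: proper_weights_def ennreal_divide_self)
 finally show ?thesis .
next
 case False
 then show ?thesis by (subst suminf_finite[of "{0}"]) (auto simp: norm_weight_def)
qed

lemma prob_space_atomic_prob: "prob_space (atomic_prob w l)"
proof (rule prob_spaceI)
 have "space (atomic_prob w l) = UNIV" by (simp add: atomic_prob_def)
 then show "emeasure (atomic_prob w l) (space (atomic_prob w l)) = 1"
  using emeasure_atomic_prob[of UNIV w l] norm_weight_sum[of w] by simp
qed

lemma measure_atomic_prob:
 assumes A: "A \<in> sets borel" and w: "\<And>k. 0 <= w k" "summable w" "suminf w > 0"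
 shows "measure (atomic_prob w l) A = (\<Sum>k. w k * indicator A (l k)) / suminf w"
proof -
 have tot: "atom_total w = ennreal (suminf w)"
  unfolding atom_total_def using w by (intro suminf_ennreal2) auto
 have nw: "norm_weight w k = w k / suminf w" for k
  using w tot by (simp add: norm_weight_def proper_weights_def)
 have s: "summable (\<lambda>k. w k * indicator A (l k))"
  by (rule summable_comparison_test'[OF w(2), of 0]) (use w in \<open>auto simp: indicator_def\<close>)
 have s': "summable (\<lambda>k. w k / suminf w * indicator A (l k))"
  using summable_divide[OF s, of "suminf w"] by simp
 have "emeasure (atomic_prob w l) A = (\<Sum>k. ennreal (w k / suminf w * indicator A (l k)))"
  unfolding emeasure_atomic_prob[OF A] nw by (intro suminf_cong) (auto simp: indicator_def)
 also have "... = ennreal (\<Sum>k. w k / suminf w * indicator A (l k))"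
  using w s' by (intro suminf_ennreal2) (auto simp: less_imp_le)
 also have "(\<Sum>k. w k / suminf w * indicator A (l k)) = (\<Sum>k. w k * indicator A (l k)) / suminf w"
  using suminf_divide[OF s, of "suminf w"] by simp
 finally show ?thesis
  using w s by (simp add: measure_def suminf_nonneg less_imp_le)
qed

lemma atomic_prob_measurable:
 assumes [measurable]: "\<And>k. (\<lambda>wo. w wo k) \<in> borel_measurable M" "\<And>k. (\<lambda>wo. l wo k) \<in> borel_measurable M"
 shows "(\<lambda>wo. atomic_prob (w wo) (l wo)) \<in> measurable M (prob_algebra borel)"
proof (rule measurable_prob_algebraI[OF prob_space_atomic_prob], rule measurable_subprob_algebra)
 show "subprob_space (atomic_prob (w wo) (l wo))" for wo
  by (rule prob_space_imp_subprob_space[OF prob_space_atomic_prob])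
 have t [measurable]: "(\<lambda>wo. atom_total (w wo)) \<in> borel_measurable M" unfolding atom_total_def by measurable
 have p [measurable]: "Measurable.pred M (\<lambda>wo. proper_weights (w wo))" unfolding proper_weights_def by measurable
 have n: "(\<lambda>wo. norm_weight (w wo) k) \<in> borel_measurable M" for k unfolding norm_weight_def by measurable
 fix A :: "real set" assume A: "A \<in> sets borel"
 have i: "(\<lambda>wo. indicator A (l wo k) :: ennreal) \<in> borel_measurable M" for k
  using A by (intro measurable_compose[OF assms(2)]) auto
 show "(\<lambda>wo. emeasure (atomic_prob (w wo) (l wo)) A) \<in> borel_measurable M"
  unfolding emeasure_atomic_prob[OF A]
  by (intro borel_measurable_suminf_order borel_measurable_times_ennreal measurable_compose[OF n measurable_ennreal] i)
qed simp

text \<open>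
  The first \<open>n\<close> atoms are those at the data, the others belong to the prior.
\<close>
definition splice_seq :: "nat => (nat => 'a) => (nat => 'a) => nat => 'a" where
 "splice_seq n f g k = (if k < n then f k else g (k - n))"

lemma splice_seq_sums:
 fixes f g :: "nat => real"
 assumes g: "summable g"
 shows "summable (splice_seq n f g)" "suminf (splice_seq n f g) = (\<Sum>k<n. f k) + suminf g"
proof -
 have shift: "(\<lambda>k. splice_seq n f g (k + n)) = g" by (auto simp: splice_seq_def)
 show s: "summable (splice_seq n f g)"
  using g summable_iff_shift[of "splice_seq n f g" n] by (simp add: shift)
 have "suminf (splice_seq n f g) = (\<Sum>k. splice_seq n f g (k + n)) + (\<Sum>k<n. splice_seq n f g k)"
  by (rule suminf_split_initial_segment[OF s])
 then show "suminf (splice_seq n f g) = (\<Sum>k<n. f k) + suminf g"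
  unfolding shift by (simp add: splice_seq_def)
qed

lemma measure_spliced:
 fixes e v :: "nat => real"
 assumes A: "A \<in> sets borel" and e: "\<And>k. k < n ==> 0 <= e k" and v: "\<And>k. 0 <= v k" "summable v"
  and pos: "(\<Sum>k<n. e k) + suminf v > 0"
 shows "measure (atomic_prob (splice_seq n e v) (splice_seq n u y)) A =
  ((\<Sum>k<n. e k * indicator A (u k)) + (\<Sum>k. v k * indicator A (y k))) / ((\<Sum>k<n. e k) + suminf v)"
proof -
 have s: "summable (\<lambda>k. v k * indicator A (y k))"
  by (rule summable_comparison_test'[OF v(2), of 0]) (use v in \<open>auto simp: indicator_def\<close>)
 have w: "0 <= splice_seq n e v k" for k using e v by (simp add: splice_seq_def)
 have eq: "(\<lambda>k. splice_seq n e v k * indicator A (splice_seq n u y k)) =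
   splice_seq n (\<lambda>k. e k * indicator A (u k)) (\<lambda>k. v k * indicator A (y k))"
  by (auto simp: splice_seq_def)
 show ?thesis
  using measure_atomic_prob[OF A w splice_seq_sums(1)[OF v(2)], of "splice_seq n u y"] pos
  by (simp add: splice_seq_sums[OF v(2)] splice_seq_sums[OF s] eq)
qed

definition order_stat :: "nat => (nat => real) => nat => real" where
 "order_stat n z j = sort (map z [1..<Suc n]) ! j"

definition count_le :: "nat => (nat => real) => real => nat" where
 "count_le n z t = length (filter (\<lambda>x. x <= t) (sort (map z [1..<Suc n])))"

lemma sorted_nth_le_iff:
 fixes xs :: "real list"
 shows "sorted xs ==> j < length xs ==> xs ! j <= t \<longleftrightarrow> j < length (filter (\<lambda>x. x <= t) xs)"
proof (induction xs arbitrary: j)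
 case (Cons a xs)
 show ?case
 proof (cases "a <= t")
  case True
  then show ?thesis using Cons by (cases j) auto
 next
  case False
  then have "filter (\<lambda>x. x <= t) xs = []" using Cons.prems(1) by (auto simp: filter_empty_conv)
  moreover have "(a # xs) ! j >= a" using Cons.prems by (cases j) auto
  ultimately show ?thesis using False by auto
 qed
qed simp

lemma order_stat_le_iff: "j < n ==> order_stat n z j <= t \<longleftrightarrow> j < count_le n z t"
 unfolding order_stat_def count_le_def by (rule sorted_nth_le_iff) auto

lemma count_le_bound: "count_le n z t <= n"
 unfolding count_le_def using length_filter_le[of "\<lambda>x. x <= t" "sort (map z [1..<Suc n])"] by (simp del: upt_Suc)

lemma sum_if_less: "c <= n ==> (\<Sum>j<n. if j < c then f j else 0) = (\<Sum>j<c. f j)" for f :: "nat => 'b :: comm_monoid_add"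
 by (rule sum.mono_neutral_cong_right) auto

lemma sum_order_stat: "(\<Sum>j<n. f (order_stat n z j)) = (\<Sum>i=1..n. f (z i))" for f :: "real => 'b :: comm_monoid_add"
proof -
 have "(\<Sum>j<n. f (order_stat n z j)) = sum_list (map f (sort (map z [1..<Suc n])))"
  by (simp add: sum_list_sum_nth order_stat_def atLeast0LessThan del: upt_Suc)
 also have "... = sum_mset (image_mset f (mset (map z [1..<Suc n])))"
  by (metis mset_map mset_sort sum_mset_sum_list)
 also have "... = (\<Sum>i=1..n. f (z i))"
  by (simp add: interv_sum_list_conv_sum_set_nat atLeastLessThanSuc_atLeastAtMost o_def sum_mset_sum_list flip: mset_map del: upt_Suc)
 finally show ?thesis .
qed

text \<open>
  The sublevel sets of an order statistic are described by counting.
\<close>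
lemma order_stat_measurable [measurable]:
 assumes "j < n"
 shows "(\<lambda>z. order_stat n z j) \<in> borel_measurable (PiM {1..n} (\<lambda>_. borel))"
proof (rule borel_measurableI_le)
 fix t
 let ?P = "PiM {1..n} (\<lambda>_. borel :: real measure)"
 have c: "real (count_le n z t) = (\<Sum>i=1..n. indicator {..t} (z i))" for z
 proof -
  have "real (count_le n z t) = (\<Sum>j<n. indicator {..t} (order_stat n z j))"
  proof -
   have "(\<Sum>j<n. indicator {..t} (order_stat n z j) :: real) = (\<Sum>j<n. if j < count_le n z t then 1 else 0)"
    by (intro sum.cong) (auto simp: order_stat_le_iff[symmetric])
   also have "... = real (count_le n z t)" by (simp add: sum_if_less count_le_bound)
   finally show ?thesis by simp
  qed
  then show ?thesis by (simp add: sum_order_stat)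
 qed
 have "(\<lambda>z. \<Sum>i=1..n. indicator {..t} (z i) :: real) \<in> borel_measurable ?P"
  by (intro borel_measurable_sum measurable_compose[OF measurable_component_singleton]) auto
 then have m [measurable]: "(\<lambda>z. real (count_le n z t)) \<in> borel_measurable ?P" by (simp add: c)
 have eq: "{z \<in> space ?P. order_stat n z j <= t} = {z \<in> space ?P. real j < real (count_le n z t)}"
  using assms by (auto simp: order_stat_le_iff)
 show "{z \<in> space ?P. order_stat n z j <= t} \<in> sets ?P" unfolding eq by measurable
qed

lemma cdf_empirical:
 assumes n: "n > 0"
 shows "cdf (empirical_measure n z) t = real (count_le n z t) / n"
proof -
 have "(\<Sum>j<n. indicator {..t} (order_stat n z j) :: ennreal) = (\<Sum>j<n. if j < count_le n z t then 1 else 0)"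
  by (intro sum.cong) (auto simp: order_stat_le_iff[symmetric])
 also have "... = of_nat (count_le n z t)" by (simp add: sum_if_less count_le_bound)
 finally have "(\<Sum>i=1..n. indicator {..t} (z i) :: ennreal) = of_nat (count_le n z t)"
  by (simp add: sum_order_stat)
 then show ?thesis using n
  by (simp add: cdf_def measure_def emeasure_empirical_measure ennreal_of_nat_eq_real_of_nat divide_ennreal)
qed

lemma cdf_spliced:
 fixes e v :: "nat => real"
 assumes e: "\<And>k. k < n ==> 0 <= e k" and v: "\<And>k. 0 <= v k" "summable v"
  and pos: "(\<Sum>k<n. e k) + suminf v > 0"
 shows "cdf (atomic_prob (splice_seq n e v) (splice_seq n (order_stat n z) y)) t =
  ((\<Sum>k<count_le n z t. e k) + (\<Sum>k. v k * indicator {..t} (y k))) / ((\<Sum>k<n. e k) + suminf v)"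
proof -
 have "(\<Sum>k<n. e k * indicator {..t} (order_stat n z k)) = (\<Sum>k<n. if k < count_le n z t then e k else 0)"
  by (intro sum.cong) (auto simp: order_stat_le_iff[symmetric])
 also have "... = (\<Sum>k<count_le n z t. e k)" by (simp add: sum_if_less count_le_bound)
 finally show ?thesis
  unfolding cdf_def using measure_spliced[OF _ e v pos, where A = "{..t}" and u = "order_stat n z" and y = y] by simp
qed

section \<open>The posterior as a normalised random measure\<close>

text \<open>
  Weights \<open>e\<close> for the data, and atoms of size \<open>v\<close> at \<open>loc\<close> for the prior.
\<close>
locale posterior_noise = prob_space N for N :: "'w measure" +
 fixes n :: nat and e v loc :: "'w => nat => real" and \<nu> :: "real measure"
 assumes n: "n > 0" and \<nu>: "finite_borel_measure \<nu>"
  and e_measurable: "\<And>j. j < n ==> (\<lambda>w. e w j) \<in> borel_measurable N"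
  and v_measurable: "\<And>m. (\<lambda>w. v w m) \<in> borel_measurable N"
  and loc_measurable: "\<And>m. (\<lambda>w. loc w m) \<in> borel_measurable N"
  and distr_e: "distr N (PiM {..<n} (\<lambda>_. borel)) (\<lambda>w. \<lambda>j\<in>{..<n}. e w j) = PiM {..<n} (\<lambda>_. gamma_law 1)"
  and v_nonneg: "AE w in N. \<forall>m. 0 <= v w m" and v_summable: "AE w in N. summable (v w)"
  and distr_v: "\<And>k (A :: nat => real set). A ` {..<k} \<subseteq> sets borel ==> disjoint_family_on A {..<k} ==> (\<Union>i<k. A i) = UNIV ==>
   distr N (PiM {..<k} (\<lambda>_. borel)) (\<lambda>w. \<lambda>i\<in>{..<k}. \<Sum>m. v w m * indicator (A i) (loc w m)) =
   PiM {..<k} (\<lambda>i. gamma_law (measure \<nu> (A i)))"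
  and indep: "\<And>k (A :: nat => real set). A ` {..<k} \<subseteq> sets borel ==>
   indep_var (PiM {..<n} (\<lambda>_. borel)) (\<lambda>w. \<lambda>j\<in>{..<n}. e w j)
    (PiM {..<k} (\<lambda>_. borel)) (\<lambda>w. \<lambda>i\<in>{..<k}. \<Sum>m. v w m * indicator (A i) (loc w m))"
begin

definition posterior :: "(nat => real) => 'w => real measure" where
 "posterior z w = atomic_prob (splice_seq n (e w) (v w)) (splice_seq n (order_stat n z) (loc w))"

lemma e_pos: "AE w in N. \<forall>j<n. e w j > 0"
proof -
 have "AE w in N. e w j > 0" if j: "j < n" for j
 proof -
  have r: "(\<lambda>w. \<lambda>j\<in>{..<n}. e w j) \<in> measurable N (PiM {..<n} (\<lambda>_. borel))"
   by (intro measurable_restrict e_measurable) auto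
  have "AE x in PiM {..<n} (\<lambda>_. gamma_law 1). x j > 0"
   using j by (intro AE_PiM_component prob_space_gamma_law AE_gamma_law_pos) auto
  then have "AE x in distr N (PiM {..<n} (\<lambda>_. borel)) (\<lambda>w. \<lambda>j\<in>{..<n}. e w j). x j > 0"
   unfolding distr_e .
  moreover have "{x \<in> space (PiM {..<n} (\<lambda>_. borel)). x j > (0::real)} \<in> sets (PiM {..<n} (\<lambda>_. borel))"
  proof -
   have [measurable]: "(\<lambda>x. x j) \<in> borel_measurable (PiM {..<n} (\<lambda>_. borel))"
    using j by (intro measurable_component_singleton) auto
   show ?thesis by measurable
  qed
  ultimately have "AE w in N. (\<lambda>j\<in>{..<n}. e w j) j > 0" using AE_distr_iff[OF r, of "\<lambda>x. x j > 0"] by simp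
  then show ?thesis using j by simp
 qed
 then have "AE w in N. \<forall>j\<in>{..<n}. e w j > 0" by (intro AE_finite_allI) auto
 then show ?thesis by (simp add: Ball_def)
qed

definition good_weights :: "'w => bool" where
 "good_weights w \<longleftrightarrow> (\<forall>j<n. e w j > 0) \<and> (\<forall>m. 0 <= v w m) \<and> summable (v w)"

lemma AE_good_weights: "AE w in N. good_weights w"
 using e_pos v_nonneg v_summable by eventually_elim (auto simp: good_weights_def)

lemma total_pos: "good_weights w ==> (\<Sum>k<n. e w k) + suminf (v w) > 0"
 using n unfolding good_weights_def
 by (intro add_pos_nonneg sum_pos suminf_nonneg) (auto simp: lessThan_empty_iff)

text \<open>
  Given the prior masses, the data weights of a cell add up to a gamma variable whose shape is the number of data in
  the cell; adding the independent prior mass adds the shapes.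
\<close>
lemma distr_cell_masses:
 fixes u :: "nat => real" and A :: "nat => real set"
 assumes A: "A ` {..<k} \<subseteq> sets borel" "disjoint_family_on A {..<k}" "(\<Union>i<k. A i) = UNIV"
 shows "distr N (PiM {..<k} (\<lambda>_. borel))
   (\<lambda>w. \<lambda>i\<in>{..<k}. (\<Sum>j<n. e w j * indicator (A i) (u j)) + (\<Sum>m. v w m * indicator (A i) (loc w m))) =
   PiM {..<k} (\<lambda>i. gamma_law (measure \<nu> (A i) + (\<Sum>j<n. indicator (A i) (u j))))" (is "distr N ?P ?U = _")
proof (rule PiM_eqI_product_tests)
 fix f :: "nat => real => ennreal"
 assume "\<And>j. f j \<in> borel_measurable (gamma_law (measure \<nu> (A j) + (\<Sum>i<n. indicator (A j) (u i))))"
 then have f [measurable]: "f i \<in> borel_measurable borel" for i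
  by (simp add: measurable_cong_sets[OF sets_gamma_law refl])
 let ?I = "{..<k}"
 define V where "V w = (\<lambda>i\<in>?I. \<Sum>m. v w m * indicator (A i) (loc w m))" for w
 have "\<exists>i<k. u j \<in> A i" for j using A(3) by auto
 then obtain c where c: "\<And>j. c j < k" "\<And>j. u j \<in> A (c j)" by metis
 have cu: "u j \<in> A i \<longleftrightarrow> c j = i" if "i < k" for i j
  using that c[of j] A(2) by (auto simp: disjoint_family_on_def)
 have cs: "{j. j < n \<and> u j \<in> A i} = {j. j < n \<and> c j = i}" if "i < k" for i
  using cu[OF that] by auto
 have sum_c: "(\<Sum>j<n. g j * indicator (A i) (u j)) = (\<Sum>j\<in>{j\<in>{..<n}. c j = i}. g j)" if "i < k" for g :: "nat => real" and i
  using cu[OF that] by (auto simp: sum.inter_filter indicator_def intro!: sum.cong)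
 let ?h = "\<lambda>(x, y). \<Prod>i<k. f i ((\<Sum>j\<in>{j\<in>{..<n}. c j = i}. x j) + y i)"
 have h [measurable]: "?h \<in> borel_measurable (PiM {..<n} (\<lambda>_. borel) \<Otimes>\<^sub>M PiM ?I (\<lambda>_. borel))"
  unfolding split_beta
  by (intro borel_measurable_prod_ennreal measurable_compose[OF _ f] borel_measurable_add borel_measurable_sum
    measurable_compose[OF measurable_fst measurable_component_singleton]
    measurable_compose[OF measurable_snd measurable_component_singleton]) auto
 interpret V: product_prob_space "\<lambda>i. gamma_law (measure \<nu> (A i))" ?I
  by (intro product_prob_spaceI prob_space_gamma_law)
 interpret W: product_prob_space "\<lambda>i. gamma_law (\<Sum>j\<in>{j\<in>{..<n}. c j = i}. 1)" ?I
  by (intro product_prob_spaceI prob_space_gamma_law)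
 have Um: "?U \<in> measurable N ?P"
 proof (intro measurable_restrict borel_measurable_add borel_measurable_sum borel_measurable_times borel_measurable_suminf e_measurable v_measurable borel_measurable_const)
  fix i m assume "i \<in> ?I"
  then show "(\<lambda>w. indicator (A i) (loc w m) :: real) \<in> borel_measurable N"
   using A by (intro measurable_compose[OF loc_measurable]) auto
 qed auto
 have "(\<integral>\<^sup>+x. (\<Prod>i<k. f i (x i)) \<partial>distr N ?P ?U) = (\<integral>\<^sup>+w. (\<Prod>i<k. f i (?U w i)) \<partial>N)"
  by (intro nn_integral_distr Um borel_measurable_prod_ennreal measurable_compose[OF _ f]) auto
 also have "... = (\<integral>\<^sup>+w. ?h (\<lambda>j\<in>{..<n}. e w j, V w) \<partial>N)"
  by (intro nn_integral_cong) (auto simp: V_def sum_c cs intro!: prod.cong)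
 also have "... = (\<integral>\<^sup>+x. \<integral>\<^sup>+y. ?h (x, y) \<partial>PiM ?I (\<lambda>i. gamma_law (measure \<nu> (A i))) \<partial>PiM {..<n} (\<lambda>_. gamma_law 1))"
  unfolding V_def using nn_integral_indep_var[OF indep[OF A(1)] h] unfolding distr_e distr_v[OF A] .
 also have "... = (\<integral>\<^sup>+x. (\<Prod>i<k. (\<lambda>s. \<integral>\<^sup>+y. f i (s + y) \<partial>gamma_law (measure \<nu> (A i))) (\<Sum>j\<in>{j\<in>{..<n}. c j = i}. x j)) \<partial>PiM {..<n} (\<lambda>_. gamma_law 1))"
 proof (rule nn_integral_cong)
  fix x :: "nat => real"
  have "(\<integral>\<^sup>+y. ?h (x, y) \<partial>PiM ?I (\<lambda>i. gamma_law (measure \<nu> (A i)))) =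
   (\<Prod>i<k. \<integral>\<^sup>+y. f i ((\<Sum>j\<in>{j\<in>{..<n}. c j = i}. x j) + y) \<partial>gamma_law (measure \<nu> (A i)))"
   unfolding split_conv by (intro V.product_nn_integral_prod) auto
  then show "(\<integral>\<^sup>+y. ?h (x, y) \<partial>PiM ?I (\<lambda>i. gamma_law (measure \<nu> (A i)))) =
   (\<Prod>i<k. (\<lambda>s. \<integral>\<^sup>+y. f i (s + y) \<partial>gamma_law (measure \<nu> (A i))) (\<Sum>j\<in>{j\<in>{..<n}. c j = i}. x j))" by simp
 qed
 also have "... = (\<Prod>i<k. \<integral>\<^sup>+s. (\<integral>\<^sup>+y. f i (s + y) \<partial>gamma_law (measure \<nu> (A i))) \<partial>gamma_law (\<Sum>j\<in>{j\<in>{..<n}. c j = i}. 1))"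
 proof (rule nn_integral_PiM_gamma_aggregate)
  show "(\<lambda>s. \<integral>\<^sup>+y. f i (s + y) \<partial>gamma_law (measure \<nu> (A i))) \<in> borel_measurable borel" for i
  proof -
   have "(\<lambda>p. f i (fst p + snd p)) \<in> borel_measurable (borel \<Otimes>\<^sub>M gamma_law (measure \<nu> (A i)))"
    by (simp add: measurable_cong_sets[OF sets_pair_measure_cong[OF refl sets_gamma_law] refl])
   from sigma_finite_measure.borel_measurable_nn_integral_fst[OF prob_space_imp_sigma_finite[OF prob_space_gamma_law] this] show ?thesis by simp
  qed
 qed (use c in auto)
 also have "... = (\<Prod>i<k. \<integral>\<^sup>+s. f i s \<partial>gamma_law (measure \<nu> (A i) + (\<Sum>j<n. indicator (A i) (u j))))"
 proof (rule prod.cong[OF refl])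
  fix i assume i: "i \<in> ?I"
  have "(\<Sum>j\<in>{j\<in>{..<n}. c j = i}. 1 :: real) = (\<Sum>j<n. indicator (A i) (u j))"
   using sum_c[of i "\<lambda>_. 1"] i by simp
  then show "(\<integral>\<^sup>+s. (\<integral>\<^sup>+y. f i (s + y) \<partial>gamma_law (measure \<nu> (A i))) \<partial>gamma_law (\<Sum>j\<in>{j\<in>{..<n}. c j = i}. 1)) =
   (\<integral>\<^sup>+s. f i s \<partial>gamma_law (measure \<nu> (A i) + (\<Sum>j<n. indicator (A i) (u j))))"
   by (subst nn_integral_gamma_add) (auto simp: add.commute intro!: sum_nonneg)
 qed
 finally show "(\<integral>\<^sup>+x. (\<Prod>i<k. f i (x i)) \<partial>distr N ?P ?U) =
  (\<Prod>i<k. \<integral>\<^sup>+s. f i s \<partial>gamma_law (measure \<nu> (A i) + (\<Sum>j<n. indicator (A i) (u j))))" .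
qed (auto simp: prob_space_gamma_law intro!: sets_PiM_cong)

lemma posterior_measurable: "posterior z \<in> measurable N (prob_algebra borel)"
 unfolding posterior_def
proof (intro atomic_prob_measurable)
 show "(\<lambda>w. splice_seq n (e w) (v w) k) \<in> borel_measurable N" for k
  by (cases "k < n") (auto simp: splice_seq_def e_measurable v_measurable)
 show "(\<lambda>w. splice_seq n (order_stat n z) (loc w) k) \<in> borel_measurable N" for k
  by (cases "k < n") (auto simp: splice_seq_def loc_measurable)
qed

lemma measure_posterior:
 assumes "good_weights w" "A \<in> sets borel"
 shows "measure (posterior z w) A = ((\<Sum>k<n. e w k * indicator A (order_stat n z k)) + (\<Sum>m. v w m * indicator A (loc w m))) /
  ((\<Sum>k<n. e w k) + suminf (v w))"
 unfolding posterior_def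
 using assms total_pos[OF assms(1)] by (intro measure_spliced) (auto simp: good_weights_def less_imp_le)

lemma measure_posterior_base:
 assumes "A \<in> sets borel"
 shows "measure (posterior_base \<nu> n z) A = measure \<nu> A + (\<Sum>j<n. indicator A (order_stat n z j))"
proof -
 interpret finite_borel_measure \<nu> by (rule \<nu>)
 have "emeasure (posterior_base \<nu> n z) A = ennreal (measure \<nu> A) + (\<Sum>j<n. indicator A (order_stat n z j))"
  by (simp add: emeasure_posterior_base assms M_is_borel emeasure_eq_measure sum_order_stat)
 also have "(\<Sum>j<n. indicator A (order_stat n z j) :: ennreal) = (\<Sum>j<n. ennreal (indicator A (order_stat n z j)))"
  by (intro sum.cong) (auto simp: indicator_def)
 also have "... = ennreal (\<Sum>j<n. indicator A (order_stat n z j))"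
  by (subst sum_ennreal) auto
 finally show ?thesis
  by (simp add: measure_def sum_nonneg flip: ennreal_plus)
qed

text \<open>
  The normaliser of the cell masses is their own sum, because the cells partition the line; after normalisation the
  cell masses are exactly the defining representation of the Dirichlet law.
\<close>
theorem dirichlet_posterior: "is_dirichlet_process (posterior_base \<nu> n z) (distr N (prob_algebra borel) (posterior z))"
 unfolding is_dirichlet_process_def
proof (intro conjI allI impI)
 interpret nu: finite_borel_measure \<nu> by (rule \<nu>)
 have "emeasure (posterior_base \<nu> n z) UNIV \<noteq> \<infinity>"
  using nu.emeasure_finite[of UNIV] by (auto simp: emeasure_posterior_base nu.M_is_borel)
 moreover have sp: "space (posterior_base \<nu> n z) = UNIV" by (simp add: posterior_base_def)
 ultimately show "finite_borel_measure (posterior_base \<nu> n z)"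
  by (intro finite_borel_measure.intro finite_measureI finite_borel_measure_axioms.intro) auto
 show "distr N (prob_algebra borel) (posterior z) \<in> space (prob_algebra (prob_algebra borel))"
  using prob_space_distr[OF posterior_measurable] by (simp add: space_prob_algebra)
 fix k and A :: "nat => real set"
 assume "A ` {..<k} \<subseteq> sets borel \<and> disjoint_family_on A {..<k} \<and> (\<Union>i<k. A i) = UNIV"
 then have A: "A ` {..<k} \<subseteq> sets borel" "disjoint_family_on A {..<k}" "(\<Union>i<k. A i) = UNIV" by auto
 let ?P = "PiM {..<k} (\<lambda>_. borel :: real measure)"
 let ?n = "\<lambda>g. \<lambda>i\<in>{..<k}. g i / (\<Sum>j<k. g j)"
 define U where "U w = (\<lambda>i\<in>{..<k}. (\<Sum>j<n. e w j * indicator (A i) (order_stat n z j)) + (\<Sum>m. v w m * indicator (A i) (loc w m)))" for w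
 have mA: "(\<lambda>Q. measure Q (A i)) \<in> borel_measurable (prob_algebra borel)" if "i < k" for i
  using that A(1) by (intro measurable_prob_algebraD measurable_measure_subprob_algebra measurable_compose[OF _ measurable_measure_subprob_algebra[of "A i" borel]]) auto
 have Um: "U \<in> measurable N ?P" unfolding U_def
 proof (intro measurable_restrict borel_measurable_add borel_measurable_sum borel_measurable_times borel_measurable_suminf e_measurable v_measurable borel_measurable_const)
  fix i m assume "i \<in> {..<k}"
  then show "(\<lambda>w. indicator (A i) (loc w m) :: real) \<in> borel_measurable N"
   using A by (intro measurable_compose[OF loc_measurable]) auto
 qed auto
 have nm: "?n \<in> measurable ?P ?P"
  by (intro measurable_restrict borel_measurable_divide borel_measurable_sum measurable_component_singleton) auto
 have "distr (distr N (prob_algebra borel) (posterior z)) ?P (\<lambda>Q. \<lambda>i\<in>{..<k}. measure Q (A i)) =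
   distr N ?P (\<lambda>w. \<lambda>i\<in>{..<k}. measure (posterior z w) (A i))"
  using mA posterior_measurable by (subst distr_distr) (auto simp: o_def intro!: measurable_restrict)
 also have "... = distr N ?P (\<lambda>w. ?n (U w))"
 proof (rule distr_cong_AE[OF refl refl])
  show "AE w in N. (\<lambda>i\<in>{..<k}. measure (posterior z w) (A i)) = ?n (U w)"
   using AE_good_weights
  proof eventually_elim
   case (elim w)
   let ?T = "(\<Sum>k<n. e w k) + suminf (v w)"
   interpret Q: prob_space "posterior z w" unfolding posterior_def by (rule prob_space_atomic_prob)
   have m: "measure (posterior z w) (A i) = U w i / ?T" if "i < k" for i
    using measure_posterior[OF elim, of "A i" z] that A(1) by (simp add: U_def image_subset_iff)
   have "(\<Sum>i<k. U w i / ?T) = (\<Sum>i<k. measure (posterior z w) (A i))" using m by simp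
   also have "... = measure (posterior z w) (\<Union>i<k. A i)"
    using A by (subst Q.finite_measure_finite_Union) (auto simp: posterior_def)
   also have "... = 1" using A(3) Q.prob_space by (simp add: posterior_def atomic_prob_def)
   finally have "(\<Sum>i<k. U w i) = ?T" using total_pos[OF elim] by (simp add: sum_divide_distrib[symmetric])
   then show ?case using m by auto
  qed
  show "(\<lambda>w. \<lambda>i\<in>{..<k}. measure (posterior z w) (A i)) \<in> measurable N ?P"
   using mA by (intro measurable_restrict measurable_compose[OF posterior_measurable]) auto
  show "(\<lambda>w. ?n (U w)) \<in> measurable N ?P" by (rule measurable_compose[OF Um nm])
 qed
 also have "... = distr (distr N ?P U) ?P ?n" using Um nm by (subst distr_distr) (auto simp: o_def)
 also have "distr N ?P U = PiM {..<k} (\<lambda>i. gamma_law (measure (posterior_base \<nu> n z) (A i)))"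
  unfolding U_def distr_cell_masses[OF A] using A(1) by (intro PiM_cong) (auto simp: measure_posterior_base image_subset_iff)
 finally show "distr (distr N (prob_algebra borel) (posterior z)) ?P (\<lambda>Q. \<lambda>i\<in>{..<k}. measure Q (A i)) =
    dirichlet_law k (\<lambda>i. measure (posterior_base \<nu> n z) (A i))"
  unfolding dirichlet_law_def .
qed

end

section \<open>The common noise\<close>

text \<open>
  Countably many independent real variables with prescribed laws, as coordinates of a product space.
\<close>
locale independent_coordinates =
 fixes L :: "'c => real measure"
 assumes L_prob: "\<And>c. prob_space (L c)" and L_sets: "\<And>c. sets (L c) = sets borel"
begin

abbreviation N :: "('c => real) measure" where "N \<equiv> PiM UNIV L"

sublocale prob_space N by (rule prob_space_PiM) (rule L_prob)

lemma sets_N: "sets N = sets (PiM UNIV (\<lambda>_. borel))"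
 by (rule sets_PiM_cong) (auto simp: L_sets)

lemma measurable_N: "measurable N S = measurable (PiM UNIV (\<lambda>_. borel)) S"
 by (rule measurable_cong_sets[OF sets_N refl])

lemma space_N: "space N = UNIV"
 using sets_eq_imp_space_eq[OF sets_N] by (simp add: space_PiM)

lemma coord_measurable [measurable]: "(\<lambda>y. y c) \<in> borel_measurable N"
 unfolding measurable_N by simp

lemma coord_law: "distr N borel (\<lambda>y. y c) = L c"
proof -
 have "distr N borel (\<lambda>y. y c) = distr N (L c) (\<lambda>y. y c)" by (rule distr_cong) (auto simp: L_sets)
 also have "... = L c" by (rule distr_PiM_component) (auto simp: L_prob)
 finally show ?thesis .
qed

lemma coord_indep: "indep_vars (\<lambda>_. borel) (\<lambda>c y. y c) UNIV"
proof (subst indep_vars_iff_distr_eq_PiM')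
 have "distr N (PiM UNIV (\<lambda>_. borel)) (\<lambda>y. \<lambda>c\<in>UNIV. y c) = distr N N (\<lambda>y. y)"
  by (rule distr_cong) (auto simp: sets_N)
 then show "distr N (PiM UNIV (\<lambda>_. borel)) (\<lambda>y. \<lambda>c\<in>UNIV. y c) = PiM UNIV (\<lambda>c. distr N borel (\<lambda>y. y c))"
  by (simp add: coord_law distr_id2)
qed auto

definition extend :: "'c set => ('c => real) => 'c => real" where
 "extend B r c = (if c \<in> B then r c else 0)"

lemma extend_measurable: "extend B \<in> measurable (PiM B (\<lambda>_. borel)) N"
 unfolding measurable_cong_sets[OF refl sets_N]
proof (rule measurable_PiM_single')
 show "(\<lambda>r. extend B r c) \<in> borel_measurable (PiM B (\<lambda>_. borel))" for c
  by (cases "c \<in> B") (auto simp: extend_def)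
qed auto

text \<open>
  Independence of functions of disjoint sets of coordinates is deduced from this condition, without writing them as
  functions of restricted vectors.
\<close>
definition depends_on :: "(('c => real) => 'd) => 'c set => bool" where
 "depends_on f B \<longleftrightarrow> (\<forall>y y'. (\<forall>c\<in>B. y c = y' c) --> f y = f y')"

lemma depends_onD: "depends_on f B ==> f (extend B (\<lambda>c\<in>B. y c)) = f y"
 unfolding depends_on_def by (auto simp: extend_def)

lemma indep_vars_of_blocks:
 assumes X: "\<And>j. j \<in> J ==> X j \<in> measurable N (S j)" "\<And>j. j \<in> J ==> depends_on (X j) (B j)"
  and B: "disjoint_family_on B J"
 shows "indep_vars S X J"
proof -
 have "indep_vars S (\<lambda>j y. X j (extend (B j) (\<lambda>c\<in>B j. y c))) J"
  by (rule indep_vars_compose2[OF indep_vars_restrict[OF coord_indep _ B]])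
    (auto intro: measurable_compose[OF extend_measurable] X)
 then show ?thesis
  by (rule iffD1[OF indep_vars_cong, rotated -1]) (auto simp: depends_onD[OF X(2)])
qed

lemma indep_var_of_blocks:
 assumes "X \<in> measurable N S" "depends_on X B" "Y \<in> measurable N T" "depends_on Y B'" "B \<inter> B' = {}"
 shows "indep_var S X T Y"
proof -
 have "indep_var S ((\<lambda>r. X (extend B r)) \<circ> (\<lambda>y. \<lambda>c\<in>B. y c)) T ((\<lambda>r. Y (extend B' r)) \<circ> (\<lambda>y. \<lambda>c\<in>B'. y c))"
  using assms by (intro indep_var_compose[OF indep_var_restrict[OF coord_indep]] measurable_compose[OF extend_measurable]) auto
 then show ?thesis using assms by (simp add: o_def depends_onD)
qed

lemma joint_law_of_blocks:
 assumes "X \<in> measurable N S" "depends_on X B" "Y \<in> measurable N T" "depends_on Y B'" "B \<inter> B' = {}"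
 shows "distr N (S \<Otimes>\<^sub>M T) (\<lambda>y. (X y, Y y)) = distr N S X \<Otimes>\<^sub>M distr N T Y"
 using joint_law_compose[OF indep_var_restrict[OF coord_indep \<open>B \<inter> B' = {}\<close>]
   measurable_compose[OF extend_measurable assms(1)] measurable_compose[OF extend_measurable assms(3)]] assms
 by (simp add: depends_onD)

end

text \<open>
  Coefficients of the sheet; total mass and leaf splits of the tree for each sample size; rates, locations and sizes
  of the atoms of the prior measure. The inner nodes of the trees take their normals from the sheet.
\<close>
datatype noise = Sheet sheet_index | Total nat | Leaf nat nat | Rate nat | Atom nat | Size nat

instance noise :: countable by countable_datatype

text \<open>
  The least depth at which the cells have width at most 1.
\<close>
definition depth :: "nat => nat" where "depth n = (LEAST k. n <= 2 ^ k)"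

lemma depth: "n <= 2 ^ depth n" "n > 0 ==> 2 ^ depth n <= 2 * n"
proof -
 have ex: "n <= 2 ^ n" by (rule less_imp_le[OF less_exp])
 show "n <= 2 ^ depth n" unfolding depth_def by (rule LeastI, rule ex)
 assume n: "n > 0"
 show "2 ^ depth n <= 2 * n"
 proof (cases "depth n")
  case (Suc k)
  have "\<not> n <= 2 ^ k" using not_less_Least[of k "\<lambda>k. n <= 2 ^ k"] Suc by (simp add: depth_def)
  then show ?thesis using Suc by simp
 qed (use n in simp)
qed

text \<open>
  Inner nodes use the normalised sum of the first \<open>n\<close> sheet coefficients with time level 0. This is the
  Schauder coefficient of the bridge \<open>K(\<cdot>, n) / sqrt n\<close>, which ties the exponential weights to
  the Kiefer process.
\<close>
definition tree_noise :: "nat => nat \<times> nat => (noise => real) => real" where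
 "tree_noise n i y = (case fst i of 0 => y (Total n)
   | Suc q => if q < depth n then (\<Sum>i'<n. y (Sheet (i', 0, 0, q, snd i))) / sqrt n else y (Leaf n (snd i)))"

text \<open>
  The location law is immaterial if \<open>\<nu>\<close> vanishes, because then all prior weights are 0.
\<close>
definition atom_law :: "real measure => real measure" where
 "atom_law \<nu> = (if measure \<nu> UNIV = 0 then return borel 0 else density \<nu> (\<lambda>_. ennreal (1 / measure \<nu> UNIV)))"

definition noise_law :: "real measure => noise => real measure" where
 "noise_law \<nu> s = (case s of Sheet x => std_normal_distribution | Total n => gamma_law (real n)
   | Leaf n b => beta_law (left_len n (depth n) b) (cell_width n (depth n) - left_len n (depth n) b)
   | Rate m => gamma_law 1 | Atom m => atom_law \<nu> | Size m => gamma_law 1)"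

lemma atom_law:
 assumes "finite_borel_measure \<nu>"
 shows "real_distribution (atom_law \<nu>)"
  "measure \<nu> UNIV > 0 ==> A \<in> sets borel ==> measure \<nu> UNIV * measure (atom_law \<nu>) A = measure \<nu> A"
proof -
 interpret finite_borel_measure \<nu> by fact
 have sp: "space \<nu> = UNIV" using sets_eq_imp_space_eq[OF M_is_borel] by simp
 have e: "emeasure (atom_law \<nu>) A = ennreal (measure \<nu> A / measure \<nu> UNIV)" if "measure \<nu> UNIV > 0" "A \<in> sets borel" for A
  using that by (simp add: atom_law_def emeasure_density_const M_is_borel emeasure_eq_measure ennreal_mult'[symmetric])
 show "real_distribution (atom_law \<nu>)"
 proof (cases "measure \<nu> UNIV = 0")
  case True
  then show ?thesis by (simp add: atom_law_def real_distribution_def real_distribution_axioms_def prob_space_return)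
 next
  case False
  then have pos: "measure \<nu> UNIV > 0" by (simp add: zero_less_measure_iff)
  show ?thesis
  proof (intro real_distribution.intro real_distribution_axioms.intro prob_spaceI)
   show "emeasure (atom_law \<nu>) (space (atom_law \<nu>)) = 1"
    using e[OF pos, of UNIV] pos by (simp add: atom_law_def sp)
  qed (use False in \<open>auto simp: atom_law_def M_is_borel sp\<close>)
 qed
 assume "measure \<nu> UNIV > 0" "A \<in> sets borel"
 then show "measure \<nu> UNIV * measure (atom_law \<nu>) A = measure \<nu> A"
  using e[of A] by (simp add: measure_def)
qed

locale noise_model =
 fixes \<nu> :: "real measure" assumes \<nu>: "finite_borel_measure \<nu>"
begin

lemma cell_empty: "cell_width 0 k = 0" "left_len 0 k b = 0"
 by (auto simp: cell_width_def left_len_def)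

lemma leaf_parameters:
 assumes "n > 0" shows "left_len n (depth n) b > 0" "left_len n (depth n) b <= cell_width n (depth n)"
proof -
 have c: "cell_width n (depth n) > 0" using assms by (simp add: cell_width_def)
 have "real b * cell_width n (depth n) < real (cell_floor n (depth n) b + 1)"
  unfolding cell_floor_def using c by (simp) linarith
 with c show "left_len n (depth n) b > 0" "left_len n (depth n) b <= cell_width n (depth n)"
  by (auto simp: left_len_def)
qed

sublocale independent_coordinates "noise_law \<nu>"
proof (intro independent_coordinates.intro)
 fix c :: noise
 interpret A: real_distribution "atom_law \<nu>" by (rule atom_law[OF \<nu>])
 show "sets (noise_law \<nu> c) = sets borel"
  by (auto simp: noise_law_def split: noise.splits)
 show "prob_space (noise_law \<nu> c)"
 proof (cases c)
  case (Leaf n b)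
  show ?thesis
  proof (cases "n = 0")
   case True
   then show ?thesis using Leaf by (simp add: noise_law_def cell_empty beta_law_def prob_space_return)
  next
   case False
   then show ?thesis using Leaf leaf_parameters[of n b] by (auto simp: noise_law_def intro!: prob_space_beta_law)
  qed
 qed (auto simp: noise_law_def prob_space_gamma_law A.prob_space_axioms
    intro!: prob_space_normal_density)
qed

sublocale sheet: sheet_noise N "\<lambda>x y. y (Sheet x)"
proof unfold_locales
 show "indep_vars (\<lambda>_. borel) (\<lambda>x y. y (Sheet x)) UNIV"
  by (rule indep_vars_of_blocks[where B = "\<lambda>x. {Sheet x}"]) (auto simp: depends_on_def disjoint_family_on_def)
 show "distr N borel (\<lambda>y. y (Sheet x)) = std_normal_distribution" for x
  by (simp add: coord_law noise_law_def)
qed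

lemma node_law:
 assumes n: "n > 0"
 shows "distr N borel (\<lambda>y. (\<Sum>i<n. y (Sheet (i, 0, 0, q, b))) / sqrt n) = std_normal_distribution"
proof -
 let ?I = "(\<lambda>i. (i, 0, 0, q, b)) ` {..<n} :: sheet_index set"
 have inj: "inj_on (\<lambda>i. (i, 0, 0, q, b)) {..<n}" by (auto simp: inj_on_def)
 have eq: "(\<lambda>y :: noise => real. \<Sum>x\<in>?I. 1 / sqrt n * y (Sheet x)) = (\<lambda>y. (\<Sum>i<n. y (Sheet (i, 0, 0, q, b))) / sqrt n)"
  by (auto simp: sum.reindex[OF inj] sum_divide_distrib)
 have one: "(\<Sum>x\<in>?I. (1 / sqrt n)\<^sup>2) = 1" using n by (simp add: card_image[OF inj] power_divide)
 have "char (distr N borel (\<lambda>y. (\<Sum>i<n. y (Sheet (i, 0, 0, q, b))) / sqrt n)) t = char std_normal_distribution t" for t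
  using sheet.char_linear_combination[of ?I "\<lambda>_. 1 / sqrt n" t] unfolding sheet.arr_def eq one
  by (simp add: char_std_normal_distribution exp_of_real)
 then show ?thesis
  by (intro Levy_uniqueness real_distribution_distr real_dist_normal_dist ext) auto
qed

lemma tree_noise_measurable [measurable]: "tree_noise n i \<in> borel_measurable N"
 unfolding tree_noise_def by (cases "fst i") auto

text \<open>
  Different nodes use disjoint sets of sheet coefficients.
\<close>
lemma gamma_tree_noise:
 assumes n: "n > 0"
 shows "gamma_tree N (tree_noise n) n (depth n)"
proof
 show "real n <= 2 ^ depth n" using depth(1)[of n] by (metis of_nat_le_iff of_nat_numeral of_nat_power)
 show "2 ^ depth n <= 2 * real n" using depth(2)[OF n] by (metis of_nat_le_iff of_nat_mult of_nat_numeral of_nat_power)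
 show "indep_vars (\<lambda>_. borel) (tree_noise n) (tree_index (depth n))"
 proof (rule indep_vars_of_blocks[where B = "\<lambda>i. case fst i of 0 => {Total n}
   | Suc q => if q < depth n then range (\<lambda>i'. Sheet (i', 0, 0, q, snd i)) else {Leaf n (snd i)}"])
  show "depends_on (tree_noise n i) (case fst i of 0 => {Total n}
   | Suc q => if q < depth n then range (\<lambda>i'. Sheet (i', 0, 0, q, snd i)) else {Leaf n (snd i)})" for i
   by (cases "fst i") (auto simp: depends_on_def tree_noise_def)
  show "disjoint_family_on (\<lambda>i. case fst i of 0 => {Total n}
   | Suc q => if q < depth n then range (\<lambda>i'. Sheet (i', 0, 0, q, snd i)) else {Leaf n (snd i)}) (tree_index (depth n))"
   by (auto simp: disjoint_family_on_def tree_index_def split: nat.splits if_splits)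
 qed auto
 show "distr N borel (tree_noise n (0, 0)) = gamma_law (real n)"
  using coord_law[of "Total n"] by (simp add: tree_noise_def[abs_def] noise_law_def)
 show "distr N borel (tree_noise n (Suc q, b)) = std_normal_distribution" if "q < depth n" for q b
  using node_law[OF n, of q b] that by (simp add: tree_noise_def[abs_def])
 show "distr N borel (tree_noise n (Suc (depth n), b)) =
   beta_law (left_len n (depth n) b) (cell_width n (depth n) - left_len n (depth n) b)" for b
  using coord_law[of "Leaf n b"] by (simp add: tree_noise_def[abs_def] noise_law_def)
qed (rule n)

abbreviation mass :: real where "mass \<equiv> measure \<nu> UNIV"

definition triple :: "(noise => real) => nat => real \<times> real \<times> real" where
 "triple y m = (y (Rate m), y (Atom m), y (Size m))"

lemma triple_measurable [measurable]: "(\<lambda>y. triple y m) \<in> measurable N R3"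
 unfolding triple_def by measurable

lemma perpetuity_noise_triple:
 assumes "mass > 0"
 shows "perpetuity_noise N (\<lambda>m y. triple y m) mass (atom_law \<nu>)"
proof (intro perpetuity_noise.intro perpetuity_noise_axioms.intro prob_space_axioms)
 show "mass > 0" by fact
 show "real_distribution (atom_law \<nu>)" by (rule atom_law[OF \<nu>])
 show "indep_vars (\<lambda>_. R3) (\<lambda>m y. triple y m) UNIV"
  by (rule indep_vars_of_blocks[where B = "\<lambda>m. {Rate m, Atom m, Size m}"])
    (auto simp: depends_on_def triple_def disjoint_family_on_def)
 show "distr N R3 (\<lambda>y. triple y m) = gamma_law 1 \<Otimes>\<^sub>M (atom_law \<nu> \<Otimes>\<^sub>M gamma_law 1)" for m
 proof -
  have "distr N R3 (\<lambda>y. triple y m) = distr N borel (\<lambda>y. y (Rate m)) \<Otimes>\<^sub>M distr N (borel \<Otimes>\<^sub>M borel) (\<lambda>y. (y (Atom m), y (Size m)))"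
   unfolding triple_def
   by (rule joint_law_of_blocks[where B = "{Rate m}" and B' = "{Atom m, Size m}"]) (auto simp: depends_on_def)
  also have "distr N (borel \<Otimes>\<^sub>M borel) (\<lambda>y. (y (Atom m), y (Size m))) =
    distr N borel (\<lambda>y. y (Atom m)) \<Otimes>\<^sub>M distr N borel (\<lambda>y. y (Size m))"
   by (rule joint_law_of_blocks[where B = "{Atom m}" and B' = "{Size m}"]) (auto simp: depends_on_def)
  finally have "distr N R3 (\<lambda>y. triple y m) = noise_law \<nu> (Rate m) \<Otimes>\<^sub>M (noise_law \<nu> (Atom m) \<Otimes>\<^sub>M noise_law \<nu> (Size m))"
   unfolding coord_law .
  moreover have "noise_law \<nu> (Rate m) = gamma_law 1" "noise_law \<nu> (Atom m) = atom_law \<nu>" "noise_law \<nu> (Size m) = gamma_law 1"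
   by (auto simp: noise_law_def)
  ultimately show ?thesis by (simp only:)
 qed
qed

definition prior_weight :: "(noise => real) => nat => real" where
 "prior_weight y m = (if mass = 0 then 0 else perp_weight mass (triple y) m)"

definition prior_loc :: "(noise => real) => nat => real" where "prior_loc y m = y (Atom m)"

definition data_weight :: "nat => (noise => real) => nat => real" where
 "data_weight n y j = gamma_tree.weight (tree_noise n) n (depth n) y j"

lemma prior_weight_measurable [measurable]: "(\<lambda>y. prior_weight y m) \<in> borel_measurable N"
proof -
 have [measurable]: "(\<lambda>y. fst (triple y k)) \<in> borel_measurable N" "(\<lambda>y. snd (snd (triple y k))) \<in> borel_measurable N" for k
  unfolding triple_def by auto
 show ?thesis unfolding prior_weight_def perp_weight_def perp_scale_def by measurable
qed

lemma prior_loc_measurable [measurable]: "(\<lambda>y. prior_loc y m) \<in> borel_measurable N"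
 unfolding prior_loc_def by measurable

lemma data_weight_measurable: "n > 0 ==> (\<lambda>y. data_weight n y j) \<in> borel_measurable N"
 unfolding data_weight_def by (rule gamma_tree.weight_measurable[OF gamma_tree_noise])

lemma prior_mass_measurable:
 assumes "A \<in> sets borel"
 shows "(\<lambda>y. \<Sum>m. prior_weight y m * indicator A (prior_loc y m)) \<in> borel_measurable N"
 using assms by (intro borel_measurable_suminf borel_measurable_times prior_weight_measurable
   measurable_compose[OF prior_loc_measurable borel_measurable_indicator])

lemma prior_weight_good: "AE y in N. (\<forall>m. 0 <= prior_weight y m) \<and> summable (prior_weight y)"
proof (cases "mass = 0")
 case False
 then have pos: "mass > 0" by (simp add: zero_less_measure_iff)
 interpret P: perpetuity_noise N "\<lambda>m y. triple y m" mass "atom_law \<nu>" by (rule perpetuity_noise_triple[OF pos])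
 have g: "P.gvec y = triple y" for y by (auto simp: P.gvec_def)
 show ?thesis
  using P.AE_perp_weight_nonneg P.AE_perp_weight_summable
  by eventually_elim (use False in \<open>auto simp: prior_weight_def[abs_def] g\<close>)
qed (simp add: prior_weight_def[abs_def])

lemma prior_mass_law:
 fixes A :: "nat => real set"
 assumes A: "A ` {..<k} \<subseteq> sets borel" "disjoint_family_on A {..<k}" "(\<Union>i<k. A i) = UNIV"
 shows "distr N (PiM {..<k} (\<lambda>_. borel)) (\<lambda>y. \<lambda>i\<in>{..<k}. \<Sum>m. prior_weight y m * indicator (A i) (prior_loc y m)) =
   PiM {..<k} (\<lambda>i. gamma_law (measure \<nu> (A i)))"
proof (cases "mass = 0")
 case False
 then have pos: "mass > 0" by (simp add: zero_less_measure_iff)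
 interpret P: perpetuity_noise N "\<lambda>m y. triple y m" mass "atom_law \<nu>" by (rule perpetuity_noise_triple[OF pos])
 have g: "P.gvec y = triple y" for y by (auto simp: P.gvec_def)
 have "(\<Sum>m. prior_weight y m * indicator B (prior_loc y m)) = P.perp_measure y B" for y B
 proof -
  have "fst (snd (triple y m)) = y (Atom m)" for m by (simp add: triple_def)
  then show ?thesis using False by (simp add: P.perp_measure_def g prior_weight_def prior_loc_def)
 qed
 then have "distr N (PiM {..<k} (\<lambda>_. borel)) (\<lambda>y. \<lambda>i\<in>{..<k}. \<Sum>m. prior_weight y m * indicator (A i) (prior_loc y m)) =
   PiM {..<k} (\<lambda>i. gamma_law (mass * measure (atom_law \<nu>) (A i)))"
  using P.distr_perp_measure[OF A, of "\<lambda>i. mass * measure (atom_law \<nu>) (A i)"] by simp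
 also have "... = PiM {..<k} (\<lambda>i. gamma_law (measure \<nu> (A i)))"
  using A(1) atom_law(2)[OF \<nu> pos] by (intro PiM_cong) auto
 finally show ?thesis .
next
 case True
 interpret nu: finite_borel_measure \<nu> by (rule \<nu>)
 have z: "measure \<nu> B = 0" for B
  using nu.bounded_measure[of B] True sets_eq_imp_space_eq[OF nu.M_is_borel] by (simp add: measure_le_0_iff)
 have "PiM {..<k} (\<lambda>i. gamma_law (measure \<nu> (A i))) = PiM {..<k} (\<lambda>i. return borel 0)"
  by (simp add: z gamma_law_def)
 also have "... = return (PiM {..<k} (\<lambda>_. borel)) (\<lambda>i\<in>{..<k}. 0)"
  using PiM_return[of "{..<k}" "\<lambda>_. 0::real" "\<lambda>_. borel"] by simp
 also have "... = distr N (PiM {..<k} (\<lambda>_. borel)) (\<lambda>y. \<lambda>i\<in>{..<k}. 0)"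
  by (rule distr_const[symmetric]) (simp add: space_PiM)
 finally show ?thesis using True by (simp add: prior_weight_def)
qed

text \<open>
  The weights use the sheet, totals and leaves, the prior measure uses the triples.
\<close>
lemma data_prior_indep:
 assumes n: "n > 0" and A: "A ` {..<k} \<subseteq> sets borel"
 shows "indep_var (PiM {..<n} (\<lambda>_. borel)) (\<lambda>y. \<lambda>j\<in>{..<n}. data_weight n y j)
   (PiM {..<k} (\<lambda>_. borel)) (\<lambda>y. \<lambda>i\<in>{..<k}. \<Sum>m. prior_weight y m * indicator (A i) (prior_loc y m))"
proof (rule indep_var_of_blocks)
 interpret T: gamma_tree N "tree_noise n" n "depth n" by (rule gamma_tree_noise[OF n])
 let ?B = "range Sheet \<union> range Total \<union> (\<Union>n. range (Leaf n))" and ?B' = "range Rate \<union> range Atom \<union> range Size"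
 show "(\<lambda>y. \<lambda>j\<in>{..<n}. data_weight n y j) \<in> measurable N (PiM {..<n} (\<lambda>_. borel))"
  by (intro measurable_restrict data_weight_measurable n)
 show "(\<lambda>y. \<lambda>i\<in>{..<k}. \<Sum>m. prior_weight y m * indicator (A i) (prior_loc y m)) \<in> measurable N (PiM {..<k} (\<lambda>_. borel))"
  using A by (intro measurable_restrict prior_mass_measurable) auto
 show "?B \<inter> ?B' = {}" by auto
 show "depends_on (\<lambda>y. \<lambda>i\<in>{..<k}. \<Sum>m. prior_weight y m * indicator (A i) (prior_loc y m)) ?B'"
  unfolding depends_on_def
 proof (intro allI impI)
  fix y y' :: "noise => real" assume "\<forall>c\<in>?B'. y c = y' c"
  then have "triple y = triple y'" "prior_loc y = prior_loc y'" by (auto simp: triple_def prior_loc_def fun_eq_iff)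
  moreover from this have pw: "perp_weight mass (triple y) = perp_weight mass (triple y')" by simp
  have "prior_weight y = prior_weight y'" unfolding prior_weight_def fun_eq_iff pw by simp
  ultimately show "(\<lambda>i\<in>{..<k}. \<Sum>m. prior_weight y m * indicator (A i) (prior_loc y m)) =
   (\<lambda>i\<in>{..<k}. \<Sum>m. prior_weight y' m * indicator (A i) (prior_loc y' m))" by simp
 qed
 show "depends_on (\<lambda>y. \<lambda>j\<in>{..<n}. data_weight n y j) ?B"
  unfolding depends_on_def
 proof (intro allI impI)
  fix y y' :: "noise => real" assume "\<forall>c\<in>?B. y c = y' c"
  then have "y (Sheet s) = y' (Sheet s)" "y (Total m) = y' (Total m)" "y (Leaf m b) = y' (Leaf m b)" for s m b by blast+
  then have eq: "tree_noise n i y = tree_noise n i y'" for i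
   unfolding tree_noise_def by (auto split: nat.splits)
  have nn: "T.node_noise y = T.node_noise y'" by (auto simp: T.node_noise_def eq fun_eq_iff)
  show "(\<lambda>j\<in>{..<n}. data_weight n y j) = (\<lambda>j\<in>{..<n}. data_weight n y' j)"
   unfolding data_weight_def T.weight_def T.piece_def T.cell_mass_def eq nn ..
 qed
qed

lemma posterior_noise_model:
 assumes n: "n > 0"
 shows "posterior_noise N n (data_weight n) prior_weight prior_loc \<nu>"
proof (intro posterior_noise.intro posterior_noise_axioms.intro prob_space_axioms)
 show "n > 0" by (rule n)
 show "finite_borel_measure \<nu>" by (rule \<nu>)
 show "distr N (PiM {..<n} (\<lambda>_. borel)) (\<lambda>y. \<lambda>j\<in>{..<n}. data_weight n y j) = PiM {..<n} (\<lambda>_. gamma_law 1)"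
  unfolding data_weight_def by (rule gamma_tree.distr_weight[OF gamma_tree_noise[OF n]])
 show "AE y in N. \<forall>m. 0 <= prior_weight y m" "AE y in N. summable (prior_weight y)"
  using prior_weight_good by auto
qed (auto intro: data_weight_measurable n prior_mass_law data_prior_indep)

end

section \<open>Exceptional events\<close>

text \<open>
  Chernoff bound in the form used for all exceptional events: \<open>c\<close> is the logarithm of a bound for the
  exponential moment.
\<close>
lemma (in prob_space) exponential_tail_bound:
 assumes [measurable]: "f \<in> borel_measurable M" and f: "(\<integral>\<^sup>+w. ennreal (exp (f w)) \<partial>M) <= ennreal (exp c)"
 shows "prob {w\<in>space M. f w > c + x} <= exp (- x)"
proof -
 let ?a = "exp (- (c + x))"
 have "emeasure M {w\<in>space M. f w > c + x} <= emeasure M {w\<in>space M. 1 <= ennreal ?a * ennreal (exp (f w))}"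
 proof (intro emeasure_mono)
  have "1 <= ennreal ?a * ennreal (exp (f w))" if "f w > c + x" for w
   using that by (simp flip: ennreal_mult exp_add)
  then show "{w\<in>space M. f w > c + x} \<subseteq> {w\<in>space M. 1 <= ennreal ?a * ennreal (exp (f w))}" by auto
 qed measurable
 also have "... <= ennreal ?a * (\<integral>\<^sup>+w. ennreal (exp (f w)) * indicator (space M) w \<partial>M)"
  by (rule nn_integral_Markov_inequality) auto
 also have "(\<integral>\<^sup>+w. ennreal (exp (f w)) * indicator (space M) w \<partial>M) = (\<integral>\<^sup>+w. ennreal (exp (f w)) \<partial>M)"
  by (intro nn_integral_cong) auto
 also have "ennreal ?a * (\<integral>\<^sup>+w. ennreal (exp (f w)) \<partial>M) <= ennreal ?a * ennreal (exp c)"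
  by (rule mult_left_mono[OF f]) simp
 also have "... = ennreal (exp (- x))" by (simp flip: ennreal_mult exp_add)
 finally show ?thesis by (simp add: emeasure_eq_measure)
qed

lemma nn_integral_normal_square: "(\<integral>\<^sup>+z. ennreal (exp (z\<^sup>2 / 4)) \<partial>std_normal_distribution) <= 2"
proof -
 interpret g: prob_space "density lborel (normal_density 0 (sqrt 2))" by (rule prob_space_normal_density) simp
 have d: "normal_density 0 1 z * exp (z\<^sup>2 / 4) = sqrt 2 * normal_density 0 (sqrt 2) z" for z
 proof -
  \<comment> \<open>normal_density 0 1 z * exp (z^2 / 4) is sqrt 2 times the density with variance 2\<close>
  have alg: "c1 * e1 * e2 = sqrt 2 * (c2 * e3)" if "e1 * e2 = e3" "sqrt 2 * c2 = c1" for c1 c2 e1 e2 e3 :: real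
   using that by (metis mult.assoc)
  show ?thesis unfolding normal_density_def
   by (rule alg, simp flip: exp_add, simp add: real_sqrt_mult frac_eq_eq mult.assoc[symmetric])
 qed
 have "(\<integral>\<^sup>+z. ennreal (exp (z\<^sup>2 / 4)) \<partial>std_normal_distribution) = (\<integral>\<^sup>+z. ennreal (sqrt 2) * ennreal (normal_density 0 (sqrt 2) z) \<partial>lborel)"
  by (subst nn_integral_density) (auto simp: d ennreal_mult[symmetric] intro!: nn_integral_cong)
 also have "... = ennreal (sqrt 2) * emeasure (density lborel (normal_density 0 (sqrt 2))) UNIV"
  by (simp add: nn_integral_cmult emeasure_density)
 also have "... = ennreal (sqrt 2)" using g.emeasure_space_1 by simp
 also have "... <= ennreal 2" using sqrt2_less_2 by (intro ennreal_leI) simp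
 finally show ?thesis by simp
qed

text \<open>
  The exponential moment of \<open>z\<^sup>2 / 4\<close> under the standard normal law is \<open>sqrt 2\<close>, and
  smaller variances only decrease it.
\<close>
lemma (in prob_space) gauss_tail:
 assumes [measurable]: "X \<in> borel_measurable M" and law: "distr M borel X = gauss_law \<sigma>" and \<sigma>: "\<bar>\<sigma>\<bar> <= 1"
  and L: "L >= 0"
 shows "prob {w\<in>space M. \<bar>X w\<bar> > 2 * sqrt L} <= 2 * exp (- L)"
proof -
 have "(\<integral>\<^sup>+w. ennreal (exp ((X w)\<^sup>2 / 4)) \<partial>M) = (\<integral>\<^sup>+z. ennreal (exp (z\<^sup>2 / 4)) \<partial>distr M borel X)"
  by (subst nn_integral_distr) auto
 also have "... = (\<integral>\<^sup>+z. ennreal (exp ((\<sigma> * z)\<^sup>2 / 4)) \<partial>std_normal_distribution)"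
  unfolding law gauss_law_def by (subst nn_integral_distr) auto
 also have "... <= (\<integral>\<^sup>+z. ennreal (exp (z\<^sup>2 / 4)) \<partial>std_normal_distribution)"
 proof (rule nn_integral_mono, rule ennreal_leI)
  fix z
  have "\<sigma>\<^sup>2 <= 1" using \<sigma> by (simp add: abs_square_le_1)
  then have "(\<sigma> * z)\<^sup>2 <= z\<^sup>2" using mult_right_mono[of "\<sigma>\<^sup>2" 1 "z\<^sup>2"] by (simp add: power_mult_distrib)
  then show "exp ((\<sigma> * z)\<^sup>2 / 4) <= exp (z\<^sup>2 / 4)" by simp
 qed
 also note nn_integral_normal_square
 also have "(2 :: ennreal) = ennreal (exp (ln 2))" by simp
 finally have "prob {w\<in>space M. (X w)\<^sup>2 / 4 > ln 2 + (L - ln 2)} <= exp (- (L - ln 2))"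
  by (intro exponential_tail_bound) auto
 moreover have "\<bar>t\<bar> > 2 * sqrt L \<longleftrightarrow> t\<^sup>2 / 4 > L" for t
 proof -
  have "t\<^sup>2 / 4 > L \<longleftrightarrow> sqrt (t\<^sup>2 / 4) > sqrt L" by simp
  also have "sqrt (t\<^sup>2 / 4) = \<bar>t\<bar> / 2" by (simp add: real_sqrt_divide)
  finally show ?thesis by auto
 qed
 ultimately show ?thesis by (simp add: exp_diff exp_minus field_simps)
qed

context noise_model begin

definition prior_mass :: "(noise => real) => real" where "prior_mass y = suminf (prior_weight y)"

lemma prior_mass_meas [measurable]: "prior_mass \<in> borel_measurable N"
 using prior_mass_measurable[of UNIV] by (simp add: prior_mass_def[abs_def])

lemma distr_prior_mass: "distr N borel prior_mass = gamma_law mass"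
proof -
 let ?P = "PiM {..<1} (\<lambda>_. borel :: real measure)"
 have "distr N ?P (\<lambda>y. \<lambda>i\<in>{..<1::nat}. \<Sum>m. prior_weight y m * indicator UNIV (prior_loc y m)) = PiM {..<1} (\<lambda>i. gamma_law mass)"
  by (rule prior_mass_law) (auto simp: disjoint_family_on_def)
 then have law: "distr N ?P (\<lambda>y. \<lambda>i\<in>{..<1::nat}. prior_mass y) = PiM {..<1} (\<lambda>i. gamma_law mass)"
  by (simp add: prior_mass_def)
 have "distr N borel prior_mass = distr (distr N ?P (\<lambda>y. \<lambda>i\<in>{..<1::nat}. prior_mass y)) borel (\<lambda>g. g 0)"
  by (subst distr_distr) (auto simp: o_def intro!: measurable_restrict)
 also have "... = distr (PiM {..<1::nat} (\<lambda>i. gamma_law mass)) (gamma_law mass) (\<lambda>g. g 0)"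
  unfolding law by (rule distr_cong) auto
 also have "... = gamma_law mass" by (rule distr_PiM_component) (auto simp: prob_space_gamma_law)
 finally show ?thesis .
qed

text \<open>
  The total mass has law \<open>Gamma(|\<nu>|)\<close>, for which \<open>exp (t / 2)\<close> has expectation
  \<open>2\<close> to the power \<open>|\<nu>|\<close>.
\<close>
lemma prior_mass_tail: "prob {y\<in>space N. prior_mass y > 2 * ln 2 * mass + 2 * x} <= exp (- x)"
proof -
 have "(\<integral>\<^sup>+y. ennreal (exp (prior_mass y / 2)) \<partial>N) = (\<integral>\<^sup>+t. ennreal (exp (1 / 2 * t)) \<partial>distr N borel prior_mass)"
  by (subst nn_integral_distr) auto
 also have "... = ennreal ((1 - 1 / 2) powr (- mass))"
  unfolding distr_prior_mass by (rule nn_integral_gamma_exp) auto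
 also have "(1 - 1 / 2) powr (- mass) = exp (ln 2 * mass)" by (simp add: powr_def ln_div)
 finally have "prob {y\<in>space N. prior_mass y / 2 > ln 2 * mass + x} <= exp (- x)"
  by (intro exponential_tail_bound) auto
 moreover have "{y\<in>space N. prior_mass y / 2 > ln 2 * mass + x} = {y\<in>space N. prior_mass y > 2 * ln 2 * mass + 2 * x}" by auto
 ultimately show ?thesis by simp
qed

text \<open>
  Here \<open>exp (- 3 T)\<close> has expectation \<open>4\<close> to the power \<open>- n\<close>, and \<open>ln 4
  - 3 / 4 \<ge> 1 / 2\<close>.
\<close>
lemma total_tail:
 assumes x: "x <= real n / 2"
 shows "prob {y\<in>space N. y (Total n) < real n / 4} <= exp (- x)"
proof -
 have "(\<integral>\<^sup>+y. ennreal (exp (- 3 * y (Total n))) \<partial>N) = (\<integral>\<^sup>+t. ennreal (exp ((- 3) * t)) \<partial>distr N borel (\<lambda>y. y (Total n)))"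
  by (subst nn_integral_distr) auto
 also have "... = ennreal ((1 - (- 3)) powr (- real n))"
  unfolding coord_law noise_law_def noise.case by (rule nn_integral_gamma_exp) auto
 also have "(1 - (- 3)) powr (- real n) = exp (- (real n * ln 4))" by (simp add: powr_def)
 finally have "prob {y\<in>space N. - 3 * y (Total n) > - (real n * ln 4) + x} <= exp (- x)"
  by (intro exponential_tail_bound) auto
 moreover have "prob {y\<in>space N. y (Total n) < real n / 4} <= prob {y\<in>space N. - 3 * y (Total n) > - (real n * ln 4) + x}"
 proof (intro finite_measure_mono)
  have "ln (4 :: real) = 2 * ln 2" using ln_realpow[of "2 :: real" 2] by simp
  then have "ln (4 :: real) >= 5 / 4" using ln2_ge_two_thirds by simp
  then have "real n * ln 4 >= real n * (5 / 4)" by (intro mult_left_mono) auto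
  then show "{y\<in>space N. y (Total n) < real n / 4} \<subseteq> {y\<in>space N. - 3 * y (Total n) > - (real n * ln 4) + x}"
   using x by auto
 qed measurable
 ultimately show ?thesis by linarith
qed

definition nearest_dyadic :: "nat => nat => nat" where
 "nearest_dyadic n j = nat \<lceil>real j / cell_width n (depth n)\<rceil>"

abbreviation kief_n :: "nat => real => (noise => real) => real" where "kief_n n s \<equiv> sheet.kief (s, real n)"

text \<open>
  The increment has variance \<open>n (|s - t| - (s - t)\<^sup>2) \<le> 1\<close>.
\<close>
lemma kiefer_increment_tail:
 assumes n: "n > 0" and s: "0 <= s" "s <= 1" "0 <= t" "t <= 1" "\<bar>s - t\<bar> <= 1 / n" and L: "L >= 0"
 shows "prob {y\<in>space N. \<bar>kief_n n s y - kief_n n t y\<bar> > 2 * sqrt L} <= 2 * exp (- L)"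
proof (cases "s = t")
 case True
 then show ?thesis using L by simp
next
 case False
 let ?z = "(s, real n)" and ?z' = "(t, real n)"
 have mem: "?z \<in> kiefer_index" "?z' \<in> kiefer_index" using s by (auto simp: kiefer_index_def)
 let ?r = "sheet.kcov ?z ?z + 2 * (- 1) * sheet.kcov ?z ?z' + (- 1)\<^sup>2 * sheet.kcov ?z' ?z'"
 have law: "distr N borel (\<lambda>y. kief_n n s y + (- 1) * kief_n n t y) = gauss_law (sqrt ?r)" and r0: "0 <= ?r"
  using sheet.distr_kief_pair[OF mem, of "- 1"] False by auto
 have "?r = real n * (\<bar>s - t\<bar> - (s - t)\<^sup>2)"
  by (simp add: sheet.kcov_def power2_eq_square abs_if min_def algebra_simps)
 also have "... <= real n * (1 / real n)" using s(5) by (intro mult_left_mono) (smt (verit) zero_le_power2, simp)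
 finally have r1: "?r <= 1" using n by simp
 show ?thesis
  using gauss_tail[OF _ law _ L] r0 r1 by simp
qed

text \<open>
  With \<open>L = ln n + x\<close>, each of the at most \<open>2 n\<close> normals of the tree and each of the
  \<open>n + 1\<close> increments exceeds \<open>2 sqrt L\<close> with probability at most \<open>2 exp (- x) /
  n\<close>. A small total mass is excluded only for \<open>x \<le> n / 2\<close>; for larger \<open>x\<close> the
  trivial bound 1 for the prior share is good enough.
\<close>
definition bad_noise :: "nat => real => (noise => real) set" where
 "bad_noise n x = {y\<in>space N.
   (\<exists>i\<in>(SIGMA q:{..<depth n}. {..<2 ^ q}). \<bar>tree_noise n (Suc (fst i), snd i) y\<bar> > 2 * sqrt (ln n + x)) \<or>
   (\<exists>j\<in>{..n}. \<bar>kief_n n (real j / n) y - kief_n n (real (nearest_dyadic n j) / 2 ^ depth n) y\<bar> > 2 * sqrt (ln n + x)) \<or>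
   prior_mass y > 2 * ln 2 * mass + 2 * x \<or> (x <= real n / 2 \<and> y (Total n) < real n / 4)}"

lemma bad_noise_sets: "bad_noise n x \<in> sets N"
 unfolding bad_noise_def by measurable

lemma nearest_dyadic_bounds:
 assumes n: "n > 0" and j: "j <= n"
 shows "nearest_dyadic n j <= 2 ^ depth n" "\<bar>real (nearest_dyadic n j) / 2 ^ depth n - real j / n\<bar> <= 1 / n"
proof -
 define K :: real where "K = 2 ^ depth n"
 have K: "real n <= K" "K > 0" unfolding K_def using depth(1)[of n] by (metis of_nat_le_iff of_nat_numeral of_nat_power, simp)
 have c: "real j / cell_width n (depth n) = real j * K / n" by (simp add: cell_width_def K_def)
 have le: "real j * K / n <= K" using n j K by (simp add: field_simps)
 have ge: "real j * K / n >= 0" using K by simp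
 have b: "real j * K / n <= real (nearest_dyadic n j)" "real (nearest_dyadic n j) < real j * K / n + 1"
  unfolding nearest_dyadic_def c using ge by linarith+
 have "\<lceil>real j * K / n\<rceil> <= \<lceil>K\<rceil>" by (rule ceiling_mono[OF le])
 also have "\<lceil>K\<rceil> = int (2 ^ depth n)" unfolding K_def by (metis ceiling_of_nat of_nat_numeral of_nat_power)
 finally show "nearest_dyadic n j <= 2 ^ depth n" unfolding nearest_dyadic_def c by simp
 have "real (nearest_dyadic n j) / K - real j / n = (real (nearest_dyadic n j) - real j * K / n) / K"
  using K n by (simp add: field_simps)
 then have "\<bar>real (nearest_dyadic n j) / K - real j / n\<bar> = \<bar>real (nearest_dyadic n j) - real j * K / n\<bar> / K"
  using K by (simp only: abs_divide abs_of_pos)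
 also have "... <= 1 / K" using b K by (intro divide_right_mono) auto
 also have "... <= 1 / n" using K n by (intro divide_left_mono) auto
 finally show "\<bar>real (nearest_dyadic n j) / 2 ^ depth n - real j / n\<bar> <= 1 / n" unfolding K_def .
qed

lemma gauss_law_one: "gauss_law 1 = std_normal_distribution"
 unfolding gauss_law_def mult_1 by (rule distr_id2) simp

lemma bad_noise_prob:
 assumes n: "n > 0" and x: "x >= 0"
 shows "prob (bad_noise n x) <= 10 * exp (- x)"
proof -
 let ?L = "ln n + x"
 have L: "?L >= 0" using n x by simp
 have "- ?L = - x - ln n" by simp
 then have eL: "exp (- ?L) = exp (- x) / n" using n by (simp only: exp_diff) simp
 let ?I = "SIGMA q:{..<depth n}. {..<2 ^ q :: nat}"
 let ?A = "\<lambda>i. {y\<in>space N. \<bar>tree_noise n (Suc (fst i), snd i) y\<bar> > 2 * sqrt ?L}"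
 let ?B = "\<lambda>j. {y\<in>space N. \<bar>kief_n n (real j / n) y - kief_n n (real (nearest_dyadic n j) / 2 ^ depth n) y\<bar> > 2 * sqrt ?L}"
 let ?C = "{y\<in>space N. prior_mass y > 2 * ln 2 * mass + 2 * x}"
 let ?D = "{y\<in>space N. x <= real n / 2 \<and> y (Total n) < real n / 4}"
 have A: "prob (\<Union>i\<in>?I. ?A i) <= 4 * exp (- x)"
 proof -
  have "prob (\<Union>i\<in>?I. ?A i) <= (\<Sum>i\<in>?I. prob (?A i))"
   by (rule finite_measure_subadditive_finite) auto
  also have "... <= (\<Sum>i\<in>?I. 2 * exp (- ?L))"
  proof (rule sum_mono)
   fix i assume "i \<in> ?I"
   then show "prob (?A i) <= 2 * exp (- ?L)"
    using gamma_tree.law_node[OF gamma_tree_noise[OF n], of "fst i" "snd i"] L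
    by (intro gauss_tail[where \<sigma> = 1]) (auto simp: gauss_law_one)
  qed
  also have "... = real (card ?I) * (2 * exp (- ?L))" by simp
  also have "real (card ?I) <= 2 * real n"
  proof -
   have "card ?I = (\<Sum>q<depth n. 2 ^ q)" by simp
   also have "... <= 2 ^ depth n"
   proof -
    have "(\<Sum>q<K. 2 ^ q) <= (2 :: nat) ^ K" for K by (induction K) auto
    then show ?thesis .
   qed
   also have "... <= 2 * n" by (rule depth(2)[OF n])
   finally show ?thesis by (simp flip: of_nat_le_iff[where 'a = real])
  qed
  finally show ?thesis using n unfolding eL by (simp add: mult_right_mono field_simps)
 qed
 have B: "prob (\<Union>j\<in>{..n}. ?B j) <= 4 * exp (- x)"
 proof -
  have "prob (\<Union>j\<in>{..n}. ?B j) <= (\<Sum>j\<in>{..n}. prob (?B j))"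
   by (rule finite_measure_subadditive_finite) auto
  also have "... <= (\<Sum>j\<in>{..n}. 2 * exp (- ?L))"
  proof (rule sum_mono)
   fix j assume "j \<in> {..n}"
   then have j: "j <= n" by simp
   have "real (nearest_dyadic n j) <= 2 ^ depth n"
    using nearest_dyadic_bounds(1)[OF n j] by (metis of_nat_le_iff of_nat_numeral of_nat_power)
   then show "prob (?B j) <= 2 * exp (- ?L)"
    using n j nearest_dyadic_bounds(2)[OF n j] by (intro kiefer_increment_tail n L) (auto simp: abs_minus_commute)
  qed
  also have "... = real (n + 1) * (2 * exp (- ?L))" by simp
  also have "... <= (2 * real n) * (2 * exp (- ?L))" using n by (intro mult_right_mono) auto
  finally show ?thesis using n unfolding eL by (simp add: field_simps)
 qed
 have D: "prob ?D <= exp (- x)"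
 proof (cases "x <= real n / 2")
  case True
  then show ?thesis using total_tail[OF True] by simp
 qed simp
 have alg: "p <= 10 * e" if "p <= a + (b + (c + d))" "a <= 4 * e" "b <= 4 * e" "c <= e" "d <= e" for p a b c d e :: real
  using that by linarith
 have eq: "bad_noise n x = (\<Union>i\<in>?I. ?A i) \<union> ((\<Union>j\<in>{..n}. ?B j) \<union> (?C \<union> ?D))"
  unfolding bad_noise_def by blast
 have "prob ((\<Union>i\<in>?I. ?A i) \<union> ((\<Union>j\<in>{..n}. ?B j) \<union> (?C \<union> ?D))) <=
   prob (\<Union>i\<in>?I. ?A i) + (prob (\<Union>j\<in>{..n}. ?B j) + (prob ?C + prob ?D))"
  by (intro order_trans[OF measure_Un_le] add_mono order_refl) auto
 from alg[OF this A B prior_mass_tail D] show ?thesis unfolding eq .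
qed

end

section \<open>Error of the approximation\<close>

lemma dyadic_bridge_cong:
 assumes "\<And>r c. r < q ==> c < 2 ^ r ==> \<eta> r c = \<eta>' r c" "b <= 2 ^ q"
 shows "dyadic_bridge \<eta> q b = dyadic_bridge \<eta>' q b"
 using assms
proof (induction q arbitrary: b)
 case (Suc q)
 have IH: "c <= 2 ^ q ==> dyadic_bridge \<eta> q c = dyadic_bridge \<eta>' q c" for c
  using Suc by simp
 show ?case
 proof (cases "even b")
  case True
  then show ?thesis using IH[of "b div 2"] Suc.prems by auto
 next
  case False
  then have "b div 2 < 2 ^ q" using Suc.prems(2) by (auto elim!: oddE)
  then show ?thesis using False IH[of "b div 2"] IH[of "b div 2 + 1"] Suc.prems(1)[of q "b div 2"] by simp
 qed
qed simp

text \<open>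
  The left fraction is a convex combination of \<open>S / T\<close> and \<open>g / c\<close> with weight \<open>c /
  (c + T)\<close> on the latter.
\<close>
lemma mixture_error:
 fixes S T g c :: real
 assumes "0 <= S" "S <= T" "0 < T" "0 <= g" "g <= c"
 shows "\<bar>(S + g) / (T + c) - S / T\<bar> <= c / (c + T)"
proof -
 have pos: "T * (T + c) > 0" using assms by auto
 have "(S + g) / (T + c) - S / T = (g * T - S * c) / (T * (T + c))"
  using assms by (simp add: field_simps add_nonneg_eq_0_iff)
 moreover have le: "\<bar>g * T - S * c\<bar> <= c * T"
 proof -
  have "0 <= g * T" "g * T <= c * T" "0 <= S * c" "S * c <= T * c"
   using assms by (auto intro!: mult_nonneg_nonneg mult_right_mono)
  moreover have "T * c = c * T" by simp
  ultimately show ?thesis by linarith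
 qed
 moreover have "\<bar>(g * T - S * c) / (T * (T + c))\<bar> = \<bar>g * T - S * c\<bar> / (T * (T + c))"
  using pos by (simp only: abs_divide abs_of_pos)
 ultimately have "\<bar>(S + g) / (T + c) - S / T\<bar> <= (c * T) / (T * (T + c))"
  using divide_right_mono[OF le less_imp_le[OF pos]] by (simp only:)
 also have "... = c / (c + T)" using assms by (simp only: mult.commute[of c T]) (simp add: add.commute)
 finally show ?thesis .
qed

lemma ln_nat_ge: "n >= 2 ==> ln (real n) >= 2 / 3"
proof -
 assume "n >= 2"
 then have "ln 2 <= ln (real n)" by simp
 then show ?thesis using ln2_ge_two_thirds by linarith
qed

lemma depth_le_ln:
 assumes "n >= 2"
 shows "real (depth n) <= 3 * ln n"
proof -
 have "2 ^ depth n <= 2 * real n" using depth(2)[of n] assms by (metis of_nat_le_iff of_nat_mult of_nat_numeral of_nat_power gr0I not_numeral_le_zero)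
 then have "ln (2 ^ depth n) <= ln (2 * real n)" using assms by (intro ln_mono) auto
 then have "real (depth n) * ln 2 <= ln 2 + ln n" using assms by (simp add: ln_realpow ln_mult)
 moreover have "ln 2 <= ln (real n)" using assms by simp
 moreover have "real (depth n) * (2 / 3) <= real (depth n) * ln 2" using ln2_ge_two_thirds by (intro mult_left_mono) auto
 ultimately show ?thesis by linarith
qed

text \<open>
  Uses \<open>depth n \<le> 3 ln n\<close>, and \<open>ln n \<ge> 2/3\<close> to turn constants into multiples of
  \<open>ln n\<close>.
\<close>
lemma discretization_error_bound:
 assumes n: "n >= 2" and x: "x >= 1"
 shows "603 * (ln n + x) * depth n + 2401 * (ln n + x) + 2 * sqrt (ln n + x) <= 5500 * (ln n + x) * ln n"
proof -
 let ?L = "ln n + x"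
 have l: "ln n >= 2 / 3" by (rule ln_nat_ge[OF n])
 have L: "?L >= 1" using l x by simp
 have "sqrt ?L <= ?L" using L by (intro real_le_lsqrt) (auto simp: power2_eq_square mult_le_cancel_left1)
 moreover have "?L * depth n <= ?L * (3 * ln n)" using L depth_le_ln[OF n] by (intro mult_left_mono) auto
 moreover have "?L * (2 / 3) <= ?L * ln n" using l L by (intro mult_left_mono) auto
 moreover have "603 * K + 2401 * M + 2 * s <= 5500 * P" if "s <= M" "K <= 3 * P" "M * (2 / 3) <= P" "M >= 1" for K M s P :: real
  using that by linarith
 ultimately have "603 * (?L * depth n) + 2401 * ?L + 2 * sqrt ?L <= 5500 * (?L * ln n)"
  using L by (simp only: mult.left_commute[of ?L 3])
 then show ?thesis by (simp only: mult.assoc)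
qed

context noise_model begin

definition post :: "nat => (nat => real) => (noise => real) => real measure" where
 "post n z y = posterior_noise.posterior n (data_weight n) prior_weight prior_loc z y"

text \<open>
  The almost sure properties on which the pathwise estimate relies.
\<close>
definition regular_noise :: "nat => (noise => real) => bool" where
 "regular_noise n y \<longleftrightarrow> good_array (sheet.arr y) \<and> gamma_tree.good_leaves (tree_noise n) n (depth n) y \<and>
   posterior_noise.good_weights n (data_weight n) prior_weight y"

text \<open>
  For \<open>x \<le> n / 2\<close> the prior share is at most \<open>4 V / n\<close> with \<open>V \<le> 2 ln 2
  |\<nu>| + 2 x\<close>; otherwise it is at most \<open>1 \<le> 2 x / n\<close>.
\<close>
lemma prior_term_bounds:
 assumes n: "n > 0" and x: "x >= 1" and y: "y \<notin> bad_noise n x" and V: "prior_mass y >= 0" and T: "y (Total n) > 0" and n2: "n >= 2"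
 shows "sqrt n * (prior_mass y / (prior_mass y + y (Total n))) <= (6 * mass + 12 * x * ln n) / sqrt n"
proof -
 let ?V = "prior_mass y" and ?T = "y (Total n)"
 have sn: "sqrt n > 0" "sqrt n * sqrt n = n" using n by auto
 have xl: "x * (2 / 3) <= x * ln n" using ln_nat_ge[OF n2] x by (intro mult_left_mono) auto
 have frac: "n * (?V / (?V + ?T)) <= 6 * mass + 12 * x * ln n"
 proof (cases "x <= real n / 2")
  case True
  then have T4: "?T >= real n / 4" and V4: "?V <= 2 * ln 2 * mass + 2 * x"
   using y by (auto simp: bad_noise_def space_N not_less)
  have "?V / (?V + ?T) <= ?V / (real n / 4)" using V T4 n by (intro divide_left_mono) auto
  then have "n * (?V / (?V + ?T)) <= n * (?V / (real n / 4))" using n by (intro mult_left_mono) auto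
  also have "... = 4 * ?V" using n by simp
  also have "... <= 8 * (ln 2 * mass) + 8 * x" using V4 by simp
  also have "ln 2 * mass <= 3 / 4 * mass" using ln2_le_25_over_36 by (intro mult_right_mono) auto
  also have "8 * (3 / 4 * mass) + 8 * x <= 6 * mass + 12 * (x * ln n)" using xl by simp
  finally show ?thesis by (simp add: mult.assoc)
 next
  case False
  have "?V / (?V + ?T) <= 1" using V T by simp
  then have "real n * (?V / (?V + ?T)) <= real n * 1" by (rule mult_left_mono) simp
  also have "... <= 2 * x" using False by simp
  also have "... <= 6 * mass + 12 * (x * ln n)"
  proof -
   have "0 <= 6 * mass" by simp
   then show ?thesis using xl x by linarith
  qed
  finally show ?thesis by (simp add: mult.assoc)
 qed
 have "sqrt n * w = n * w / sqrt n" for w :: real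
  using sn by (simp add: nonzero_eq_divide_eq)
 then have "sqrt n * (?V / (?V + ?T)) = n * (?V / (?V + ?T)) / sqrt n" .
 also have "... <= (6 * mass + 12 * x * ln n) / sqrt n" using frac sn by (intro divide_right_mono) auto
 finally show ?thesis .
qed

text \<open>
  Three comparisons are added up: the posterior with the data weights alone, these with the bridge at the
  neighbouring cell boundary, and the bridge there with the Kiefer process at \<open>j / n\<close>.
\<close>
theorem posterior_kiefer_error:
 assumes n: "n >= 2" and x: "x >= 1" and y: "y \<notin> bad_noise n x" and reg: "regular_noise n y"
 shows "\<bar>sqrt n * (cdf (post n z y) t - real (count_le n z t) / n) - kief_n n (real (count_le n z t) / n) y / sqrt n\<bar>
   <= (6 * mass + 12 * x * ln n + 5500 * (ln n + x) * ln n) / sqrt n"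
proof -
 have n0: "n > 0" using n by simp
 interpret P: posterior_noise N n "data_weight n" prior_weight prior_loc \<nu> by (rule posterior_noise_model[OF n0])
 interpret T: gamma_tree N "tree_noise n" n "depth n" by (rule gamma_tree_noise[OF n0])
 let ?L = "ln n + x" and ?j = "count_le n z t" and ?T = "y (Total n)" and ?V = "prior_mass y"
 have leaves: "T.good_leaves y" and arr: "good_array (sheet.arr y)" and gw: "P.good_weights y"
  using reg by (auto simp: regular_noise_def)
 then have e: "\<And>k. k < n ==> data_weight n y k > 0" and v: "\<And>m. 0 <= prior_weight y m" "summable (prior_weight y)"
  by (auto simp: P.good_weights_def)
 have ws: "(\<Sum>k<j. data_weight n y k) = T.weight_sum y j" for j by (simp add: T.weight_sum_def data_weight_def)
 have tot: "T.weight_sum y n = ?T" using T.weight_sum_total[OF leaves] by (simp add: tree_noise_def)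
 have Tpos: "?T > 0" using e n0 unfolding tot[symmetric] ws[symmetric] by (intro sum_pos) (auto simp: lessThan_empty_iff)
 have jn: "?j <= n" by (rule count_le_bound)
 have Vnn: "?V >= 0" unfolding prior_mass_def using v by (intro suminf_nonneg)
 \<comment> \<open>data part and prior part of the unnormalised posterior mass of {..t}\<close>
 define S where "S = T.weight_sum y ?j"
 define g where "g = (\<Sum>m. prior_weight y m * indicator {..t} (prior_loc y m))"
 have S: "0 <= S" "S <= ?T"
 proof -
  show "0 <= S" unfolding S_def ws[symmetric] using e jn by (intro sum_nonneg) (auto intro: less_imp_le)
  show "S <= ?T" unfolding S_def tot[symmetric] ws[symmetric] using e jn by (intro sum_mono2) (auto intro: less_imp_le)
 qed
 have sg: "summable (\<lambda>m. prior_weight y m * indicator {..t} (prior_loc y m))"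
  by (rule summable_comparison_test'[OF v(2), of 0]) (use v in \<open>auto simp: indicator_def\<close>)
 have g: "0 <= g" "g <= ?V"
  unfolding g_def prior_mass_def using v sg by (auto intro!: suminf_nonneg suminf_le simp: indicator_def)
 have cdf: "cdf (post n z y) t = (S + g) / (?T + ?V)"
  unfolding post_def P.posterior_def S_def g_def
  using cdf_spliced[of n "data_weight n y" "prior_weight y" z "prior_loc y" t] e v P.total_pos[OF gw]
  by (simp add: ws tot prior_mass_def less_imp_le)
 have nodes: "\<bar>T.node_noise y q b\<bar> <= 2 * sqrt ?L" if "q < depth n" "b < 2 ^ q" for q b
  using y that by (auto simp: bad_noise_def T.node_noise_def space_N not_less)
 have L: "?L >= 1" using ln_nat_ge[OF n] x by simp
 let ?b = "nearest_dyadic n ?j"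
 have Tp: "tree_noise n (0, 0) y > 0" using Tpos by (simp add: tree_noise_def)
 note err = T.weight_sum_error[OF leaves Tp L nodes jn nearest_dyadic_def]
 have kd: "kief_n n (real ?b / 2 ^ depth n) y = sqrt n * dyadic_bridge (T.node_noise y) (depth n) ?b"
 proof -
  have "kief_n n (real ?b / 2 ^ depth n) y =
   sqrt n * dyadic_bridge (\<lambda>r b. (\<Sum>i<n. sheet.arr y (i, 0, 0, r, b)) / sqrt n) (depth n) ?b"
   unfolding sheet.kief_def by (rule kiefer_of_integer_dyadic[OF arr n0 err(1)])
  also have "dyadic_bridge (\<lambda>r b. (\<Sum>i<n. sheet.arr y (i, 0, 0, r, b)) / sqrt n) (depth n) ?b =
    dyadic_bridge (T.node_noise y) (depth n) ?b"
   by (rule dyadic_bridge_cong[OF _ err(1)]) (simp add: T.node_noise_def tree_noise_def sheet.arr_def)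
  finally show ?thesis .
 qed
 have inc: "\<bar>kief_n n (real ?j / n) y - kief_n n (real ?b / 2 ^ depth n) y\<bar> <= 2 * sqrt ?L"
  using y jn by (auto simp: bad_noise_def space_N not_less)
 have main: "\<bar>n * (S / ?T) - ?j - kief_n n (real ?j / n) y\<bar> <= 5500 * ?L * ln n"
 proof -
  have "\<bar>n * (S / ?T) - ?j - kief_n n (real ?b / 2 ^ depth n) y\<bar> <= 603 * ?L * depth n + 2401 * ?L"
   using err(3) unfolding S_def kd tot .
  then show ?thesis using inc discretization_error_bound[OF n x] by linarith
 qed
 have mix: "\<bar>(S + g) / (?T + ?V) - S / ?T\<bar> <= ?V / (?V + ?T)"
  by (rule mixture_error) (use S g Tpos in auto)
 have sn: "sqrt n > 0" "sqrt n * sqrt n = n" using n0 by auto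
 let ?F = "(S + g) / (?T + ?V)" and ?K = "kief_n n (real ?j / n) y"
 have split: "sqrt n * (?F - real ?j / n) - ?K / sqrt n = sqrt n * (?F - S / ?T) + (n * (S / ?T) - ?j - ?K) / sqrt n"
 proof -
  have a: "sqrt n * (F - j / n) - K / sqrt n = sqrt n * (F - s) + (n * s - j - K) / sqrt n" for F j K s :: real
  proof -
   have "(n * s - j - K) / sqrt n = sqrt n * s - j / sqrt n - K / sqrt n"
    using sn by (simp add: diff_divide_distrib) (simp add: field_simps)
   moreover have "sqrt n * (j / n) = j / sqrt n" using sn by (simp add: field_simps)
   ultimately show ?thesis by (simp add: algebra_simps)
  qed
  show ?thesis by (rule a)
 qed
 have "\<bar>sqrt n * (?F - real ?j / n) - ?K / sqrt n\<bar> <= \<bar>sqrt n * (?F - S / ?T)\<bar> + \<bar>(n * (S / ?T) - ?j - ?K) / sqrt n\<bar>"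
  unfolding split by (rule abs_triangle_ineq)
 also have "\<bar>sqrt n * (?F - S / ?T)\<bar> = sqrt n * \<bar>?F - S / ?T\<bar>" by (simp add: abs_mult)
 also have "... <= sqrt n * (?V / (?V + ?T))" using mix by (intro mult_left_mono) auto
 also have "... <= (6 * mass + 12 * x * ln n) / sqrt n"
  by (rule prior_term_bounds[OF n0 x y Vnn Tpos n])
 also have "\<bar>(n * (S / ?T) - ?j - ?K) / sqrt n\<bar> = \<bar>n * (S / ?T) - ?j - ?K\<bar> / sqrt n" using sn by simp
 also have "... <= (5500 * ?L * ln n) / sqrt n" using main sn by (intro divide_right_mono) auto
 finally show ?thesis unfolding cdf by (simp add: add_divide_distrib)
qed

lemma AE_regular_noise:
 assumes n: "n > 0"
 shows "AE y in N. regular_noise n y"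
proof -
 interpret P: posterior_noise N n "data_weight n" prior_weight prior_loc \<nu> by (rule posterior_noise_model[OF n])
 interpret T: gamma_tree N "tree_noise n" n "depth n" by (rule gamma_tree_noise[OF n])
 let ?c = "cell_width n (depth n)"
 have "AE y in N. \<forall>b\<in>{..<2 ^ depth n}. 0 <= T.leaf y b \<and> T.leaf y b <= 1 \<and> (left_len n (depth n) b = ?c --> T.leaf y b = 1)"
 proof (intro AE_finite_allI)
  fix b :: nat assume b: "b \<in> {..<2 ^ depth n}"
  let ?l = "left_len n (depth n) b"
  let ?Q = "\<lambda>t :: real. 0 <= t \<and> t <= 1 \<and> (?l = ?c --> t = 1)"
  have Q: "AE t in beta_law ?l (?c - ?l). ?Q t"
  proof (cases "?l = ?c")
   case True
   have "AE t in return borel (1 :: real). ?Q t" by (subst AE_return) auto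
   then show ?thesis using True by (simp only: beta_law_def diff_self less_irrefl if_False)
  next
   case False
   then have pos: "?l > 0" "?c - ?l > 0" using leaf_parameters[OF n, of b] by auto
   have "AE t in density lborel (\<lambda>t. ennreal (beta_dens ?l (?c - ?l) t)). 0 <= t \<and> t <= 1"
    by (subst AE_density) (auto simp: beta_dens_def intro!: AE_I2 split: if_splits)
   moreover have "beta_law ?l (?c - ?l) = density lborel (\<lambda>t. ennreal (beta_dens ?l (?c - ?l) t))"
    using pos by (simp add: beta_law_def)
   ultimately show ?thesis using False by (simp only:) simp
  qed
  have "AE t in distr N borel (tree_noise n (Suc (depth n), b)). ?Q t"
  proof -
   have b': "b < 2 ^ depth n" using b by simp
   show ?thesis unfolding T.law_leaf[OF b'] by (rule Q)
  qed
  then show "AE y in N. ?Q (T.leaf y b)"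
   by (subst (asm) AE_distr_iff) auto
 qed simp
 then show ?thesis using sheet.AE_good_array P.AE_good_weights
  by eventually_elim (auto simp: regular_noise_def T.good_leaves_def)
qed

end

section \<open>The coupling\<close>

text \<open>
  With \<open>u\<close> the twelfth root of \<open>n\<close>, \<open>ln n = 6 ln (u\<^sup>2) \<le> 6
  u\<^sup>2\<close>, and the claim is \<open>(ln n)\<^sup>3\<^sup>/\<^sup>2 \<le> 15 u\<^sup>3\<close>.
\<close>
lemma log_power_bound:
 assumes n: "n >= 2"
 shows "(ln (real n))\<^sup>2 / sqrt n <= 15 * (sqrt (ln n) / n powr (1 / 4))"
proof -
 \<comment> \<open>the twelfth root makes all powers of n in the claim integral powers of u\<close>
 define u where "u = real n powr (1 / 12)"
 define s where "s = sqrt (ln (real n))"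
 have n0: "real n > 0" using n by simp
 have u: "u > 0" "u ^ 3 = n powr (1 / 4)" "u ^ 6 = sqrt n"
  using n0 by (auto simp: u_def powr_half_sqrt[symmetric] powr_powr simp flip: powr_realpow)
 have l: "ln (real n) > 0" using ln_nat_ge[OF n] by linarith
 have s: "s >= 0" "s\<^sup>2 = ln n" using l by (auto simp: s_def)
 have "ln (real n) = 6 * ln (u\<^sup>2)" using n0 by (simp add: u_def ln_powr power2_eq_square ln_mult)
 also have "ln (u\<^sup>2) <= u\<^sup>2 - 1" using u by (intro ln_le_minus_one) simp
 finally have "s\<^sup>2 <= (5 / 2 * u)\<^sup>2" unfolding s(2) by (simp add: power_mult_distrib power_divide) (use zero_le_power2[of u] in linarith)
 then have "s <= 5 / 2 * u" by (rule power2_le_imp_le) (use u in simp)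
 have "s\<^sup>2 <= 6 * u\<^sup>2" using \<open>ln (real n) = 6 * ln (u\<^sup>2)\<close> \<open>ln (u\<^sup>2) <= u\<^sup>2 - 1\<close> unfolding s(2) by linarith
 then have "s\<^sup>2 * s <= (6 * u\<^sup>2) * (5 / 2 * u)" using \<open>s <= 5 / 2 * u\<close> s u by (intro mult_mono) auto
 then have c: "s ^ 3 <= 15 * u ^ 3" by (simp add: power3_eq_cube power2_eq_square mult_ac)
 have "(ln (real n))\<^sup>2 / sqrt n = s ^ 3 * (s / u ^ 6)" unfolding s(2)[symmetric] u(3) by (simp add: power3_eq_cube power2_eq_square)
 also have "... <= 15 * u ^ 3 * (s / u ^ 6)" using c s u by (intro mult_right_mono) auto
 also have "... = 15 * (s / u ^ 3)" using u(1) by (simp add: field_simps flip: power_add)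
 finally show ?thesis unfolding u(2) s_def .
qed

text \<open>
  Replacing \<open>x\<close> by \<open>x / 12000\<close> turns the coefficient of \<open>x ln n\<close> into less
  than 1, at the price of a slower exponential rate. The term \<open>5500 (ln n)\<^sup>2 / sqrt n\<close> is
  absorbed because \<open>x \<ge> 1\<close>; \<open>82500 = 5500 * 15\<close>.
\<close>
lemma rescaled_error_bound:
 fixes n :: nat
 assumes n: "n >= 2" and x: "x >= 12000" and m: "m >= 0"
 shows "(6 * m + 12 * (x / 12000) * ln n + 5500 * (ln n + x / 12000) * ln n) / sqrt n <
  (6 * m + x * ln n) / sqrt n + 82500 * sqrt (ln n) * x powr (3 / 4) / n powr (1 / 4)"
proof -
 let ?l = "ln (real n)"
 have l: "?l > 0" using ln_nat_ge[OF n] by linarith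
 have xl: "x * ?l > 0" using x l by simp
 have sn: "sqrt n > 0" using n by simp
 have "12 * (x / 12000) * ?l + 5500 * (x / 12000) * ?l < x * ?l" using xl by simp
 then have "6 * m + 12 * (x / 12000) * ?l + 5500 * (?l + x / 12000) * ?l < 6 * m + x * ?l + 5500 * ?l\<^sup>2"
  by (simp add: power2_eq_square distrib_left distrib_right mult.assoc)
 then have "(6 * m + 12 * (x / 12000) * ?l + 5500 * (?l + x / 12000) * ?l) / sqrt n < (6 * m + x * ?l + 5500 * ?l\<^sup>2) / sqrt n"
  using sn by (rule divide_strict_right_mono)
 also have "... = (6 * m + x * ?l) / sqrt n + 5500 * (?l\<^sup>2 / sqrt n)" by (simp add: add_divide_distrib)
 also have "... <= (6 * m + x * ?l) / sqrt n + 5500 * (15 * (sqrt ?l / n powr (1 / 4)))"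
  using log_power_bound[OF n] by (intro add_left_mono mult_left_mono) auto
 also have "... <= (6 * m + x * ?l) / sqrt n + 5500 * (15 * (sqrt ?l / n powr (1 / 4))) * x powr (3 / 4)"
 proof -
  have "1 <= x powr (3 / 4)" using x by (intro ge_one_powr_ge_zero) auto
  then have scale: "a <= a * x powr (3 / 4)" if "a >= 0" for a :: real using that by (simp add: mult_le_cancel_left1)
  then show ?thesis using l by (intro add_left_mono scale) simp
 qed
 finally show ?thesis by (simp add: mult_ac)
qed

locale coupling = noise_model +
 fixes P0 :: "real measure" assumes P0: "real_distribution P0"
begin

text \<open>
  Data and noise are listed in one sequence by enumerating the sum type.
\<close>
definition joint_law :: "nat => real measure" where
 "joint_law m = (case (from_nat m :: nat + noise) of Inl i => P0 | Inr s => noise_law \<nu> s)"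

sublocale joint: independent_coordinates joint_law
proof (intro independent_coordinates.intro)
 fix m
 interpret P: real_distribution P0 by (rule P0)
 show "prob_space (joint_law m)" "sets (joint_law m) = sets borel"
  using P.prob_space_axioms L_prob L_sets by (auto simp: joint_law_def split: sum.split)
qed

definition obs_index :: "nat => nat" where "obs_index i = to_nat (Inl i :: nat + noise)"
definition noise_index :: "noise => nat" where "noise_index s = to_nat (Inr s :: nat + noise)"

lemma index_inj: "inj obs_index" "inj noise_index" "range obs_index \<inter> range noise_index = {}"
 by (auto simp: inj_on_def obs_index_def noise_index_def)

lemma joint_law_index: "joint_law (obs_index i) = P0" "joint_law (noise_index s) = noise_law \<nu> s"
 by (simp_all add: joint_law_def obs_index_def noise_index_def)

definition obs :: "nat => (nat => real) => real" where "obs i w = w (obs_index i)"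
definition noise_of :: "(nat => real) => noise => real" where "noise_of w s = w (noise_index s)"

lemma obs_measurable [measurable]: "obs i \<in> borel_measurable joint.N"
 unfolding obs_def by measurable

lemma noise_of_measurable [measurable]: "noise_of \<in> measurable joint.N N"
 unfolding measurable_cong_sets[OF refl sets_N] noise_of_def
 by (rule measurable_PiM_single') auto

lemma distr_noise_of: "distr joint.N N noise_of = N"
proof -
 have eq: "(\<Pi>\<^sub>M s\<in>UNIV. joint_law (noise_index s)) = N" by (intro PiM_cong) (auto simp: joint_law_index)
 have "distr joint.N (\<Pi>\<^sub>M s\<in>UNIV. joint_law (noise_index s)) (\<lambda>w. \<lambda>s\<in>UNIV. w (noise_index s)) =
   (\<Pi>\<^sub>M s\<in>UNIV. joint_law (noise_index s))"
  by (rule distr_PiM_reindex) (auto simp: joint.L_prob index_inj)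
 then show ?thesis unfolding eq by (simp add: noise_of_def[abs_def] restrict_def)
qed

lemma obs_indep: "joint.indep_vars (\<lambda>_. borel) obs {1..}"
 by (rule joint.indep_vars_of_blocks[where B = "\<lambda>i. {obs_index i}"])
   (use index_inj(1) in \<open>auto simp: joint.depends_on_def disjoint_family_on_def obs_def inj_def\<close>)

lemma obs_law: "distr joint.N borel (obs i) = P0"
 unfolding obs_def by (simp add: joint.coord_law joint_law_index)

lemma obs_noise_pair:
 "independent_pair joint.N (PiM I (\<lambda>_. borel)) (\<lambda>w. \<lambda>i\<in>I. obs i w) N noise_of"
proof (intro independent_pair.intro independent_pair_axioms.intro joint.prob_space_axioms)
 show X: "(\<lambda>w. \<lambda>i\<in>I. obs i w) \<in> measurable joint.N (PiM I (\<lambda>_. borel))" by measurable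
 show Y: "noise_of \<in> measurable joint.N N" by measurable
 show "distr joint.N (PiM I (\<lambda>_. borel) \<Otimes>\<^sub>M N) (\<lambda>w. (\<lambda>i\<in>I. obs i w, noise_of w)) =
  distr joint.N (PiM I (\<lambda>_. borel)) (\<lambda>w. \<lambda>i\<in>I. obs i w) \<Otimes>\<^sub>M distr joint.N N noise_of"
  by (rule joint.joint_law_of_blocks[OF X _ Y _ index_inj(3)])
    (auto simp: joint.depends_on_def obs_def noise_of_def intro!: restrict_ext ext)
qed

definition kiefer :: "real \<times> real => (nat => real) => real" where "kiefer p w = sheet.kief p (noise_of w)"

lemma integral_noise: "f \<in> borel_measurable N ==> (\<integral>w. f (noise_of w) \<partial>joint.N) = (\<integral>y. f y \<partial>N)" for f :: "_ => real"
 using integral_distr[OF noise_of_measurable, of f] by (simp add: distr_noise_of)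

text \<open>
  The defining properties concern laws and integrals only, and the noise keeps its law inside the product.
\<close>
lemma kiefer_process_kiefer: "kiefer_process joint.N kiefer"
proof -
 have K: "kiefer_process N sheet.kief" by (rule sheet.kiefer_process_kief)
 have "gaussian_rv joint.N (\<lambda>w. f (noise_of w))" if "gaussian_rv N f" for f
 proof -
  have [measurable]: "f \<in> borel_measurable N" using that by (simp add: gaussian_rv_def)
  have "distr joint.N borel (\<lambda>w. f (noise_of w)) = distr (distr joint.N N noise_of) borel f"
   by (subst distr_distr) (auto simp: o_def)
  then show ?thesis using that by (simp add: gaussian_rv_def distr_noise_of)
 qed
 from this[of "\<lambda>y. \<Sum>t\<in>J. c t * sheet.kief t y" for J c] K
 have "gaussian_process joint.N kiefer_index kiefer"
  by (simp add: kiefer_process_def gaussian_process_def kiefer_def)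
 moreover have "(\<integral>w. kiefer p w \<partial>joint.N) = (\<integral>y. sheet.kief p y \<partial>N)" for p
  unfolding kiefer_def by (rule integral_noise) measurable
 moreover have "(\<integral>w. kiefer p w * kiefer q w \<partial>joint.N) = (\<integral>y. sheet.kief p y * sheet.kief q y \<partial>N)" for p q
  unfolding kiefer_def by (rule integral_noise) measurable
 moreover have "continuous_on kiefer_index (\<lambda>p. kiefer p w)" for w
  unfolding kiefer_def sheet.kief_def by (rule continuous_on_subset[OF continuous_kiefer_of]) simp
 ultimately show ?thesis using K by (simp add: kiefer_process_def)
qed

lemma kiefer_independent:
 "independent_rvs joint.N (PiM kiefer_index (\<lambda>_. borel)) (\<lambda>w. \<lambda>p\<in>kiefer_index. kiefer p w)
   (PiM {1..} (\<lambda>_. borel)) (\<lambda>w. \<lambda>i\<in>{1..}. obs i w)"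
proof -
 interpret O: independent_pair joint.N "PiM {1..} (\<lambda>_. borel)" "\<lambda>w. \<lambda>i\<in>{1..}. obs i w" N noise_of
  by (rule obs_noise_pair)
 have "(\<lambda>y. \<lambda>p\<in>kiefer_index. sheet.kief p y) \<in> measurable N (PiM kiefer_index (\<lambda>_. borel))" by measurable
 from O.independent_rvs_compose[OF this, of "\<lambda>z. z"] show ?thesis by (simp add: kiefer_def)
qed

definition post_measure :: "nat => (nat => real) => real measure" where
 "post_measure n w = post n (\<lambda>i\<in>{1..n}. obs i w) (noise_of w)"

lemma order_stat_restrict: "order_stat n (\<lambda>i\<in>{1..n}. z i) = order_stat n z" "count_le n (\<lambda>i\<in>{1..n}. z i) = count_le n z"
proof -
 have "map (\<lambda>i\<in>{1..n}. z i) [1..<Suc n] = map z [1..<Suc n]" by (rule map_cong) auto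
 then show "order_stat n (\<lambda>i\<in>{1..n}. z i) = order_stat n z" "count_le n (\<lambda>i\<in>{1..n}. z i) = count_le n z"
  by (simp_all only: order_stat_def[abs_def] count_le_def[abs_def])
qed

lemma post_measurable:
 assumes n: "n > 0"
 shows "(\<lambda>(z, y). post n z y) \<in> measurable (PiM {1..n} (\<lambda>_. borel) \<Otimes>\<^sub>M N) (prob_algebra borel)"
proof -
 let ?S = "PiM {1..n} (\<lambda>_. borel) \<Otimes>\<^sub>M N"
 interpret P: posterior_noise N n "data_weight n" prior_weight prior_loc \<nu> by (rule posterior_noise_model[OF n])
 have "(\<lambda>p. splice_seq n (data_weight n (snd p)) (prior_weight (snd p)) k) \<in> borel_measurable ?S" for k
  using data_weight_measurable[OF n]
  by (cases "k < n") (auto simp: splice_seq_def intro: measurable_compose[OF measurable_snd])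
 moreover have "(\<lambda>p. splice_seq n (order_stat n (fst p)) (prior_loc (snd p)) k) \<in> borel_measurable ?S" for k
  by (cases "k < n") (auto simp: splice_seq_def simp del: One_nat_def intro: measurable_compose[OF measurable_snd] measurable_compose[OF measurable_fst order_stat_measurable])
 ultimately show ?thesis
  unfolding post_def P.posterior_def split_beta by (rule atomic_prob_measurable)
qed

lemma cond_DP_post:
 assumes n: "n > 0"
 shows "cond_DP joint.N (gen_by joint.N obs n) (\<lambda>w. cdf (post_measure n w)) (\<lambda>w. posterior_base \<nu> n (\<lambda>i. obs i w))"
proof -
 interpret O: independent_pair joint.N "PiM {1..n} (\<lambda>_. borel)" "\<lambda>w. \<lambda>i\<in>{1..n}. obs i w" N noise_of
  by (rule obs_noise_pair)
 interpret P: posterior_noise N n "data_weight n" prior_weight prior_loc \<nu> by (rule posterior_noise_model[OF n])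
 have G: "gen_by joint.N obs n = O.history" unfolding gen_by_def O.history_def ..
 have "regular_cond_law joint.N (gen_by joint.N obs n) (prob_algebra borel) (post_measure n)
   (\<lambda>w. distr N (prob_algebra borel) (\<lambda>y. post n (\<lambda>i\<in>{1..n}. obs i w) y))"
  using O.regular_cond_law_pair[OF post_measurable[OF n]]
  unfolding G distr_noise_of by (simp add: post_measure_def[abs_def])
 moreover have "is_dirichlet_process (posterior_base \<nu> n (\<lambda>i. obs i w))
   (distr N (prob_algebra borel) (\<lambda>y. post n (\<lambda>i\<in>{1..n}. obs i w) y))" for w
 proof -
  have "(\<lambda>y. post n (\<lambda>i\<in>{1..n}. obs i w) y) = P.posterior (\<lambda>i. obs i w)"
   by (rule ext) (simp only: post_def P.posterior_def order_stat_restrict)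
  then show ?thesis using P.dirichlet_posterior[of "\<lambda>i. obs i w"] by (simp only:)
 qed
 ultimately show ?thesis unfolding cond_DP_def by blast
qed

definition gap :: "nat => (nat => real) => real => real" where
 "gap n w z = \<bar>sqrt n * (cdf (post_measure n w) z - cdf (empirical_measure n (\<lambda>i. obs i w)) z)
   - kiefer (cdf (empirical_measure n (\<lambda>i. obs i w)) z, real n) w / sqrt n\<bar>"

lemma gap_bdd:
 assumes n: "n > 0" shows "bdd_above (range (gap n w))"
proof -
 interpret Q: prob_space "post_measure n w"
  unfolding post_measure_def post_def posterior_noise.posterior_def[OF posterior_noise_model[OF n]] by (rule prob_space_atomic_prob)
 define B where "B = Max ((\<lambda>j. \<bar>kiefer (real j / n, real n) w\<bar>) ` {..n})"
 have "gap n w z <= sqrt n + B / sqrt n" for z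
 proof -
  let ?j = "count_le n (\<lambda>i. obs i w) z"
  have E: "cdf (empirical_measure n (\<lambda>i. obs i w)) z = real ?j / n" by (rule cdf_empirical[OF n])
  have j: "?j <= n" by (rule count_le_bound)
  have "0 <= cdf (post_measure n w) z" "cdf (post_measure n w) z <= 1" by (auto simp: cdf_def)
  moreover have "0 <= real ?j / n" "real ?j / n <= 1" using j n by auto
  ultimately have "\<bar>cdf (post_measure n w) z - real ?j / n\<bar> <= 1" by linarith
  then have "\<bar>sqrt n * (cdf (post_measure n w) z - real ?j / n)\<bar> <= sqrt n * 1"
   unfolding abs_mult by (intro mult_mono) auto
  moreover have "\<bar>kiefer (real ?j / n, real n) w / sqrt n\<bar> <= B / sqrt n"
   unfolding abs_divide B_def using j by (auto intro!: divide_right_mono Max_ge)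
  moreover have "\<bar>a - b\<bar> <= p + q" if "\<bar>a\<bar> <= p * 1" "\<bar>b\<bar> <= q" for a b p q :: real using that by linarith
  ultimately show ?thesis unfolding gap_def E by blast
 qed
 then show ?thesis by (intro bdd_aboveI2)
qed

text \<open>
  The empirical distribution function is constant on an interval to the right of each point, so only the posterior
  varies there.
\<close>
lemma gap_right_cont:
 assumes n: "n > 0" shows "continuous (at_right z) (gap n w)"
proof -
 interpret Q: prob_space "post_measure n w"
  unfolding post_measure_def post_def posterior_noise.posterior_def[OF posterior_noise_model[OF n]] by (rule prob_space_atomic_prob)
 interpret Q: real_distribution "post_measure n w"
  by (intro real_distribution.intro real_distribution_axioms.intro Q.prob_space_axioms)
    (simp_all add: post_measure_def post_def posterior_noise.posterior_def[OF posterior_noise_model[OF n]] atomic_prob_def)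
 let ?z = "\<lambda>i. obs i w"
 let ?c = "cdf (empirical_measure n ?z)"
 have "eventually (\<lambda>s. ?c s = ?c z) (at_right z)"
 proof -
  have "eventually (\<lambda>s. \<forall>j\<in>{..<n}. order_stat n ?z j <= s \<longleftrightarrow> order_stat n ?z j <= z) (at_right z)"
  proof (intro eventually_ball_finite ballI)
   fix j
   show "eventually (\<lambda>s. order_stat n ?z j <= s \<longleftrightarrow> order_stat n ?z j <= z) (at_right z)"
   proof (cases "order_stat n ?z j <= z")
    case True
    then show ?thesis by (auto simp: eventually_at_filter)
   next
    case False
    then have "eventually (\<lambda>s. s < order_stat n ?z j) (at_right z)"
     by (intro eventually_at_rightI[of z "order_stat n ?z j"]) auto
    then show ?thesis by eventually_elim (use False in auto)
   qed
  qed simp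
  then show ?thesis
  proof eventually_elim
   case (elim s)
   have "count_le n ?z s = count_le n ?z z"
   proof (rule ccontr)
    assume ne: "count_le n ?z s \<noteq> count_le n ?z z"
    let ?m = "min (count_le n ?z s) (count_le n ?z z)"
    have m: "?m < n" using ne count_le_bound[of n ?z s] count_le_bound[of n ?z z] by linarith
    then have "?m < count_le n ?z s \<longleftrightarrow> ?m < count_le n ?z z"
     using elim order_stat_le_iff[OF m, of ?z] by auto
    then show False using ne by linarith
   qed
   then show ?case by (simp add: cdf_empirical[OF n])
  qed
 qed
 then have ev: "eventually (\<lambda>s. gap n w s = \<bar>sqrt n * (cdf (post_measure n w) s - ?c z) - kiefer (?c z, real n) w / sqrt n\<bar>) (at_right z)"
  by eventually_elim (simp add: gap_def)
 have "((\<lambda>s. \<bar>sqrt n * (cdf (post_measure n w) s - ?c z) - kiefer (?c z, real n) w / sqrt n\<bar>) \<longlongrightarrow> gap n w z) (at_right z)"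
  unfolding gap_def using Q.cdf_is_right_cont[of z] unfolding continuous_within by (intro tendsto_intros)
 then show ?thesis unfolding continuous_within using ev by (simp add: tendsto_cong)
qed

text \<open>
  By right continuity; a countable supremum is measurable.
\<close>
lemma sup_gap_rational:
 assumes n: "n > 0"
 shows "(SUP z. gap n w z) = (SUP r. gap n w (real_of_rat r))"
proof (rule antisym)
 have bdd: "bdd_above (range (\<lambda>r. gap n w (real_of_rat r)))"
  by (rule bdd_above_mono[OF gap_bdd[OF n]]) auto
 show "(SUP r. gap n w (real_of_rat r)) <= (SUP z. gap n w z)"
  by (intro cSUP_least cSUP_upper gap_bdd[OF n]) auto
 show "(SUP z. gap n w z) <= (SUP r. gap n w (real_of_rat r))"
 proof (intro cSUP_least)
  fix z
  show "gap n w z <= (SUP r. gap n w (real_of_rat r))"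
  proof (rule ccontr)
   assume "\<not> gap n w z <= (SUP r. gap n w (real_of_rat r))"
   then have "eventually (\<lambda>s. (SUP r. gap n w (real_of_rat r)) < gap n w s) (at_right z)"
    using gap_right_cont[OF n, of z w] by (intro order_tendstoD(1)) (auto simp: continuous_within)
   then obtain b where b: "b > z" "\<And>s. z < s ==> s < b ==> (SUP r. gap n w (real_of_rat r)) < gap n w s"
    unfolding eventually_at_right_field by auto
   obtain q where q: "z < real_of_rat q" "real_of_rat q < b" using of_rat_dense[OF b(1)] by auto
   have "gap n w (real_of_rat q) <= (SUP r. gap n w (real_of_rat r))" by (rule cSUP_upper[OF _ bdd]) simp
   then show False using b(2)[OF q] by simp
  qed
 qed simp
qed

text \<open>
  The Kiefer process is evaluated at a random argument, but this takes only the values \<open>j / n\<close>.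
\<close>
lemma gap_measurable:
 assumes n: "n > 0" shows "(\<lambda>w. gap n w z) \<in> borel_measurable joint.N"
proof -
 have X: "(\<lambda>w. (\<lambda>i\<in>{1..n}. obs i w, noise_of w)) \<in> measurable joint.N (PiM {1..n} (\<lambda>_. borel) \<Otimes>\<^sub>M N)"
  by measurable
 have P: "post_measure n \<in> measurable joint.N (prob_algebra borel)"
  using measurable_compose[OF X post_measurable[OF n]] by (simp add: post_measure_def[abs_def])
 have F [measurable]: "(\<lambda>w. cdf (post_measure n w) z) \<in> borel_measurable joint.N"
  unfolding cdf_def
  by (rule measurable_compose[OF measurable_prob_algebraD[OF P] measurable_measure_subprob_algebra]) simp
 have k [measurable]: "(\<lambda>w. kiefer p w) \<in> borel_measurable joint.N" for p
  unfolding kiefer_def by measurable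
 have c: "(\<lambda>w. order_stat n (\<lambda>i. obs i w) j <= z) \<in> measurable joint.N (count_space UNIV)" if "j < n" for j
 proof -
  have "(\<lambda>w. order_stat n (\<lambda>i\<in>{1..n}. obs i w) j) \<in> borel_measurable joint.N"
   by (rule measurable_compose[OF _ order_stat_measurable[OF that]]) measurable
  then have [measurable]: "(\<lambda>w. order_stat n (\<lambda>i. obs i w) j) \<in> borel_measurable joint.N"
   unfolding order_stat_restrict .
  show ?thesis by measurable
 qed
 have cnt: "(\<lambda>w. real (count_le n (\<lambda>i. obs i w) z)) \<in> borel_measurable joint.N"
 proof -
  have "real (count_le n (\<lambda>i. obs i w) z) = (\<Sum>j<n. if order_stat n (\<lambda>i. obs i w) j <= z then 1 else 0)" for w
  proof -
   have "(\<Sum>j<n. if order_stat n (\<lambda>i. obs i w) j <= z then 1 else (0 :: real)) =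
     (\<Sum>j<n. if j < count_le n (\<lambda>i. obs i w) z then 1 else 0)"
    by (intro sum.cong) (auto simp: order_stat_le_iff)
   then show ?thesis by (simp add: sum_if_less count_le_bound)
  qed
  moreover have "(\<lambda>w. \<Sum>j<n. if order_stat n (\<lambda>i. obs i w) j <= z then 1 else (0::real)) \<in> borel_measurable joint.N"
   by (intro borel_measurable_sum measurable_If) (use c[unfolded pred_def] in auto)
  ultimately show ?thesis by simp
 qed
 note [measurable] = cnt
 have "gap n w z = \<bar>sqrt n * (cdf (post_measure n w) z - real (count_le n (\<lambda>i. obs i w) z) / n)
   - (\<Sum>j\<le>n. if real (count_le n (\<lambda>i. obs i w) z) = real j then kiefer (real j / n, real n) w else 0) / sqrt n\<bar>" for w
 proof -
  have "(\<Sum>j\<le>n. if real (count_le n (\<lambda>i. obs i w) z) = real j then kiefer (real j / n, real n) w else 0) =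
    kiefer (real (count_le n (\<lambda>i. obs i w) z) / n, real n) w"
   using count_le_bound[of n "\<lambda>i. obs i w" z] by (simp add: sum.delta')
  then show ?thesis by (simp add: gap_def cdf_empirical[OF n])
 qed
 moreover have "(\<lambda>w. \<bar>sqrt n * (cdf (post_measure n w) z - real (count_le n (\<lambda>i. obs i w) z) / n)
   - (\<Sum>j\<le>n. if real (count_le n (\<lambda>i. obs i w) z) = real j then kiefer (real j / n, real n) w else 0) / sqrt n\<bar>) \<in> borel_measurable joint.N"
  by measurable
 ultimately show ?thesis by simp
qed

text \<open>
  For \<open>x < 12000\<close> the bound exceeds 1. Otherwise the pathwise estimate with \<open>x / 12000\<close>
  shows that the event forces the noise into the exceptional set.
\<close>
lemma sup_gap_tail:
 assumes n: "n >= 2" and x: "x > 0"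
 defines "E \<equiv> {w\<in>space joint.N. (SUP z. gap n w z) >= (6 * mass + x * ln n) / sqrt n
   + 82500 * sqrt (ln n) * x powr (3 / 4) / n powr (1 / 4)}"
 shows "E \<in> sets joint.N"
  "AE w in joint.N. cond_prob_given joint.N (gen_by joint.N obs n) E w <= 10 * exp (- (1 / 12000) * x)"
proof -
 have n0: "n > 0" using n by simp
 interpret O: independent_pair joint.N "PiM {1..n} (\<lambda>_. borel)" "\<lambda>w. \<lambda>i\<in>{1..n}. obs i w" N noise_of
  by (rule obs_noise_pair)
 have G: "gen_by joint.N obs n = O.history" unfolding gen_by_def O.history_def ..
 have "(\<lambda>w. SUP r. gap n w (real_of_rat r)) \<in> borel_measurable joint.N"
  by (intro borel_measurable_cSUP gap_measurable[OF n0] bdd_above_mono[OF gap_bdd[OF n0]]) auto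
 then have [measurable]: "(\<lambda>w. SUP z. gap n w z) \<in> borel_measurable joint.N" by (simp add: sup_gap_rational[OF n0])
 show E: "E \<in> sets joint.N" unfolding E_def by measurable
 have "\<exists>B\<in>sets N. (\<forall>w\<in>E. noise_of w \<in> B) \<and> measure N B <= 10 * exp (- (1 / 12000) * x)"
 proof (cases "x >= 12000")
  case False
  have "exp (- 1) <= exp (- (1 / 12000) * x)" using False by simp
  moreover have "1 / 3 <= exp (- 1 :: real)" using e_less_272 by (simp add: exp_minus field_simps)
  ultimately have "1 <= 10 * exp (- (1 / 12000) * x)" by linarith
  then show ?thesis using prob_le_1[of UNIV] sets.top[of N]
   by (intro bexI[of _ UNIV]) (auto simp: space_N intro: order_trans[OF prob_le_1])
 next
  case True
  obtain N0 where N0: "{y\<in>space N. \<not> regular_noise n y} \<subseteq> N0" "emeasure N N0 = 0" "N0 \<in> sets N"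
   using AE_regular_noise[OF n0] by (rule AE_E)
  \<comment> \<open>the null set turns the almost sure properties into an inclusion of events\<close>
  let ?B = "bad_noise n (x / 12000) \<union> N0"
  have "\<forall>w\<in>E. noise_of w \<in> ?B"
  proof (intro ballI, rule ccontr)
   fix w assume w: "w \<in> E" and nb: "noise_of w \<notin> ?B"
   then have reg: "regular_noise n (noise_of w)" using N0(1) by (auto simp: space_N)
   let ?r = "(6 * mass + 12 * (x / 12000) * ln n + 5500 * (ln n + x / 12000) * ln n) / sqrt n"
   have "gap n w z <= ?r" for z
    using posterior_kiefer_error[OF n _ _ reg, of "x / 12000" "\<lambda>i\<in>{1..n}. obs i w" z] nb True
    unfolding gap_def cdf_empirical[OF n0] post_measure_def kiefer_def order_stat_restrict by simp
   then have "(SUP z. gap n w z) <= ?r" by (intro cSUP_least) auto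
   moreover have "?r < (6 * mass + x * ln n) / sqrt n + 82500 * sqrt (ln n) * x powr (3 / 4) / n powr (1 / 4)"
    by (rule rescaled_error_bound[OF n True]) simp
   ultimately show False using w unfolding E_def by simp
  qed
  moreover have "measure N ?B <= 10 * exp (- (1 / 12000) * x)"
  proof -
   have "measure N ?B <= measure N (bad_noise n (x / 12000)) + measure N N0"
    by (rule measure_Un_le[OF bad_noise_sets N0(3)])
   also have "measure N N0 = 0" using N0(2) by (simp add: measure_def)
   finally show ?thesis using bad_noise_prob[OF n0, of "x / 12000"] x by simp
  qed
  ultimately show ?thesis using bad_noise_sets N0(3) by blast
 qed
 then obtain B where B: "B \<in> sets N" "\<And>w. w \<in> E ==> noise_of w \<in> B" "measure N B <= 10 * exp (- (1 / 12000) * x)"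
  by blast
 show "AE w in joint.N. cond_prob_given joint.N (gen_by joint.N obs n) E w <= 10 * exp (- (1 / 12000) * x)"
  unfolding G by (rule O.cond_prob_le_of_bad_event[OF E B(1,2)]) (assumption, simp only: distr_noise_of, rule B(3))
qed

end

theorem theorem3:
  shows "\<exists>C1 C2 C3 C4 :: real. C1 > 0 \<and> C2 > 0 \<and> C3 > 0 \<and> C4 > 0 \<and>
    (\<forall>P0 \<nu> :: real measure. real_distribution P0 \<and> finite_borel_measure \<nu> \<longrightarrow>
      (\<exists>(M :: (nat \<Rightarrow> real) measure) Z F K.
        prob_space M \<and>
        prob_space.indep_vars M (\<lambda>_. borel) Z {1..} \<and>
        (\<forall>i\<in>{1..}. distr M borel (Z i) = P0) \<and>
        (\<forall>n\<ge>1. cond_DP M (gen_by M Z n) (F n) (\<lambda>\<omega>. posterior_base \<nu> n (\<lambda>i. Z i \<omega>))) \<and>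
        kiefer_process M K \<and>
        independent_rvs M
          (PiM kiefer_index (\<lambda>_. borel)) (\<lambda>\<omega>. \<lambda>p\<in>kiefer_index. K p \<omega>)
          (PiM {1..} (\<lambda>_. borel)) (\<lambda>\<omega>. \<lambda>i\<in>{1..}. Z i \<omega>) \<and>
        (\<forall>x>0. \<forall>n\<ge>2.
          let EF = (\<lambda>\<omega>. cdf (empirical_measure n (\<lambda>i. Z i \<omega>)));
              E = {\<omega>\<in>space M.
                (SUP z. \<bar>sqrt n * (F n \<omega> z - EF \<omega> z) - K (EF \<omega> z, n) \<omega> / sqrt n\<bar>)
                \<ge> (C1 * measure \<nu> UNIV + x * ln n) / sqrt n
                  + C2 * sqrt (ln n) * x powr (3/4) / n powr (1/4)}
          in E \<in> sets M \<and>
             (AE \<omega> in M. cond_prob_given M (gen_by M Z n) E \<omega> \<le> C3 * exp (- C4 * x)))))"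
proof (rule exI[of _ 6], rule exI[of _ 82500], rule exI[of _ 10], rule exI[of _ "1 / 12000"], intro conjI allI impI)
  fix P0 \<nu> :: "real measure" assume "real_distribution P0 \<and> finite_borel_measure \<nu>"
  then interpret C: coupling \<nu> P0
    by (intro coupling.intro noise_model.intro coupling_axioms.intro) auto
  show "\<exists>(M :: (nat \<Rightarrow> real) measure) Z F K.
        prob_space M \<and>
        prob_space.indep_vars M (\<lambda>_. borel) Z {1..} \<and>
        (\<forall>i\<in>{1..}. distr M borel (Z i) = P0) \<and>
        (\<forall>n\<ge>1. cond_DP M (gen_by M Z n) (F n) (\<lambda>\<omega>. posterior_base \<nu> n (\<lambda>i. Z i \<omega>))) \<and>
        kiefer_process M K \<and>
        independent_rvs M
          (PiM kiefer_index (\<lambda>_. borel)) (\<lambda>\<omega>. \<lambda>p\<in>kiefer_index. K p \<omega>)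
          (PiM {1..} (\<lambda>_. borel)) (\<lambda>\<omega>. \<lambda>i\<in>{1..}. Z i \<omega>) \<and>
        (\<forall>x>0. \<forall>n\<ge>2.
          let EF = (\<lambda>\<omega>. cdf (empirical_measure n (\<lambda>i. Z i \<omega>)));
              E = {\<omega>\<in>space M.
                (SUP z. \<bar>sqrt n * (F n \<omega> z - EF \<omega> z) - K (EF \<omega> z, n) \<omega> / sqrt n\<bar>)
                \<ge> (6 * measure \<nu> UNIV + x * ln n) / sqrt n
                  + 82500 * sqrt (ln n) * x powr (3/4) / n powr (1/4)}
          in E \<in> sets M \<and>
             (AE \<omega> in M. cond_prob_given M (gen_by M Z n) E \<omega> \<le> 10 * exp (- (1 / 12000) * x)))"
  proof (rule exI[of _ C.joint.N], rule exI[of _ C.obs], rule exI[of _ "\<lambda>n \<omega>. cdf (C.post_measure n \<omega>)"],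
      rule exI[of _ C.kiefer], intro conjI ballI allI impI, goal_cases)
    case 1 show ?case by (rule C.joint.prob_space_axioms)
  next
    case 2 show ?case by (rule C.obs_indep)
  next
    case 3 show ?case by (rule C.obs_law)
  next
    case (4 n) then show ?case by (intro C.cond_DP_post) simp
  next
    case 5 show ?case by (rule C.kiefer_process_kiefer)
  next
    case 6 show ?case by (rule C.kiefer_independent)
  next
    case (7 x n)
    show ?case unfolding Let_def
      by (rule conjI[OF C.sup_gap_tail[OF 7(2,1), unfolded C.gap_def[abs_def]]])
  qed
qed simp_all

end
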